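(* Let $p\in[2,+\infty)$, $n\in\mathbb{N}_0$, $\tau\in(0,+\infty)$, $x_0\in\mathbb{R}^d$, and $\varrho,\alpha_1,\alpha_2\in(0,1]$. Let $f:[0,(n+1)\tau]\times\mathbb{R}^d\times\mathbb{R}^d\to\mathbb{R}^d$ and $g:[0,(n+1)\tau]\times\mathbb{R}^d\times\mathbb{R}^d\to\mathbb{R}^{d\times m}$ satisfy: (A1) $f(t,\cdot,\cdot)\in C(\mathbb{R}^d\times\mathbb{R}^d;\mathbb{R}^d)$ for all $t\in[0,(n+1)\tau]$; (A2) $f(\cdot,x,z):[0,(n+1)\tau]\to\mathbb{R}^d$ is Borel measurable for all $(x,z)\in\mathbb{R}^d\times\mathbb{R}^d$; (A3') there are $\bar K_f,L_f\in(0,\infty)$ such that for all $t\in[0,(n+1)\tau]$ one has $|f(t,0,0)|\le\bar K_f$, and for all $t\in[0,(n+1)\tau]$, $x_1,x_2,z_1,z_2\in\mathbb{R}^d$, $$|f(t,x_1,z_1)-f(t,x_2,z_2)|\le L_f\bigl(|x_1-x_2|+|z_1-z_2|^{\alpha_1}\bigr);$$ (B1) $g(t,\cdot,\cdot)\in C(\mathbb{R}^d\times\mathbb{R}^d;\mathbb{R}^{d\times m})$ for all $t\in[0,(n+1)\tau]$; (B2) $g(\cdot,x,z):[0,(n+1)\tau]\to\mathbb{R}^{d\times m}$ is Borel measurable for all $(x,z)\in\mathbb{R}^d\times\mathbb{R}^d$; (B3') there are $\bar K_g,L_g\in(0,\infty)$ such that for all $t_1,t_2\in[0,(n+1)\tau]$,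 $x,z\in\mathbb{R}^d$, $$|g(t_1,x,z)-g(t_2,x,z)|\le\bar K_g(1+|x|+|z|)|t_1-t_2|^{\varrho},$$ and for all $t\in[0,(n+1)\tau]$, $x_1,x_2,z_1,z_2\in\mathbb{R}^d$, $$|g(t,x_1,z_1)-g(t,x_2,z_2)|\le L_g\bigl(|x_1-x_2|+|z_1-z_2|^{\alpha_2}\bigr).$$ Let $X$ be the unique strong solution on $[-\tau,(n+1)\tau]$ of $$\begin{cases}\mathrm{d}X(t)=f(t,X(t),X(t-\tau))\,\mathrm{d}t+g(t,X(t),X(t-\tau))\,\mathrm{d}W(t), & t\in[0,(n+1)\tau],\\ X(t)=x_0, & t\in[-\tau,0],\end{cases}$$ and, for $N\in\mathbb{N}$, let $h=\tau/N$, $t_k^j=j\tau+kh$, and let $\{y_k^j\}$ be the output of the randomized Euler scheme (defined in the context) with discretization parameter $N$. Then there exist $C_0,C_1,\ldots,C_n\in(0,+\infty)$, not depending on $N$, such that for all integers $N\ge\lceil\tau\rceil$ and all $j=0,1,\ldots,n$, $$\Bigl\|\max_{0\le k\le N}|X(t_k^j)-y_k^j|\Bigr\|_{L^p(\Omega)}\le C_j\,h^{\min\{\varrho,\frac12\}\alpha^{j}},$$ where $\alpha:=\min\{\alpha_1,\alpha_2\}$; in particular, if $\alpha=1$ then $$\Bigl\|\max_{0\le k\le N}|X(t_k^j)-y_k^j|\Bigr\|_{L^p(\Omega)}\le C_j\,h^{\min\{\varrho,\frac12\}}.$$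
   Context: $\mathbb{N}=\{1,2,\ldots\}$, $\mathbb{N}_0=\mathbb{N}\cup\{0\}$, and $d,m\in\mathbb{N}$. $|\cdot|$ denotes the Euclidean norm in $\mathbb{R}^d$ or the Frobenius norm in $\mathbb{R}^{d\times m}$. $(\Omega,\Sigma,\mathbb{P})$ is a complete probability space with a filtration $(\Sigma_t)_{t\ge0}$ satisfying the usual conditions, $W=(W(t))_{t\ge0}$ is an $m$-dimensional Wiener process with respect to $(\Sigma_t)_{t\ge0}$, and $\Sigma_\infty=\sigma(\bigcup_{t\ge0}\Sigma_t)$. $\|Z\|_{L^p(\Omega)}=(\mathbb{E}|Z|^p)^{1/p}$. A strong solution is an $\mathbb{R}^d$-valued process with continuous trajectories, equal to $x_0$ on $[-\tau,0]$, adapted to $(\Sigma_t)$ on $[0,(n+1)\tau]$, and satisfying the integrated form of the equation almost surely; uniqueness is up to indistinguishability. Under the assumptions of the claim such a solution exists and is unique. Randomized Euler scheme: let $\{\gamma_k^j\}_{j\in\mathbb{N}_0,k\in\mathbb{N}}$ be an i.i.d. family of random variables on $(\Omega,\Sigma,\mathbb{P})$, each uniformly distributed on $[0,1]$, such that $\sigma(\{\gamma_k^j\}_{j\in\mathbb{N}_0,k\in\mathbb{N}})$ and $\Sigma_\infty$ are independent. Fix $N\in\mathbb{N}$, $h=\tau/N$, $t_k^j=j\tau+kh$ for $k=0,\ldots,N$, $j=0,\ldots,n$, and $\theta_{k+1}^j=t_k^j+h\gamma_{k+1}^j$. Set $y_0^{-1}=\cdots=y_N^{-1}=x_0$, and for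 $j=0,1,\ldots,n$ and $k=0,1,\ldots,N-1$ put $$y_0^j=y_N^{j-1},\qquad y_{k+1}^j=y_k^j+h\,f(\theta_{k+1}^j,y_k^j,y_k^{j-1})+g(t_k^j,y_k^j,y_k^{j-1})\bigl(W(t_{k+1}^j)-W(t_k^j)\bigr).$$ *)

theory Defs
  imports "HOL-Probability.Probability"
begin

text \<open>
  Time is of type \<^typ>\<open>real\<close>; the value of a filtration or of a Wiener process at a negative time is
  never used. An element of \<open>\<real>\<^sup>d\<close> has type \<open>real^'d\<close>, and a \<open>d \<times> m\<close> matrix has type \<open>real^'m^'d\<close>.
  The library norm of the latter is the Euclidean norm of the vector of the Euclidean norms of the
  rows, that is, the Frobenius norm.
\<close>


section \<open>Filtrations and Wiener processes\<close>

definition usual_conditions :: "'a measure \<Rightarrow> (real \<Rightarrow> 'a measure) \<Rightarrow> bool" where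
  "usual_conditions M F \<longleftrightarrow>
     filtration (space M) (\<lambda>t. F (max 0 t)) \<and>
     (\<forall>t\<ge>0. subalgebra M (F t)) \<and>
     null_sets M \<subseteq> sets (F 0) \<and>
     (\<forall>t\<ge>0. sets (F t) = (\<Inter>s\<in>{t<..}. sets (F s)))"

definition sigma_infinity :: "'a measure \<Rightarrow> (real \<Rightarrow> 'a measure) \<Rightarrow> 'a set set" where
  "sigma_infinity M F = sigma_sets (space M) (\<Union>t\<in>{0..}. sets (F t))"

text \<open>The density below is that of the centred Gaussian law on \<open>\<real>\<^sup>m\<close> with covariance \<open>(t - s)\<close> times
  the identity matrix; \<^const>\<open>normal_density\<close> is parametrised by the standard deviation.\<close>

definition wiener_process ::
  "'a measure \<Rightarrow> (real \<Rightarrow> 'a measure) \<Rightarrow> (real \<Rightarrow> 'a \<Rightarrow> real^'m) \<Rightarrow> bool" where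
  "wiener_process M F W \<longleftrightarrow>
     (AE \<omega> in M. W 0 \<omega> = 0) \<and>
     (AE \<omega> in M. continuous_on {0..} (\<lambda>t. W t \<omega>)) \<and>
     (\<forall>t\<ge>0. W t \<in> borel_measurable (F t)) \<and>
     (\<forall>s t. 0 \<le> s \<and> s < t \<longrightarrow>
        prob_space.indep_set M (sets (F s))
          {(\<lambda>\<omega>. W t \<omega> - W s \<omega>) -` A \<inter> space M | A. A \<in> sets borel} \<and>
        distributed M lborel (\<lambda>\<omega>. W t \<omega> - W s \<omega>)
          (\<lambda>x. ennreal (\<Prod>i\<in>UNIV. normal_density 0 (sqrt (t - s)) (x $ i))))"


section \<open>The Ito integral\<close>

definition progressively_measurable ::
  "(real \<Rightarrow> 'a measure) \<Rightarrow> real \<Rightarrow> (real \<Rightarrow> 'a \<Rightarrow> 'b::topological_space) \<Rightarrow> bool" where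
  "progressively_measurable F T H \<longleftrightarrow>
     (\<forall>t\<in>{0..T}. (\<lambda>(s, \<omega>). H s \<omega>) \<in> borel_measurable (restrict_space borel {0..t} \<Otimes>\<^sub>M F t))"

definition tendsto_zero_in_prob :: "'a measure \<Rightarrow> (nat \<Rightarrow> 'a \<Rightarrow> ennreal) \<Rightarrow> bool" where
  "tendsto_zero_in_prob M Z \<longleftrightarrow>
     (\<forall>\<epsilon>>0. (\<lambda>q. measure M {\<omega> \<in> space M. Z q \<omega> > ennreal \<epsilon>}) \<longlonglongrightarrow> 0)"

text \<open>A simple process on \<open>[0, T]\<close> is given by \<open>K\<close>, a partition \<open>0 = u\<^sub>0 < \<dots> < u\<^sub>K = T\<close> and bounded
  random matrices \<open>\<xi>\<^sub>i\<close> that are measurable with respect to the filtration at time \<open>u\<^sub>i\<close>; its value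
  on \<open>(u\<^sub>i, u\<^sub>i\<^sub>+\<^sub>1]\<close> is \<open>\<xi>\<^sub>i\<close>.\<close>

definition simple_process_data ::
  "'a measure \<Rightarrow> (real \<Rightarrow> 'a measure) \<Rightarrow> real \<Rightarrow> nat \<Rightarrow> (nat \<Rightarrow> real) \<Rightarrow>
   (nat \<Rightarrow> 'a \<Rightarrow> real^'m^'d) \<Rightarrow> bool" where
  "simple_process_data M F T K u \<xi> \<longleftrightarrow>
     u 0 = 0 \<and> u K = T \<and> (\<forall>i<K. u i < u (Suc i)) \<and>
     (\<forall>i<K. \<xi> i \<in> borel_measurable (F (u i)) \<and> bounded (\<xi> i ` space M))"

definition simple_process ::
  "nat \<Rightarrow> (nat \<Rightarrow> real) \<Rightarrow> (nat \<Rightarrow> 'a \<Rightarrow> real^'m^'d) \<Rightarrow> real \<Rightarrow> 'a \<Rightarrow> real^'m^'d" where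
  "simple_process K u \<xi> s \<omega> = (\<Sum>i<K. indicator {u i<..u (Suc i)} s *\<^sub>R \<xi> i \<omega>)"

definition simple_integral ::
  "(real \<Rightarrow> 'a \<Rightarrow> real^'m) \<Rightarrow> nat \<Rightarrow> (nat \<Rightarrow> real) \<Rightarrow> (nat \<Rightarrow> 'a \<Rightarrow> real^'m^'d) \<Rightarrow>
   real \<Rightarrow> 'a \<Rightarrow> real^'d" where
  "simple_integral W K u \<xi> t \<omega> =
     (\<Sum>i<K. \<xi> i \<omega> *v (W (min t (u (Suc i))) \<omega> - W (min t (u i)) \<omega>))"

text \<open>\<open>is_ito_integral M F W T H I\<close> says that the continuous adapted process \<open>I\<close> is (a version of)
  the integral process of \<open>H\<close> against \<open>W\<close> on \<open>[0, T]\<close>, for progressively measurable \<open>H\<close> whose square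
  is almost surely integrable on \<open>[0, T]\<close>: the integrals of simple processes approximating \<open>H\<close> in
  \<open>L\<^sup>2(0, T)\<close> in probability converge to \<open>I\<close> uniformly on \<open>[0, T]\<close> in probability. The limit does
  not depend on the approximating sequence, up to indistinguishability.\<close>

definition is_ito_integral ::
  "'a measure \<Rightarrow> (real \<Rightarrow> 'a measure) \<Rightarrow> (real \<Rightarrow> 'a \<Rightarrow> real^'m) \<Rightarrow> real \<Rightarrow>
   (real \<Rightarrow> 'a \<Rightarrow> real^'m^'d) \<Rightarrow> (real \<Rightarrow> 'a \<Rightarrow> real^'d) \<Rightarrow> bool" where
  "is_ito_integral M F W T H I \<longleftrightarrow>
     progressively_measurable F T H \<and>
     (AE \<omega> in M. (\<integral>\<^sup>+s\<in>{0..T}. ennreal ((norm (H s \<omega>))\<^sup>2) \<partial>lborel) < \<infinity>) \<and>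
     (\<forall>t\<in>{0..T}. I t \<in> borel_measurable (F t)) \<and>
     (\<forall>\<omega>\<in>space M. continuous_on {0..T} (\<lambda>t. I t \<omega>)) \<and>
     (\<exists>K u \<xi>.
        (\<forall>q. simple_process_data M F T (K q) (u q) (\<xi> q)) \<and>
        tendsto_zero_in_prob M (\<lambda>q \<omega>.
          \<integral>\<^sup>+s\<in>{0..T}. ennreal ((norm (simple_process (K q) (u q) (\<xi> q) s \<omega> - H s \<omega>))\<^sup>2) \<partial>lborel) \<and>
        tendsto_zero_in_prob M (\<lambda>q \<omega>.
          SUP t\<in>{0..T}. ennreal (norm (simple_integral W (K q) (u q) (\<xi> q) t \<omega> - I t \<omega>))))"


section \<open>The delay equation\<close>

definition strong_solution ::
  "'a measure \<Rightarrow> (real \<Rightarrow> 'a measure) \<Rightarrow> (real \<Rightarrow> 'a \<Rightarrow> real^'m) \<Rightarrow>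
   (real \<Rightarrow> real^'d \<Rightarrow> real^'d \<Rightarrow> real^'d) \<Rightarrow> (real \<Rightarrow> real^'d \<Rightarrow> real^'d \<Rightarrow> real^'m^'d) \<Rightarrow>
   real \<Rightarrow> real^'d \<Rightarrow> real \<Rightarrow> (real \<Rightarrow> 'a \<Rightarrow> real^'d) \<Rightarrow> bool" where
  "strong_solution M F W f g \<tau> x0 T X \<longleftrightarrow>
     (\<forall>\<omega>\<in>space M. continuous_on {-\<tau>..T} (\<lambda>t. X t \<omega>)) \<and>
     (\<forall>\<omega>\<in>space M. \<forall>t\<in>{-\<tau>..0}. X t \<omega> = x0) \<and>
     (\<forall>t\<in>{0..T}. X t \<in> borel_measurable (F t)) \<and>
     (AE \<omega> in M. set_integrable lborel {0..T} (\<lambda>s. f s (X s \<omega>) (X (s - \<tau>) \<omega>))) \<and>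
     (\<exists>I. is_ito_integral M F W T (\<lambda>s \<omega>. g s (X s \<omega>) (X (s - \<tau>) \<omega>)) I \<and>
        (AE \<omega> in M. \<forall>t\<in>{0..T}.
           X t \<omega> = x0 + (LINT s:{0..t}|lborel. f s (X s \<omega>) (X (s - \<tau>) \<omega>)) + I t \<omega>))"


section \<open>The randomized Euler scheme\<close>

text \<open>The scheme is evaluated along one realisation: \<open>w\<close> is a path of the Wiener process and \<open>c j k\<close>
  the value of \<open>\<gamma>\<^sub>k\<^sup>j\<close>. The first index is shifted by one, so that \<open>euler_shifted \<dots> (Suc j) k\<close> is
  \<open>y\<^sub>k\<^sup>j\<close> and \<open>euler_shifted \<dots> 0 k\<close> is \<open>y\<^sub>k\<^sup>-\<^sup>1 = x\<^sub>0\<close>. Only indices \<open>k \<le> N\<close> are meaningful.\<close>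

definition grid_time :: "real \<Rightarrow> nat \<Rightarrow> nat \<Rightarrow> nat \<Rightarrow> real" where
  "grid_time \<tau> N j k = real j * \<tau> + real k * (\<tau> / real N)"

fun euler_shifted ::
  "(real \<Rightarrow> real^'d \<Rightarrow> real^'d \<Rightarrow> real^'d) \<Rightarrow> (real \<Rightarrow> real^'d \<Rightarrow> real^'d \<Rightarrow> real^'m^'d) \<Rightarrow>
   real \<Rightarrow> real^'d \<Rightarrow> nat \<Rightarrow> (real \<Rightarrow> real^'m) \<Rightarrow> (nat \<Rightarrow> nat \<Rightarrow> real) \<Rightarrow>
   nat \<Rightarrow> nat \<Rightarrow> real^'d" where
  "euler_shifted f g \<tau> x0 N w c 0 k = x0"
| "euler_shifted f g \<tau> x0 N w c (Suc j) 0 = euler_shifted f g \<tau> x0 N w c j N"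
| "euler_shifted f g \<tau> x0 N w c (Suc j) (Suc k) =
     (let h = \<tau> / real N;
          y = euler_shifted f g \<tau> x0 N w c (Suc j) k;
          z = euler_shifted f g \<tau> x0 N w c j k;
          \<theta> = grid_time \<tau> N j k + h * c j (Suc k)
      in y + h *\<^sub>R f \<theta> y z
           + g (grid_time \<tau> N j k) y z *v (w (grid_time \<tau> N j (Suc k)) - w (grid_time \<tau> N j k)))"

definition randomized_euler ::
  "(real \<Rightarrow> real^'d \<Rightarrow> real^'d \<Rightarrow> real^'d) \<Rightarrow> (real \<Rightarrow> real^'d \<Rightarrow> real^'d \<Rightarrow> real^'m^'d) \<Rightarrow>
   real \<Rightarrow> real^'d \<Rightarrow> nat \<Rightarrow> (real \<Rightarrow> 'a \<Rightarrow> real^'m) \<Rightarrow> (nat \<Rightarrow> nat \<Rightarrow> 'a \<Rightarrow> real) \<Rightarrow>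
   nat \<Rightarrow> nat \<Rightarrow> 'a \<Rightarrow> real^'d" where
  "randomized_euler f g \<tau> x0 N W \<gamma> j k \<omega> =
     euler_shifted f g \<tau> x0 N (\<lambda>t. W t \<omega>) (\<lambda>i l. \<gamma> i l \<omega>) (Suc j) k"

text \<open>The variables \<open>\<gamma>\<^sub>k\<^sup>j\<close> (\<open>j \<ge> 0\<close>, \<open>k \<ge> 1\<close>) are i.i.d., uniform on \<open>[0, 1]\<close>, and the
  \<open>\<sigma>\<close>-algebra they generate is independent of \<^const>\<open>sigma_infinity\<close>.\<close>

definition scheme_randomness ::
  "'a measure \<Rightarrow> (real \<Rightarrow> 'a measure) \<Rightarrow> (nat \<Rightarrow> nat \<Rightarrow> 'a \<Rightarrow> real) \<Rightarrow> bool" where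
  "scheme_randomness M F \<gamma> \<longleftrightarrow>
     prob_space.indep_vars M (\<lambda>_. borel) (\<lambda>(j, k). \<gamma> j k) (UNIV \<times> {1..}) \<and>
     (\<forall>j. \<forall>k\<ge>1. distributed M lborel (\<gamma> j k)
        (\<lambda>x. indicator {0..1::real} x / measure lborel {0..1::real})) \<and>
     prob_space.indep_set M
       (sigma_sets (space M)
          (\<Union>j. \<Union>k\<in>{1..}. {\<gamma> j k -` A \<inter> space M | A. A \<in> sets borel}))
       (sigma_infinity M F)"


section \<open>The Lp norm\<close>

text \<open>Extended-valued, so that a bound on the norm includes the finiteness of the \<open>p\<close>-th moment.\<close>

definition Lp_norm :: "'a measure \<Rightarrow> real \<Rightarrow> ('a \<Rightarrow> 'b::real_normed_vector) \<Rightarrow> ennreal" where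
  "Lp_norm M p Z =
     (let m = \<integral>\<^sup>+\<omega>. ennreal (norm (Z \<omega>) powr p) \<partial>M
      in if m = \<infinity> then \<infinity> else ennreal (enn2real m powr (1 / p)))"

end

theory Submission
  imports Defs
begin

text \<open>
  All norms are taken with the even exponent \<open>2r \<ge> p\<close>. For such an exponent a second-order Taylor
  expansion of \<open>|x|\<^sup>2\<^sup>r\<close>, Gronwall's lemma and the pathwise form of Doob's inequality bound the maximum
  of a discrete martingale, which replaces the Burkholder inequality. The integrand of the equation
  has continuous paths, so its Ito integral is a limit in probability of Riemann sums, and moment
  bounds pass from the sums to the integral by Fatou's lemma; the moments of the solution itself
  come from localisation.

  The error splits into a drift error, a noise error and the error of the randomized quadrature of
  the drift along the exact solution. The sampling points are independent of the solution, so the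
  last one is a martingale with increments of order \<open>h\<close> and contributes an error of order \<open>1/2\<close>. A
  discrete Gronwall argument then bounds the error on one delay interval by that on the previous
  one, raised to the power \<open>\<alpha>\<close> since the coefficients are only Hoelder continuous in the delayed
  argument, and the rate follows by induction over the intervals.
\<close>

section \<open>Powers and running maxima\<close>

text \<open>The noise error and the quadrature error need different conditionings. The scheme
  depends on the sampling points, so it is not adapted to \<open>F\<close>. For the noise error
  \<open>F u\<close> is joined with all sampling points at once (\<open>G u\<close>), which leaves
  the Wiener increments after \<open>u\<close> independent. For the quadrature error the whole path
  of the solution has to be known before one sampling point is drawn, so all of \<open>F\<close> is
  joined with every other sampling point (\<open>Q j k\<close>).

  No conditional expectation is formed: a martingale difference is tested against measurable
  functions, and an independent variable is frozen by Fubini's theorem.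

  On the first interval the delayed solution is constant, so no power is lost there. The induction
  therefore starts one interval earlier, where the error is zero, with the exponent of the rate
  divided by \<alpha>.

  The equation and its coefficients are controlled only up to the final time; clamping the time
  argument extends them, so that almost no estimate carries a domain condition. Bounds for the
  exponent 2r give those for p by concavity of the power p / (2r).\<close>

lemma mult_powers_le:
  fixes a b :: real
  assumes "0 \<le> a" "0 \<le> b"
  shows "a ^ i * b ^ j \<le> a ^ (i + j) + b ^ (i + j)"
proof (cases "a \<le> b")
  case True
  then have "a ^ i * b ^ j \<le> b ^ i * b ^ j" using assms by (intro mult_right_mono power_mono) auto
  then show ?thesis using assms by (simp add: power_add add_increasing)
next
  case False
  then have "a ^ i * b ^ j \<le> a ^ i * a ^ j" using assms by (intro mult_left_mono power_mono) auto
  then show ?thesis using assms by (simp add: power_add add_increasing2)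
qed

text \<open>Bernoulli's inequality for \<open>x / m\<close>. Summed or integrated with
  \<open>m\<close> the mean, it becomes Jensen's inequality in \<open>power_sum_le\<close> and
  \<open>nn_integral_power_le\<close>.\<close>

lemma power_ge_tangent:
  fixes x m :: real
  assumes "0 \<le> x" "0 \<le> m"
  shows "m ^ p + real p * m ^ (p - 1) * (x - m) \<le> x ^ p"
proof (cases "m = 0 \<or> p = 0")
  case True
  then show ?thesis using assms by (cases p; cases "p - 1") (auto simp: power_0_left)
next
  case False
  then have m: "m > 0" using assms by auto
  obtain q where q: "p = Suc q" using False by (cases p) auto
  have "1 + real p * (x / m - 1) \<le> (1 + (x / m - 1)) ^ p"
    by (rule Bernoulli_inequality) (use assms m in auto)
  then have "m ^ p * (1 + real p * (x / m - 1)) \<le> m ^ p * (x / m) ^ p"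
    using m by (intro mult_left_mono) auto
  also have "m ^ p * (x / m) ^ p = x ^ p" using m by (simp add: power_divide)
  finally have "m ^ p * (1 + real p * (x / m - 1)) \<le> x ^ p" .
  moreover have "m ^ p * (1 + real p * (x / m - 1)) = m ^ p + real p * m ^ (p - 1) * (x - m)"
    using m by (simp add: q field_simps)
  ultimately show ?thesis by simp
qed

lemma power_sum_le:
  fixes a :: "nat \<Rightarrow> real"
  assumes "\<And>i. i < k \<Longrightarrow> 0 \<le> a i" "1 \<le> p"
  shows "(\<Sum>i<k. a i) ^ p \<le> real k ^ (p - 1) * (\<Sum>i<k. a i ^ p)"
proof (cases "k = 0")
  case True then show ?thesis using assms by (simp add: power_0_left)
next
  case False
  define m where "m = (\<Sum>i<k. a i) / real k"
  have m0: "0 \<le> m" unfolding m_def by (intro divide_nonneg_nonneg sum_nonneg) (use assms in auto)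
  have km: "(\<Sum>i<k. a i) = real k * m" using False by (simp add: m_def)
  have "real k * m ^ p = (\<Sum>i<k. m ^ p + real p * m ^ (p - 1) * (a i - m))"
    by (simp add: sum.distrib sum_subtractf flip: sum_distrib_left) (simp add: km)
  also have "\<dots> \<le> (\<Sum>i<k. a i ^ p)"
    by (intro sum_mono power_ge_tangent) (use assms m0 in auto)
  finally have *: "real k * m ^ p \<le> (\<Sum>i<k. a i ^ p)" .
  have "(\<Sum>i<k. a i) ^ p = real k ^ (p - 1) * (real k * m ^ p)"
    unfolding km using assms(2) by (cases p) (auto simp: power_mult_distrib)
  also have "\<dots> \<le> real k ^ (p - 1) * (\<Sum>i<k. a i ^ p)"
    by (intro mult_left_mono *) auto
  finally show ?thesis .
qed

lemma power_add_le:
  fixes a b :: real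
  assumes "0 \<le> a" "0 \<le> b" "1 \<le> p"
  shows "(a + b) ^ p \<le> 2 ^ p * (a ^ p + b ^ p)"
proof -
  have "(a + b) ^ p \<le> (2 * max a b) ^ p" using assms by (intro power_mono) auto
  also have "\<dots> \<le> 2 ^ p * (a ^ p + b ^ p)" using assms
    by (auto simp: power_mult_distrib max_def)
  finally show ?thesis .
qed

text \<open>Young's inequality for \<open>y / m\<close> and 1 with the weights \<alpha> and 1 -
  \<alpha>. In \<open>Ebd_powr\<close> the point \<open>m\<close> is an upper bound of the mean
  rather than the mean itself; this is harmless because the tangent increases in
  \<open>y\<close>.\<close>

lemma powr_le_tangent:
  fixes y m :: real
  assumes "0 \<le> y" "0 < m" "0 < \<alpha>" "\<alpha> \<le> 1"
  shows "y powr \<alpha> \<le> (1 - \<alpha>) * m powr \<alpha> + \<alpha> * m powr (\<alpha> - 1) * y"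
proof -
  have *: "(y / m) powr \<alpha> \<le> 1 + \<alpha> * (y / m - 1)"
  proof (cases "\<alpha> = 1 \<or> y = 0")
    case True then show ?thesis using assms by auto
  next
    case False
    have "(y / m) powr \<alpha> * 1 powr (1 - \<alpha>) \<le> \<alpha> * (y / m) + (1 - \<alpha>) * 1"
      by (rule Youngs_inequality_0) (use assms False in auto)
    then show ?thesis by (simp add: algebra_simps)
  qed
  have "y powr \<alpha> = m powr \<alpha> * (y / m) powr \<alpha>" using assms by (simp add: powr_divide)
  also have "\<dots> \<le> m powr \<alpha> * (1 + \<alpha> * (y / m - 1))" by (intro mult_left_mono *) auto
  also have "\<dots> = (1 - \<alpha>) * m powr \<alpha> + \<alpha> * m powr (\<alpha> - 1) * y"
    using assms by (simp add: powr_diff field_simps)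
  finally show ?thesis .
qed

lemma powr_le_one_plus:
  fixes y :: real
  assumes "0 \<le> y" "0 < \<alpha>" "\<alpha> \<le> 1"
  shows "y powr \<alpha> \<le> 1 + y"
  using powr_le_tangent[of y 1 \<alpha>] assms mult_right_mono[of \<alpha> 1 y] by auto

lemma powr_add_le:
  fixes a b \<alpha> :: real
  assumes "0 \<le> a" "0 \<le> b" "0 < \<alpha>" "\<alpha> \<le> 1"
  shows "(a + b) powr \<alpha> \<le> 2 * a powr \<alpha> + 2 * b powr \<alpha>"
proof -
  have "(a + b) powr \<alpha> \<le> (2 * max a b) powr \<alpha>" using assms by (intro powr_mono2) auto
  also have "\<dots> = 2 powr \<alpha> * max a b powr \<alpha>" using assms by (simp add: powr_mult)
  also have "\<dots> \<le> 2 powr 1 * max a b powr \<alpha>" using assms by (intro mult_right_mono powr_mono) auto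
  also have "\<dots> \<le> 2 * a powr \<alpha> + 2 * b powr \<alpha>" by (auto simp: max_def)
  finally show ?thesis .
qed

text \<open>Lets the Hoelder exponent act on the p-th power of a norm, where \<open>Ebd_powr\<close>
  can take it out of the expectation.\<close>

lemma powr_power_commute:
  fixes x :: real
  assumes "0 \<le> x" "1 \<le> p"
  shows "(x powr a) ^ p = (x ^ p) powr a"
proof (cases "x = 0")
  case True then show ?thesis using assms by (simp add: power_0_left)
next
  case False
  then have "0 < x" using assms by simp
  then show ?thesis using assms by (simp add: powr_power powr_realpow[symmetric] powr_powr mult.commute)
qed

lemma scale_powr_le:
  fixes A e e' hh \<alpha> :: real
  assumes "0 < A" "0 < hh" "hh \<le> 1" "0 < \<alpha>" "\<alpha> \<le> 1" "e' \<le> e * \<alpha>"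
  shows "(A * hh powr e) powr \<alpha> \<le> (1 + A) * hh powr e'"
proof -
  have "(A * hh powr e) powr \<alpha> = A powr \<alpha> * hh powr (e * \<alpha>)" using assms by (simp add: powr_mult powr_powr)
  also have "\<dots> \<le> (1 + A) * hh powr e'"
    using assms powr_le_one_plus[of A \<alpha>] by (intro mult_mono powr_mono') auto
  finally show ?thesis .
qed

text \<open>Induction on \<open>r\<close>, multiplying the expansion by |a + d|^2. Apart from the
  leading and the linear term, every term that arises has total degree 2r + 2 and carries at least
  two factors |d|, so \<open>mult_powers_le\<close> puts it below the new remainder. The even
  exponent keeps the computation polynomial in |a|, |d| and the inner product.\<close>

lemma norm_power_even_Taylor:
  assumes "1 \<le> r"
  shows "\<exists>C\<ge>0. \<forall>a d :: 'b::real_inner.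
    norm (a + d) ^ (2 * r) \<le> norm a ^ (2 * r) + 2 * real r * norm a ^ (2 * r - 2) * inner a d
      + C * (norm a ^ (2 * r - 2) * (norm d)\<^sup>2 + norm d ^ (2 * r))"
  using assms
proof (induction r rule: dec_induct)
  case base
  have "norm (a + d) ^ 2 = norm a ^ 2 + 2 * inner a d + norm d ^ 2" for a d :: 'b
    by (simp add: power2_norm_eq_inner inner_add_left inner_add_right inner_commute)
  then show ?case by (intro exI[of _ 1]) auto
next
  case (step r)
  obtain C where C: "C \<ge> 0" and IH: "\<And>a d :: 'b. norm (a + d) ^ (2 * r) \<le> norm a ^ (2 * r)
      + 2 * real r * norm a ^ (2 * r - 2) * inner a d
      + C * (norm a ^ (2 * r - 2) * (norm d)\<^sup>2 + norm d ^ (2 * r))" using step by blast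
  obtain q where q: "r = Suc q" using step by (cases r) auto
  show ?case
  \<comment> \<open>The constant is generous: counting the remainder terms gives 1 + 6r +
    8C.\<close>
  proof (intro exI[of _ "1 + 8 * real r + 20 * C"] conjI allI)
    show "0 \<le> 1 + 8 * real r + 20 * C" using C by auto
    fix a d :: 'b
    define s t u where "s = norm a" and "t = norm d" and "u = inner a d"
    have st: "0 \<le> s" "0 \<le> t" by (auto simp: s_def t_def)
    have u: "\<bar>u\<bar> \<le> s * t" unfolding s_def t_def u_def by (rule Cauchy_Schwarz_ineq2)
    define P where "P = s ^ (2 * r) * t\<^sup>2 + t ^ (2 * r + 2)"
    have sq: "norm (a + d) ^ 2 = s\<^sup>2 + 2 * u + t\<^sup>2"
      by (simp add: s_def t_def u_def power2_norm_eq_inner inner_add_left inner_add_right inner_commute)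
    have mono: "s ^ i * t ^ (j + 2) \<le> P" if "i + j = 2 * r" for i j
    proof -
      have "s ^ i * t ^ (j + 2) = t\<^sup>2 * (s ^ i * t ^ j)" by (simp add: power_add power2_eq_square)
      also have "\<dots> \<le> t\<^sup>2 * (s ^ (2 * r) + t ^ (2 * r))"
        using mult_powers_le[OF st, of i j] that by (intro mult_left_mono) auto
      also have "\<dots> = P" by (simp add: P_def distrib_left power2_eq_square mult_ac)
      finally show ?thesis .
    qed
    have m1: "s ^ (2 * q) * t\<^sup>2 * s\<^sup>2 \<le> P" using mono[of "2 * q + 2" 0] q by (simp add: power_add mult_ac power2_eq_square)
    have m2: "s ^ (2 * q + 1) * t ^ 3 \<le> P" using mono[of "2 * q + 1" 1] q by (simp add: numeral_eq_Suc)
    have m3: "s ^ (2 * q) * t ^ 4 \<le> P" using mono[of "2 * q" 2] q by simp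
    have m4: "s\<^sup>2 * t ^ (2 * r) \<le> P" using mono[of 2 "2 * q"] q by simp
    have m5: "s * t ^ (2 * r + 1) \<le> P" using mono[of 1 "2 * q + 1"] q by simp
    have m6: "t ^ (2 * r + 2) \<le> P" using st by (simp add: P_def)
    have m7: "s ^ (2 * r) * t\<^sup>2 \<le> P" using st by (simp add: P_def)
    have e1: "s ^ (2 * q) * u * u \<le> P"
    proof -
      have "u * u \<le> (s * t) * (s * t)" using u st mult_mono[of "\<bar>u\<bar>" "s * t" "\<bar>u\<bar>" "s * t"] by auto
      then have "s ^ (2 * q) * (u * u) \<le> s ^ (2 * q) * ((s * t) * (s * t))" using st by (intro mult_left_mono) auto
      also have "\<dots> = s ^ (2 * q) * t\<^sup>2 * s\<^sup>2" by (simp add: power2_eq_square)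
      finally show ?thesis using m1 by (simp add: mult.assoc)
    qed
    have e2: "s ^ (2 * q) * u * t\<^sup>2 \<le> P"
    proof -
      have "s ^ (2 * q) * t\<^sup>2 * u \<le> s ^ (2 * q) * t\<^sup>2 * (s * t)" using u st by (intro mult_left_mono) auto
      also have "\<dots> = s ^ (2 * q + 1) * t ^ 3" by (simp add: numeral_eq_Suc)
      finally show ?thesis using m2 by (simp add: mult_ac)
    qed
    have e3: "s ^ (2 * q) * t\<^sup>2 * u \<le> P" using e2 by (simp add: mult_ac)
    have e4: "t ^ (2 * r) * u \<le> P"
    proof -
      have "t ^ (2 * r) * u \<le> t ^ (2 * r) * (s * t)" using u st by (intro mult_left_mono) auto
      then show ?thesis using m5 by (simp add: mult_ac)
    qed
    have P0: "0 \<le> P" using st by (simp add: P_def)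
    have CE: "C * (s ^ (2 * q) * t\<^sup>2 * s\<^sup>2 + 2 * (s ^ (2 * q) * t\<^sup>2 * u) + s ^ (2 * q) * t ^ 4
        + s\<^sup>2 * t ^ (2 * r) + 2 * (t ^ (2 * r) * u) + t ^ (2 * r + 2)) \<le> C * (8 * P)"
      using m1 e3 m3 m4 e4 m6 by (intro mult_left_mono C) linarith
    have rE: "real r * (4 * (s ^ (2 * q) * u * u) + 2 * (s ^ (2 * q) * u * t\<^sup>2)) \<le> real r * (6 * P)"
      using e1 e2 by (intro mult_left_mono) auto
    have "norm (a + d) ^ (2 * Suc r) = norm (a + d) ^ (2 * r) * norm (a + d) ^ 2"
      by (simp add: power_add power2_eq_square)
    also have "\<dots> \<le> (s ^ (2 * r) + 2 * real r * s ^ (2 * r - 2) * u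
      + C * (s ^ (2 * r - 2) * t\<^sup>2 + t ^ (2 * r))) * norm (a + d) ^ 2"
      using IH[of a d] by (intro mult_right_mono) (auto simp: s_def t_def u_def)
    also have "\<dots> = s ^ (2 * r + 2) + (2 * real r + 2) * s ^ (2 * r) * u + s ^ (2 * r) * t\<^sup>2
       + real r * (4 * (s ^ (2 * q) * u * u) + 2 * (s ^ (2 * q) * u * t\<^sup>2))
       + C * (s ^ (2 * q) * t\<^sup>2 * s\<^sup>2 + 2 * (s ^ (2 * q) * t\<^sup>2 * u) + s ^ (2 * q) * t ^ 4
        + s\<^sup>2 * t ^ (2 * r) + 2 * (t ^ (2 * r) * u) + t ^ (2 * r + 2))"
      unfolding sq using q by (simp add: algebra_simps numeral_eq_Suc)
    also have "\<dots> \<le> s ^ (2 * r + 2) + (2 * real r + 2) * s ^ (2 * r) * u + P + real r * (6 * P) + C * (8 * P)"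
      using CE rE m7 by linarith
    also have "\<dots> \<le> s ^ (2 * r + 2) + (2 * real r + 2) * s ^ (2 * r) * u + (1 + 8 * real r + 20 * C) * P"
      using P0 C mult_nonneg_nonneg[OF C P0] by (simp add: algebra_simps)
    finally show "norm (a + d) ^ (2 * Suc r) \<le> norm a ^ (2 * Suc r) + 2 * real (Suc r) * norm a ^ (2 * Suc r - 2) * inner a d
      + (1 + 8 * real r + 20 * C) * (norm a ^ (2 * Suc r - 2) * (norm d)\<^sup>2 + norm d ^ (2 * Suc r))"
      by (simp add: s_def t_def u_def P_def algebra_simps)
  qed
qed

primrec running_max :: "(nat \<Rightarrow> real) \<Rightarrow> nat \<Rightarrow> real" where
  "running_max s 0 = s 0"
| "running_max s (Suc n) = max (running_max s n) (s (Suc n))"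

lemma running_max_ge: "k \<le> n \<Longrightarrow> s k \<le> running_max s n"
  by (induction n) (auto simp: le_Suc_eq)

lemma running_max_attained: "\<exists>k\<le>n. running_max s n = s k"
proof (induction n)
  case (Suc n)
  then show ?case by (auto simp: max_def intro: le_SucI)
qed auto

lemma running_max_nonneg: "(\<And>i. 0 \<le> s i) \<Longrightarrow> 0 \<le> running_max s n"
  by (induction n) (auto simp: le_max_iff_disj)

lemma running_max_le: "(\<And>k. k \<le> n \<Longrightarrow> s k \<le> c) \<Longrightarrow> running_max s n \<le> c"
  by (induction n) auto

text \<open>The recursive form suits inductions over time and measurability; the \<open>MAX\<close>
  of the theorem is turned into it only at the very end.\<close>

lemma Max_eq_running_max: "(MAX k\<in>{0..N}. s k) = running_max (s :: nat \<Rightarrow> real) N"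
proof (rule antisym)
  show "(MAX k\<in>{0..N}. s k) \<le> running_max s N" by (intro Max.boundedI) (auto intro: running_max_ge)
  show "running_max s N \<le> (MAX k\<in>{0..N}. s k)" by (intro running_max_le Max_ge) auto
qed

lemma running_max_diff_le:
  assumes "\<And>k. k \<le> n \<Longrightarrow> \<bar>s k - s' k\<bar> \<le> c"
  shows "\<bar>running_max s n - running_max s' n\<bar> \<le> c"
  using assms
proof (induction n)
  case (Suc n)
  have "\<bar>running_max s n - running_max s' n\<bar> \<le> c" "\<bar>s (Suc n) - s' (Suc n)\<bar> \<le> c" using Suc by auto
  then show ?case by (auto simp: max_def abs_le_iff)
qed auto

lemma running_max_le_sum:
  assumes "\<And>i. 0 \<le> s i"
  shows "running_max s n \<le> (\<Sum>i\<le>n. s i)"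
proof -
  obtain k where "k \<le> n" "running_max s n = s k" using running_max_attained by blast
  then show ?thesis using assms by (auto intro!: member_le_sum)
qed

lemma running_max_measurable:
  assumes "\<And>k. k \<le> n \<Longrightarrow> (\<lambda>\<omega>. s k \<omega>) \<in> borel_measurable M"
  shows "(\<lambda>\<omega>. running_max (\<lambda>k. s k \<omega>) n) \<in> borel_measurable M"
  using assms by (induction n) auto

text \<open>While no new maximum is reached the running maximum is constant and the right-hand side
  does not change at all. When \<open>x\<close> becomes the new maximum after \<open>y\<close>, the
  step reduces to 2 x y^(p-1) \<le> x^p + y^p.\<close>

lemma power_Doob_pathwise_aux:
  fixes s :: "nat \<Rightarrow> real"
  assumes "\<And>i. 0 \<le> s i" "s 0 = 0" "2 \<le> p"
  shows "running_max s n ^ p \<le> 2 * running_max s n ^ (p - 1) * s n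
    - 2 * (\<Sum>i<n. running_max s i ^ (p - 1) * (s (Suc i) - s i))"
proof (induction n)
  case 0 then show ?case using assms by (auto simp: power_0_left)
next
  case (Suc n)
  obtain q where q: "p = Suc (Suc q)" using assms(3) by (metis Suc_le_D numeral_2_eq_2 Suc_le_mono)
  define x y S where "x = s (Suc n)" and "y = running_max s n"
    and "S = (\<Sum>i<n. running_max s i ^ (p - 1) * (s (Suc i) - s i))"
  have IH: "y ^ p \<le> 2 * y ^ (p - 1) * s n - 2 * S" using Suc by (simp add: y_def S_def)
  have y0: "0 \<le> y" using running_max_ge[of 0 n s] assms(1)[of 0] by (simp add: y_def)
  have SS: "(\<Sum>i<Suc n. running_max s i ^ (p - 1) * (s (Suc i) - s i)) = S + (y ^ (p - 1) * x - y ^ (p - 1) * s n)"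
    by (simp add: S_def x_def y_def right_diff_distrib)
  show ?case
  proof (cases "x \<le> y")
    case True
    then have "running_max s (Suc n) = y" by (simp add: x_def y_def max_def)
    then show ?thesis unfolding SS using IH by (simp add: x_def[symmetric] right_diff_distrib distrib_left)
  next
    case False
    have "2 * x * y ^ (p - 1) \<le> x ^ p + y ^ p"
    proof -
      have "2 * (x * y) * y ^ q \<le> (x\<^sup>2 + y\<^sup>2) * y ^ q"
        using sum_squares_bound[of x y] y0 by (intro mult_right_mono) auto
      also have "\<dots> \<le> x\<^sup>2 * x ^ q + y\<^sup>2 * y ^ q"
        using False y0 by (auto simp: distrib_right intro!: mult_left_mono power_mono)
      finally show ?thesis by (simp add: q power2_eq_square mult_ac)
    qed
    moreover have "x * x ^ (p - 1) = x ^ p" by (simp add: q)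
    moreover have "running_max s (Suc n) = x" using False by (simp add: x_def y_def max_def)
    ultimately show ?thesis unfolding SS using IH
      by (simp add: x_def[symmetric] right_diff_distrib distrib_left mult_ac)
  qed
qed

text \<open>A pathwise form of Doob's maximal inequality: for a submartingale the sum on the right has
  nonnegative expectation.\<close>

lemma power_Doob_pathwise:
  fixes s :: "nat \<Rightarrow> real"
  assumes "\<And>i. 0 \<le> s i" "s 0 = 0" "2 \<le> p"
  shows "running_max s n ^ p \<le> 4 ^ p * s n ^ p
    - 4 * (\<Sum>i<n. running_max s i ^ (p - 1) * (s (Suc i) - s i))"
proof -
  define x where "x = running_max s n"
  have x0: "0 \<le> x" using running_max_ge[of 0 n s] assms(1)[of 0] by (simp add: x_def)
  have e: "x * x ^ (p - 1) = x ^ p" using assms(3) by (cases p) auto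
  \<comment> \<open>The auxiliary inequality is doubled; of the resulting \<open>2 * x ^ p\<close>
    one half absorbs the mixed term. Either \<open>4 * s n\<close> is at most \<open>x\<close>, or
    \<open>x\<close> may be replaced by \<open>4 * s n\<close>.\<close>
  have "4 * (x ^ (p - 1) * s n) \<le> x ^ p + 4 ^ p * s n ^ p"
  proof (cases "4 * s n \<le> x")
    case True
    then have "x ^ (p - 1) * (4 * s n) \<le> x ^ (p - 1) * x" using x0 by (intro mult_left_mono) auto
    moreover have "0 \<le> 4 ^ p * s n ^ p" using assms(1) by auto
    ultimately show ?thesis using e by (simp add: mult_ac)
  next
    case False
    then have "x ^ (p - 1) * (4 * s n) \<le> (4 * s n) ^ (p - 1) * (4 * s n)" using x0 assms(1)
      by (intro mult_right_mono power_mono) auto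
    also have "\<dots> = 4 ^ p * s n ^ p" using assms(3) by (cases p) (auto simp: power_mult_distrib)
    finally show ?thesis using x0 by (simp add: mult_ac add_increasing)
  qed
  then show ?thesis using power_Doob_pathwise_aux[of s p n, OF assms] by (simp add: x_def[symmetric])
qed

text \<open>Cauchy-Schwarz in each row; the norm of the matrix is the Frobenius norm.\<close>

lemma norm_mult_vec_le:
  fixes A :: "real^'m^'d"
  shows "norm (A *v x) \<le> norm A * norm x"
proof -
  have "norm (A *v x) = L2_set (\<lambda>i. norm (inner (A $ i) x)) UNIV"
    by (simp add: norm_vec_def matrix_vector_mul_component)
  also have "\<dots> \<le> L2_set (\<lambda>i. norm (A $ i) * norm x) UNIV"
    by (intro L2_set_mono) (auto simp: Cauchy_Schwarz_ineq2)
  also have "\<dots> = norm A * norm x"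
    by (subst L2_set_left_distrib[symmetric]) (auto simp: norm_vec_def)
  finally show ?thesis .
qed

section \<open>Moment bounds and independence\<close>

text \<open>The Bochner integral of a non-integrable function is 0 by convention, so a bound on it
  carries information only together with integrability. The two are kept in one predicate, with
  nonnegativity, so that bounds can be compared, added and scaled without side computations.\<close>

definition Ebd :: "'a measure \<Rightarrow> ('a \<Rightarrow> real) \<Rightarrow> real \<Rightarrow> bool" where
  "Ebd M f b \<longleftrightarrow> integrable M f \<and> (\<forall>\<omega>\<in>space M. 0 \<le> f \<omega>) \<and> integral\<^sup>L M f \<le> b"

lemma EbdD:
  assumes "Ebd M f b"
  shows "integrable M f" "f \<in> borel_measurable M" "\<And>\<omega>. \<omega> \<in> space M \<Longrightarrow> 0 \<le> f \<omega>" "integral\<^sup>L M f \<le> b" "0 \<le> b"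
proof -
  show i: "integrable M f" and n: "\<And>\<omega>. \<omega> \<in> space M \<Longrightarrow> 0 \<le> f \<omega>" and b: "integral\<^sup>L M f \<le> b"
    using assms by (auto simp: Ebd_def)
  show "f \<in> borel_measurable M" using i by auto
  have "0 \<le> integral\<^sup>L M f" by (intro Bochner_Integration.integral_nonneg n)
  then show "0 \<le> b" using b by simp
qed

lemma Ebd_nn_integral:
  assumes "f \<in> borel_measurable M" "\<And>\<omega>. \<omega> \<in> space M \<Longrightarrow> 0 \<le> f \<omega>" "0 \<le> b"
  shows "Ebd M f b \<longleftrightarrow> (\<integral>\<^sup>+\<omega>. ennreal (f \<omega>) \<partial>M) \<le> ennreal b"
proof
  assume "Ebd M f b"
  note e = EbdD[OF this]
  have "(\<integral>\<^sup>+\<omega>. ennreal (f \<omega>) \<partial>M) = ennreal (integral\<^sup>L M f)"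
    by (intro nn_integral_eq_integral e AE_I2) (use assms in auto)
  then show "(\<integral>\<^sup>+\<omega>. ennreal (f \<omega>) \<partial>M) \<le> ennreal b" using e by (simp add: ennreal_leI)
next
  assume a: "(\<integral>\<^sup>+\<omega>. ennreal (f \<omega>) \<partial>M) \<le> ennreal b"
  then have "(\<integral>\<^sup>+\<omega>. ennreal (f \<omega>) \<partial>M) < \<infinity>" by (rule le_less_trans) simp
  then have i: "integrable M f" by (intro integrableI_nonneg assms AE_I2) auto
  have "(\<integral>\<^sup>+\<omega>. ennreal (f \<omega>) \<partial>M) = ennreal (integral\<^sup>L M f)"
    by (intro nn_integral_eq_integral i AE_I2) (use assms in auto)
  then show "Ebd M f b" using a i assms by (auto simp: Ebd_def)
qed

lemma Ebd_mono:
  assumes "Ebd M g b" "f \<in> borel_measurable M" "\<And>\<omega>. \<omega> \<in> space M \<Longrightarrow> 0 \<le> f \<omega>"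
    "\<And>\<omega>. \<omega> \<in> space M \<Longrightarrow> f \<omega> \<le> g \<omega>" "b \<le> c"
  shows "Ebd M f c"
proof -
  note e = EbdD[OF assms(1)]
  have i: "integrable M f"
    by (rule Bochner_Integration.integrable_bound[OF e(1) assms(2)]) (use assms in \<open>auto intro!: AE_I2 order_trans[OF assms(4)]\<close>)
  have "integral\<^sup>L M f \<le> integral\<^sup>L M g" by (intro integral_mono i e assms)
  then show ?thesis using i e assms by (auto simp: Ebd_def)
qed

lemma Ebd_mono_const: "Ebd M f b \<Longrightarrow> b \<le> c \<Longrightarrow> Ebd M f c"
  by (auto simp: Ebd_def)

lemma Ebd_add: "Ebd M f a \<Longrightarrow> Ebd M g b \<Longrightarrow> Ebd M (\<lambda>\<omega>. f \<omega> + g \<omega>) (a + b)"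
  by (auto simp: Ebd_def)

lemma Ebd_cmult: "Ebd M f a \<Longrightarrow> 0 \<le> c \<Longrightarrow> Ebd M (\<lambda>\<omega>. c * f \<omega>) (c * a)"
  by (auto simp: Ebd_def intro!: mult_left_mono)

lemma Ebd_sum: "(\<And>i. i \<in> I \<Longrightarrow> Ebd M (f i) (a i)) \<Longrightarrow> Ebd M (\<lambda>\<omega>. \<Sum>i\<in>I. f i \<omega>) (\<Sum>i\<in>I. a i)"
  by (auto simp: Ebd_def intro!: sum_mono sum_nonneg)

lemma (in prob_space) Ebd_const: "0 \<le> c \<Longrightarrow> Ebd M (\<lambda>\<omega>. c) c"
  by (auto simp: Ebd_def prob_space)

lemma Ebd_zero:
  assumes "\<And>\<omega>. \<omega> \<in> space M \<Longrightarrow> f \<omega> = 0" "0 \<le> b"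
  shows "Ebd M f b"
proof -
  have "integrable M f \<longleftrightarrow> integrable M (\<lambda>\<omega>. 0 :: real)" by (rule Bochner_Integration.integrable_cong) (auto simp: assms)
  moreover have "integral\<^sup>L M f = integral\<^sup>L M (\<lambda>\<omega>. 0 :: real)" by (rule Bochner_Integration.integral_cong) (auto simp: assms)
  ultimately show ?thesis using assms by (auto simp: Ebd_def)
qed

lemma (in prob_space) Ebd_powr:
  assumes "Ebd M f b" "0 < b" "0 < \<alpha>" "\<alpha> \<le> 1"
  shows "Ebd M (\<lambda>\<omega>. f \<omega> powr \<alpha>) (b powr \<alpha>)"
proof (rule Ebd_mono)
  note e = EbdD[OF assms(1)]
  show "Ebd M (\<lambda>\<omega>. (1 - \<alpha>) * b powr \<alpha> + \<alpha> * b powr (\<alpha> - 1) * f \<omega>) ((1 - \<alpha>) * b powr \<alpha> + \<alpha> * b powr (\<alpha> - 1) * b)"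
    by (intro Ebd_add Ebd_const Ebd_cmult assms) (use assms in auto)
  show "(\<lambda>\<omega>. f \<omega> powr \<alpha>) \<in> borel_measurable M" using e by measurable
  show "(1 - \<alpha>) * b powr \<alpha> + \<alpha> * b powr (\<alpha> - 1) * b \<le> b powr \<alpha>"
    using assms by (simp add: powr_diff algebra_simps)
  show "f \<omega> powr \<alpha> \<le> (1 - \<alpha>) * b powr \<alpha> + \<alpha> * b powr (\<alpha> - 1) * f \<omega>" if "\<omega> \<in> space M" for \<omega>
    by (rule powr_le_tangent) (use assms e that in auto)
qed auto

text \<open>Jensen's inequality on a measure of total mass \<open>L\<close>, stated with the
  nonnegative integral so that the right-hand side may be infinite; this is the form needed before
  Tonelli's theorem.\<close>

lemma nn_integral_power_le:
  assumes [measurable]: "x \<in> borel_measurable \<mu>" and "\<And>s. s \<in> space \<mu> \<Longrightarrow> 0 \<le> x s"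
    and \<mu>: "emeasure \<mu> (space \<mu>) = ennreal L" "0 \<le> L" and p: "1 \<le> p" and i: "integrable \<mu> (x :: _ \<Rightarrow> real)"
  shows "ennreal ((\<integral>s. x s \<partial>\<mu>) ^ p) \<le> ennreal (L ^ (p - 1)) * (\<integral>\<^sup>+s. ennreal (x s ^ p) \<partial>\<mu>)"
proof (cases "(\<integral>\<^sup>+s. ennreal (x s ^ p) \<partial>\<mu>) = \<infinity> \<or> L = 0")
  case True
  show ?thesis
  proof (cases "L = 0")
    case True
    then have "AE s in \<mu>. x s = 0" using \<mu> by (intro AE_I[of _ _ "space \<mu>"]) auto
    then have "(\<integral>s. x s \<partial>\<mu>) = 0" by (simp add: integral_eq_zero_AE)
    then show ?thesis using p by (simp add: power_0_left)
  next
    case False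
    then show ?thesis using True \<mu> by (auto simp: ennreal_mult_top)
  qed
next
  case False
  then have L: "0 < L" using \<mu> by auto
  interpret finite_measure \<mu> by standard (use \<mu> in auto)
  have iP: "integrable \<mu> (\<lambda>s. x s ^ p)"
    by (intro integrableI_nonneg) (use False assms in \<open>auto simp: top.not_eq_extremum\<close>)
  define m where "m = (\<integral>s. x s \<partial>\<mu>) / L"
  have m0: "0 \<le> m" unfolding m_def using L assms by (intro divide_nonneg_nonneg integral_nonneg) auto
  have mL: "measure \<mu> (space \<mu>) = L" using \<mu> by (simp add: measure_def)
  have "(\<integral>s. m ^ p + real p * m ^ (p - 1) * (x s - m) \<partial>\<mu>) \<le> (\<integral>s. x s ^ p \<partial>\<mu>)"
    by (intro integral_mono power_ge_tangent iP) (use assms m0 i in auto)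
  also have "(\<integral>s. m ^ p + real p * m ^ (p - 1) * (x s - m) \<partial>\<mu>) = L * m ^ p"
    using i L by (simp add: mL) (simp add: m_def)
  finally have *: "L * m ^ p \<le> (\<integral>s. x s ^ p \<partial>\<mu>)" .
  have "(\<integral>s. x s \<partial>\<mu>) ^ p = L ^ (p - 1) * (L * m ^ p)"
    using p L by (cases p) (auto simp: m_def power_divide)
  also have "\<dots> \<le> L ^ (p - 1) * (\<integral>s. x s ^ p \<partial>\<mu>)" using L by (intro mult_left_mono *) auto
  finally have "ennreal ((\<integral>s. x s \<partial>\<mu>) ^ p) \<le> ennreal (L ^ (p - 1)) * ennreal (\<integral>s. x s ^ p \<partial>\<mu>)"
    using L assms by (simp add: ennreal_leI integral_nonneg flip: ennreal_mult)
  then show ?thesis using iP assms by (subst nn_integral_eq_integral) auto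
qed

section \<open>Independence from a sigma-algebra and martingale differences\<close>

definition indep_of :: "'a measure \<Rightarrow> 'a measure \<Rightarrow> ('a \<Rightarrow> 'b::topological_space) \<Rightarrow> bool" where
  "indep_of M G Z \<longleftrightarrow> subalgebra M G \<and> Z \<in> borel_measurable M \<and>
     (\<forall>A\<in>sets borel. \<forall>B\<in>sets G.
        measure M (Z -` A \<inter> space M \<inter> B) = measure M (Z -` A \<inter> space M) * measure M B)"

text \<open>The weak form of vanishing conditional expectation given \<open>G\<close>. Integrability
  is asked of the product with the test function, because the test functions of the moment estimate
  are powers of the martingale itself and unbounded.\<close>

definition mart_diff :: "'a measure \<Rightarrow> 'a measure \<Rightarrow> ('a \<Rightarrow> 'b::euclidean_space) \<Rightarrow> bool" where
  "mart_diff M G D \<longleftrightarrow> subalgebra M G \<and> D \<in> borel_measurable M \<and>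
     (\<forall>\<psi>\<in>borel_measurable G. integrable M (\<lambda>\<omega>. norm (\<psi> \<omega>) * norm (D \<omega>)) \<longrightarrow>
        (\<integral>\<omega>. inner (\<psi> \<omega>) (D \<omega>) \<partial>M) = 0)"

lemma subalgebra_measurable:
  "subalgebra M G \<Longrightarrow> f \<in> measurable G N \<Longrightarrow> f \<in> measurable M N"
  by (rule measurable_from_subalg)

lemma subalgebra_id_measurable: "subalgebra M G \<Longrightarrow> (\<lambda>\<omega>. \<omega>) \<in> measurable M G"
  by (auto simp: subalgebra_def measurable_def)

text \<open>Independence in the form to which Fubini's theorem applies. The second component is the
  sample point itself, seen through \<open>G\<close>, so that any amount of
  \<open>G\<close>-measurable data is covered by one pair.\<close>

lemma (in prob_space) indep_of_distr:
  fixes Z :: "'a \<Rightarrow> 'b::second_countable_topology"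
  assumes "indep_of M G Z"
  shows "distr M borel Z \<Otimes>\<^sub>M restr_to_subalg M G = distr M (borel \<Otimes>\<^sub>M G) (\<lambda>\<omega>. (Z \<omega>, \<omega>))"
proof -
  have sub: "subalgebra M G" and Z[measurable]: "Z \<in> borel_measurable M"
    and I: "\<And>A B. A \<in> sets borel \<Longrightarrow> B \<in> sets G \<Longrightarrow>
      prob (Z -` A \<inter> space M \<inter> B) = prob (Z -` A \<inter> space M) * prob B"
    using assms by (auto simp: indep_of_def)
  note id[measurable] = subalgebra_id_measurable[OF sub]
  interpret Z: prob_space "distr M borel Z" by (rule prob_space_distr) simp
  interpret R: prob_space "restr_to_subalg M G" by (rule prob_space_restr_to_subalg[OF sub]) unfold_locales
  show ?thesis
  proof (rule pair_measure_eqI)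
    show "sets (distr M borel Z \<Otimes>\<^sub>M restr_to_subalg M G) = sets (distr M (borel \<Otimes>\<^sub>M G) (\<lambda>\<omega>. (Z \<omega>, \<omega>)))"
      by (auto simp: sets_restr_to_subalg[OF sub] intro!: sets_pair_measure_cong)
    fix A B assume A: "A \<in> sets (distr M borel Z)" and "B \<in> sets (restr_to_subalg M G)"
    then have B: "B \<in> sets G" by (simp add: sets_restr_to_subalg[OF sub])
    then have BM: "B \<in> sets M" using sub by (auto simp: subalgebra_def)
    have eq: "(\<lambda>\<omega>. (Z \<omega>, \<omega>)) -` (A \<times> B) \<inter> space M = Z -` A \<inter> space M \<inter> B"
      using sets.sets_into_space[OF BM] by auto
    show "emeasure (distr M borel Z) A * emeasure (restr_to_subalg M G) B
        = emeasure (distr M (borel \<Otimes>\<^sub>M G) (\<lambda>\<omega>. (Z \<omega>, \<omega>))) (A \<times> B)"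
      using A B BM I[of A B]
      by (simp add: emeasure_distr emeasure_restr_to_subalg[OF sub] eq emeasure_eq_measure ennreal_mult)
  qed (unfold_locales)
qed

lemma (in prob_space) indep_of_nn_integral:
  fixes Z :: "'a \<Rightarrow> 'b::second_countable_topology"
  assumes "indep_of M G Z" and \<Phi>: "\<Phi> \<in> borel_measurable (borel \<Otimes>\<^sub>M G)"
  shows "(\<integral>\<^sup>+\<omega>. \<Phi> (Z \<omega>, \<omega>) \<partial>M) = (\<integral>\<^sup>+z. (\<integral>\<^sup>+\<omega>. \<Phi> (z, \<omega>) \<partial>M) \<partial>distr M borel Z)"
proof -
  have sub: "subalgebra M G" and Z[measurable]: "Z \<in> borel_measurable M"
    using assms by (auto simp: indep_of_def)
  note [measurable] = subalgebra_id_measurable[OF sub] \<Phi>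
  interpret Z: prob_space "distr M borel Z" by (rule prob_space_distr) simp
  interpret R: prob_space "restr_to_subalg M G" by (rule prob_space_restr_to_subalg[OF sub]) unfold_locales
  have seq: "sets (distr M borel Z \<Otimes>\<^sub>M restr_to_subalg M G) = sets (borel \<Otimes>\<^sub>M G)"
    by (auto simp: sets_restr_to_subalg[OF sub] intro!: sets_pair_measure_cong)
  have "(\<integral>\<^sup>+\<omega>. \<Phi> (Z \<omega>, \<omega>) \<partial>M) = (\<integral>\<^sup>+x. \<Phi> x \<partial>distr M (borel \<Otimes>\<^sub>M G) (\<lambda>\<omega>. (Z \<omega>, \<omega>)))"
    by (subst nn_integral_distr) auto
  also have "\<dots> = (\<integral>\<^sup>+z. (\<integral>\<^sup>+\<omega>. \<Phi> (z, \<omega>) \<partial>restr_to_subalg M G) \<partial>distr M borel Z)"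
    unfolding indep_of_distr[OF assms(1), symmetric]
    by (rule R.nn_integral_fst[symmetric]) (use \<Phi> in \<open>simp cong: measurable_cong_sets[OF seq refl]\<close>)
  also have "\<dots> = (\<integral>\<^sup>+z. (\<integral>\<^sup>+\<omega>. \<Phi> (z, \<omega>) \<partial>M) \<partial>distr M borel Z)"
    by (intro nn_integral_cong nn_integral_subalgebra2[OF sub]) auto
  finally show ?thesis .
qed

text \<open>Freezing: by the product form of the joint law, \<open>Z\<close> is integrated out first
  with the sample point fixed. A test function is then a fixed vector \<open>v\<close>, which is why
  the mean is required to vanish against every \<open>v\<close>.\<close>

lemma (in prob_space) mart_diffI:
  fixes Z :: "'a \<Rightarrow> 'b::second_countable_topology" and d :: "'b \<times> 'a \<Rightarrow> 'c::euclidean_space"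
  assumes ind: "indep_of M G Z" and d[measurable]: "d \<in> borel_measurable (borel \<Otimes>\<^sub>M G)"
    and zero: "\<And>v \<omega>. \<omega> \<in> space M \<Longrightarrow> (\<integral>z. inner v (d (z, \<omega>)) \<partial>distr M borel Z) = 0"
  shows "mart_diff M G (\<lambda>\<omega>. d (Z \<omega>, \<omega>))"
proof -
  have sub: "subalgebra M G" and Z[measurable]: "Z \<in> borel_measurable M"
    using ind by (auto simp: indep_of_def)
  note [measurable] = subalgebra_id_measurable[OF sub]
  interpret Z: prob_space "distr M borel Z" by (rule prob_space_distr) simp
  interpret R: prob_space "restr_to_subalg M G" by (rule prob_space_restr_to_subalg[OF sub]) unfold_locales
  interpret pair_sigma_finite "distr M borel Z" "restr_to_subalg M G" ..
  have seq: "sets (distr M borel Z \<Otimes>\<^sub>M restr_to_subalg M G) = sets (borel \<Otimes>\<^sub>M G)"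
    by (auto simp: sets_restr_to_subalg[OF sub] intro!: sets_pair_measure_cong)
  have "(\<integral>\<omega>. inner (\<psi> \<omega>) (d (Z \<omega>, \<omega>)) \<partial>M) = 0"
    if [measurable]: "\<psi> \<in> borel_measurable G" and i: "integrable M (\<lambda>\<omega>. norm (\<psi> \<omega>) * norm (d (Z \<omega>, \<omega>)))" for \<psi>
  proof -
    have [measurable]: "\<psi> \<in> borel_measurable M" by (rule subalgebra_measurable[OF sub]) fact
    define \<Phi> where "\<Phi> = (\<lambda>(z, \<omega>). inner (\<psi> \<omega>) (d (z, \<omega>)))"
    have \<Phi>m[measurable]: "\<Phi> \<in> borel_measurable (borel \<Otimes>\<^sub>M G)" unfolding \<Phi>_def by measurable
    have "integrable M (\<lambda>\<omega>. \<Phi> (Z \<omega>, \<omega>))"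
      by (rule Bochner_Integration.integrable_bound[OF i])
        (auto simp: \<Phi>_def Cauchy_Schwarz_ineq2)
    then have "integrable (distr M (borel \<Otimes>\<^sub>M G) (\<lambda>\<omega>. (Z \<omega>, \<omega>))) \<Phi>"
      by (subst integrable_distr_eq) auto
    then have int: "integrable (distr M borel Z \<Otimes>\<^sub>M restr_to_subalg M G) \<Phi>"
      unfolding indep_of_distr[OF ind, symmetric] .
    have "(\<integral>\<omega>. inner (\<psi> \<omega>) (d (Z \<omega>, \<omega>)) \<partial>M) = integral\<^sup>L (distr M (borel \<Otimes>\<^sub>M G) (\<lambda>\<omega>. (Z \<omega>, \<omega>))) \<Phi>"
      by (subst integral_distr) (auto simp: \<Phi>_def)
    also have "\<dots> = (\<integral>\<omega>. (\<integral>z. \<Phi> (z, \<omega>) \<partial>distr M borel Z) \<partial>restr_to_subalg M G)"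
      unfolding indep_of_distr[OF ind, symmetric] using integral_snd[of "\<lambda>z \<omega>. \<Phi> (z, \<omega>)"] int by simp
    also have "\<dots> = (\<integral>\<omega>. 0 \<partial>restr_to_subalg M G)"
      by (intro Bochner_Integration.integral_cong refl) (auto simp: \<Phi>_def zero space_restr_to_subalg)
    finally show ?thesis by simp
  qed
  then show ?thesis using sub unfolding mart_diff_def by auto
qed

text \<open>The intersections \<open>b \<inter> c\<close> form an intersection-stable generator of
  the join, so the product formula has to be checked on them alone.\<close>

lemma (in prob_space) indep_of_join:
  assumes B: "subalgebra M B" and C: "subalgebra M C" and Z: "Z \<in> borel_measurable M"
    and prod: "\<And>A b c. A \<in> sets borel \<Longrightarrow> b \<in> sets B \<Longrightarrow> c \<in> sets C \<Longrightarrow>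
      prob (Z -` A \<inter> space M \<inter> (b \<inter> c)) = prob (Z -` A \<inter> space M) * prob (b \<inter> c)"
  shows "indep_of M (sigma (space M) (sets B \<union> sets C)) Z"
proof -
  let ?J = "{b \<inter> c | b c. b \<in> sets B \<and> c \<in> sets C}"
  let ?Z = "{Z -` A \<inter> space M | A. A \<in> sets borel}"
  have sB: "sets B \<subseteq> sets M" "space M \<in> sets B" and sC: "sets C \<subseteq> sets M" "space M \<in> sets C"
    using B C by (auto simp: subalgebra_def) (metis sets.top)+
  have BC: "sets B \<union> sets C \<subseteq> Pow (space M)" using sB sC sets.sets_into_space by blast
  have "indep_set ?Z ?J"
    unfolding indep_set_def indep_sets2_eq[unfolded indep_set_def]
    using prod Z sB sC by (auto simp: indep_sets2_eq[unfolded indep_set_def])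
  then have "indep_set (sigma_sets (space M) ?Z) (sigma_sets (space M) ?J)"
  proof (rule indep_set_sigma_sets)
    show "Int_stable ?Z"
    proof (rule Int_stableI)
      fix a b assume "a \<in> ?Z" "b \<in> ?Z"
      then obtain A A' where "a = Z -` A \<inter> space M" "b = Z -` A' \<inter> space M" "A \<in> sets borel" "A' \<in> sets borel" by auto
      then show "a \<inter> b \<in> ?Z" by (auto intro!: exI[of _ "A \<inter> A'"])
    qed
    show "Int_stable ?J"
    proof (rule Int_stableI)
      fix a b assume "a \<in> ?J" "b \<in> ?J"
      then obtain a1 a2 b1 b2 where "a = a1 \<inter> a2" "b = b1 \<inter> b2" "a1 \<in> sets B" "b1 \<in> sets B" "a2 \<in> sets C" "b2 \<in> sets C" by blast
      then have "a \<inter> b = (a1 \<inter> b1) \<inter> (a2 \<inter> b2)" "a1 \<inter> b1 \<in> sets B" "a2 \<inter> b2 \<in> sets C" by auto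
      then show "a \<inter> b \<in> ?J" by blast
    qed
  qed
  moreover have "sigma_sets (space M) (sets B \<union> sets C) \<subseteq> sigma_sets (space M) ?J"
  proof (rule sigma_sets_mono)
    show "sets B \<union> sets C \<subseteq> sigma_sets (space M) ?J"
    proof
      fix x assume "x \<in> sets B \<union> sets C"
      then have "x \<in> ?J"
      proof
        assume x: "x \<in> sets B"
        then have "x = x \<inter> space M" using sB sets.sets_into_space by blast
        then show ?thesis using x sC by blast
      next
        assume x: "x \<in> sets C"
        then have "x = space M \<inter> x" using sC sets.sets_into_space by blast
        then show ?thesis using x sB by blast
      qed
      then show "x \<in> sigma_sets (space M) ?J" by (rule sigma_sets.Basic)
    qed
  qed
  ultimately have "\<And>A E. A \<in> sets borel \<Longrightarrow> E \<in> sigma_sets (space M) (sets B \<union> sets C) \<Longrightarrow>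
     prob (Z -` A \<inter> space M \<inter> E) = prob (Z -` A \<inter> space M) * prob E"
  proof -
    fix A :: "'b set" and E assume "A \<in> sets borel" "E \<in> sigma_sets (space M) (sets B \<union> sets C)"
      and S: "sigma_sets (space M) (sets B \<union> sets C) \<subseteq> sigma_sets (space M) ?J"
      and I: "indep_set (sigma_sets (space M) ?Z) (sigma_sets (space M) ?J)"
    then show "prob (Z -` A \<inter> space M \<inter> E) = prob (Z -` A \<inter> space M) * prob E"
      by (intro indep_setD[OF I]) (auto intro: sigma_sets.Basic)
  qed
  moreover have "sigma_sets (space M) (sets B \<union> sets C) \<subseteq> sets M"
    using sB sC by (intro sets.sigma_sets_subset) auto
  ultimately show ?thesis using BC Z by (auto simp: indep_of_def subalgebra_def sets_measure_of space_measure_of)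
qed

lemma indep_of_comp:
  assumes "indep_of M G Z" "\<phi> \<in> borel_measurable borel"
  shows "indep_of M G (\<lambda>\<omega>. \<phi> (Z \<omega>))"
proof -
  have "(\<lambda>\<omega>. \<phi> (Z \<omega>)) -` A \<inter> space M = Z -` (\<phi> -` A) \<inter> space M" for A by auto
  moreover have "\<phi> -` A \<in> sets borel" if "A \<in> sets borel" for A
    using measurable_sets[OF assms(2) that] by simp
  ultimately show ?thesis using assms by (auto simp: indep_of_def intro: measurable_compose)
qed

section \<open>Convergence in probability\<close>

definition conv_prob :: "'a measure \<Rightarrow> (nat \<Rightarrow> 'a \<Rightarrow> 'b::real_normed_vector) \<Rightarrow> ('a \<Rightarrow> 'b) \<Rightarrow> bool" where
  "conv_prob M Y Z \<longleftrightarrow> (\<forall>\<epsilon>>0. (\<lambda>q. measure M {\<omega> \<in> space M. norm (Y q \<omega> - Z \<omega>) > \<epsilon>}) \<longlonglongrightarrow> 0)"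

lemma (in prob_space) conv_prob_dominated:
  fixes Y :: "'i \<Rightarrow> nat \<Rightarrow> 'a \<Rightarrow> 'b::{banach, second_countable_topology}"
    and U :: "nat \<Rightarrow> 'a \<Rightarrow> 'c::{banach, second_countable_topology}"
  assumes I: "finite I" and conv: "\<And>i. i \<in> I \<Longrightarrow> conv_prob M (Y i) (Z i)"
    and [measurable]: "\<And>i q. i \<in> I \<Longrightarrow> Y i q \<in> borel_measurable M" "\<And>i. i \<in> I \<Longrightarrow> Z i \<in> borel_measurable M"
    and dom: "\<And>q \<omega>. \<omega> \<in> space M \<Longrightarrow> norm (U q \<omega> - V \<omega>) \<le> (\<Sum>i\<in>I. norm (Y i q \<omega> - Z i \<omega>))"
  shows "conv_prob M U V"
  unfolding conv_prob_def
proof (intro allI impI)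
  fix \<epsilon> :: real assume "\<epsilon> > 0"
  \<comment> \<open>If every summand is at most \<delta>, the sum is at most \<epsilon>. The added 1
    covers an empty index set.\<close>
  define \<delta> where "\<delta> = \<epsilon> / (real (card I) + 1)"
  have \<delta>: "\<delta> > 0" using \<open>\<epsilon> > 0\<close> by (simp add: \<delta>_def)
  have "(\<lambda>q. \<Sum>i\<in>I. prob {\<omega> \<in> space M. norm (Y i q \<omega> - Z i \<omega>) > \<delta>}) \<longlonglongrightarrow> (\<Sum>i\<in>I. 0)"
    by (intro tendsto_sum) (use conv \<delta> in \<open>auto simp: conv_prob_def\<close>)
  then have lim: "(\<lambda>q. \<Sum>i\<in>I. prob {\<omega> \<in> space M. norm (Y i q \<omega> - Z i \<omega>) > \<delta>}) \<longlonglongrightarrow> 0" by simp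
  have le: "prob {\<omega> \<in> space M. norm (U q \<omega> - V \<omega>) > \<epsilon>} \<le> (\<Sum>i\<in>I. prob {\<omega> \<in> space M. norm (Y i q \<omega> - Z i \<omega>) > \<delta>})" for q
  proof -
    have [measurable]: "{\<omega> \<in> space M. norm (Y i q \<omega> - Z i \<omega>) > \<delta>} \<in> sets M" if "i \<in> I" for i
      using that by measurable
    have "prob {\<omega> \<in> space M. norm (U q \<omega> - V \<omega>) > \<epsilon>} \<le> prob (\<Union>i\<in>I. {\<omega> \<in> space M. norm (Y i q \<omega> - Z i \<omega>) > \<delta>})"
    proof (rule finite_measure_mono)
      show "(\<Union>i\<in>I. {\<omega> \<in> space M. norm (Y i q \<omega> - Z i \<omega>) > \<delta>}) \<in> sets M"
        using I by (intro sets.finite_UN) auto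
      show "{\<omega> \<in> space M. norm (U q \<omega> - V \<omega>) > \<epsilon>} \<subseteq> (\<Union>i\<in>I. {\<omega> \<in> space M. norm (Y i q \<omega> - Z i \<omega>) > \<delta>})"
      proof (safe, rule ccontr)
        fix \<omega> assume w: "\<omega> \<in> space M" "norm (U q \<omega> - V \<omega>) > \<epsilon>"
          and "\<omega> \<notin> (\<Union>i\<in>I. {\<omega> \<in> space M. norm (Y i q \<omega> - Z i \<omega>) > \<delta>})"
        then have "(\<Sum>i\<in>I. norm (Y i q \<omega> - Z i \<omega>)) \<le> (\<Sum>i\<in>I. \<delta>)" by (intro sum_mono) force
        also have "\<dots> \<le> \<epsilon>" using \<open>\<epsilon> > 0\<close> by (simp add: \<delta>_def field_simps)
        finally show False using dom[OF w(1), of q] w by simp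
      qed
    qed
    also have "\<dots> \<le> (\<Sum>i\<in>I. prob {\<omega> \<in> space M. norm (Y i q \<omega> - Z i \<omega>) > \<delta>})"
      using I by (intro finite_measure_subadditive_finite) auto
    finally show ?thesis .
  qed
  show "(\<lambda>q. prob {\<omega> \<in> space M. norm (U q \<omega> - V \<omega>) > \<epsilon>}) \<longlonglongrightarrow> 0"
    by (rule tendsto_sandwich[OF _ _ tendsto_const lim]) (auto intro!: always_eventually le)
qed

text \<open>Borel-Cantelli: the k-th index is chosen so that a deviation above 2^-k has probability
  below 2^-k. The selection \<rho> is not claimed to increase; pointwise convergence along it is all
  that Fatou's lemma asks for.\<close>

lemma (in prob_space) conv_prob_subseq:
  fixes Y :: "nat \<Rightarrow> 'a \<Rightarrow> 'b::{banach, second_countable_topology}"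
  assumes conv: "conv_prob M Y Z" and [measurable]: "\<And>q. Y q \<in> borel_measurable M" "Z \<in> borel_measurable M"
  shows "\<exists>\<rho>. AE \<omega> in M. (\<lambda>k. Y (\<rho> k) \<omega>) \<longlonglongrightarrow> Z \<omega>"
proof -
  have "\<exists>q. prob {\<omega> \<in> space M. norm (Y q \<omega> - Z \<omega>) > (1/2) ^ k} < (1/2) ^ k" for k :: nat
  proof -
    have "(\<lambda>q. prob {\<omega> \<in> space M. norm (Y q \<omega> - Z \<omega>) > (1/2) ^ k}) \<longlonglongrightarrow> 0"
      using conv by (simp add: conv_prob_def)
    then have "eventually (\<lambda>q. prob {\<omega> \<in> space M. norm (Y q \<omega> - Z \<omega>) > (1/2) ^ k} < (1/2) ^ k) sequentially"
      by (rule order_tendstoD) simp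
    then show ?thesis by (auto simp: eventually_sequentially)
  qed
  then obtain \<rho> where \<rho>: "\<And>k. prob {\<omega> \<in> space M. norm (Y (\<rho> k) \<omega> - Z \<omega>) > (1/2) ^ k} < (1/2) ^ k" by metis
  have "AE \<omega> in M. eventually (\<lambda>k. \<omega> \<in> space M - {\<omega> \<in> space M. norm (Y (\<rho> k) \<omega> - Z \<omega>) > (1/2) ^ k}) sequentially"
  proof (rule borel_cantelli_AE1)
    show "summable (\<lambda>k. prob {\<omega> \<in> space M. norm (Y (\<rho> k) \<omega> - Z \<omega>) > (1/2) ^ k})"
      by (rule summable_comparison_test'[where g = "\<lambda>k. (1/2) ^ k" and N = 0])
        (auto simp: summable_geometric intro: less_imp_le[OF \<rho>])
  qed (auto simp: emeasure_eq_measure)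
  then have "AE \<omega> in M. (\<lambda>k. Y (\<rho> k) \<omega>) \<longlonglongrightarrow> Z \<omega>"
  proof (eventually_elim)
    case (elim \<omega>)
    have "(\<lambda>k. norm (Y (\<rho> k) \<omega> - Z \<omega>)) \<longlonglongrightarrow> 0"
      by (rule tendsto_sandwich[OF _ _ tendsto_const LIMSEQ_power_zero[of "1/2 :: real"]])
        (use elim in \<open>auto elim!: eventually_mono\<close>)
    then show ?case by (rule LIM_zero_cancel[OF tendsto_norm_zero_cancel])
  qed
  then show ?thesis by blast
qed

text \<open>Fatou's lemma needs almost sure convergence, so it is applied along the selection of
  \<open>conv_prob_subseq\<close>.\<close>

lemma (in prob_space) Ebd_conv_prob:
  fixes Y :: "nat \<Rightarrow> 'a \<Rightarrow> 'b::{banach, second_countable_topology}"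
  assumes conv: "conv_prob M Y Z" and [measurable]: "Z \<in> borel_measurable M" 
    and [measurable]: "\<And>q. Y q \<in> borel_measurable M"
    and b: "\<And>q. Ebd M (\<lambda>\<omega>. norm (Y q \<omega>) ^ p) b"
  shows "Ebd M (\<lambda>\<omega>. norm (Z \<omega>) ^ p) b"
proof -
  obtain \<rho> where \<rho>: "AE \<omega> in M. (\<lambda>k. Y (\<rho> k) \<omega>) \<longlonglongrightarrow> Z \<omega>"
    using conv_prob_subseq[OF conv] by auto
  have b0: "0 \<le> b" using EbdD[OF b[of 0]] by simp
  have "AE \<omega> in M. ennreal (norm (Z \<omega>) ^ p) = liminf (\<lambda>k. ennreal (norm (Y (\<rho> k) \<omega>) ^ p))"
    using \<rho>
  proof eventually_elim
    case (elim \<omega>)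
    then have "(\<lambda>k. ennreal (norm (Y (\<rho> k) \<omega>) ^ p)) \<longlonglongrightarrow> ennreal (norm (Z \<omega>) ^ p)"
      by (intro tendsto_ennrealI tendsto_power tendsto_norm)
    then show ?case by (intro lim_imp_Liminf[symmetric]) auto
  qed
  then have "(\<integral>\<^sup>+\<omega>. ennreal (norm (Z \<omega>) ^ p) \<partial>M) = (\<integral>\<^sup>+\<omega>. liminf (\<lambda>k. ennreal (norm (Y (\<rho> k) \<omega>) ^ p)) \<partial>M)"
    by (rule nn_integral_cong_AE)
  also have "\<dots> \<le> liminf (\<lambda>k. \<integral>\<^sup>+\<omega>. ennreal (norm (Y (\<rho> k) \<omega>) ^ p) \<partial>M)"
    by (intro nn_integral_liminf) auto
  also have "\<dots> \<le> liminf (\<lambda>k. ennreal b)"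
    by (intro Liminf_mono always_eventually allI) (use b b0 in \<open>auto simp: Ebd_nn_integral[symmetric]\<close>)
  finally have "(\<integral>\<^sup>+\<omega>. ennreal (norm (Z \<omega>) ^ p) \<partial>M) \<le> ennreal b" by (simp add: Liminf_const)
  then show ?thesis using b0 by (subst Ebd_nn_integral) auto
qed

lemma (in prob_space) integrable_power_sum:
  fixes f :: "'i \<Rightarrow> 'a \<Rightarrow> real"
  assumes "finite I" "\<And>i. i \<in> I \<Longrightarrow> f i \<in> borel_measurable M" "\<And>i \<omega>. i \<in> I \<Longrightarrow> 0 \<le> f i \<omega>"
    "\<And>i. i \<in> I \<Longrightarrow> integrable M (\<lambda>\<omega>. f i \<omega> ^ p)" "1 \<le> p"
  shows "integrable M (\<lambda>\<omega>. (\<Sum>i\<in>I. f i \<omega>) ^ p)"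
  using assms(1-4)
proof (induction I)
  case empty then show ?case using assms(5) by (simp add: power_0_left)
next
  case (insert x I)
  have [measurable]: "f x \<in> borel_measurable M" using insert by auto
  have i1: "integrable M (\<lambda>\<omega>. 2 ^ p * (f x \<omega> ^ p + (\<Sum>i\<in>I. f i \<omega>) ^ p))"
    using insert by (intro integrable_mult_right Bochner_Integration.integrable_add) auto
  show ?case
  proof (rule Bochner_Integration.integrable_bound[OF i1])
    have [measurable]: "(\<lambda>\<omega>. \<Sum>i\<in>I. f i \<omega>) \<in> borel_measurable M" using insert by (intro borel_measurable_sum) auto
    show "(\<lambda>\<omega>. (\<Sum>i\<in>insert x I. f i \<omega>) ^ p) \<in> borel_measurable M" by (intro borel_measurable_power borel_measurable_sum insert(4))
    have "(f x \<omega> + (\<Sum>i\<in>I. f i \<omega>)) ^ p \<le> 2 ^ p * (f x \<omega> ^ p + (\<Sum>i\<in>I. f i \<omega>) ^ p)" for \<omega>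
      using insert(5) assms(5) by (intro power_add_le sum_nonneg) auto
    then show "AE \<omega> in M. norm ((\<Sum>i\<in>insert x I. f i \<omega>) ^ p) \<le> norm (2 ^ p * (f x \<omega> ^ p + (\<Sum>i\<in>I. f i \<omega>) ^ p))"
    proof (intro AE_I2)
      fix \<omega>
      have "0 \<le> f x \<omega> + (\<Sum>i\<in>I. f i \<omega>)" using insert(5) by (intro add_nonneg_nonneg sum_nonneg) auto
      then show "norm ((\<Sum>i\<in>insert x I. f i \<omega>) ^ p) \<le> norm (2 ^ p * (f x \<omega> ^ p + (\<Sum>i\<in>I. f i \<omega>) ^ p))"
        using insert(1,2) \<open>\<And>\<omega>. (f x \<omega> + (\<Sum>i\<in>I. f i \<omega>)) ^ p \<le> 2 ^ p * (f x \<omega> ^ p + (\<Sum>i\<in>I. f i \<omega>) ^ p)\<close>[of \<omega>]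
        by simp
    qed
  qed
qed

lemma (in prob_space) integrable_power_mult:
  fixes f g :: "'a \<Rightarrow> real"
  assumes [measurable]: "f \<in> borel_measurable M" "g \<in> borel_measurable M"
    and "\<And>\<omega>. 0 \<le> f \<omega>" "\<And>\<omega>. 0 \<le> g \<omega>"
    and i: "integrable M (\<lambda>\<omega>. f \<omega> ^ (i + j))" "integrable M (\<lambda>\<omega>. g \<omega> ^ (i + j))"
  shows "integrable M (\<lambda>\<omega>. f \<omega> ^ i * g \<omega> ^ j)"
proof (rule Bochner_Integration.integrable_bound)
  show "integrable M (\<lambda>\<omega>. f \<omega> ^ (i + j) + g \<omega> ^ (i + j))" by (intro Bochner_Integration.integrable_add i)
  show "AE \<omega> in M. norm (f \<omega> ^ i * g \<omega> ^ j) \<le> norm (f \<omega> ^ (i + j) + g \<omega> ^ (i + j))"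
    using mult_powers_le assms(3,4) by (auto intro!: AE_I2 order_trans[OF _ abs_ge_self] simp: abs_of_nonneg)
qed measurable

text \<open>The second moment of the increments enters only through Young's inequality, so that a bound on
  their \<open>2r\<close>-th moments of order \<open>n\<^sup>-\<^sup>r\<close> is all that is required of them. The moments of the
  martingale grow by a factor \<open>1 + C / n\<close> per step.\<close>

lemma (in prob_space) martingale_moment:
  assumes r: "1 \<le> r"
  shows "\<exists>C>0. \<forall>n K (D :: nat \<Rightarrow> 'a \<Rightarrow> 'b::euclidean_space) G B. 0 < n \<longrightarrow> K \<le> n \<longrightarrow>
    (\<forall>i<K. mart_diff M (G i) (D i)) \<longrightarrow> (\<forall>i<K. \<forall>l<i. D l \<in> borel_measurable (G i)) \<longrightarrow>
    (\<forall>i<K. Ebd M (\<lambda>\<omega>. norm (D i \<omega>) ^ (2 * r)) (B i / real n ^ r)) \<longrightarrow>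
    Ebd M (\<lambda>\<omega>. running_max (\<lambda>k. norm (\<Sum>i<k. D i \<omega>)) K ^ (2 * r)) (C * (\<Sum>i<K. B i) / real n)"
proof -
  obtain C0 where C0: "C0 \<ge> 0" and T: "\<And>a d :: 'b. norm (a + d) ^ (2 * r) \<le> norm a ^ (2 * r)
      + 2 * real r * norm a ^ (2 * r - 2) * inner a d
      + C0 * (norm a ^ (2 * r - 2) * (norm d)\<^sup>2 + norm d ^ (2 * r))"
    using norm_power_even_Taylor[OF r, where 'b = 'b] by blast
  define p where "p = 2 * r"
  have p: "2 \<le> p" using r by (simp add: p_def)
  \<comment> \<open>\<open>4 ^ p\<close> comes from the pathwise maximal inequality,
    \<open>exp C0\<close> bounds the product of the growth factors \<open>1 + C0 / n\<close> over at
    most \<open>n\<close> steps, and \<open>2 * C0\<close> is the weight of the increments in one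
    step; the added 1 makes the constant positive.\<close>
  define C where "C = 4 ^ p * (exp C0 * (2 * C0 + 1))"
  have main: "Ebd M (\<lambda>\<omega>. running_max (\<lambda>k. norm (\<Sum>i<k. D i \<omega>)) K ^ p) (C * (\<Sum>i<K. B i) / real n)"
    if n: "0 < n" and K: "K \<le> n" and md: "\<And>i. i < K \<Longrightarrow> mart_diff M (G i) (D i)"
      and adapt: "\<And>i l. i < K \<Longrightarrow> l < i \<Longrightarrow> D l \<in> borel_measurable (G i)"
      and B: "\<And>i. i < K \<Longrightarrow> Ebd M (\<lambda>\<omega>. norm (D i \<omega>) ^ p) (B i / real n ^ r)"
    for n K G B and D :: "nat \<Rightarrow> 'a \<Rightarrow> 'b"
  proof -
    have Dm[measurable]: "i < K \<Longrightarrow> D i \<in> borel_measurable M" for i using md by (auto simp: mart_diff_def)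
    have sub: "i < K \<Longrightarrow> subalgebra M (G i)" for i using md by (auto simp: mart_diff_def)
    have B0: "i < K \<Longrightarrow> 0 \<le> B i" for i using EbdD(5)[OF B, of i] pos_le_divide_eq[of "real n ^ r" 0 "B i"] n by simp
    define S where "S k \<omega> = (\<Sum>i<k. D i \<omega>)" for k \<omega>
    define s where "s k \<omega> = norm (S k \<omega>)" for k \<omega>
    define R where "R k \<omega> = running_max (\<lambda>i. s i \<omega>) k" for k \<omega>
    have SG: "S k \<in> borel_measurable (G i)" if "i < K" "k \<le> i" for i k
      unfolding S_def using that adapt by (intro borel_measurable_sum) auto
    have sG: "s k \<in> borel_measurable (G i)" if "i < K" "k \<le> i" for i k
      unfolding s_def using SG[OF that] by measurable
    have RG: "R i \<in> borel_measurable (G i)" if "i < K" for i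
      unfolding R_def using sG that by (intro running_max_measurable) auto
    have [measurable]: "S k \<in> borel_measurable M" if "k \<le> K" for k unfolding S_def using that by (intro borel_measurable_sum) auto
    have [measurable]: "s k \<in> borel_measurable M" if "k \<le> K" for k unfolding s_def using that by measurable
    have [measurable]: "R k \<in> borel_measurable M" if "k \<le> K" for k
      unfolding R_def using that by (intro running_max_measurable) auto
    have s0: "0 \<le> s k \<omega>" for k \<omega> by (simp add: s_def)
    have R0: "0 \<le> R k \<omega>" for k \<omega> unfolding R_def by (intro running_max_nonneg s0)
    have iD: "integrable M (\<lambda>\<omega>. norm (D i \<omega>) ^ p)" if "i < K" for i using EbdD(1)[OF B[OF that]] .
    have iS: "integrable M (\<lambda>\<omega>. s k \<omega> ^ p)" if "k \<le> K" for k
    proof (rule Bochner_Integration.integrable_bound[OF integrable_power_sum[of "{..<k}" "\<lambda>i \<omega>. norm (D i \<omega>)" p]])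
      show "AE \<omega> in M. norm (s k \<omega> ^ p) \<le> norm ((\<Sum>i<k. norm (D i \<omega>)) ^ p)"
        by (auto simp: s_def S_def sum_nonneg intro!: AE_I2 power_mono norm_sum)
    qed (use that iD p in auto)
    have iR: "integrable M (\<lambda>\<omega>. R k \<omega> ^ p)" if "k \<le> K" for k
    proof (rule Bochner_Integration.integrable_bound[OF integrable_power_sum[of "{..k}" s p]])
      show "AE \<omega> in M. norm (R k \<omega> ^ p) \<le> norm ((\<Sum>i\<le>k. s i \<omega>) ^ p)"
        using s0 R0 by (auto simp: R_def[symmetric] sum_nonneg intro!: AE_I2 power_mono running_max_le_sum[of "\<lambda>i. s i _", folded R_def])
    qed (use that iS s0 p in auto)
    have imult: "integrable M (\<lambda>\<omega>. norm (\<psi> \<omega>) * norm (D i \<omega>))"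
      if "i < K" and [measurable]: "\<psi> \<in> borel_measurable M" and le: "\<And>\<omega>. norm (\<psi> \<omega>) \<le> R i \<omega> ^ (p - 1)" for i and \<psi> :: "'a \<Rightarrow> 'b"
    proof (rule Bochner_Integration.integrable_bound)
      show "integrable M (\<lambda>\<omega>. R i \<omega> ^ (p - 1) * norm (D i \<omega>) ^ 1)"
        by (rule integrable_power_mult) (use that R0 iR[of i] iD[of i] p in auto)
      show "AE \<omega> in M. norm (norm (\<psi> \<omega>) * norm (D i \<omega>)) \<le> norm (R i \<omega> ^ (p - 1) * norm (D i \<omega>) ^ 1)"
        using R0 le by (auto intro!: AE_I2 mult_right_mono simp: abs_mult)
    qed (use that in measurable)
    \<comment> \<open>A test function bounded by the power p - 1 of the running maximum has an
      integrable product with \<open>D i\<close>, because both have moments of order p. The linear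
      Taylor term and the term of the maximal inequality are both of this kind.\<close>
    have orth: "integrable M (\<lambda>\<omega>. inner (\<psi> \<omega>) (D i \<omega>)) \<and> (\<integral>\<omega>. inner (\<psi> \<omega>) (D i \<omega>) \<partial>M) = 0"
      if i: "i < K" and m: "\<psi> \<in> borel_measurable (G i)" and le: "\<And>\<omega>. norm (\<psi> \<omega>) \<le> R i \<omega> ^ (p - 1)" for i and \<psi> :: "'a \<Rightarrow> 'b"
    proof
      have [measurable]: "\<psi> \<in> borel_measurable M" using subalgebra_measurable[OF sub[OF i] m] .
      note im = imult[OF i this le]
      show "(\<integral>\<omega>. inner (\<psi> \<omega>) (D i \<omega>) \<partial>M) = 0" using md[OF i] m im by (auto simp: mart_diff_def)
      show "integrable M (\<lambda>\<omega>. inner (\<psi> \<omega>) (D i \<omega>))"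
        by (rule Bochner_Integration.integrable_bound[OF im]) (use i in \<open>auto simp: Cauchy_Schwarz_ineq2\<close>)
    qed
    have sR: "s i \<omega> \<le> R i \<omega>" for i \<omega> unfolding R_def by (rule running_max_ge) simp
    define a where "a k = (\<integral>\<omega>. s k \<omega> ^ p \<partial>M)" for k
    have a_step: "a (Suc k) \<le> (1 + C0 / n) * a k + 2 * C0 / n * B k" if k: "k < K" for k
    proof -
      \<comment> \<open>Up to the factor p this is the gradient of |x|^p at \<open>S k\<close>,
        hence the vector in the linear Taylor term.\<close>
      define \<psi> where "\<psi> \<omega> = s k \<omega> ^ (p - 2) *\<^sub>R S k \<omega>" for \<omega>
      have \<psi>G: "\<psi> \<in> borel_measurable (G k)" unfolding \<psi>_def using sG[OF k order_refl] SG[OF k order_refl] by measurable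
      have "norm (\<psi> \<omega>) = s k \<omega> ^ (p - 1)" for \<omega>
      proof -
        obtain q where "p = Suc (Suc q)" using p by (metis add_2_eq_Suc le_Suc_ex)
        then show ?thesis by (simp add: \<psi>_def s_def)
      qed
      then have "norm (\<psi> \<omega>) \<le> R k \<omega> ^ (p - 1)" for \<omega> using sR s0 by (auto intro: power_mono)
      note o = orth[OF k \<psi>G this]
      define d where "d \<omega> = norm (D k \<omega>)" for \<omega>
      have d0: "0 \<le> d \<omega>" for \<omega> by (simp add: d_def)
      have pt: "s (Suc k) \<omega> ^ p \<le> s k \<omega> ^ p + 2 * real r * inner (\<psi> \<omega>) (D k \<omega>)
          + (C0 / n * s k \<omega> ^ p + 2 * C0 / n * real n ^ r * d \<omega> ^ p)" for \<omega>
      proof -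
        \<comment> \<open>The increment is rescaled by the square root of \<open>n\<close> before
          Young's inequality. Its p-th power then has mean at most \<open>B k\<close>, and dividing
          by \<open>n\<close> leaves a contribution of order 1 / n from both the martingale and the
          increment.\<close>
        have e: "(sqrt (real n) * d \<omega>) ^ 2 = real n * d \<omega> ^ 2" "(sqrt (real n) * d \<omega>) ^ p = real n ^ r * d \<omega> ^ p"
          by (auto simp: power_mult_distrib p_def power_mult)
        have "s k \<omega> ^ (p - 2) * (sqrt (real n) * d \<omega>) ^ 2 \<le> s k \<omega> ^ (p - 2 + 2) + (sqrt (real n) * d \<omega>) ^ (p - 2 + 2)"
          by (rule mult_powers_le) (auto simp: s0 d0)
        then have "real n * (s k \<omega> ^ (p - 2) * d \<omega> ^ 2) \<le> s k \<omega> ^ p + real n ^ r * d \<omega> ^ p"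
          unfolding le_add_diff_inverse2[OF p] e by (simp add: mult_ac)
        then have 1: "s k \<omega> ^ (p - 2) * d \<omega> ^ 2 \<le> (s k \<omega> ^ p + real n ^ r * d \<omega> ^ p) / n"
          using n by (simp add: field_simps)
        have "real n ^ 1 \<le> real n ^ r" using n r by (intro power_increasing) auto
        then have 2: "d \<omega> ^ p \<le> real n ^ r * d \<omega> ^ p / n" using n d0[of \<omega>]
          by (simp add: field_simps mult_right_mono)
        have "s (Suc k) \<omega> ^ p \<le> s k \<omega> ^ p + 2 * real r * inner (\<psi> \<omega>) (D k \<omega>) + C0 * (s k \<omega> ^ (p - 2) * d \<omega> ^ 2 + d \<omega> ^ p)"
          using T[of "S k \<omega>" "D k \<omega>"] by (simp add: s_def S_def p_def d_def \<psi>_def mult_ac)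
        also have "C0 * (s k \<omega> ^ (p - 2) * d \<omega> ^ 2 + d \<omega> ^ p)
          \<le> C0 * ((s k \<omega> ^ p + real n ^ r * d \<omega> ^ p) / n + real n ^ r * d \<omega> ^ p / n)"
          using 1 2 by (intro mult_left_mono C0 add_mono) auto
        finally show ?thesis by (simp add: field_simps add_divide_distrib)
      qed
      have i1: "integrable M (\<lambda>\<omega>. s (Suc k) \<omega> ^ p)" "integrable M (\<lambda>\<omega>. s k \<omega> ^ p)" using iS k by auto
      have i2: "integrable M (\<lambda>\<omega>. d \<omega> ^ p)" using iD[OF k] by (simp add: d_def)
      have "a (Suc k) \<le> (\<integral>\<omega>. s k \<omega> ^ p + 2 * real r * inner (\<psi> \<omega>) (D k \<omega>)
          + (C0 / n * s k \<omega> ^ p + 2 * C0 / n * real n ^ r * d \<omega> ^ p) \<partial>M)"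
        unfolding a_def by (intro integral_mono pt i1 Bochner_Integration.integrable_add integrable_mult_right i2) (use o in auto)
      also have "\<dots> = a k + 0 + (C0 / n * a k + 2 * C0 / n * real n ^ r * (\<integral>\<omega>. d \<omega> ^ p \<partial>M))"
        unfolding a_def using i1 i2 o by (simp add: Bochner_Integration.integral_add)
      also have "\<dots> \<le> a k + 0 + (C0 / n * a k + 2 * C0 / n * real n ^ r * (B k / real n ^ r))"
        using EbdD(4)[OF B[OF k]] C0 by (intro add_mono mult_left_mono order_refl) (auto simp: d_def)
      finally show ?thesis using n by (simp add: algebra_simps)
    qed
    have a_bd: "a k \<le> (1 + C0 / n) ^ k * (2 * C0 / n * (\<Sum>i<k. B i))" if "k \<le> K" for k
      using that
    proof (induction k)
      case 0 then show ?case using p by (simp add: a_def s_def S_def power_0_left)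
    next
      case (Suc k)
      have "2 * C0 / n * B k \<le> (1 + C0 / n) ^ Suc k * (2 * C0 / n * B k)"
        using B0[of k] Suc C0 mult_right_mono[of 1 "(1 + C0 / n) ^ Suc k" "2 * C0 / n * B k"]
        by (simp add: one_le_power del: power_Suc)
      moreover have "(1 + C0 / n) * a k \<le> (1 + C0 / n) * ((1 + C0 / n) ^ k * (2 * C0 / n * (\<Sum>i<k. B i)))"
        using Suc C0 by (intro mult_left_mono) auto
      moreover have "q * (q ^ k * (c * S)) + q ^ Suc k * (c * b) = q ^ Suc k * (c * (S + b))" for q c S b :: real
        by (simp add: algebra_simps)
      ultimately show ?case using a_step[of k] Suc(2) unfolding sum.lessThan_Suc by (smt (verit) Suc_le_lessD)
    qed
    have SB0: "0 \<le> (\<Sum>i<K. B i)" by (intro sum_nonneg) (use B0 in auto)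
    have "(1 + C0 / n) ^ K \<le> exp (C0 / n) ^ K" using C0 exp_ge_add_one_self[of "C0 / n"] by (intro power_mono) (auto)
    also have "\<dots> = exp (C0 * (real K / n))" by (simp add: exp_of_nat_mult[symmetric] mult_ac)
    also have "\<dots> \<le> exp (C0 * 1)" using K n C0 by (intro exp_le_cancel_iff[THEN iffD2] mult_left_mono) (auto)
    finally have ex: "(1 + C0 / n) ^ K \<le> exp C0" by simp
    have "a K \<le> exp C0 * (2 * C0 / n * (\<Sum>i<K. B i))"
      by (rule order_trans[OF a_bd[OF order_refl] mult_right_mono[OF ex]]) (use C0 SB0 in auto)
    also have "\<dots> \<le> exp C0 * ((2 * C0 + 1) / n * (\<Sum>i<K. B i))"
      using SB0 by (intro mult_left_mono mult_right_mono divide_right_mono) auto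
    finally have aK: "a K \<le> exp C0 * ((2 * C0 + 1) / n * (\<Sum>i<K. B i))" .
    \<comment> \<open>The unit vector along \<open>S i\<close> is a subgradient of the norm there,
      so its product with \<open>D i\<close> is at most the increment of \<open>s\<close>. Where
      \<open>S i\<close> is 0 the division yields the zero vector, and the inequality remains true
      because the norm can only grow from 0.\<close>
    define \<phi> where "\<phi> i \<omega> = R i \<omega> ^ (p - 1) *\<^sub>R (S i \<omega> /\<^sub>R s i \<omega>)" for i \<omega>
    have o: "integrable M (\<lambda>\<omega>. inner (\<phi> i \<omega>) (D i \<omega>))" "(\<integral>\<omega>. inner (\<phi> i \<omega>) (D i \<omega>) \<partial>M) = 0" if i: "i < K" for i
    proof -
      have "\<phi> i \<in> borel_measurable (G i)" unfolding \<phi>_def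
        using RG[OF i] SG[OF i order_refl] sG[OF i order_refl] by measurable
      moreover have "norm (\<phi> i \<omega>) \<le> R i \<omega> ^ (p - 1)" for \<omega>
        using R0[of i \<omega>] by (cases "S i \<omega> = 0") (auto simp: \<phi>_def s_def mult.assoc)
      ultimately show "integrable M (\<lambda>\<omega>. inner (\<phi> i \<omega>) (D i \<omega>))" "(\<integral>\<omega>. inner (\<phi> i \<omega>) (D i \<omega>) \<partial>M) = 0"
        using orth[OF i] by blast+
    qed
    have pt: "R K \<omega> ^ p \<le> 4 ^ p * s K \<omega> ^ p - 4 * (\<Sum>i<K. inner (\<phi> i \<omega>) (D i \<omega>))" for \<omega>
    proof -
      have "inner (\<phi> i \<omega>) (D i \<omega>) \<le> R i \<omega> ^ (p - 1) * (s (Suc i) \<omega> - s i \<omega>)" for i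
      proof -
        have "inner (S i \<omega> /\<^sub>R s i \<omega>) (D i \<omega>) \<le> s (Suc i) \<omega> - s i \<omega>"
        proof (cases "s i \<omega> = 0")
          case True then show ?thesis using s0 by auto
        next
          case False
          have "inner (S i \<omega> /\<^sub>R s i \<omega>) (S i \<omega> + D i \<omega>) \<le> norm (S i \<omega> /\<^sub>R s i \<omega>) * norm (S i \<omega> + D i \<omega>)"
            by (rule norm_cauchy_schwarz)
          also have "\<dots> = s (Suc i) \<omega>" using False by (auto simp: s_def S_def)
          also have "inner (S i \<omega> /\<^sub>R s i \<omega>) (S i \<omega> + D i \<omega>) = s i \<omega> + inner (S i \<omega> /\<^sub>R s i \<omega>) (D i \<omega>)"
            using False by (simp add: s_def inner_add_right dot_square_norm power2_eq_square)
          finally show ?thesis by simp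
        qed
        then show ?thesis using R0[of i \<omega>] unfolding \<phi>_def inner_scaleR_left by (intro mult_left_mono) auto
      qed
      then have "(\<Sum>i<K. inner (\<phi> i \<omega>) (D i \<omega>)) \<le> (\<Sum>i<K. R i \<omega> ^ (p - 1) * (s (Suc i) \<omega> - s i \<omega>))"
        by (intro sum_mono)
      moreover have "R K \<omega> ^ p \<le> 4 ^ p * s K \<omega> ^ p - 4 * (\<Sum>i<K. R i \<omega> ^ (p - 1) * (s (Suc i) \<omega> - s i \<omega>))"
        unfolding R_def by (rule power_Doob_pathwise) (auto simp: s_def S_def p)
      ultimately show ?thesis by linarith
    qed
    have "(\<integral>\<omega>. R K \<omega> ^ p \<partial>M) \<le> (\<integral>\<omega>. 4 ^ p * s K \<omega> ^ p - 4 * (\<Sum>i<K. inner (\<phi> i \<omega>) (D i \<omega>)) \<partial>M)"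
      by (intro integral_mono pt iR Bochner_Integration.integrable_diff integrable_mult_right iS Bochner_Integration.integrable_sum o) auto
    also have "\<dots> = 4 ^ p * a K"
    proof -
      have "integrable M (\<lambda>\<omega>. \<Sum>i<K. inner (\<phi> i \<omega>) (D i \<omega>))" by (intro Bochner_Integration.integrable_sum o) auto
      moreover have "(\<integral>\<omega>. (\<Sum>i<K. inner (\<phi> i \<omega>) (D i \<omega>)) \<partial>M) = 0"
        using o by (subst Bochner_Integration.integral_sum) auto
      ultimately show ?thesis unfolding a_def using iS[of K] by simp
    qed
    also have "\<dots> \<le> 4 ^ p * (exp C0 * ((2 * C0 + 1) / n * (\<Sum>i<K. B i)))" by (intro mult_left_mono aK) auto
    also have "\<dots> = C * (\<Sum>i<K. B i) / real n" by (simp add: C_def)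
    finally show ?thesis using iR[of K] R0 unfolding Ebd_def R_def s_def S_def by auto
  qed
  show ?thesis
  proof (intro exI[of _ C] conjI allI impI)
    show "C > 0" using C0 by (simp add: C_def)
    fix n K :: nat and D :: "nat \<Rightarrow> 'a \<Rightarrow> 'b" and G B
    assume "0 < n" "K \<le> n" "\<forall>i<K. mart_diff M (G i) (D i)" "\<forall>i<K. \<forall>l<i. D l \<in> borel_measurable (G i)"
      "\<forall>i<K. Ebd M (\<lambda>\<omega>. norm (D i \<omega>) ^ (2 * r)) (B i / real n ^ r)"
    then show "Ebd M (\<lambda>\<omega>. running_max (\<lambda>k. norm (\<Sum>i<k. D i \<omega>)) K ^ (2 * r)) (C * (\<Sum>i<K. B i) / real n)"
      unfolding p_def[symmetric] by (intro main[of n K G D B]) auto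
  qed
qed

section \<open>Gaussian increments\<close>

lemma lborel_distr_uminus_euclidean: "distr lborel borel uminus = (lborel :: 'a::euclidean_space measure)"
proof -
  have "(lborel :: 'a measure) = density (distr lborel borel (\<lambda>x. 0 + (-1) *\<^sub>R x)) (\<lambda>_. 1)"
    using lborel_affine[of "-1" "0 :: 'a"] by simp
  also have "\<dots> = distr lborel borel uminus" by (simp add: density_1)
  finally show ?thesis by simp
qed

definition gauss_density :: "real \<Rightarrow> real^'m \<Rightarrow> real" where
  "gauss_density \<sigma> x = (\<Prod>i\<in>UNIV. normal_density 0 \<sigma> (x $ i))"

lemma gauss_density_measurable[measurable]: "gauss_density \<sigma> \<in> borel_measurable borel"
  unfolding gauss_density_def[abs_def] by measurable

lemma gauss_density_nonneg: "0 \<le> gauss_density \<sigma> x"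
  unfolding gauss_density_def by (intro prod_nonneg) auto

lemma mult_vec_measurable[measurable (raw)]:
  fixes A :: "'a \<Rightarrow> real^'m^'d" and z :: "'a \<Rightarrow> real^'m"
  assumes "A \<in> borel_measurable N" "z \<in> borel_measurable N"
  shows "(\<lambda>\<omega>. A \<omega> *v z \<omega>) \<in> borel_measurable N"
  by (rule borel_measurable_continuous_Pair[OF assms])
    (auto simp: matrix_vector_mult_def split_beta intro!: continuous_intros)

text \<open>The density is even and the integrand odd, so reflection turns the integral into its
  negative. This argument also covers a non-integrable integrand, whose integral is 0 by
  convention.\<close>

lemma gauss_mean_zero:
  assumes "distributed M lborel Z (\<lambda>x. ennreal (gauss_density \<sigma> x))"
  shows "(\<integral>z. inner v (A *v z) \<partial>distr M borel Z) = 0"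
proof -
  have "distr M borel Z = density lborel (\<lambda>x. ennreal (gauss_density \<sigma> x))"
    using distributed_distr_eq_density[OF assms] by (simp cong: distr_cong)
  then have E: "(\<integral>z. inner v (A *v z) \<partial>distr M borel Z) = (\<integral>z. gauss_density \<sigma> z * inner v (A *v z) \<partial>lborel)"
    by (simp add: integral_real_density gauss_density_nonneg)
  have "(\<integral>z. gauss_density \<sigma> z * inner v (A *v z) \<partial>lborel) = (\<integral>z. gauss_density \<sigma> z * inner v (A *v z) \<partial>distr lborel borel uminus)"
    by (simp add: lborel_distr_uminus_euclidean)
  also have "\<dots> = (\<integral>z. gauss_density \<sigma> (- z) * inner v (A *v (- z)) \<partial>lborel)"
    by (subst integral_distr) auto
  also have "\<dots> = - (\<integral>z. gauss_density \<sigma> z * inner v (A *v z) \<partial>lborel)"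
    by (simp add: gauss_density_def normal_density_def linear_neg[OF matrix_vector_mul_linear])
  finally have *: "(\<integral>z. gauss_density \<sigma> z * inner v (A *v z) \<partial>lborel) = - (\<integral>z. gauss_density \<sigma> z * inner v (A *v z) \<partial>lborel)" .
  then show ?thesis using E by simp
qed

text \<open>Tonelli's theorem over the coordinates; the work lies in reindexing \<open>Basis\<close>
  by the axis vectors.\<close>

lemma nn_integral_lborel_vec_prod:
  fixes h :: "'m::finite \<Rightarrow> real \<Rightarrow> real"
  assumes "\<And>i. h i \<in> borel_measurable borel" "\<And>i x. 0 \<le> h i x"
  shows "(\<integral>\<^sup>+x. ennreal (\<Prod>i\<in>UNIV. h i ((x :: real^'m) $ i)) \<partial>lborel) = (\<Prod>i\<in>UNIV. \<integral>\<^sup>+y. ennreal (h i y) \<partial>lborel)"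
proof -
  define e where "e i = (axis i 1 :: real^'m)" for i
  have inj: "inj e" by (auto simp: inj_def e_def axis_eq_axis)
  have B: "(Basis :: (real^'m) set) = range e" by (auto simp: Basis_vec_def e_def)
  have P: "(\<Prod>b\<in>Basis. F b) = (\<Prod>i\<in>UNIV. F (e i))" for F :: "real^'m \<Rightarrow> 'z::comm_monoid_mult"
    unfolding B by (subst prod.reindex[OF inj]) simp
  have "(\<integral>\<^sup>+x. (\<Prod>b\<in>Basis. ennreal (h (inv e b) (x \<bullet> b))) \<partial>lborel) = (\<Prod>b\<in>Basis. \<integral>\<^sup>+y. ennreal (h (inv e b) y) \<partial>lborel)"
    by (rule nn_integral_lborel_prod) (use assms(1) in auto)
  then show ?thesis unfolding P
    by (simp add: inv_f_f[OF inj] e_def[symmetric] prod_ennreal assms) (simp add: e_def inner_axis assms prod_ennreal)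
qed

text \<open>The fraction of factorials is the even moment of a standard normal variable. The
  dimension enters through the crude bound of |x|^p by m^p times the sum of the |x_i|^p, and through
  the number of these summands, hence the power 2r + 1.\<close>

lemma gauss_moment:
  fixes Z :: "'a \<Rightarrow> real^'m"
  assumes d: "distributed M lborel Z (\<lambda>x. ennreal (gauss_density \<sigma> x))" and \<sigma>: "0 < \<sigma>" and r: "1 \<le> r"
  shows "Ebd M (\<lambda>\<omega>. norm (Z \<omega>) ^ (2 * r))
    (real CARD('m) ^ Suc (2 * r) * (fact (2 * r) / (2 ^ r * fact r)) * (\<sigma>\<^sup>2) ^ r)"
proof -
  define p where "p = 2 * r"
  have p: "1 \<le> p" using r by (simp add: p_def)
  define c where "c = fact (2 * r) / (2 ^ r * fact r) * (\<sigma>\<^sup>2) ^ r"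
  have Zm[measurable]: "Z \<in> borel_measurable M" using distributed_measurable[OF d] by simp
  have one: "(\<integral>\<^sup>+y. ennreal (normal_density 0 \<sigma> y) \<partial>lborel) = 1"
    by (subst nn_integral_eq_integral) (use \<sigma> in auto)
  have ev: "\<bar>y\<bar> ^ p = y ^ p" for y :: real by (simp add: p_def power_mult)
  have mom: "(\<integral>\<^sup>+y. ennreal (normal_density 0 \<sigma> y * \<bar>y\<bar> ^ p) \<partial>lborel) = ennreal c"
  proof -
    have hb: "has_bochner_integral lborel (\<lambda>x. normal_density 0 \<sigma> x * (x - 0) ^ (2 * r)) (fact (2 * r) / ((2 / \<sigma>\<^sup>2)^r * fact r))"
      by (rule normal_moment_even[OF \<sigma>])
    have "fact (2 * r) / ((2 / \<sigma>\<^sup>2)^r * fact r) = c" using \<sigma> by (simp add: c_def power_divide field_simps)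
    moreover have "(\<integral>\<^sup>+y. ennreal (normal_density 0 \<sigma> y * \<bar>y\<bar> ^ p) \<partial>lborel) = ennreal (\<integral>y. normal_density 0 \<sigma> y * \<bar>y\<bar> ^ p \<partial>lborel)"
      by (rule nn_integral_eq_integral) (use hb in \<open>auto simp: ev[unfolded p_def] p_def has_bochner_integral_iff\<close>)
    ultimately show ?thesis using hb by (simp add: ev has_bochner_integral_iff) (simp add: p_def)
  qed
  have c0: "0 \<le> c" by (simp add: c_def)
  have comp: "(\<integral>\<^sup>+x. ennreal (gauss_density \<sigma> x) * ennreal (\<bar>x $ i\<bar> ^ p) \<partial>lborel) = ennreal c" for i :: 'm
  proof -
    \<comment> \<open>Attaching the weight to the factor \<open>i\<close> alone leaves a product of
      one-dimensional integrals, all but one of them equal to 1.\<close>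
    define h where "h j y = (if j = i then normal_density 0 \<sigma> y * \<bar>y\<bar> ^ p else normal_density 0 \<sigma> y)" for j :: 'm and y
    have [measurable]: "h j \<in> borel_measurable borel" for j unfolding h_def by (cases "j = i") auto
    have "gauss_density \<sigma> x * \<bar>x $ i\<bar> ^ p = (\<Prod>j\<in>UNIV. h j (x $ j))" for x :: "real^'m"
      unfolding gauss_density_def h_def by (subst (1 2) prod.remove[of UNIV i]) (auto intro!: prod.cong)
    then have "(\<integral>\<^sup>+x. ennreal (gauss_density \<sigma> x) * ennreal (\<bar>x $ i\<bar> ^ p) \<partial>lborel)
      = (\<integral>\<^sup>+x. ennreal (\<Prod>j\<in>UNIV. h j (x $ j)) \<partial>lborel)"
      by (simp add: ennreal_mult[symmetric] gauss_density_nonneg)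
    also have "\<dots> = (\<Prod>j\<in>UNIV. \<integral>\<^sup>+y. ennreal (h j y) \<partial>lborel)"
      by (rule nn_integral_lborel_vec_prod) (auto simp: h_def)
    also have "\<dots> = ennreal c" by (subst prod.remove[of UNIV i]) (auto simp: h_def mom one)
    finally show ?thesis .
  qed
  have le: "norm x ^ p \<le> real CARD('m) ^ p * (\<Sum>i\<in>UNIV. \<bar>x $ i\<bar> ^ p)" for x :: "real^'m"
  proof -
    define m where "m = Max (range (\<lambda>i. \<bar>x $ i\<bar>))"
    have mi: "\<bar>x $ i\<bar> \<le> m" for i unfolding m_def by (intro Max_ge) auto
    have "norm x \<le> (\<Sum>i\<in>UNIV. \<bar>x $ i\<bar>)" by (rule norm_le_l1_cart)
    also have "\<dots> \<le> real CARD('m) * m" using sum_mono[of UNIV "\<lambda>i. \<bar>x $ i\<bar>" "\<lambda>_. m"] mi by simp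
    finally have "norm x ^ p \<le> (real CARD('m) * m) ^ p" by (intro power_mono) auto
    also have "m \<in> range (\<lambda>i. \<bar>x $ i\<bar>)" unfolding m_def by (intro Max_in) auto
    then obtain i where i: "m = \<bar>x $ i\<bar>" by auto
    have "(real CARD('m) * m) ^ p \<le> real CARD('m) ^ p * (\<Sum>i\<in>UNIV. \<bar>x $ i\<bar> ^ p)"
      unfolding power_mult_distrib i by (intro mult_left_mono member_le_sum[of i UNIV "\<lambda>i. \<bar>x $ i\<bar> ^ p"]) auto
    finally show ?thesis .
  qed
  have "(\<integral>\<^sup>+\<omega>. ennreal (norm (Z \<omega>) ^ p) \<partial>M) = (\<integral>\<^sup>+x. ennreal (gauss_density \<sigma> (x :: real^'m)) * ennreal (norm x ^ p) \<partial>lborel)"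
    by (rule distributed_nn_integral[OF d, of "\<lambda>x. ennreal (norm x ^ p)", symmetric]) simp
  also have "\<dots> \<le> (\<integral>\<^sup>+x. (\<Sum>i\<in>UNIV. ennreal (real CARD('m) ^ p) * (ennreal (gauss_density \<sigma> (x :: real^'m)) * ennreal (\<bar>x $ i\<bar> ^ p))) \<partial>lborel)"
  proof (rule nn_integral_mono)
    fix x :: "real^'m"
    have "gauss_density \<sigma> x * norm x ^ p \<le> gauss_density \<sigma> x * (real CARD('m) ^ p * (\<Sum>i\<in>UNIV. \<bar>x $ i\<bar> ^ p))"
      by (intro mult_left_mono le gauss_density_nonneg)
    also have "\<dots> = (\<Sum>i\<in>UNIV. real CARD('m) ^ p * (gauss_density \<sigma> x * \<bar>x $ i\<bar> ^ p))"
      by (simp add: sum_distrib_left mult_ac)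
    finally show "ennreal (gauss_density \<sigma> x) * ennreal (norm x ^ p) \<le> (\<Sum>i\<in>UNIV. ennreal (real CARD('m) ^ p) * (ennreal (gauss_density \<sigma> x) * ennreal (\<bar>x $ i\<bar> ^ p)))"
      by (simp add: ennreal_mult[symmetric] gauss_density_nonneg sum_ennreal ennreal_leI)
  qed
  also have "\<dots> = (\<Sum>i\<in>(UNIV :: 'm set). ennreal (real CARD('m) ^ p) * ennreal c)"
    by (simp add: nn_integral_sum nn_integral_cmult comp)
  also have "\<dots> = ennreal (real CARD('m) * (real CARD('m) ^ p * c))" using c0
    by (simp add: ennreal_mult ennreal_of_nat_eq_real_of_nat)
  finally have "(\<integral>\<^sup>+\<omega>. ennreal (norm (Z \<omega>) ^ p) \<partial>M) \<le> ennreal (real CARD('m) * real CARD('m) ^ p * c)" by (simp add: mult.assoc)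
  then have "Ebd M (\<lambda>\<omega>. norm (Z \<omega>) ^ p) (real CARD('m) * real CARD('m) ^ p * c)"
    using c0 by (subst Ebd_nn_integral) auto
  then show ?thesis by (simp add: c_def p_def mult_ac)
qed

section \<open>Measurability and partitions\<close>

text \<open>The second argument is replaced by simple functions converging to the identity. Each of
  them takes finitely many values, so the composed function is measurable, and continuity in the
  second argument gives the limit.\<close>

lemma caratheodory_measurable:
  fixes f :: "'a \<Rightarrow> 'b::{metric_space, second_countable_topology} \<Rightarrow> 'c::metric_space"
  assumes m: "\<And>y. (\<lambda>x. f x y) \<in> borel_measurable N"
    and c: "\<And>x. x \<in> space N \<Longrightarrow> continuous_on UNIV (f x)"
  shows "(\<lambda>(x, y). f x y) \<in> borel_measurable (N \<Otimes>\<^sub>M borel)"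
proof -
  have "(\<lambda>y::'b. y) \<in> borel_measurable borel" by simp
  from borel_measurable_implies_sequence_metric[OF this, of undefined]
  obtain S where S: "\<And>i. simple_function borel (S i)" and lim: "\<And>y :: 'b. (\<lambda>i. S i y) \<longlonglongrightarrow> y" by auto
  have "(\<lambda>(p :: 'a \<times> 'b). f (fst p) (S i (snd p))) \<in> borel_measurable (N \<Otimes>\<^sub>M borel)" for i
  proof -
    define k :: "'a \<times> 'b \<Rightarrow> 'b" where "k p = S i (snd p)" for p
    define \<phi> :: "'b \<Rightarrow> 'a \<times> 'b \<Rightarrow> 'c" where "\<phi> y p = f (fst p) y" for y p
    have "S i \<in> borel \<rightarrow>\<^sub>M count_space (range (S i))"
      using simple_functionD[OF S[of i]] by (subst measurable_count_space_eq2) auto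
    then have k: "k \<in> N \<Otimes>\<^sub>M borel \<rightarrow>\<^sub>M count_space (range (S i))"
      unfolding k_def by (rule measurable_compose[OF measurable_snd])
    have "\<phi> y \<in> borel_measurable (N \<Otimes>\<^sub>M borel)" for y
      unfolding \<phi>_def by (rule measurable_compose[OF measurable_fst m])
    then have "(\<lambda>p. \<phi> y p) \<in> borel_measurable (N \<Otimes>\<^sub>M borel)" for y .
    moreover have "countable (range (S i))" using simple_functionD(1)[OF S[of i]] by (auto intro: countable_finite)
    ultimately have "(\<lambda>p. \<phi> (k p) p) \<in> borel_measurable (N \<Otimes>\<^sub>M borel)"
      using measurable_compose_countable'[of "range (S i)" \<phi>, OF _ k] by blast
    then show ?thesis unfolding \<phi>_def k_def .
  qed
  then have "(\<lambda>(p :: 'a \<times> 'b). f (fst p) (snd p)) \<in> borel_measurable (N \<Otimes>\<^sub>M borel)"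
  proof (rule borel_measurable_LIMSEQ_metric)
    fix p assume "p \<in> space (N \<Otimes>\<^sub>M (borel :: 'b measure))"
    then have "continuous_on UNIV (f (fst p))" by (intro c) (auto simp: space_pair_measure)
    then show "(\<lambda>i. f (fst p) (S i (snd p))) \<longlonglongrightarrow> f (fst p) (snd p)"
      by (rule continuous_on_tendsto_compose[OF _ lim]) auto
  qed
  then show ?thesis by (simp add: split_beta')
qed

lemma (in prob_space) measure_tendsto_zero:
  assumes [measurable]: "\<And>m. A m \<in> sets M" and ev: "\<And>\<omega>. \<omega> \<in> space M \<Longrightarrow> eventually (\<lambda>m. \<omega> \<notin> A m) sequentially"
  shows "(\<lambda>m::nat. measure M (A m)) \<longlonglongrightarrow> 0"
proof -
  have "(\<lambda>m. \<integral>\<omega>. indicator (A m) \<omega> \<partial>M) \<longlonglongrightarrow> (\<integral>\<omega>. 0 \<partial>M :: real)"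
  proof (rule integral_dominated_convergence[where w = "\<lambda>_. 1"])
    show "AE \<omega> in M. (\<lambda>m. indicator (A m) \<omega> :: real) \<longlonglongrightarrow> 0"
      by (intro AE_I2 tendsto_eventually) (use ev in \<open>auto simp: indicator_def elim!: eventually_mono\<close>)
  qed (auto intro!: AE_I2 simp: indicator_def)
  then show ?thesis by simp
qed

lemma exists_partition:
  fixes U :: "real set"
  assumes "finite U" "U \<noteq> {}"
  shows "\<exists>v L. (\<forall>i<L. v i < v (Suc i)) \<and> v ` {..L} = U"
proof -
  define xs where "xs = sorted_list_of_set U"
  have xs: "set xs = U" "sorted_wrt (<) xs" using assms by (auto simp: xs_def)
  have "xs \<noteq> []" using xs assms by auto
  then have "{..length xs - 1} = {..<length xs}" by (cases xs) auto
  moreover have "(!) xs ` {..<length xs} = U" using xs(1) by (auto simp: set_conv_nth)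
  ultimately show ?thesis using xs(2)
    by (intro exI[of _ "(!) xs"] exI[of _ "length xs - 1"]) (auto simp: sorted_wrt_nth_less)
qed

lemma strict_steps_less_iff:
  fixes v :: "nat \<Rightarrow> real"
  assumes "\<And>i. i < L \<Longrightarrow> v i < v (Suc i)" "i \<le> L" "j \<le> L"
  shows "v i < v j \<longleftrightarrow> i < j"
proof -
  have "v a < v b" if "a < b" "b \<le> L" for a b
    using that
  proof (induction b)
    case (Suc b) then show ?case using assms(1)[of b] by (cases "a = b") auto
  qed auto
  then show ?thesis using assms(2,3) by (metis less_asym less_irrefl linorder_neqE_nat)
qed

lemma sum_mult_vec: "(\<Sum>j\<in>J. A j) *v (x :: real^'m) = (\<Sum>j\<in>J. A j *v x :: real^'d)"
  by (induction J rule: infinite_finite_induct) (auto simp: matrix_vector_mult_add_rdistrib)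

text \<open>Each increment over [a j, b j] telescopes over the cells of \<open>v\<close> that it
  contains; exchanging the two sums collects all coefficients of a cell.\<close>

lemma refine_sum:
  fixes v :: "nat \<Rightarrow> real" and c :: "nat \<Rightarrow> real^'m^'d" and w :: "real \<Rightarrow> real^'m"
  assumes v: "\<And>i. i < L \<Longrightarrow> v i < v (Suc i)"
    and ab: "\<And>j. j < K \<Longrightarrow> a j \<in> v ` {..L} \<and> b j \<in> v ` {..L} \<and> a j \<le> b j"
  shows "(\<Sum>j<K. c j *v (w (b j) - w (a j)))
    = (\<Sum>i<L. (\<Sum>j<K. if a j \<le> v i \<and> v i < b j then c j else 0) *v (w (v (Suc i)) - w (v i)))"
proof -
  have tel: "w (b j) - w (a j) = (\<Sum>i<L. if a j \<le> v i \<and> v i < b j then w (v (Suc i)) - w (v i) else 0)" if j: "j < K" for j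
  proof -
    obtain ia ib where i: "ia \<le> L" "ib \<le> L" "a j = v ia" "b j = v ib" using ab[OF j] by (auto simp: image_iff)
    then have le: "ia \<le> ib" using strict_steps_less_iff[of L v ib ia, OF v] ab[OF j] by (metis not_le)
    have eq: "{..<L} \<inter> {i. a j \<le> v i \<and> v i < b j} = {ia..<ib}"
      using i strict_steps_less_iff[of L v, OF v] by (auto simp: not_less[symmetric])
    have "(\<Sum>i<L. if a j \<le> v i \<and> v i < b j then w (v (Suc i)) - w (v i) else 0) = (\<Sum>i\<in>{ia..<ib}. w (v (Suc i)) - w (v i))"
      unfolding eq[symmetric] by (subst sum.inter_restrict) auto
    also have "\<dots> = w (b j) - w (a j)" using sum_Suc_diff'[OF le, of "\<lambda>i. w (v i)"] i by simp
    finally show ?thesis by simp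
  qed
  have "(\<Sum>j<K. c j *v (w (b j) - w (a j)))
    = (\<Sum>j<K. \<Sum>i<L. (if a j \<le> v i \<and> v i < b j then c j else 0) *v (w (v (Suc i)) - w (v i)))"
    by (intro sum.cong refl, subst tel) (auto simp: linear_sum[OF matrix_vector_mul_linear] intro!: sum.cong)
  also have "\<dots> = (\<Sum>i<L. \<Sum>j<K. (if a j \<le> v i \<and> v i < b j then c j else 0) *v (w (v (Suc i)) - w (v i)))"
    by (rule sum.swap)
  finally show ?thesis by (simp add: sum_mult_vec)
qed

section \<open>Simple integrals against Wiener increments\<close>

definition gauss_const :: "'m itself \<Rightarrow> nat \<Rightarrow> real" where
  "gauss_const _ r = real CARD('m) ^ Suc (2 * r) * (fact (2 * r) / (2 ^ r * fact r))"

lemma gauss_const_pos: "0 < gauss_const TYPE('m::finite) r"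
  by (simp add: gauss_const_def)

locale wiener_space = prob_space M for M :: "'a measure" +
  fixes F :: "real \<Rightarrow> 'a measure" and W :: "real \<Rightarrow> 'a \<Rightarrow> real^'m"
  assumes complete: "complete_measure M"
    and subalg: "0 \<le> t \<Longrightarrow> subalgebra M (F t)"
    and filt: "0 \<le> s \<Longrightarrow> s \<le> t \<Longrightarrow> subalgebra (F t) (F s)"
    and W_adapted: "0 \<le> t \<Longrightarrow> W t \<in> borel_measurable (F t)"
    and W_cont: "AE \<omega> in M. continuous_on {0..} (\<lambda>t. W t \<omega>)"
    and W_indep: "0 \<le> s \<Longrightarrow> s < t \<Longrightarrow> indep_of M (F s) (\<lambda>\<omega>. W t \<omega> - W s \<omega>)"
    and W_distr: "0 \<le> s \<Longrightarrow> s < t \<Longrightarrow>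
      distributed M lborel (\<lambda>\<omega>. W t \<omega> - W s \<omega>) (\<lambda>x. ennreal (gauss_density (sqrt (t - s)) x))"
begin

lemma F_measurable: "0 \<le> s \<Longrightarrow> s \<le> t \<Longrightarrow> f \<in> measurable (F s) N \<Longrightarrow> f \<in> measurable (F t) N"
  using filt by (rule subalgebra_measurable)

lemma F_measurable_M: "0 \<le> t \<Longrightarrow> f \<in> measurable (F t) N \<Longrightarrow> f \<in> measurable M N"
  using subalg by (rule subalgebra_measurable)

lemma W_measurable: "0 \<le> t \<Longrightarrow> W t \<in> borel_measurable M"
  using F_measurable_M W_adapted by blast

text \<open>\<open>G\<close> is kept apart from \<open>F\<close>: for the scheme it will be the
  filtration enlarged by the sampling points, with respect to which the increments are still
  independent.\<close>

lemma mart_diff_increment: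
  fixes \<xi> :: "'a \<Rightarrow> real^'m^'d"
  assumes st: "0 \<le> s" "s < t" and ind: "indep_of M G (\<lambda>\<omega>. W t \<omega> - W s \<omega>)" and [measurable]: "\<xi> \<in> borel_measurable G"
  shows "mart_diff M G (\<lambda>\<omega>. \<xi> \<omega> *v (W t \<omega> - W s \<omega>))"
proof -
  have "mart_diff M G (\<lambda>\<omega>. (\<lambda>(z, \<omega>). \<xi> \<omega> *v z) (W t \<omega> - W s \<omega>, \<omega>))"
    by (rule mart_diffI[OF ind]) (use gauss_mean_zero[OF W_distr[OF st]] in auto)
  then show ?thesis by simp
qed

lemma Ebd_increment:
  fixes \<xi> :: "'a \<Rightarrow> real^'m^'d"
  assumes st: "0 \<le> s" "s < t" and ind: "indep_of M G (\<lambda>\<omega>. W t \<omega> - W s \<omega>)" and \<xi>[measurable]: "\<xi> \<in> borel_measurable G"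
    and b: "Ebd M (\<lambda>\<omega>. norm (\<xi> \<omega>) ^ (2 * r)) b" and r: "1 \<le> r"
  shows "Ebd M (\<lambda>\<omega>. norm (\<xi> \<omega> *v (W t \<omega> - W s \<omega>)) ^ (2 * r)) (gauss_const TYPE('m) r * b * (t - s) ^ r)"
proof -
  let ?Z = "\<lambda>\<omega>. W t \<omega> - W s \<omega>"
  let ?p = "2 * r"
  let ?c = "gauss_const TYPE('m) r * (t - s) ^ r"
  have sub: "subalgebra M G" using ind by (simp add: indep_of_def)
  have Zm[measurable]: "?Z \<in> borel_measurable M" using ind by (simp add: indep_of_def)
  have [measurable]: "\<xi> \<in> borel_measurable M" using subalgebra_measurable[OF sub \<xi>] .
  have g: "Ebd M (\<lambda>\<omega>. norm (?Z \<omega>) ^ ?p) ?c"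
    using gauss_moment[OF W_distr[OF st] _ r] st by (simp add: gauss_const_def)
  have b0: "0 \<le> b" using EbdD(5)[OF b] .
  have c0: "0 \<le> ?c" using gauss_const_pos[where 'm='m, of r] st by (intro mult_nonneg_nonneg) auto
  have bn: "(\<integral>\<^sup>+\<omega>. ennreal (norm (\<xi> \<omega>) ^ ?p) \<partial>M) \<le> ennreal b"
    using b b0 by (subst Ebd_nn_integral[symmetric]) auto
  have gn: "(\<integral>\<^sup>+\<omega>. ennreal (norm (?Z \<omega>) ^ ?p) \<partial>M) \<le> ennreal ?c"
    using g c0 by (subst Ebd_nn_integral[symmetric]) auto
  have "(\<integral>\<^sup>+\<omega>. ennreal (norm (\<xi> \<omega> *v ?Z \<omega>) ^ ?p) \<partial>M)
     \<le> (\<integral>\<^sup>+\<omega>. (\<lambda>(z, \<omega>). ennreal (norm z ^ ?p) * ennreal (norm (\<xi> \<omega>) ^ ?p)) (?Z \<omega>, \<omega>) \<partial>M)"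
  proof (rule nn_integral_mono)
    fix \<omega>
    have "norm (\<xi> \<omega> *v ?Z \<omega>) ^ ?p \<le> (norm (\<xi> \<omega>) * norm (?Z \<omega>)) ^ ?p" by (intro power_mono norm_mult_vec_le) auto
    then show "ennreal (norm (\<xi> \<omega> *v ?Z \<omega>) ^ ?p) \<le> (\<lambda>(z, \<omega>). ennreal (norm z ^ ?p) * ennreal (norm (\<xi> \<omega>) ^ ?p)) (?Z \<omega>, \<omega>)"
      by (simp add: power_mult_distrib mult.commute ennreal_leI flip: ennreal_mult)
  qed
  also have "\<dots> = (\<integral>\<^sup>+z. (\<integral>\<^sup>+\<omega>. ennreal (norm z ^ ?p) * ennreal (norm (\<xi> \<omega>) ^ ?p) \<partial>M) \<partial>distr M borel ?Z)"
    by (subst indep_of_nn_integral[OF ind]) auto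
  also have "\<dots> \<le> (\<integral>\<^sup>+z. ennreal (norm z ^ ?p) * ennreal b \<partial>distr M borel ?Z)"
    by (intro nn_integral_mono) (auto simp: nn_integral_cmult intro!: mult_left_mono bn)
  also have "\<dots> = (\<integral>\<^sup>+\<omega>. ennreal (norm (?Z \<omega>) ^ ?p) \<partial>M) * ennreal b"
    by (subst nn_integral_distr) (auto simp: nn_integral_multc)
  also have "\<dots> \<le> ennreal ?c * ennreal b" by (intro mult_right_mono gn) auto
  also have "\<dots> = ennreal (gauss_const TYPE('m) r * b * (t - s) ^ r)"
    using b0 c0 by (simp add: mult_ac flip: ennreal_mult)
  finally show ?thesis using b0 c0 gauss_const_pos[where 'm='m, of r] st
    by (subst Ebd_nn_integral) (auto intro!: mult_nonneg_nonneg)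
qed

text \<open>One half of the Ito isometry, with \<open>gauss_const\<close> as its constant. The
  increment over the next cell is a martingale difference with respect to \<open>F (v k)\<close>,
  where the sum up to there is measurable, so the cross term vanishes.\<close>

lemma Ebd_simple_sum:
  fixes \<Xi> :: "nat \<Rightarrow> 'a \<Rightarrow> real^'m^'d"
  assumes v: "0 \<le> v 0" "\<And>i. i < L \<Longrightarrow> v i < v (Suc i)"
    and \<Xi>: "\<And>i. i < L \<Longrightarrow> \<Xi> i \<in> borel_measurable (F (v i))"
    and e: "\<And>i. i < L \<Longrightarrow> Ebd M (\<lambda>\<omega>. norm (\<Xi> i \<omega>) ^ 2) (e i)"
    and k: "k \<le> L"
  shows "Ebd M (\<lambda>\<omega>. norm (\<Sum>i<k. \<Xi> i \<omega> *v (W (v (Suc i)) \<omega> - W (v i) \<omega>)) ^ 2)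
    (gauss_const TYPE('m) 1 * (\<Sum>i<k. e i * (v (Suc i) - v i)))"
  using k
proof (induction k)
  case 0 then show ?case by (auto simp: Ebd_def)
next
  case (Suc k)
  have vmono: "v i \<le> v j" if "i \<le> j" "j \<le> L" for i j
    using strict_steps_less_iff[of L v j i, OF v(2)] that by auto
  have v0: "0 \<le> v i" if "i \<le> L" for i using vmono[of 0 i] that v(1) by auto
  define S where "S \<omega> = (\<Sum>i<k. \<Xi> i \<omega> *v (W (v (Suc i)) \<omega> - W (v i) \<omega>))" for \<omega>
  define D where "D \<omega> = \<Xi> k \<omega> *v (W (v (Suc k)) \<omega> - W (v k) \<omega>)" for \<omega>
  have kL: "k < L" using Suc by simp
  have st: "0 \<le> v k" "v k < v (Suc k)" using v0 v(2) kL by auto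
  note ind = W_indep[OF st]
  have S1: "Ebd M (\<lambda>\<omega>. norm (S \<omega>) ^ 2) (gauss_const TYPE('m) 1 * (\<Sum>i<k. e i * (v (Suc i) - v i)))"
    using Suc unfolding S_def by auto
  have D1: "Ebd M (\<lambda>\<omega>. norm (D \<omega>) ^ 2) (gauss_const TYPE('m) 1 * e k * (v (Suc k) - v k))"
    using Ebd_increment[OF st ind \<Xi>[OF kL], of 1 "e k"] e[OF kL] unfolding D_def by simp
  have SF: "S \<in> borel_measurable (F (v k))" unfolding S_def
  proof (rule borel_measurable_sum)
    fix i assume i: "i \<in> {..<k}"
    have "\<Xi> i \<in> borel_measurable (F (v k))" by (rule F_measurable[OF v0 vmono \<Xi>]) (use i kL in auto)
    moreover have "W (v (Suc i)) \<in> borel_measurable (F (v k))" by (rule F_measurable[OF v0 vmono W_adapted[OF v0]]) (use i kL in auto)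
    moreover have "W (v i) \<in> borel_measurable (F (v k))" by (rule F_measurable[OF v0 vmono W_adapted[OF v0]]) (use i kL in auto)
    ultimately show "(\<lambda>\<omega>. \<Xi> i \<omega> *v (W (v (Suc i)) \<omega> - W (v i) \<omega>)) \<in> borel_measurable (F (v k))" by measurable
  qed
  have Sm[measurable]: "S \<in> borel_measurable M" by (rule F_measurable_M[OF st(1) SF])
  have md: "mart_diff M (F (v k)) D" unfolding D_def by (rule mart_diff_increment[OF st ind \<Xi>[OF kL]])
  have Dm[measurable]: "D \<in> borel_measurable M" using md by (simp add: mart_diff_def)
  have i: "integrable M (\<lambda>\<omega>. norm (S \<omega>) ^ 1 * norm (D \<omega>) ^ 1)"
    by (rule integrable_power_mult) (use EbdD(1)[OF S1] EbdD(1)[OF D1] in \<open>auto simp: numeral_2_eq_2\<close>)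
  have z: "(\<integral>\<omega>. inner (S \<omega>) (D \<omega>) \<partial>M) = 0" using md SF i by (simp add: mart_diff_def)
  have i': "integrable M (\<lambda>\<omega>. inner (S \<omega>) (D \<omega>))"
    by (rule Bochner_Integration.integrable_bound[OF i]) (auto simp: Cauchy_Schwarz_ineq2)
  have eq: "norm (\<Sum>i<Suc k. \<Xi> i \<omega> *v (W (v (Suc i)) \<omega> - W (v i) \<omega>)) ^ 2 = norm (S \<omega>) ^ 2 + norm (D \<omega>) ^ 2 + 2 * inner (S \<omega>) (D \<omega>)" for \<omega>
    by (simp add: S_def[symmetric] D_def[symmetric] power2_norm_eq_inner inner_add_left inner_add_right inner_commute)
  show ?case unfolding Ebd_def eq
  proof (intro conjI ballI)
    show "integrable M (\<lambda>\<omega>. (norm (S \<omega>))\<^sup>2 + (norm (D \<omega>))\<^sup>2 + 2 * inner (S \<omega>) (D \<omega>))"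
      using EbdD(1)[OF S1] EbdD(1)[OF D1] i' by auto
    show "0 \<le> (norm (S \<omega>))\<^sup>2 + (norm (D \<omega>))\<^sup>2 + 2 * inner (S \<omega>) (D \<omega>)" for \<omega> unfolding eq[symmetric] by simp
    have "(\<integral>\<omega>. (norm (S \<omega>))\<^sup>2 + (norm (D \<omega>))\<^sup>2 + 2 * inner (S \<omega>) (D \<omega>) \<partial>M) = (\<integral>\<omega>. (norm (S \<omega>))\<^sup>2 \<partial>M) + (\<integral>\<omega>. (norm (D \<omega>))\<^sup>2 \<partial>M)"
      using EbdD(1)[OF S1] EbdD(1)[OF D1] i' z by simp
    then show "(\<integral>\<omega>. (norm (S \<omega>))\<^sup>2 + (norm (D \<omega>))\<^sup>2 + 2 * inner (S \<omega>) (D \<omega>) \<partial>M) \<le> gauss_const TYPE('m) 1 * (\<Sum>i<Suc k. e i * (v (Suc i) - v i))"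
      using EbdD(4)[OF S1] EbdD(4)[OF D1] by (simp add: algebra_simps)
  qed
qed

text \<open>Lenglart's inequality for sums of increments. Freezing \<open>\<Xi>\<close> as soon as its quadratic variation
  would exceed \<open>\<delta>\<close> keeps it adapted, because the increments are taken after \<open>v\<^sub>i\<close>.\<close>

lemma Lenglart_simple_sum:
  fixes \<Xi> :: "nat \<Rightarrow> 'a \<Rightarrow> real^'m^'d"
  assumes v: "0 \<le> v 0" "\<And>i. i < L \<Longrightarrow> v i < v (Suc i)"
    and \<Xi>: "\<And>i. i < L \<Longrightarrow> \<Xi> i \<in> borel_measurable (F (v i))"
    and \<epsilon>: "0 < \<epsilon>" and \<delta>: "0 < \<delta>"
  shows "prob {\<omega> \<in> space M. norm (\<Sum>i<L. \<Xi> i \<omega> *v (W (v (Suc i)) \<omega> - W (v i) \<omega>)) > \<epsilon>}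
    \<le> prob {\<omega> \<in> space M. (\<Sum>i<L. norm (\<Xi> i \<omega>) ^ 2 * (v (Suc i) - v i)) > \<delta>} + gauss_const TYPE('m) 1 * \<delta> / \<epsilon>\<^sup>2"
proof -
  have vmono: "v i \<le> v j" if "i \<le> j" "j \<le> L" for i j
    using strict_steps_less_iff[of L v j i, OF v(2)] that by auto
  have v0: "0 \<le> v i" if "i \<le> L" for i using vmono[of 0 i] that v(1) by auto
  define Q where "Q k \<omega> = (\<Sum>i<k. norm (\<Xi> i \<omega>) ^ 2 * (v (Suc i) - v i))" for k \<omega>
  define X where "X i \<omega> = (if Q (Suc i) \<omega> \<le> \<delta> then \<Xi> i \<omega> else 0)" for i \<omega>
  have QF: "Q (Suc i) \<in> borel_measurable (F (v i))" if "i < L" for i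
    unfolding Q_def
  proof (rule borel_measurable_sum)
    fix l assume "l \<in> {..<Suc i}"
    then have "\<Xi> l \<in> borel_measurable (F (v i))" using that by (intro F_measurable[OF v0 vmono \<Xi>]) auto
    then show "(\<lambda>\<omega>. norm (\<Xi> l \<omega>) ^ 2 * (v (Suc l) - v l)) \<in> borel_measurable (F (v i))" by measurable
  qed
  have XF: "X i \<in> borel_measurable (F (v i))" if "i < L" for i
    unfolding X_def using QF[OF that] \<Xi>[OF that] by measurable
  have XM[measurable]: "i < L \<Longrightarrow> X i \<in> borel_measurable M" for i using XF F_measurable_M v0 by (meson less_imp_le)
  have \<Xi>M[measurable]: "i < L \<Longrightarrow> \<Xi> i \<in> borel_measurable M" for i using \<Xi> F_measurable_M v0 by (meson less_imp_le)
  have WM[measurable]: "i \<le> L \<Longrightarrow> W (v i) \<in> borel_measurable M" for i using W_measurable v0 by auto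
  have dpos: "0 < v (Suc i) - v i" if "i < L" for i using v(2)[OF that] by simp
  have Qmono: "Q k \<omega> \<le> Q l \<omega>" if "k \<le> l" "l \<le> L" for k l \<omega>
    unfolding Q_def by (rule sum_mono2) (use that dpos in \<open>auto intro!: mult_nonneg_nonneg less_imp_le[OF dpos]\<close>)
  have Xsum: "(\<Sum>i<k. norm (X i \<omega>) ^ 2 * (v (Suc i) - v i)) \<le> \<delta>" if "k \<le> L" for k \<omega>
    using that
  proof (induction k)
    case 0 then show ?case using \<delta> by simp
  next
    case (Suc k)
    show ?case
    proof (cases "Q (Suc k) \<omega> \<le> \<delta>")
      case True
      have "X i \<omega> = \<Xi> i \<omega>" if "i < Suc k" for i
        using Qmono[of "Suc i" "Suc k" \<omega>] that Suc True by (auto simp: X_def)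
      then have "(\<Sum>i<Suc k. norm (X i \<omega>) ^ 2 * (v (Suc i) - v i)) = Q (Suc k) \<omega>" unfolding Q_def by (intro sum.cong) auto
      then show ?thesis using True by simp
    next
      case False
      then show ?thesis using Suc by (simp add: X_def)
    qed
  qed
  have Xb: "norm (X i \<omega>) ^ 2 \<le> \<delta> / (v (Suc i) - v i)" if "i < L" for i \<omega>
  proof -
    have "norm (X i \<omega>) ^ 2 * (v (Suc i) - v i) \<le> (\<Sum>l<L. norm (X l \<omega>) ^ 2 * (v (Suc l) - v l))"
      by (rule member_le_sum) (use that dpos in \<open>auto intro!: mult_nonneg_nonneg less_imp_le[OF dpos]\<close>)
    then show ?thesis using Xsum[of L \<omega>] dpos[OF that] by (simp add: field_simps)
  qed
  have iX: "integrable M (\<lambda>\<omega>. norm (X i \<omega>) ^ 2)" if "i < L" for i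
    by (rule integrable_const_bound[where B = "\<delta> / (v (Suc i) - v i)"]) (use Xb that in auto)
  define e where "e i = (\<integral>\<omega>. norm (X i \<omega>) ^ 2 \<partial>M)" for i
  define S where "S \<omega> = (\<Sum>i<L. X i \<omega> *v (W (v (Suc i)) \<omega> - W (v i) \<omega>))" for \<omega>
  define c where "c = gauss_const TYPE('m) 1"
  have c0: "0 < c" unfolding c_def by (rule gauss_const_pos)
  have "Ebd M (\<lambda>\<omega>. norm (S \<omega>) ^ 2) (c * (\<Sum>i<L. e i * (v (Suc i) - v i)))"
    unfolding S_def c_def by (rule Ebd_simple_sum[where v = v, OF v XF]) (use iX in \<open>auto simp: Ebd_def e_def\<close>)
  moreover have "(\<Sum>i<L. e i * (v (Suc i) - v i)) \<le> \<delta>"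
  proof -
    have "(\<Sum>i<L. e i * (v (Suc i) - v i)) = (\<integral>\<omega>. (\<Sum>i<L. norm (X i \<omega>) ^ 2 * (v (Suc i) - v i)) \<partial>M)"
      unfolding e_def using iX by (subst Bochner_Integration.integral_sum) auto
    also have "\<dots> \<le> (\<integral>\<omega>. \<delta> \<partial>M)"
      by (intro integral_mono Bochner_Integration.integrable_sum integrable_mult_left iX Xsum) auto
    finally show ?thesis by (simp add: prob_space)
  qed
  ultimately have ES: "Ebd M (\<lambda>\<omega>. norm (S \<omega>) ^ 2) (c * \<delta>)" using c0 by (auto elim!: Ebd_mono_const)
  have [measurable]: "S \<in> borel_measurable M" unfolding S_def by (intro borel_measurable_sum) auto
  have "prob {\<omega> \<in> space M. norm (S \<omega>) > \<epsilon>} \<le> prob {\<omega> \<in> space M. norm (S \<omega>) ^ 2 \<ge> \<epsilon>\<^sup>2}"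
    by (rule finite_measure_mono) (use \<epsilon> in \<open>auto intro!: power_mono\<close>)
  also have "\<dots> \<le> (\<integral>\<omega>. norm (S \<omega>) ^ 2 \<partial>M) / \<epsilon>\<^sup>2"
    by (rule integral_Markov_inequality_measure[where A = "{}"]) (use EbdD(1)[OF ES] \<epsilon> in auto)
  also have "\<dots> \<le> c * \<delta> / \<epsilon>\<^sup>2" using EbdD(4)[OF ES] by (intro divide_right_mono) auto
  finally have P: "prob {\<omega> \<in> space M. norm (S \<omega>) > \<epsilon>} \<le> c * \<delta> / \<epsilon>\<^sup>2" .
  have [measurable]: "{\<omega> \<in> space M. Q L \<omega> > \<delta>} \<in> sets M" unfolding Q_def by measurable
  have "prob {\<omega> \<in> space M. norm (\<Sum>i<L. \<Xi> i \<omega> *v (W (v (Suc i)) \<omega> - W (v i) \<omega>)) > \<epsilon>}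
    \<le> prob ({\<omega> \<in> space M. Q L \<omega> > \<delta>} \<union> {\<omega> \<in> space M. norm (S \<omega>) > \<epsilon>})"
  proof (rule finite_measure_mono)
    show "{\<omega> \<in> space M. norm (\<Sum>i<L. \<Xi> i \<omega> *v (W (v (Suc i)) \<omega> - W (v i) \<omega>)) > \<epsilon>}
      \<subseteq> {\<omega> \<in> space M. Q L \<omega> > \<delta>} \<union> {\<omega> \<in> space M. norm (S \<omega>) > \<epsilon>}"
    proof
      fix \<omega> assume w: "\<omega> \<in> {\<omega> \<in> space M. norm (\<Sum>i<L. \<Xi> i \<omega> *v (W (v (Suc i)) \<omega> - W (v i) \<omega>)) > \<epsilon>}"
      show "\<omega> \<in> {\<omega> \<in> space M. Q L \<omega> > \<delta>} \<union> {\<omega> \<in> space M. norm (S \<omega>) > \<epsilon>}"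
      proof (cases "Q L \<omega> \<le> \<delta>")
        case True
        have "X i \<omega> = \<Xi> i \<omega>" if "i < L" for i using Qmono[of "Suc i" L \<omega>] that True by (auto simp: X_def)
        then have "S \<omega> = (\<Sum>i<L. \<Xi> i \<omega> *v (W (v (Suc i)) \<omega> - W (v i) \<omega>))" unfolding S_def by (intro sum.cong) auto
        then show ?thesis using w by auto
      qed (use w in auto)
    qed
  qed measurable
  also have "\<dots> \<le> prob {\<omega> \<in> space M. Q L \<omega> > \<delta>} + prob {\<omega> \<in> space M. norm (S \<omega>) > \<epsilon>}"
    by (rule measure_Un_le) measurable
  finally show ?thesis using P by (simp add: Q_def c_def)
qed

end

text \<open>No point of the partition lies inside an open cell, so a comparison of such a point with
  the left end of the cell agrees with either comparison with an interior point \<open>r\<close>.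
  This reconciles the cells of \<open>simple_process\<close>, open on the left, with those of
  \<open>step_function\<close>, open on the right.\<close>

lemma simple_process_refine:
  fixes v u :: "nat \<Rightarrow> real"
  assumes v: "\<And>i. i < L \<Longrightarrow> v i < v (Suc i)" and i: "i < L" and r: "v i < r" "r < v (Suc i)"
    and a: "a \<in> v ` {..L}"
  shows "a \<le> v i \<longleftrightarrow> a < r" and "a \<le> v i \<longleftrightarrow> a \<le> r" and "v i < a \<longleftrightarrow> r \<le> a" and "v i < a \<longleftrightarrow> r < a"
proof -
  obtain l where l: "l \<le> L" "a = v l" using a by auto
  have "l \<le> i \<or> Suc i \<le> l" by auto
  then have "a \<le> v i \<or> v (Suc i) \<le> a"
    using strict_steps_less_iff[of L v, OF v] l i by (metis Suc_leI less_imp_le_nat not_le)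
  then show "a \<le> v i \<longleftrightarrow> a < r" "a \<le> v i \<longleftrightarrow> a \<le> r" "v i < a \<longleftrightarrow> r \<le> a" "v i < a \<longleftrightarrow> r < a"
    using r by auto
qed

section \<open>Ito integrals of continuous processes\<close>

definition uniform_point :: "real \<Rightarrow> real \<Rightarrow> nat \<Rightarrow> nat \<Rightarrow> real" where
  "uniform_point s t n l = s + real l * (t - s) / real n"

lemma uniform_point_props:
  assumes "s < t" "0 < n"
  shows "uniform_point s t n 0 = s" "uniform_point s t n n = t"
    "uniform_point s t n l < uniform_point s t n (Suc l)"
    "l \<le> n \<Longrightarrow> s \<le> uniform_point s t n l" "l \<le> n \<Longrightarrow> uniform_point s t n l \<le> t"
    "uniform_point s t n (Suc l) - uniform_point s t n l = (t - s) / n"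
proof -
  show "uniform_point s t n 0 = s" "uniform_point s t n n = t"
    "uniform_point s t n (Suc l) - uniform_point s t n l = (t - s) / n"
    using assms by (auto simp: uniform_point_def field_simps)
  then show "uniform_point s t n l < uniform_point s t n (Suc l)"
    using assms by (metis diff_gt_0_iff_gt divide_pos_pos of_nat_0_less_iff)
  show "s \<le> uniform_point s t n l" using assms by (simp add: uniform_point_def)
  show "uniform_point s t n l \<le> t" if "l \<le> n"
  proof -
    have "real l * (t - s) \<le> real n * (t - s)" using that assms by (intro mult_right_mono) auto
    then show ?thesis using assms by (simp add: uniform_point_def field_simps)
  qed
qed

definition riemann_sum :: "(real \<Rightarrow> real^'m^'d) \<Rightarrow> (real \<Rightarrow> real^'m) \<Rightarrow> real \<Rightarrow> real \<Rightarrow> nat \<Rightarrow> real^'d" where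
  "riemann_sum H w s t n = (\<Sum>l<n. H (uniform_point s t n l) *v
     (w (uniform_point s t n (Suc l)) - w (uniform_point s t n l)))"

text \<open>Unlike those of \<open>simple_process\<close>, the cells are closed on the left. The
  conventions differ at grid points only, which the integrals do not see.\<close>

definition step_function :: "(real \<Rightarrow> 'b::real_vector) \<Rightarrow> real \<Rightarrow> real \<Rightarrow> nat \<Rightarrow> real \<Rightarrow> 'b" where
  "step_function H s t n r = (\<Sum>l<n. if uniform_point s t n l \<le> r \<and> r < uniform_point s t n (Suc l)
     then H (uniform_point s t n l) else 0)"

lemma step_function_eq:
  assumes st: "s < t" "0 < n" and r: "s \<le> r" "r < t"
  shows "\<exists>l<n. step_function H s t n r = H (uniform_point s t n l) \<and> \<bar>uniform_point s t n l - r\<bar> \<le> (t - s) / n"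
proof -
  let ?u = "uniform_point s t n"
  have ex: "\<exists>k. r < ?u k" using uniform_point_props(2)[OF st] r by (intro exI[of _ n]) simp
  define k where "k = (LEAST k. r < ?u k)"
  have k: "r < ?u k" unfolding k_def using ex by (rule LeastI_ex)
  have "k \<noteq> 0" using k r uniform_point_props(1)[OF st] by (metis not_le)
  then obtain l where l: "k = Suc l" by (cases k) auto
  have lr: "?u l \<le> r" using not_less_Least[of l "\<lambda>k. r < ?u k"] l by (simp add: k_def[symmetric])
  have "k \<le> n" unfolding k_def by (rule Least_le) (use uniform_point_props(2)[OF st] r in auto)
  then have ln: "l < n" using l by simp
  have mono: "?u i \<le> ?u j" if "i \<le> j" for i j
    using that st by (auto simp: uniform_point_def intro!: divide_right_mono mult_right_mono)
  have "step_function H s t n r = (\<Sum>i<n. if i = l then H (?u l) else 0)"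
    unfolding step_function_def
  proof (intro sum.cong refl)
    fix i
    show "(if ?u i \<le> r \<and> r < ?u (Suc i) then H (?u i) else 0) = (if i = l then H (?u l) else 0)"
    proof (cases "i = l")
      case False
      have "\<not> (?u i \<le> r \<and> r < ?u (Suc i))"
      proof
        assume a: "?u i \<le> r \<and> r < ?u (Suc i)"
        then have "\<not> k \<le> i" using mono[of k i] k by auto
        moreover have "\<not> Suc i \<le> l" using mono[of "Suc i" l] lr a by auto
        ultimately show False using False l by auto
      qed
      then show ?thesis using False by (simp only: if_False)
    qed (use k l lr in auto)
  qed
  also have "\<dots> = H (?u l)" using ln by simp
  finally show ?thesis using ln lr k l uniform_point_props(6)[OF st, of l] by (intro exI[of _ l]) auto
qed

context wiener_space
begin

lemma continuous_process_measurable: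
  fixes Y :: "real \<Rightarrow> 'a \<Rightarrow> 'b::{metric_space, second_countable_topology}"
  assumes "\<And>t. Y t \<in> borel_measurable N" "\<And>\<omega>. \<omega> \<in> space N \<Longrightarrow> continuous_on UNIV (\<lambda>t. Y t \<omega>)"
  shows "(\<lambda>(t, \<omega>). Y t \<omega>) \<in> borel_measurable (borel \<Otimes>\<^sub>M N)"
proof -
  have "(\<lambda>(\<omega>, t). Y t \<omega>) \<in> borel_measurable (N \<Otimes>\<^sub>M borel)"
    by (rule caratheodory_measurable) (use assms in auto)
  from measurable_pair_swap[OF this] show ?thesis by (simp add: split_beta' comp_def)
qed

text \<open>For a continuous path the supremum exceeds \<epsilon> if and only if some rational time
  does. Continuity is known only almost surely, and completeness of the measure absorbs the
  exceptional set. The result matters because a set that is not measurable has measure 0 by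
  convention, so that smallness of its measure in \<open>tendsto_zero_in_prob\<close> would say
  nothing.\<close>

lemma sup_event_measurable:
  fixes Y :: "real \<Rightarrow> 'a \<Rightarrow> 'b::{banach, second_countable_topology}"
  assumes T: "0 < T" and m: "\<And>t. t \<in> {0..T} \<Longrightarrow> Y t \<in> borel_measurable M"
    and c: "AE \<omega> in M. continuous_on {0..T} (\<lambda>t. Y t \<omega>)" and \<epsilon>: "0 < \<epsilon>"
  shows "{\<omega> \<in> space M. (SUP t\<in>{0..T}. ennreal (norm (Y t \<omega>))) > ennreal \<epsilon>} \<in> sets M"
proof -
  let ?B = "{\<omega> \<in> space M. (SUP t\<in>{0..T}. ennreal (norm (Y t \<omega>))) > ennreal \<epsilon>}"
  let ?A = "{\<omega> \<in> space M. \<exists>q\<in>\<rat> \<inter> {0..T}. norm (Y q \<omega>) > \<epsilon>}"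
  have B: "\<omega> \<in> ?B \<longleftrightarrow> \<omega> \<in> space M \<and> (\<exists>t\<in>{0..T}. norm (Y t \<omega>) > \<epsilon>)" for \<omega>
    using \<epsilon> by (auto simp: less_SUP_iff ennreal_less_iff)
  have A: "?A \<in> sets M"
  proof -
    have "countable (\<rat> \<inter> {0..T})" using countable_rat by (rule countable_Int1)
    moreover have "{\<omega> \<in> space M. norm (Y q \<omega>) > \<epsilon>} \<in> sets M" if "q \<in> \<rat> \<inter> {0..T}" for q
    proof -
      have [measurable]: "Y q \<in> borel_measurable M" using m that by auto
      show ?thesis by measurable
    qed
    ultimately have "(\<Union>q\<in>\<rat> \<inter> {0..T}. {\<omega> \<in> space M. norm (Y q \<omega>) > \<epsilon>}) \<in> sets M"
      by (rule sets.countable_UN'')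
    also have "(\<Union>q\<in>\<rat> \<inter> {0..T}. {\<omega> \<in> space M. norm (Y q \<omega>) > \<epsilon>}) = ?A" by auto
    finally show ?thesis .
  qed
  show ?thesis
  proof (rule complete_measure.in_sets_AE[OF complete _ A])
    show "AE \<omega> in M. \<omega> \<in> ?A \<longleftrightarrow> \<omega> \<in> ?B" using c
    proof (rule AE_mp, intro AE_I2 impI iffI)
      fix \<omega> assume "\<omega> \<in> ?A" then show "\<omega> \<in> ?B" unfolding B by blast
    next
      fix \<omega> assume cont: "continuous_on {0..T} (\<lambda>t. Y t \<omega>)" and "\<omega> \<in> ?B"
      then obtain t where w: "\<omega> \<in> space M" and t: "t \<in> {0..T}" "norm (Y t \<omega>) > \<epsilon>" unfolding B by blast
      have "continuous_on {0..T} (\<lambda>t. norm (Y t \<omega>))" using cont by (intro continuous_intros)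
      then obtain d where d: "d > 0" "\<And>q. q \<in> {0..T} \<Longrightarrow> dist q t < d \<Longrightarrow> dist (norm (Y q \<omega>)) (norm (Y t \<omega>)) < norm (Y t \<omega>) - \<epsilon>"
        using t unfolding continuous_on_iff by (metis diff_gt_0_iff_gt)
      have "max 0 (t - d) < min T (t + d)" using t d T by auto
      from Rats_dense_in_real[OF this] obtain q where q: "q \<in> \<rat>" "max 0 (t - d) < q" "q < min T (t + d)" by auto
      have "dist (norm (Y q \<omega>)) (norm (Y t \<omega>)) < norm (Y t \<omega>) - \<epsilon>"
        by (rule d(2)) (use q t in \<open>auto simp: dist_real_def\<close>)
      then have "norm (Y q \<omega>) > \<epsilon>" by (auto simp: dist_real_def)
      then show "\<omega> \<in> ?A" using q w by auto
    qed
  qed auto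
qed

text \<open>The contributions before \<open>s\<close> cancel; clamping the partition points to
  [s, t] expresses what is left without splitting a cell.\<close>

lemma simple_integral_diff_eq:
  assumes u: "u 0 = 0" "u K = T" "\<And>i. i < K \<Longrightarrow> u i < u (Suc i)" and st: "0 \<le> s" "s < t" "t \<le> T"
  shows "simple_integral W K u \<xi> t \<omega> - simple_integral W K u \<xi> s \<omega>
    = (\<Sum>j<K. \<xi> j \<omega> *v (W (max s (min t (u (Suc j)))) \<omega> - W (max s (min t (u j))) \<omega>))"
proof -
  have "W (min t b) \<omega> - W (min t a) \<omega> - (W (min s b) \<omega> - W (min s a) \<omega>)
    = W (max s (min t b)) \<omega> - W (max s (min t a)) \<omega>" for a b
    using st by (cases "a \<le> s"; cases "b \<le> s"; cases "a \<le> t"; cases "b \<le> t") (auto simp: min_def max_def)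
  then show ?thesis unfolding simple_integral_def
    by (simp add: sum_subtractf[symmetric] matrix_vector_mult_diff_distrib[symmetric])
qed

text \<open>Both sums are written on a common refinement \<open>v\<close>, where their difference is the integral of a
  simple process whose quadratic variation is at most the \<open>L\<^sup>2\<close>-distance of the integrands.\<close>

lemma simple_minus_riemann:
  fixes \<xi> :: "nat \<Rightarrow> 'a \<Rightarrow> real^'m^'d" and H :: "real \<Rightarrow> 'a \<Rightarrow> real^'m^'d"
  assumes data: "simple_process_data M F T K u \<xi>" and st: "0 \<le> s" "s < t" "t \<le> T" and n: "0 < n"
    and H: "\<And>r. r \<in> {0..T} \<Longrightarrow> H r \<in> borel_measurable (F r)"
    and \<epsilon>: "0 < \<epsilon>" and \<delta>: "0 < \<delta>"
  shows "\<exists>Q. Q \<in> borel_measurable M \<and>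
    (\<forall>\<omega>. ennreal (Q \<omega>) \<le> (\<integral>\<^sup>+r\<in>{s..<t}. ennreal ((norm (simple_process K u \<xi> r \<omega> - step_function (\<lambda>r. H r \<omega>) s t n r))\<^sup>2) \<partial>lborel)) \<and>
    prob {\<omega> \<in> space M. norm (simple_integral W K u \<xi> t \<omega> - simple_integral W K u \<xi> s \<omega>
        - riemann_sum (\<lambda>r. H r \<omega>) (\<lambda>r. W r \<omega>) s t n) > \<epsilon>}
      \<le> prob {\<omega> \<in> space M. Q \<omega> > \<delta>} + gauss_const TYPE('m) 1 * \<delta> / \<epsilon>\<^sup>2"
proof -
  have u: "u 0 = 0" "u K = T" "\<And>i. i < K \<Longrightarrow> u i < u (Suc i)"
    and \<xi>: "\<And>i. i < K \<Longrightarrow> \<xi> i \<in> borel_measurable (F (u i))"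
    using data by (auto simp: simple_process_data_def)
  define cl where "cl x = max s (min t x)" for x :: real
  let ?p = "uniform_point s t n"
  note up = uniform_point_props[OF st(2) n]
  \<comment> \<open>The partition points of the simple process, clamped to [s, t], together with the
    points of the Riemann sum: on every open cell of this refinement both integrands are constant in
    time.\<close>
  define U where "U = cl ` u ` {..K} \<union> ?p ` {..n}"
  have "finite U" "U \<noteq> {}" by (auto simp: U_def)
  then obtain v L where v: "\<And>i. i < L \<Longrightarrow> v i < v (Suc i)" and vU: "v ` {..L} = U"
    using exists_partition by blast
  have vst: "s \<le> v i \<and> v i \<le> t" if "i \<le> L" for i
  proof -
    have "v i \<in> U" using vU that by auto
    then show ?thesis using st up(4,5) by (auto simp: U_def cl_def)
  qed
  have clU: "cl (u j) \<in> v ` {..L}" if "j \<le> K" for j using that unfolding vU U_def by auto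
  have pU: "?p l \<in> v ` {..L}" if "l \<le> n" for l using that unfolding vU U_def by auto
  have umono: "u i \<le> u j" if "i \<le> j" "j \<le> K" for i j
    using strict_steps_less_iff[of K u j i, OF u(3)] that by auto
  have u0: "0 \<le> u j" if "j \<le> K" for j using umono[of 0 j] that u by auto
  define \<Xi> where "\<Xi> i \<omega> = (\<Sum>j<K. if cl (u j) \<le> v i \<and> v i < cl (u (Suc j)) then \<xi> j \<omega> else 0)
     - (\<Sum>l<n. if ?p l \<le> v i \<and> v i < ?p (Suc l) then H (?p l) \<omega> else 0)" for i \<omega>
  have \<Xi>F: "\<Xi> i \<in> borel_measurable (F (v i))" if i: "i < L" for i
  proof -
    have 1: "(\<lambda>\<omega>. if cl (u j) \<le> v i \<and> v i < cl (u (Suc j)) then \<xi> j \<omega> else 0) \<in> borel_measurable (F (v i))" if "j < K" for j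
    proof (cases "cl (u j) \<le> v i \<and> v i < cl (u (Suc j))")
      case True
      have "u j \<le> v i" using True vst[of i] i by (auto simp: cl_def max_def min_def split: if_splits)
      then show ?thesis using True F_measurable[OF u0 _ \<xi>, of j "v i"] that by simp
    next
      case False
      show ?thesis unfolding if_not_P[OF False] by simp
    qed
    have 2: "(\<lambda>\<omega>. if ?p l \<le> v i \<and> v i < ?p (Suc l) then H (?p l) \<omega> else 0) \<in> borel_measurable (F (v i))" if "l < n" for l
    proof (cases "?p l \<le> v i \<and> v i < ?p (Suc l)")
      case True
      have "0 \<le> ?p l" "?p l \<le> T" using up(4)[of l] up(5)[of l] that st by auto
      then show ?thesis using True F_measurable[OF _ _ H, of "?p l" "v i"] by simp
    next
      case False
      show ?thesis unfolding if_not_P[OF False] by simp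
    qed
    show ?thesis unfolding \<Xi>_def
      by (intro borel_measurable_diff borel_measurable_sum) (use 1 2 in auto)
  qed
  define Q where "Q \<omega> = (\<Sum>i<L. norm (\<Xi> i \<omega>) ^ 2 * (v (Suc i) - v i))" for \<omega>
  have Qm: "Q \<in> borel_measurable M"
    unfolding Q_def
  proof (rule borel_measurable_sum)
    fix i assume "i \<in> {..<L}"
    then have "\<Xi> i \<in> borel_measurable M" using F_measurable_M[OF _ \<Xi>F, of i] vst[of i] st by auto
    then show "(\<lambda>\<omega>. norm (\<Xi> i \<omega>) ^ 2 * (v (Suc i) - v i)) \<in> borel_measurable M" by measurable
  qed
  have \<Xi>_eq: "\<Xi> i \<omega> = (if s < r \<and> r < t then simple_process K u \<xi> r \<omega> - step_function (\<lambda>r. H r \<omega>) s t n r else 0)"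
    if i: "i < L" and r: "v i < r" "r < v (Suc i)" for i r \<omega>
  proof -
    note ref = simple_process_refine[of L v, OF v i r]
    have a: "\<Xi> i \<omega> = (\<Sum>j<K. if cl (u j) < r \<and> r \<le> cl (u (Suc j)) then \<xi> j \<omega> else 0)
      - (\<Sum>l<n. if ?p l \<le> r \<and> r < ?p (Suc l) then H (?p l) \<omega> else 0)"
    proof -
      have 1: "(cl (u j) \<le> v i \<and> v i < cl (u (Suc j))) \<longleftrightarrow> (cl (u j) < r \<and> r \<le> cl (u (Suc j)))" if "j < K" for j
        using ref(1)[OF _ clU[of j]] ref(3)[OF _ clU[of "Suc j"]] that by auto
      have 2: "(?p l \<le> v i \<and> v i < ?p (Suc l)) \<longleftrightarrow> (?p l \<le> r \<and> r < ?p (Suc l))" if "l < n" for l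
        using ref(2)[OF _ pU[of l]] ref(4)[OF _ pU[of "Suc l"]] that by auto
      show ?thesis unfolding \<Xi>_def by (intro arg_cong2[where f = "(-)"] sum.cong refl) (use 1 2 in auto)
    qed
    have rst: "s < r" "r < t" using vst[of i] vst[of "Suc i"] i r by auto
    have "(cl (u j) < r \<and> r \<le> cl (u (Suc j))) \<longleftrightarrow> (u j < r \<and> r \<le> u (Suc j))" for j
      using rst by (auto simp: cl_def)
    then show ?thesis unfolding a simple_process_def step_function_def using rst
      by (auto simp: indicator_def intro!: sum.cong arg_cong2[where f = "(-)"])
  qed
  have Qle: "ennreal (Q \<omega>) \<le> (\<integral>\<^sup>+r\<in>{s..<t}. ennreal ((norm (simple_process K u \<xi> r \<omega> - step_function (\<lambda>r. H r \<omega>) s t n r))\<^sup>2) \<partial>lborel)" for \<omega>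
  proof -
    have "ennreal (Q \<omega>) = (\<Sum>i<L. ennreal (norm (\<Xi> i \<omega>) ^ 2) * ennreal (v (Suc i) - v i))"
      unfolding Q_def using v by (subst sum_ennreal[symmetric]) (auto intro!: sum.cong mult_nonneg_nonneg simp: less_imp_le ennreal_mult)
    also have "\<dots> = (\<Sum>i<L. \<integral>\<^sup>+r. ennreal (norm (\<Xi> i \<omega>) ^ 2) * indicator {v i<..<v (Suc i)} r \<partial>lborel)"
      by (intro sum.cong refl) (use v in \<open>auto simp: nn_integral_cmult_indicator less_imp_le\<close>)
    also have "\<dots> = (\<integral>\<^sup>+r. (\<Sum>i<L. ennreal (norm (\<Xi> i \<omega>) ^ 2) * indicator {v i<..<v (Suc i)} r) \<partial>lborel)"
      by (intro nn_integral_sum[symmetric]) auto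
    also have "\<dots> \<le> (\<integral>\<^sup>+r\<in>{s..<t}. ennreal ((norm (simple_process K u \<xi> r \<omega> - step_function (\<lambda>r. H r \<omega>) s t n r))\<^sup>2) \<partial>lborel)"
    proof (rule nn_integral_mono)
      fix r :: real
      let ?R = "ennreal ((norm (simple_process K u \<xi> r \<omega> - step_function (\<lambda>r. H r \<omega>) s t n r))\<^sup>2) * indicator {s..<t} r"
      show "(\<Sum>i<L. ennreal (norm (\<Xi> i \<omega>) ^ 2) * indicator {v i<..<v (Suc i)} r) \<le> ?R"
      proof (cases "\<exists>i<L. v i < r \<and> r < v (Suc i)")
        case True
        then obtain i where i: "i < L" "v i < r" "r < v (Suc i)" by auto
        have uniq: "j = i" if "j < L" "v j < r" "r < v (Suc j)" for j
        proof -
          have "v j < v (Suc i)" "v i < v (Suc j)" using that i by auto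
          then have "j < Suc i" "i < Suc j" using strict_steps_less_iff[of L v, OF v] that i by auto
          then show ?thesis by auto
        qed
        have "r \<in> {v j<..<v (Suc j)} \<longleftrightarrow> j = i" if "j < L" for j
          using uniq[OF that] i(2,3) unfolding greaterThanLessThan_iff by blast
        then have "(\<Sum>j<L. ennreal (norm (\<Xi> j \<omega>) ^ 2) * indicator {v j<..<v (Suc j)} r) = (\<Sum>j<L. if j = i then ennreal (norm (\<Xi> i \<omega>) ^ 2) else 0)"
          by (intro sum.cong refl) (simp add: indicator_def)
        also have "\<dots> = ennreal (norm (\<Xi> i \<omega>) ^ 2)" using i by simp
        also have "\<dots> \<le> ?R" using \<Xi>_eq[OF i, of \<omega>] by auto
        finally show ?thesis .
      next
        case False
        then have "(\<Sum>i<L. ennreal (norm (\<Xi> i \<omega>) ^ 2) * indicator {v i<..<v (Suc i)} r) = 0"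
          by (intro sum.neutral) (auto simp: indicator_def)
        then show ?thesis by simp
      qed
    qed
    finally show ?thesis .
  qed
  have diff: "simple_integral W K u \<xi> t \<omega> - simple_integral W K u \<xi> s \<omega> - riemann_sum (\<lambda>r. H r \<omega>) (\<lambda>r. W r \<omega>) s t n
    = (\<Sum>i<L. \<Xi> i \<omega> *v (W (v (Suc i)) \<omega> - W (v i) \<omega>))" for \<omega>
  proof -
    have 1: "simple_integral W K u \<xi> t \<omega> - simple_integral W K u \<xi> s \<omega> = (\<Sum>i<L. (\<Sum>j<K. if cl (u j) \<le> v i \<and> v i < cl (u (Suc j)) then \<xi> j \<omega> else 0) *v (W (v (Suc i)) \<omega> - W (v i) \<omega>))"
    proof -
      have "simple_integral W K u \<xi> t \<omega> - simple_integral W K u \<xi> s \<omega> = (\<Sum>j<K. \<xi> j \<omega> *v (W (cl (u (Suc j))) \<omega> - W (cl (u j)) \<omega>))"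
        unfolding cl_def by (rule simple_integral_diff_eq) (use u st in auto)
      also have "\<dots> = (\<Sum>i<L. (\<Sum>j<K. if cl (u j) \<le> v i \<and> v i < cl (u (Suc j)) then \<xi> j \<omega> else 0) *v (W (v (Suc i)) \<omega> - W (v i) \<omega>))"
      proof (rule refine_sum[of L v K "\<lambda>j. cl (u j)" "\<lambda>j. cl (u (Suc j))" "\<lambda>j. \<xi> j \<omega>" "\<lambda>r. W r \<omega>"])
        fix j assume j: "j < K"
        then have "u j \<le> u (Suc j)" using u(3) by (simp add: less_imp_le)
        then have "cl (u j) \<le> cl (u (Suc j))" unfolding cl_def by (intro max.mono min.mono order_refl)
        then show "cl (u j) \<in> v ` {..L} \<and> cl (u (Suc j)) \<in> v ` {..L} \<and> cl (u j) \<le> cl (u (Suc j))"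
          using clU[of j] clU[of "Suc j"] j by simp
      qed (rule v)
      finally show ?thesis .
    qed
    have 2: "riemann_sum (\<lambda>r. H r \<omega>) (\<lambda>r. W r \<omega>) s t n = (\<Sum>i<L. (\<Sum>l<n. if ?p l \<le> v i \<and> v i < ?p (Suc l) then H (?p l) \<omega> else 0) *v (W (v (Suc i)) \<omega> - W (v i) \<omega>))"
      unfolding riemann_sum_def
    proof (rule refine_sum[of L v n ?p "\<lambda>l. ?p (Suc l)" "\<lambda>l. H (?p l) \<omega>" "\<lambda>r. W r \<omega>"])
      fix l assume "l < n"
      then show "?p l \<in> v ` {..L} \<and> ?p (Suc l) \<in> v ` {..L} \<and> ?p l \<le> ?p (Suc l)"
        using pU[of l] pU[of "Suc l"] up(3)[of l] by (simp add: less_imp_le)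
    qed (rule v)
    show ?thesis unfolding 1 2 \<Xi>_def by (simp add: sum_subtractf matrix_vector_mult_diff_rdistrib)
  qed
  have "v 0 \<ge> 0" using vst[of 0] st by auto
  then have "prob {\<omega> \<in> space M. norm (\<Sum>i<L. \<Xi> i \<omega> *v (W (v (Suc i)) \<omega> - W (v i) \<omega>)) > \<epsilon>}
    \<le> prob {\<omega> \<in> space M. Q \<omega> > \<delta>} + gauss_const TYPE('m) 1 * \<delta> / \<epsilon>\<^sup>2"
    unfolding Q_def by (intro Lenglart_simple_sum v \<Xi>F \<epsilon> \<delta>)
  then show ?thesis using Qm Qle unfolding diff by blast
qed

lemma nn_integral_step_function_tendsto:
  fixes h :: "real \<Rightarrow> 'b::real_normed_vector"
  assumes st: "s < t" and c: "continuous_on {s..t} h" and \<epsilon>: "0 < \<epsilon>"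
  shows "eventually (\<lambda>n. (\<integral>\<^sup>+r\<in>{s..<t}. ennreal ((norm (h r - step_function h s t (Suc n) r))\<^sup>2) \<partial>lborel) \<le> ennreal \<epsilon>) sequentially"
proof -
  \<comment> \<open>Chosen so that \<kappa>^2 times the length of the interval is
    \<epsilon>.\<close>
  define \<kappa> where "\<kappa> = sqrt (\<epsilon> / (t - s))"
  have \<kappa>: "0 < \<kappa>" using \<epsilon> st by (simp add: \<kappa>_def)
  have "uniformly_continuous_on {s..t} h" using c by (intro compact_uniformly_continuous) auto
  then obtain d where d: "d > 0" "\<And>x y. x \<in> {s..t} \<Longrightarrow> y \<in> {s..t} \<Longrightarrow> dist y x < d \<Longrightarrow> dist (h y) (h x) < \<kappa>"
    using \<kappa> unfolding uniformly_continuous_on_def by metis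
  have "(\<lambda>n. (t - s) / real (Suc n)) \<longlonglongrightarrow> 0"
    by (rule LIMSEQ_Suc) (rule lim_const_over_n)
  then have "eventually (\<lambda>n. (t - s) / real (Suc n) < d) sequentially" using d(1) by (rule order_tendstoD)
  then show ?thesis
  proof eventually_elim
    case (elim n)
    have "(\<integral>\<^sup>+r\<in>{s..<t}. ennreal ((norm (h r - step_function h s t (Suc n) r))\<^sup>2) \<partial>lborel) \<le> (\<integral>\<^sup>+r\<in>{s..<t}. ennreal (\<kappa>\<^sup>2) \<partial>lborel)"
    proof (rule nn_integral_mono)
      fix r :: real
      show "ennreal ((norm (h r - step_function h s t (Suc n) r))\<^sup>2) * indicator {s..<t} r \<le> ennreal (\<kappa>\<^sup>2) * indicator {s..<t} r"
      proof (cases "r \<in> {s..<t}")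
        case True
        then obtain l where l: "l < Suc n" "step_function h s t (Suc n) r = h (uniform_point s t (Suc n) l)"
            "\<bar>uniform_point s t (Suc n) l - r\<bar> \<le> (t - s) / real (Suc n)"
          using step_function_eq[OF st, of "Suc n" r h] by auto
        have "dist (h r) (h (uniform_point s t (Suc n) l)) < \<kappa>"
        proof (rule d(2))
          show "uniform_point s t (Suc n) l \<in> {s..t}" using uniform_point_props(4,5)[OF st, of "Suc n" l] l by auto
          show "dist r (uniform_point s t (Suc n) l) < d" using l(3) elim by (simp add: dist_real_def abs_minus_commute)
        qed (use True in auto)
        then have "(norm (h r - step_function h s t (Suc n) r))\<^sup>2 \<le> \<kappa>\<^sup>2" unfolding l by (intro power_mono) (auto simp: dist_norm)
        then show ?thesis using True by (simp add: ennreal_leI)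
      qed simp
    qed
    also have "\<dots> = ennreal (\<kappa>\<^sup>2) * ennreal (t - s)" using st by (simp add: nn_integral_cmult_indicator)
    also have "\<dots> = ennreal \<epsilon>" using \<epsilon> st by (simp add: \<kappa>_def flip: ennreal_mult)
    finally show ?case .
  qed
qed

text \<open>This is the only property of the Ito integral that the proof uses.\<close>

lemma ito_integral_riemann:
  fixes H :: "real \<Rightarrow> 'a \<Rightarrow> real^'m^'d"
  assumes ito: "is_ito_integral M F W T H I"
    and HF: "\<And>r. r \<in> {0..T} \<Longrightarrow> H r \<in> borel_measurable (F r)"
    and Hc: "\<And>\<omega>. \<omega> \<in> space M \<Longrightarrow> continuous_on {0..T} (\<lambda>r. H r \<omega>)"
    and st: "0 \<le> s" "s < t" "t \<le> T"
  shows "conv_prob M (\<lambda>n \<omega>. riemann_sum (\<lambda>r. H r \<omega>) (\<lambda>r. W r \<omega>) s t (Suc n)) (\<lambda>\<omega>. I t \<omega> - I s \<omega>)"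
  unfolding conv_prob_def
proof (intro allI impI)
  fix \<epsilon> :: real assume \<epsilon>: "\<epsilon> > 0"
  have T: "0 < T" using st by auto
  from ito obtain K u \<xi> where IF: "\<And>t. t \<in> {0..T} \<Longrightarrow> I t \<in> borel_measurable (F t)"
    and Ic: "\<And>\<omega>. \<omega> \<in> space M \<Longrightarrow> continuous_on {0..T} (\<lambda>t. I t \<omega>)"
    and data: "\<And>q. simple_process_data M F T (K q) (u q) (\<xi> q)"
    and L2: "tendsto_zero_in_prob M (\<lambda>q \<omega>. \<integral>\<^sup>+s\<in>{0..T}. ennreal ((norm (simple_process (K q) (u q) (\<xi> q) s \<omega> - H s \<omega>))\<^sup>2) \<partial>lborel)"
    and SI: "tendsto_zero_in_prob M (\<lambda>q \<omega>. SUP t\<in>{0..T}. ennreal (norm (simple_integral W (K q) (u q) (\<xi> q) t \<omega> - I t \<omega>)))"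
    unfolding is_ito_integral_def by blast
  have IM[measurable]: "t \<in> {0..T} \<Longrightarrow> I t \<in> borel_measurable M" for t using IF F_measurable_M by auto
  \<comment> \<open>\<open>H\<close> is controlled on [0, T] only; composing it with the clamp gives
    a process with continuous paths on the whole line, hence a jointly measurable one, without
    changing the integrals below.\<close>
  define cl where "cl r = max 0 (min T r)" for r :: real
  have cl: "cl r \<in> {0..T}" for r using T by (auto simp: cl_def)
  have cl_id: "cl r = r" if "r \<in> {0..T}" for r using that by (auto simp: cl_def)
  have HM: "r \<in> {0..T} \<Longrightarrow> H r \<in> borel_measurable M" for r using HF F_measurable_M by auto
  have Hj[measurable]: "(\<lambda>(r, \<omega>). H (cl r) \<omega>) \<in> borel_measurable (borel \<Otimes>\<^sub>M M)"
  proof (rule continuous_process_measurable)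
    show "H (cl r) \<in> borel_measurable M" for r using HM cl by auto
    show "continuous_on UNIV (\<lambda>t. H (cl t) \<omega>)" if "\<omega> \<in> space M" for \<omega>
      by (rule continuous_on_compose2[OF Hc[OF that]]) (use cl in \<open>auto simp: cl_def intro!: continuous_intros\<close>)
  qed
  have uT: "0 \<le> u q j \<and> u q j \<le> T" if "j \<le> K q" for q j
  proof -
    have "u q 0 = 0" "u q (K q) = T" "\<And>i. i < K q \<Longrightarrow> u q i < u q (Suc i)" using data by (auto simp: simple_process_data_def)
    then show ?thesis using strict_steps_less_iff[of "K q" "u q" j 0] strict_steps_less_iff[of "K q" "u q" "K q" j] that by auto
  qed
  have \<xi>M[measurable]: "\<xi> q j \<in> borel_measurable M" if "j < K q" for q j
    using data[of q] F_measurable_M[of "u q j" "\<xi> q j" borel] uT[of j q] that by (auto simp: simple_process_data_def)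
  have Sj: "(\<lambda>(r, \<omega>). simple_process (K q) (u q) (\<xi> q) r \<omega>) \<in> borel_measurable (borel \<Otimes>\<^sub>M M)" for q
    unfolding simple_process_def split_beta'
    by (rule borel_measurable_sum) (intro borel_measurable_scaleR borel_measurable_indicator' , auto intro: measurable_compose[OF measurable_snd \<xi>M])
  define A where "A q \<omega> = (\<integral>\<^sup>+s\<in>{0..T}. ennreal ((norm (simple_process (K q) (u q) (\<xi> q) s \<omega> - H s \<omega>))\<^sup>2) \<partial>lborel)" for q \<omega>
  define B where "B n \<omega> = (\<integral>\<^sup>+r\<in>{s..<t}. ennreal ((norm (H r \<omega> - step_function (\<lambda>r. H r \<omega>) s t (Suc n) r))\<^sup>2) \<partial>lborel)" for n \<omega>
  have Am[measurable]: "A q \<in> borel_measurable M" for q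
  proof -
    have "A q = (\<lambda>\<omega>. \<integral>\<^sup>+s\<in>{0..T}. ennreal ((norm (simple_process (K q) (u q) (\<xi> q) s \<omega> - H (cl s) \<omega>))\<^sup>2) \<partial>lborel)"
      unfolding A_def by (intro ext nn_integral_cong) (auto simp: indicator_def cl_id)
    also have "\<dots> \<in> borel_measurable M" using Sj[of q] by measurable
    finally show ?thesis .
  qed
  have Bm[measurable]: "B n \<in> borel_measurable M" for n
  proof -
    have p: "uniform_point s t (Suc n) l \<in> {0..T}" if "l < Suc n" for l
      using uniform_point_props(4,5)[OF st(2), of "Suc n" l] that st by auto
    have [measurable]: "(\<lambda>(r, \<omega>). step_function (\<lambda>r. H r \<omega>) s t (Suc n) r) \<in> borel_measurable (borel \<Otimes>\<^sub>M M)"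
      unfolding step_function_def split_beta'
    proof (rule borel_measurable_sum)
      fix l assume "l \<in> {..<Suc n}"
      then have [measurable]: "H (uniform_point s t (Suc n) l) \<in> borel_measurable M" using HM p by auto
      show "(\<lambda>x. if uniform_point s t (Suc n) l \<le> fst x \<and> fst x < uniform_point s t (Suc n) (Suc l) then H (uniform_point s t (Suc n) l) (snd x) else 0) \<in> borel_measurable (borel \<Otimes>\<^sub>M M)"
        by measurable
    qed
    have "B n = (\<lambda>\<omega>. \<integral>\<^sup>+r\<in>{s..<t}. ennreal ((norm (H (cl r) \<omega> - step_function (\<lambda>r. H r \<omega>) s t (Suc n) r))\<^sup>2) \<partial>lborel)"
      unfolding B_def using st by (intro ext nn_integral_cong) (auto simp: indicator_def cl_id)
    also have "\<dots> \<in> borel_measurable M" by measurable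
    finally show ?thesis .
  qed
  define c where "c = gauss_const TYPE('m) 1"
  have c0: "0 < c" unfolding c_def by (rule gauss_const_pos)
  show "(\<lambda>n. prob {\<omega> \<in> space M. norm (riemann_sum (\<lambda>r. H r \<omega>) (\<lambda>r. W r \<omega>) s t (Suc n) - (I t \<omega> - I s \<omega>)) > \<epsilon>}) \<longlonglongrightarrow> 0"
  proof (rule tendstoI, unfold dist_real_def)
    fix \<eta> :: real assume \<eta>: "0 < \<eta>"
    \<comment> \<open>Makes the last term of \<open>simple_minus_riemann\<close> equal to
      \<open>\<eta> / 5\<close>. Three further events get \<open>\<eta> / 5\<close> each:
      \<open>A q\<close> or \<open>B n\<close> above \<open>\<delta> / 4\<close>, where their
      doubled sum could exceed \<delta>, and a uniform error of the simple integral above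
      \<open>\<epsilon> / 4\<close>, which is met at both \<open>s\<close> and
      \<open>t\<close>.\<close>
    define \<delta> where "\<delta> = \<eta> / 5 * (\<epsilon> / 2)\<^sup>2 / c"
    have \<delta>: "0 < \<delta>" using \<eta> \<epsilon> c0 by (simp add: \<delta>_def)
    have \<delta>c: "c * \<delta> / (\<epsilon> / 2)\<^sup>2 = \<eta> / 5" using c0 \<epsilon> by (simp add: \<delta>_def)
    have "(\<lambda>q. prob {\<omega> \<in> space M. A q \<omega> > ennreal (\<delta> / 4)}) \<longlonglongrightarrow> 0"
      using L2 \<delta> unfolding tendsto_zero_in_prob_def A_def by simp
    moreover have "(\<lambda>q. prob {\<omega> \<in> space M. (SUP t\<in>{0..T}. ennreal (norm (simple_integral W (K q) (u q) (\<xi> q) t \<omega> - I t \<omega>))) > ennreal (\<epsilon> / 4)}) \<longlonglongrightarrow> 0"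
      using SI \<epsilon> unfolding tendsto_zero_in_prob_def by simp
    ultimately have "eventually (\<lambda>q. prob {\<omega> \<in> space M. A q \<omega> > ennreal (\<delta> / 4)} < \<eta> / 5 \<and>
       prob {\<omega> \<in> space M. (SUP t\<in>{0..T}. ennreal (norm (simple_integral W (K q) (u q) (\<xi> q) t \<omega> - I t \<omega>))) > ennreal (\<epsilon> / 4)} < \<eta> / 5) sequentially"
      using \<eta> by (intro eventually_conj order_tendstoD) auto
    \<comment> \<open>One simple process is fixed before the mesh of the Riemann sums tends to 0, so
      the two approximations need not be coordinated.\<close>
    then obtain q where q1: "prob {\<omega> \<in> space M. A q \<omega> > ennreal (\<delta> / 4)} < \<eta> / 5"
      and q2: "prob {\<omega> \<in> space M. (SUP t\<in>{0..T}. ennreal (norm (simple_integral W (K q) (u q) (\<xi> q) t \<omega> - I t \<omega>))) > ennreal (\<epsilon> / 4)} < \<eta> / 5"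
      by (auto simp: eventually_sequentially)
    define S where "S t \<omega> = simple_integral W (K q) (u q) (\<xi> q) t \<omega>" for t \<omega>
    define E where "E = {\<omega> \<in> space M. (SUP t\<in>{0..T}. ennreal (norm (S t \<omega> - I t \<omega>))) > ennreal (\<epsilon> / 4)}"
    have SM: "S t \<in> borel_measurable M" if "t \<in> {0..T}" for t
      unfolding S_def simple_integral_def
    proof (rule borel_measurable_sum)
      fix j assume j: "j \<in> {..<K q}"
      have [measurable]: "W (min t (u q (Suc j))) \<in> borel_measurable M" "W (min t (u q j)) \<in> borel_measurable M"
        using uT[of j q] uT[of "Suc j" q] j that by (auto intro!: W_measurable)
      show "(\<lambda>\<omega>. \<xi> q j \<omega> *v (W (min t (u q (Suc j))) \<omega> - W (min t (u q j)) \<omega>)) \<in> borel_measurable M"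
        by (intro mult_vec_measurable borel_measurable_diff \<xi>M) (use j in auto)
    qed
    have E[measurable]: "E \<in> sets M"
      unfolding E_def
    proof (rule sup_event_measurable[OF T])
      show "(\<lambda>\<omega>. S t \<omega> - I t \<omega>) \<in> borel_measurable M" if "t \<in> {0..T}" for t using SM[OF that] IM[OF that] by measurable
      show "AE \<omega> in M. continuous_on {0..T} (\<lambda>t. S t \<omega> - I t \<omega>)"
        using W_cont AE_space
      proof eventually_elim
        case (elim \<omega>)
        have "continuous_on {0..T} (\<lambda>t. W (min t (u q j)) \<omega>)" if "j \<le> K q" for j
          by (rule continuous_on_compose2[OF elim(1)]) (use uT[OF that] in \<open>auto intro!: continuous_intros\<close>)
        then have "continuous_on {0..T} (\<lambda>t. \<xi> q j \<omega> *v (W (min t (u q (Suc j))) \<omega> - W (min t (u q j)) \<omega>))" if "j < K q" for j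
          using that by (intro bounded_linear.continuous_on[OF matrix_vector_mul_bounded_linear] continuous_on_diff) auto
        then show ?case unfolding S_def simple_integral_def
          by (intro continuous_on_diff continuous_on_sum Ic[OF elim(2)]) auto
      qed
    qed (use \<epsilon> in auto)
    have "(\<lambda>n. prob {\<omega> \<in> space M. B n \<omega> > ennreal (\<delta> / 4)}) \<longlonglongrightarrow> 0"
    proof (rule measure_tendsto_zero)
      fix \<omega> assume "\<omega> \<in> space M"
      then have "continuous_on {s..t} (\<lambda>r. H r \<omega>)" using st by (intro continuous_on_subset[OF Hc]) auto
      from nn_integral_step_function_tendsto[OF st(2) this, of "\<delta> / 4"]
      show "eventually (\<lambda>n. \<omega> \<notin> {\<omega> \<in> space M. B n \<omega> > ennreal (\<delta> / 4)}) sequentially"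
        using \<delta> by (auto simp: B_def not_less elim!: eventually_mono)
    qed measurable
    then have "eventually (\<lambda>n. prob {\<omega> \<in> space M. B n \<omega> > ennreal (\<delta> / 4)} < \<eta> / 5) sequentially"
      using \<eta> by (intro order_tendstoD) auto
    then show "eventually (\<lambda>n. \<bar>prob {\<omega> \<in> space M. norm (riemann_sum (\<lambda>r. H r \<omega>) (\<lambda>r. W r \<omega>) s t (Suc n) - (I t \<omega> - I s \<omega>)) > \<epsilon>} - 0\<bar> < \<eta>) sequentially"
    proof eventually_elim
      case (elim n)
      define R where "R \<omega> = riemann_sum (\<lambda>r. H r \<omega>) (\<lambda>r. W r \<omega>) s t (Suc n)" for \<omega>
      have RM[measurable]: "R \<in> borel_measurable M"
        unfolding R_def riemann_sum_def
      proof (rule borel_measurable_sum)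
        fix l assume l: "l \<in> {..<Suc n}"
        have "uniform_point s t (Suc n) l \<in> {0..T}" "uniform_point s t (Suc n) (Suc l) \<in> {0..T}"
          using uniform_point_props(4,5)[OF st(2), of "Suc n" l] uniform_point_props(4,5)[OF st(2), of "Suc n" "Suc l"] l st by auto
        then have [measurable]: "H (uniform_point s t (Suc n) l) \<in> borel_measurable M" "W (uniform_point s t (Suc n) l) \<in> borel_measurable M"
          "W (uniform_point s t (Suc n) (Suc l)) \<in> borel_measurable M" using HM W_measurable by auto
        show "(\<lambda>\<omega>. H (uniform_point s t (Suc n) l) \<omega> *v (W (uniform_point s t (Suc n) (Suc l)) \<omega> - W (uniform_point s t (Suc n) l) \<omega>)) \<in> borel_measurable M"
          by measurable
      qed
      obtain Q where Q[measurable]: "Q \<in> borel_measurable M"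
        and Qle: "\<And>\<omega>. ennreal (Q \<omega>) \<le> (\<integral>\<^sup>+r\<in>{s..<t}. ennreal ((norm (simple_process (K q) (u q) (\<xi> q) r \<omega> - step_function (\<lambda>r. H r \<omega>) s t (Suc n) r))\<^sup>2) \<partial>lborel)"
        and QP: "prob {\<omega> \<in> space M. norm (S t \<omega> - S s \<omega> - R \<omega>) > \<epsilon> / 2} \<le> prob {\<omega> \<in> space M. Q \<omega> > \<delta>} + c * \<delta> / (\<epsilon> / 2)\<^sup>2"
        using simple_minus_riemann[OF data[of q] st, of "Suc n" H "\<epsilon> / 2" \<delta>, OF _ HF] \<epsilon> \<delta>
        unfolding S_def R_def c_def by auto
      have QAB: "ennreal (Q \<omega>) \<le> 2 * A q \<omega> + 2 * B n \<omega>" if w: "\<omega> \<in> space M" for \<omega>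
      proof -
        define f1 where "f1 r = ennreal ((norm (simple_process (K q) (u q) (\<xi> q) r \<omega> - H (cl r) \<omega>))\<^sup>2) * indicator {0..T} r" for r
        define f2 where "f2 r = ennreal ((norm (H (cl r) \<omega> - step_function (\<lambda>r. H r \<omega>) s t (Suc n) r))\<^sup>2) * indicator {s..<t} r" for r
        have [measurable]: "(\<lambda>r. H (cl r) \<omega>) \<in> borel_measurable borel" using measurable_compose[OF measurable_Pair2'[OF w] Hj] by simp
        have [measurable]: "(\<lambda>r. simple_process (K q) (u q) (\<xi> q) r \<omega>) \<in> borel_measurable borel" using measurable_compose[OF measurable_Pair2'[OF w] Sj] by simp
        have [measurable]: "f1 \<in> borel_measurable borel" unfolding f1_def by measurable
        have [measurable]: "f2 \<in> borel_measurable borel" unfolding f2_def step_function_def by measurable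
        have "(\<integral>\<^sup>+r\<in>{s..<t}. ennreal ((norm (simple_process (K q) (u q) (\<xi> q) r \<omega> - step_function (\<lambda>r. H r \<omega>) s t (Suc n) r))\<^sup>2) \<partial>lborel)
          \<le> (\<integral>\<^sup>+r. 2 * f1 r + 2 * f2 r \<partial>lborel)"
        proof (rule nn_integral_mono)
          fix r :: real
          have tri: "(norm (a - b))\<^sup>2 \<le> 2 * (norm (a - h))\<^sup>2 + 2 * (norm (h - b))\<^sup>2" for a b h :: "real^'m^'d"
          proof -
            have "(norm (a - b))\<^sup>2 \<le> (norm (a - h) + norm (h - b))\<^sup>2" by (intro power_mono) (auto intro: norm_triangle_sub order_trans[OF _ norm_triangle_ineq])
            also have "\<dots> \<le> 2 * (norm (a - h))\<^sup>2 + 2 * (norm (h - b))\<^sup>2" using sum_squares_bound[of "norm (a - h)" "norm (h - b)"] by (simp add: power2_sum)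
            finally show ?thesis .
          qed
          show "ennreal ((norm (simple_process (K q) (u q) (\<xi> q) r \<omega> - step_function (\<lambda>r. H r \<omega>) s t (Suc n) r))\<^sup>2) * indicator {s..<t} r \<le> 2 * f1 r + 2 * f2 r"
          proof (cases "r \<in> {s..<t}")
            case True
            then have "r \<in> {0..T}" using st by auto
            have "ennreal ((norm (simple_process (K q) (u q) (\<xi> q) r \<omega> - step_function (\<lambda>r. H r \<omega>) s t (Suc n) r))\<^sup>2)
              \<le> ennreal (2 * (norm (simple_process (K q) (u q) (\<xi> q) r \<omega> - H (cl r) \<omega>))\<^sup>2 + 2 * (norm (H (cl r) \<omega> - step_function (\<lambda>r. H r \<omega>) s t (Suc n) r))\<^sup>2)"
              by (intro ennreal_leI tri)
            also have "\<dots> = 2 * f1 r + 2 * f2 r" using True \<open>r \<in> {0..T}\<close> by (simp add: f1_def f2_def ennreal_mult)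
            finally show ?thesis using True by simp
          qed simp
        qed
        also have "\<dots> = 2 * (\<integral>\<^sup>+r. f1 r \<partial>lborel) + 2 * (\<integral>\<^sup>+r. f2 r \<partial>lborel)"
          by (simp add: nn_integral_add nn_integral_cmult)
        also have "(\<integral>\<^sup>+r. f1 r \<partial>lborel) = A q \<omega>" unfolding A_def f1_def by (intro nn_integral_cong) (auto simp: indicator_def cl_id)
        also have "(\<integral>\<^sup>+r. f2 r \<partial>lborel) = B n \<omega>" unfolding B_def f2_def using st by (intro nn_integral_cong) (auto simp: indicator_def cl_id)
        finally show ?thesis using Qle[of \<omega>] by (rule order_trans[rotated])
      qed
      have "prob {\<omega> \<in> space M. Q \<omega> > \<delta>} \<le> prob ({\<omega> \<in> space M. A q \<omega> > ennreal (\<delta> / 4)} \<union> {\<omega> \<in> space M. B n \<omega> > ennreal (\<delta> / 4)})"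
      proof (rule finite_measure_mono, rule subsetI, rule ccontr)
        fix \<omega> assume w: "\<omega> \<in> {\<omega> \<in> space M. Q \<omega> > \<delta>}" and "\<omega> \<notin> {\<omega> \<in> space M. A q \<omega> > ennreal (\<delta> / 4)} \<union> {\<omega> \<in> space M. B n \<omega> > ennreal (\<delta> / 4)}"
        then have "A q \<omega> \<le> ennreal (\<delta> / 4)" "B n \<omega> \<le> ennreal (\<delta> / 4)" by auto
        then have "2 * A q \<omega> + 2 * B n \<omega> \<le> 2 * ennreal (\<delta> / 4) + 2 * ennreal (\<delta> / 4)" by (intro add_mono mult_left_mono) auto
        also have "\<dots> = ennreal (2 * (\<delta> / 4)) + ennreal (2 * (\<delta> / 4))"
        proof -
          have "2 * ennreal (\<delta> / 4) = ennreal (2 * (\<delta> / 4))" using \<delta> by (subst ennreal_mult) auto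
          then show ?thesis by (rule arg_cong)
        qed
        also have "\<dots> = ennreal (2 * (\<delta> / 4) + 2 * (\<delta> / 4))" using \<delta> by (intro ennreal_plus[symmetric]) auto
        also have "\<dots> = ennreal \<delta>" by simp
        finally have "2 * A q \<omega> + 2 * B n \<omega> \<le> ennreal \<delta>" .
        with QAB[of \<omega>] w have "ennreal (Q \<omega>) \<le> ennreal \<delta>" by (metis (mono_tags, lifting) mem_Collect_eq order_trans)
        then show False using w \<delta> by (auto simp: ennreal_le_iff)
      qed measurable
      also have "\<dots> \<le> prob {\<omega> \<in> space M. A q \<omega> > ennreal (\<delta> / 4)} + prob {\<omega> \<in> space M. B n \<omega> > ennreal (\<delta> / 4)}"
        by (rule measure_Un_le) measurable
      finally have P1: "prob {\<omega> \<in> space M. norm (S t \<omega> - S s \<omega> - R \<omega>) > \<epsilon> / 2} < 3 * (\<eta> / 5)"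
        using QP[unfolded \<delta>c] q1 elim by linarith
      have [measurable]: "I t \<in> borel_measurable M" "I s \<in> borel_measurable M" "S t \<in> borel_measurable M" "S s \<in> borel_measurable M"
        using IM SM st by auto
      have "prob {\<omega> \<in> space M. norm (R \<omega> - (I t \<omega> - I s \<omega>)) > \<epsilon>} \<le> prob (E \<union> {\<omega> \<in> space M. norm (S t \<omega> - S s \<omega> - R \<omega>) > \<epsilon> / 2})"
      proof (rule finite_measure_mono, rule subsetI, rule ccontr)
        fix \<omega> assume w: "\<omega> \<in> {\<omega> \<in> space M. norm (R \<omega> - (I t \<omega> - I s \<omega>)) > \<epsilon>}" and n: "\<omega> \<notin> E \<union> {\<omega> \<in> space M. norm (S t \<omega> - S s \<omega> - R \<omega>) > \<epsilon> / 2}"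
        have *: "norm (S x \<omega> - I x \<omega>) \<le> \<epsilon> / 4" if "x \<in> {0..T}" for x
        proof -
          have "ennreal (norm (S x \<omega> - I x \<omega>)) \<le> (SUP t\<in>{0..T}. ennreal (norm (S t \<omega> - I t \<omega>)))" by (rule SUP_upper2[OF that order_refl])
          also have "\<dots> \<le> ennreal (\<epsilon> / 4)" using n w by (auto simp: E_def not_less)
          finally show ?thesis using \<epsilon> by (simp add: ennreal_le_iff)
        qed
        have "norm (S t \<omega> - S s \<omega> - R \<omega>) \<le> \<epsilon> / 2" using n w by auto
        moreover have e: "R \<omega> - (I t \<omega> - I s \<omega>) = (S t \<omega> - I t \<omega>) - (S s \<omega> - I s \<omega>) - (S t \<omega> - S s \<omega> - R \<omega>)" by simp
        have "norm (R \<omega> - (I t \<omega> - I s \<omega>)) \<le> norm (S t \<omega> - I t \<omega>) + norm (S s \<omega> - I s \<omega>) + norm (S t \<omega> - S s \<omega> - R \<omega>)"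
          unfolding e using norm_triangle_ineq4[of "S t \<omega> - I t \<omega> - (S s \<omega> - I s \<omega>)" "S t \<omega> - S s \<omega> - R \<omega>"]
            norm_triangle_ineq4[of "S t \<omega> - I t \<omega>" "S s \<omega> - I s \<omega>"] by linarith
        moreover have "norm (S t \<omega> - I t \<omega>) \<le> \<epsilon> / 4" "norm (S s \<omega> - I s \<omega>) \<le> \<epsilon> / 4" by (rule *, use st in simp)+
        moreover have "norm (R \<omega> - (I t \<omega> - I s \<omega>)) > \<epsilon>" using w by simp
        ultimately show False by linarith
      qed measurable
      also have "\<dots> \<le> prob E + prob {\<omega> \<in> space M. norm (S t \<omega> - S s \<omega> - R \<omega>) > \<epsilon> / 2}"
        by (rule measure_Un_le) measurable
      also have "\<dots> < \<eta>" using P1 q2 \<eta> by (simp add: E_def S_def)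
      finally show ?case by (simp add: R_def)
    qed
  qed
qed

end

text \<open>Jensen's inequality in time followed by Tonelli's theorem. The bound
  \<open>\<beta>\<close> may vary with time, which the exponentially weighted estimates of the
  solution use.\<close>

lemma (in prob_space) Ebd_time_integral:
  fixes Y :: "real \<Rightarrow> 'a \<Rightarrow> real"
  assumes ab: "a \<le> b" and Y[measurable]: "(\<lambda>(u, \<omega>). Y u \<omega>) \<in> borel_measurable (borel \<Otimes>\<^sub>M M)"
    and Y0: "\<And>u \<omega>. 0 \<le> Y u \<omega>" and int: "\<And>\<omega>. \<omega> \<in> space M \<Longrightarrow> set_integrable lborel {a..b} (\<lambda>u. Y u \<omega>)"
    and E: "\<And>u. u \<in> {a..b} \<Longrightarrow> Ebd M (\<lambda>\<omega>. Y u \<omega> ^ p) (\<beta> u)"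
    and B: "(\<integral>\<^sup>+u\<in>{a..b}. ennreal (\<beta> u) \<partial>lborel) \<le> ennreal B" "0 \<le> B" and p: "1 \<le> p"
  shows "Ebd M (\<lambda>\<omega>. (LINT u:{a..b}|lborel. Y u \<omega>) ^ p) ((b - a) ^ (p - 1) * B)"
proof -
  interpret L: sigma_finite_measure "lborel :: real measure" ..
  interpret PS: pair_sigma_finite M "lborel :: real measure" ..
  have [measurable]: "(\<lambda>\<omega>. LINT u:{a..b}|lborel. Y u \<omega>) \<in> borel_measurable M"
    unfolding set_lebesgue_integral_def by measurable
  have nn: "0 \<le> (LINT u:{a..b}|lborel. Y u \<omega>)" for \<omega>
    unfolding set_lebesgue_integral_def by (intro Bochner_Integration.integral_nonneg) (auto simp: Y0)
  have pt: "ennreal ((LINT u:{a..b}|lborel. Y u \<omega>) ^ p) \<le> ennreal ((b - a) ^ (p - 1)) * (\<integral>\<^sup>+u. ennreal (Y u \<omega> ^ p) * indicator {a..b} u \<partial>lborel)"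
    if w: "\<omega> \<in> space M" for \<omega>
  proof -
    let ?\<mu> = "restrict_space lborel {a..b}"
    have [measurable]: "(\<lambda>u. Y u \<omega>) \<in> borel_measurable borel" using measurable_compose[OF measurable_Pair2'[OF w] Y] by simp
    have "ennreal ((\<integral>u. Y u \<omega> \<partial>?\<mu>) ^ p) \<le> ennreal ((b - a) ^ (p - 1)) * (\<integral>\<^sup>+u. ennreal (Y u \<omega> ^ p) \<partial>?\<mu>)"
    proof (rule nn_integral_power_le)
      show "(\<lambda>u. Y u \<omega>) \<in> borel_measurable ?\<mu>" by (intro measurable_restrict_space1) simp
      show "integrable ?\<mu> (\<lambda>u. Y u \<omega>)" using int[OF w] by (simp add: integrable_restrict_space set_integrable_def)
    qed (use ab p Y0 in \<open>auto simp: emeasure_restrict_space space_restrict_space\<close>)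
    then show ?thesis by (simp add: integral_restrict_space nn_integral_restrict_space set_lebesgue_integral_def)
  qed
  have "(\<integral>\<^sup>+\<omega>. ennreal ((LINT u:{a..b}|lborel. Y u \<omega>) ^ p) \<partial>M)
    \<le> (\<integral>\<^sup>+\<omega>. ennreal ((b - a) ^ (p - 1)) * (\<integral>\<^sup>+u. ennreal (Y u \<omega> ^ p) * indicator {a..b} u \<partial>lborel) \<partial>M)"
    by (intro nn_integral_mono pt)
  also have "\<dots> = ennreal ((b - a) ^ (p - 1)) * (\<integral>\<^sup>+\<omega>. (\<integral>\<^sup>+u. ennreal (Y u \<omega> ^ p) * indicator {a..b} u \<partial>lborel) \<partial>M)"
    by (rule nn_integral_cmult) measurable
  also have "(\<integral>\<^sup>+\<omega>. (\<integral>\<^sup>+u. ennreal (Y u \<omega> ^ p) * indicator {a..b} u \<partial>lborel) \<partial>M)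
     = (\<integral>\<^sup>+u. (\<integral>\<^sup>+\<omega>. ennreal (Y u \<omega> ^ p) * indicator {a..b} u \<partial>M) \<partial>lborel)"
    by (rule PS.Fubini'[symmetric]) measurable
  also have "\<dots> \<le> (\<integral>\<^sup>+u\<in>{a..b}. ennreal (\<beta> u) \<partial>lborel)"
  proof (rule nn_integral_mono)
    fix u :: real
    show "(\<integral>\<^sup>+\<omega>. ennreal (Y u \<omega> ^ p) * indicator {a..b} u \<partial>M) \<le> ennreal (\<beta> u) * indicator {a..b} u"
    proof (cases "u \<in> {a..b}")
      case True
      note e = EbdD[OF E[OF True]]
      have "(\<integral>\<^sup>+\<omega>. ennreal (Y u \<omega> ^ p) \<partial>M) \<le> ennreal (\<beta> u)"
        using E[OF True] e by (subst Ebd_nn_integral[symmetric]) auto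
      then show ?thesis using True by simp
    qed simp
  qed
  also have "\<dots> \<le> ennreal B" by (rule B)
  finally have "(\<integral>\<^sup>+\<omega>. ennreal ((LINT u:{a..b}|lborel. Y u \<omega>) ^ p) \<partial>M) \<le> ennreal ((b - a) ^ (p - 1)) * ennreal B"
    by (simp add: mult_left_mono)
  then show ?thesis using ab B nn by (subst Ebd_nn_integral) (auto simp: ennreal_mult)
qed

context wiener_space
begin

text \<open>What the estimates of stochastic sums need from a filtration. It is satisfied by
  \<open>F\<close>, for the solution, and by the enlargement of \<open>F\<close> by the sampling
  points, for the scheme.\<close>

definition wiener_filtration :: "(real \<Rightarrow> 'a measure) \<Rightarrow> bool" where
  "wiener_filtration G \<longleftrightarrow> (\<forall>u\<ge>0. W u \<in> borel_measurable (G u)) \<and>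
     (\<forall>u v. 0 \<le> u \<longrightarrow> u \<le> v \<longrightarrow> subalgebra (G v) (G u)) \<and>
     (\<forall>u v. 0 \<le> u \<longrightarrow> u < v \<longrightarrow> indep_of M (G u) (\<lambda>\<omega>. W v \<omega> - W u \<omega>))"

lemma wiener_filtration_F: "wiener_filtration F"
  using W_adapted filt W_indep by (auto simp: wiener_filtration_def)

text \<open>A cell has length (b - a) / n, so its Wiener increment has a 2r-th moment of the order
  n^-r that \<open>martingale_moment\<close> asks for. \<open>K\<close> may be smaller than
  \<open>n\<close>, because the noise error is later estimated up to an intermediate grid
  point.\<close>

lemma wiener_sum_moment:
  assumes r: "1 \<le> r"
  shows "\<exists>C>0. \<forall>G a b n K (Y :: nat \<Rightarrow> 'a \<Rightarrow> real^'m^'d) B.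
    wiener_filtration G \<longrightarrow> 0 \<le> a \<longrightarrow> a < b \<longrightarrow> 0 < n \<longrightarrow> K \<le> n \<longrightarrow>
    (\<forall>l<K. Y l \<in> borel_measurable (G (uniform_point a b n l))) \<longrightarrow>
    (\<forall>l<K. Ebd M (\<lambda>\<omega>. norm (Y l \<omega>) ^ (2 * r)) (B l)) \<longrightarrow>
    Ebd M (\<lambda>\<omega>. running_max (\<lambda>k. norm (\<Sum>l<k. Y l \<omega> *v
      (W (uniform_point a b n (Suc l)) \<omega> - W (uniform_point a b n l) \<omega>))) K ^ (2 * r)) (C * (b - a) ^ r * (\<Sum>l<K. B l) / n)"
proof -
  let ?c = "gauss_const TYPE('m) r"
  have c0: "0 < ?c" by (rule gauss_const_pos)
  obtain C where C: "C > 0" and mm: "\<And>n K (D :: nat \<Rightarrow> 'a \<Rightarrow> real^'d) G B. 0 < n \<Longrightarrow> K \<le> n \<Longrightarrow>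
    (\<forall>i<K. mart_diff M (G i) (D i)) \<Longrightarrow> (\<forall>i<K. \<forall>l<i. D l \<in> borel_measurable (G i)) \<Longrightarrow>
    (\<forall>i<K. Ebd M (\<lambda>\<omega>. norm (D i \<omega>) ^ (2 * r)) (B i / real n ^ r)) \<Longrightarrow>
    Ebd M (\<lambda>\<omega>. running_max (\<lambda>k. norm (\<Sum>i<k. D i \<omega>)) K ^ (2 * r)) (C * (\<Sum>i<K. B i) / real n)"
    using martingale_moment[OF r, where 'b = "real^'d"] by blast
  have main: "Ebd M (\<lambda>\<omega>. running_max (\<lambda>k. norm (\<Sum>l<k. Y l \<omega> *v
      (W (uniform_point a b n (Suc l)) \<omega> - W (uniform_point a b n l) \<omega>))) K ^ (2 * r)) (C * ?c * (b - a) ^ r * (\<Sum>l<K. B l) / n)"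
    if G: "wiener_filtration G" and ab: "0 \<le> a" "a < b" and n: "0 < n" and K: "K \<le> n"
      and Y: "\<forall>l<K. Y l \<in> borel_measurable (G (uniform_point a b n l))"
      and B: "\<forall>l<K. Ebd M (\<lambda>\<omega>. norm (Y l \<omega>) ^ (2 * r)) (B l)"
    for G a b n K B and Y :: "nat \<Rightarrow> 'a \<Rightarrow> real^'m^'d"
  proof -
    let ?u = "uniform_point a b n"
    note up = uniform_point_props[OF ab(2) n]
    define D where "D l \<omega> = Y l \<omega> *v (W (?u (Suc l)) \<omega> - W (?u l) \<omega>)" for l \<omega>
    have u0: "0 \<le> ?u l" for l using ab by (simp add: uniform_point_def)
    have umono: "?u l \<le> ?u i" if "l \<le> i" for l i using that ab n
      by (auto simp: uniform_point_def intro!: divide_right_mono mult_right_mono)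
    have ind: "indep_of M (G (?u l)) (\<lambda>\<omega>. W (?u (Suc l)) \<omega> - W (?u l) \<omega>)" for l
      using G u0 up(3) unfolding wiener_filtration_def by blast
    have Wm: "W v \<in> borel_measurable (G v)" if "0 \<le> v" for v using G that unfolding wiener_filtration_def by blast
    have mono: "subalgebra (G v) (G u)" if "0 \<le> u" "u \<le> v" for u v using G that unfolding wiener_filtration_def by blast
    have md: "\<forall>i<K. mart_diff M (G (?u i)) (D i)"
      unfolding D_def using mart_diff_increment[OF u0 up(3) ind] Y by blast
    have ad: "\<forall>i<K. \<forall>l<i. D l \<in> borel_measurable (G (?u i))"
    proof (intro allI impI)
      fix i l assume il: "i < K" "l < i"
      have sub: "subalgebra (G (?u i)) (G (?u k))" if "k \<le> i" for k by (rule mono[OF u0 umono[OF that]])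
      have [measurable]: "Y l \<in> borel_measurable (G (?u i))"
        by (rule subalgebra_measurable[OF sub[of l]]) (use il Y in auto)
      have [measurable]: "W (?u (Suc l)) \<in> borel_measurable (G (?u i))"
        by (rule subalgebra_measurable[OF sub[of "Suc l"] Wm[OF u0]]) (use il in auto)
      have [measurable]: "W (?u l) \<in> borel_measurable (G (?u i))"
        by (rule subalgebra_measurable[OF sub[of l] Wm[OF u0]]) (use il in auto)
      show "D l \<in> borel_measurable (G (?u i))" unfolding D_def by measurable
    qed
    have mo: "\<forall>i<K. Ebd M (\<lambda>\<omega>. norm (D i \<omega>) ^ (2 * r)) (?c * B i * (b - a) ^ r / real n ^ r)"
    proof (intro allI impI)
      fix i assume i: "i < K"
      have "Ebd M (\<lambda>\<omega>. norm (D i \<omega>) ^ (2 * r)) (?c * B i * (?u (Suc i) - ?u i) ^ r)"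
        unfolding D_def by (rule Ebd_increment[OF u0 up(3) ind _ _ r]) (use Y B i in auto)
      then show "Ebd M (\<lambda>\<omega>. norm (D i \<omega>) ^ (2 * r)) (?c * B i * (b - a) ^ r / real n ^ r)"
        unfolding up(6) by (simp add: power_divide)
    qed
    have "Ebd M (\<lambda>\<omega>. running_max (\<lambda>k. norm (\<Sum>i<k. D i \<omega>)) K ^ (2 * r)) (C * (\<Sum>l<K. ?c * B l * (b - a) ^ r) / real n)"
      by (rule mm[OF n K md ad mo])
    also have "C * (\<Sum>l<K. ?c * B l * (b - a) ^ r) / real n = C * ?c * (b - a) ^ r * (\<Sum>l<K. B l) / n"
      by (simp add: sum_distrib_left sum_distrib_right mult_ac)
    finally show ?thesis unfolding D_def .
  qed
  show ?thesis
  proof (intro exI[of _ "C * ?c"] conjI allI impI)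
    show "0 < C * ?c" using C c0 by simp
  qed (rule main; assumption)
qed

end

section \<open>Moments of the solution\<close>

text \<open>Coefficients and solution are taken on the whole time axis with uniform bounds; the
  theorem supplies such extensions by clamping time. Only the equation itself is restricted to
  [0, T].\<close>

locale sdde = wiener_space M F W
  for M :: "'a measure" and F and W :: "real \<Rightarrow> 'a \<Rightarrow> real^'m" +
  fixes f :: "real \<Rightarrow> real^'d \<Rightarrow> real^'d \<Rightarrow> real^'d"
    and g :: "real \<Rightarrow> real^'d \<Rightarrow> real^'d \<Rightarrow> real^'m^'d"
    and \<tau> \<rho> \<alpha>1 \<alpha>2 T K L :: real and x0 :: "real^'d" and X :: "real \<Rightarrow> 'a \<Rightarrow> real^'d"
  assumes tau: "0 < \<tau>" and T: "0 < T" and rho: "0 < \<rho>" "\<rho> \<le> 1"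
    and alpha1: "0 < \<alpha>1" "\<alpha>1 \<le> 1" and alpha2: "0 < \<alpha>2" "\<alpha>2 \<le> 1" and KL: "0 < K" "0 < L"
    and f_cont: "continuous_on UNIV (\<lambda>(x, z). f t x z)"
    and f_meas: "(\<lambda>t. f t x z) \<in> borel_measurable borel"
    and f_bound: "norm (f t 0 0) \<le> K"
    and f_lip: "norm (f t x1 z1 - f t x2 z2) \<le> L * (norm (x1 - x2) + norm (z1 - z2) powr \<alpha>1)"
    and g_time: "norm (g t1 x z - g t2 x z) \<le> K * (1 + norm x + norm z) * \<bar>t1 - t2\<bar> powr \<rho>"
    and g_lip: "norm (g t x1 z1 - g t x2 z2) \<le> L * (norm (x1 - x2) + norm (z1 - z2) powr \<alpha>2)"
    and X_cont: "\<omega> \<in> space M \<Longrightarrow> continuous_on UNIV (\<lambda>t. X t \<omega>)"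
    and X_init: "\<omega> \<in> space M \<Longrightarrow> t \<le> 0 \<Longrightarrow> X t \<omega> = x0"
    and X_adapted: "0 \<le> t \<Longrightarrow> X t \<in> borel_measurable (F t)"
    and X_eq: "\<exists>I. is_ito_integral M F W T (\<lambda>s \<omega>. g s (X s \<omega>) (X (s - \<tau>) \<omega>)) I \<and>
        (AE \<omega> in M. \<forall>t\<in>{0..T}. X t \<omega> = x0 + (LINT s:{0..t}|lborel. f s (X s \<omega>) (X (s - \<tau>) \<omega>)) + I t \<omega>)"
begin

definition \<phi> :: "real \<Rightarrow> 'a \<Rightarrow> real^'d" where "\<phi> s \<omega> = f s (X s \<omega>) (X (s - \<tau>) \<omega>)"
definition H :: "real \<Rightarrow> 'a \<Rightarrow> real^'m^'d" where "H s \<omega> = g s (X s \<omega>) (X (s - \<tau>) \<omega>)"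

lemma f_growth: "norm (f t x z) \<le> (K + L) * (1 + norm x + norm z)"
proof -
  have "norm (f t x z) \<le> norm (f t 0 0) + norm (f t x z - f t 0 0)" by (rule norm_triangle_sub)
  also have "\<dots> \<le> K + L * (norm (x - 0) + norm (z - 0) powr \<alpha>1)" by (intro add_mono f_bound f_lip)
  also have "\<dots> \<le> K + L * (norm x + (1 + norm z))"
    using powr_le_one_plus[of "norm z", OF _ alpha1] KL by (intro add_mono mult_left_mono) auto
  also have "\<dots> \<le> (K + L) * (1 + norm x + norm z)" using KL by (simp add: algebra_simps)
  finally show ?thesis .
qed

text \<open>A linear growth constant of \<open>g\<close> up to time \<open>T\<close>, from a
  comparison with time 0 and then with the point 0; \<open>1 + T\<close> bounds the power \<rho> of
  the elapsed time.\<close>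

definition Kg :: real where "Kg = norm (g 0 0 0) + L + K * (1 + T)"

lemma Kg_pos: "0 < Kg"
  using KL T by (simp add: Kg_def add_nonneg_pos)

lemma g_growth:
  assumes "t \<in> {0..T}"
  shows "norm (g t x z) \<le> Kg * (1 + norm x + norm z)"
proof -
  have "norm (g t x z) \<le> norm (g 0 x z) + norm (g t x z - g 0 x z)" by (rule norm_triangle_sub)
  also have "norm (g 0 x z) \<le> norm (g 0 0 0) + norm (g 0 x z - g 0 0 0)" by (rule norm_triangle_sub)
  also have "norm (g 0 x z - g 0 0 0) \<le> L * (norm (x - 0) + norm (z - 0) powr \<alpha>2)" by (rule g_lip)
  also have "\<dots> \<le> L * (norm x + (1 + norm z))"
    using powr_le_one_plus[of "norm z", OF _ alpha2] KL by (intro mult_left_mono) auto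
  also have "norm (g t x z - g 0 x z) \<le> K * (1 + norm x + norm z) * \<bar>t - 0\<bar> powr \<rho>" by (rule g_time)
  also have "\<bar>t - 0\<bar> powr \<rho> \<le> 1 + T" using powr_le_one_plus[of t, OF _ rho] assms by auto
  then have "K * (1 + norm x + norm z) * \<bar>t - 0\<bar> powr \<rho> \<le> K * (1 + norm x + norm z) * (1 + T)" using KL by (intro mult_left_mono) auto
  finally have "norm (g t x z) \<le> norm (g 0 0 0) + L * (norm x + (1 + norm z)) + K * (1 + norm x + norm z) * (1 + T)" by simp
  also have "norm (g 0 0 0) \<le> norm (g 0 0 0) * (1 + norm x + norm z)" by (simp add: algebra_simps)
  finally show ?thesis by (simp add: Kg_def algebra_simps)
qed

lemma f_measurable: "(\<lambda>(t, x, z). f t x z) \<in> borel_measurable borel"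
proof -
  have "(\<lambda>(t, y). (\<lambda>(x, z). f t x z) y) \<in> borel_measurable (borel \<Otimes>\<^sub>M borel)"
    by (rule caratheodory_measurable) (use f_meas f_cont in auto)
  then show ?thesis by (simp add: borel_prod split_beta')
qed

lemma f_measurable_comp[measurable (raw)]:
  assumes [measurable]: "a \<in> borel_measurable N" "b \<in> borel_measurable N" "c \<in> borel_measurable N"
  shows "(\<lambda>\<omega>. f (a \<omega>) (b \<omega>) (c \<omega>)) \<in> borel_measurable N"
proof -
  have "(\<lambda>\<omega>. (a \<omega>, b \<omega>, c \<omega>)) \<in> borel_measurable N" by (intro borel_measurable_Pair assms)
  from measurable_compose[OF this f_measurable] show ?thesis by simp
qed

text \<open>Regularity in time and in space combine to joint continuity. Hence \<open>H\<close> has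
  continuous paths, as the Riemann sums require, whereas \<open>f\<close> is only measurable in time
  and its integral has to be sampled at random.\<close>

lemma g_continuous: "continuous_on UNIV (\<lambda>(t, x, z). g t x z)"
  unfolding continuous_on_def
proof (intro ballI)
  fix y0 :: "real \<times> (real^'d) \<times> (real^'d)"
  obtain t0 a b where y0: "y0 = (t0, a, b)" by (cases y0) auto
  have "((\<lambda>y. K * (1 + norm (fst (snd y)) + norm (snd (snd y))) * \<bar>fst y - t0\<bar> powr \<rho>
      + L * (norm (fst (snd y) - a) + norm (snd (snd y) - b) powr \<alpha>2)) \<longlongrightarrow>
      K * (1 + norm a + norm b) * \<bar>t0 - t0\<bar> powr \<rho> + L * (norm (a - a) + norm (b - b) powr \<alpha>2)) (at y0)"
    unfolding y0
    by (intro tendsto_intros tendsto_powr' ) (use rho alpha2 in \<open>auto intro!: tendsto_eq_intros\<close>)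
  then have lim: "((\<lambda>y. K * (1 + norm (fst (snd y)) + norm (snd (snd y))) * \<bar>fst y - t0\<bar> powr \<rho>
      + L * (norm (fst (snd y) - a) + norm (snd (snd y) - b) powr \<alpha>2)) \<longlongrightarrow> 0) (at y0)" by simp
  have "((\<lambda>y. (\<lambda>(t, x, z). g t x z) y - g t0 a b) \<longlongrightarrow> 0) (at y0)"
  proof (rule Lim_null_comparison[OF always_eventually lim], rule allI)
    fix y :: "real \<times> (real^'d) \<times> (real^'d)"
    obtain t x z where y: "y = (t, x, z)" by (cases y) auto
    have "norm (g t x z - g t0 a b) \<le> norm (g t x z - g t0 x z) + norm (g t0 x z - g t0 a b)"
      using norm_triangle_ineq[of "g t x z - g t0 x z" "g t0 x z - g t0 a b"] by simp
    also have "\<dots> \<le> K * (1 + norm x + norm z) * \<bar>t - t0\<bar> powr \<rho> + L * (norm (x - a) + norm (z - b) powr \<alpha>2)"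
      by (intro add_mono g_time g_lip)
    finally show "norm ((\<lambda>(t, x, z). g t x z) y - g t0 a b) \<le> K * (1 + norm (fst (snd y)) + norm (snd (snd y))) * \<bar>fst y - t0\<bar> powr \<rho>
      + L * (norm (fst (snd y) - a) + norm (snd (snd y) - b) powr \<alpha>2)" by (simp add: y)
  qed
  then show "((\<lambda>(t, x, z). g t x z) \<longlongrightarrow> (\<lambda>(t, x, z). g t x z) y0) (at y0 within UNIV)"
    by (simp add: y0 LIM_zero_iff)
qed

lemma g_measurable_comp[measurable (raw)]:
  assumes [measurable]: "a \<in> borel_measurable N" "b \<in> borel_measurable N" "c \<in> borel_measurable N"
  shows "(\<lambda>\<omega>. g (a \<omega>) (b \<omega>) (c \<omega>)) \<in> borel_measurable N"
proof -
  have "(\<lambda>\<omega>. (a \<omega>, b \<omega>, c \<omega>)) \<in> borel_measurable N" by (intro borel_measurable_Pair assms)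
  from measurable_compose[OF this borel_measurable_continuous_onI[OF g_continuous]] show ?thesis by simp
qed

lemma H_cont: "\<omega> \<in> space M \<Longrightarrow> continuous_on UNIV (\<lambda>s. H s \<omega>)"
proof -
  assume w: "\<omega> \<in> space M"
  have "continuous_on UNIV (\<lambda>s. (\<lambda>(t, x, z). g t x z) (s, X s \<omega>, X (s - \<tau>) \<omega>))"
    by (rule continuous_on_compose2[OF g_continuous])
      (auto intro!: continuous_intros X_cont[OF w] continuous_on_compose2[OF X_cont[OF w]])
  then show ?thesis by (simp add: H_def)
qed

lemma X_measurable_F:
  assumes "0 \<le> t" "s \<le> t"
  shows "X s \<in> borel_measurable (F t)"
proof (cases "0 \<le> s")
  case True then show ?thesis using F_measurable[OF True assms(2) X_adapted[OF True]] by simp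
next
  case False
  have "space (F t) = space M" using subalg[OF assms(1)] by (simp add: subalgebra_def)
  then have "X s \<in> borel_measurable (F t) \<longleftrightarrow> (\<lambda>_. x0) \<in> borel_measurable (F t)"
    using False X_init by (intro measurable_cong) auto
  then show ?thesis by simp
qed

lemma X_measurable[measurable]: "X s \<in> borel_measurable M"
  by (rule F_measurable_M[OF max.cobounded1 X_measurable_F[OF max.cobounded1 max.cobounded2]])

lemma H_adapted: "0 \<le> s \<Longrightarrow> H s \<in> borel_measurable (F s)"
  proof -
  assume s: "0 \<le> s"
  have [measurable]: "X s \<in> borel_measurable (F s)" "X (s - \<tau>) \<in> borel_measurable (F s)"
    using X_measurable_F[OF s] tau by auto
  show ?thesis unfolding H_def by measurable
qed

lemma X_joint:
  assumes "\<And>s. X s \<in> borel_measurable N" "space N = space M"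
  shows "(\<lambda>(s, \<omega>). X s \<omega>) \<in> borel_measurable (borel \<Otimes>\<^sub>M N)"
  by (rule continuous_process_measurable) (use assms X_cont in auto)

text \<open>The sigma-algebra \<open>N\<close> is left open because the quadrature error needs joint
  measurability with respect to \<open>Q j k\<close>, not only \<open>M\<close>.\<close>

lemma \<phi>_joint:
  assumes N: "\<And>s. X s \<in> borel_measurable N" "space N = space M"
  shows "(\<lambda>(s, \<omega>). \<phi> s \<omega>) \<in> borel_measurable (borel \<Otimes>\<^sub>M N)"
proof -
  have 1[measurable]: "(\<lambda>p. X (fst p) (snd p)) \<in> borel_measurable (borel \<Otimes>\<^sub>M N)"
    using X_joint[OF N] by (simp add: split_beta')
  have "(\<lambda>p. (fst p - \<tau>, snd p)) \<in> borel \<Otimes>\<^sub>M N \<rightarrow>\<^sub>M borel \<Otimes>\<^sub>M N" by measurable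
  from measurable_compose[OF this 1] have [measurable]: "(\<lambda>p. X (fst p - \<tau>) (snd p)) \<in> borel_measurable (borel \<Otimes>\<^sub>M N)" by simp
  show ?thesis unfolding \<phi>_def split_beta' by measurable
qed

lemma \<phi>_jointM[measurable]: "(\<lambda>(s, \<omega>). \<phi> s \<omega>) \<in> borel_measurable (borel \<Otimes>\<^sub>M M)"
  by (rule \<phi>_joint) auto

lemma H_measurable[measurable]: "H s \<in> borel_measurable M"
  unfolding H_def by measurable

lemma \<phi>_path_measurable: "\<omega> \<in> space M \<Longrightarrow> (\<lambda>s. \<phi> s \<omega>) \<in> borel_measurable borel"
  using measurable_compose[OF measurable_Pair2' \<phi>_jointM] by simp

lemma \<phi>_growth: "norm (\<phi> s \<omega>) \<le> (K + L) * (1 + norm (X s \<omega>) + norm (X (s - \<tau>) \<omega>))"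
  unfolding \<phi>_def by (rule f_growth)

lemma \<phi>_integrable:
  assumes w: "\<omega> \<in> space M"
  shows "set_integrable lborel {a..b} (\<lambda>s. \<phi> s \<omega>)"
proof (rule set_integrable_bound)
  show "set_integrable lborel {a..b} (\<lambda>s. (K + L) * (1 + norm (X s \<omega>) + norm (X (s - \<tau>) \<omega>)))"
    by (rule borel_integrable_atLeastAtMost')
      (auto intro!: continuous_intros continuous_on_subset[OF X_cont[OF w]] continuous_on_compose2[OF X_cont[OF w]])
  show "set_borel_measurable lborel {a..b} (\<lambda>s. \<phi> s \<omega>)"
    using \<phi>_path_measurable[OF w] unfolding set_borel_measurable_def by measurable
  show "AE s in lborel. s \<in> {a..b} \<longrightarrow> norm (\<phi> s \<omega>) \<le> norm ((K + L) * (1 + norm (X s \<omega>) + norm (X (s - \<tau>) \<omega>)))"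
    using \<phi>_growth KL by (auto intro!: AE_I2 order_trans[OF _ abs_ge_self])
qed

text \<open>For times in [0, T] this is almost surely the increment of the Ito integral of
  \<open>H\<close>. Defined through the solution, it makes the decomposition of \<open>X\<close> an
  identity at every sample point.\<close>

definition J :: "real \<Rightarrow> real \<Rightarrow> 'a \<Rightarrow> real^'d" where
  "J s t \<omega> = X t \<omega> - X s \<omega> - (LINT u:{s..t}|lborel. \<phi> u \<omega>)"

lemma J_measurable[measurable]: "J s t \<in> borel_measurable M"
  unfolding J_def set_lebesgue_integral_def by measurable

lemma \<phi>_integral_split:
  assumes "\<omega> \<in> space M" "a \<le> b" "b \<le> c"
  shows "(LINT u:{a..c}|lborel. \<phi> u \<omega>) = (LINT u:{a..b}|lborel. \<phi> u \<omega>) + (LINT u:{b..c}|lborel. \<phi> u \<omega>)"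
proof -
  have "{a..c} = {a..b} \<union> {b..c}" using assms by auto
  moreover have "(LINT u:{a..b} \<union> {b..c}|lborel. \<phi> u \<omega>) = (LINT u:{a..b}|lborel. \<phi> u \<omega>) + (LINT u:{b..c}|lborel. \<phi> u \<omega>)"
  proof (rule set_integral_Un_AE)
    have "AE u in lborel. u \<noteq> b" by (rule AE_lborel_singleton)
    then show "AE u in lborel. \<not> (u \<in> {a..b} \<and> u \<in> {b..c})" by eventually_elim auto
  qed (use \<phi>_integrable[OF assms(1)] in auto)
  ultimately show ?thesis by simp
qed

lemma J_riemann:
  assumes st: "0 \<le> s" "s < t" "t \<le> T"
  shows "conv_prob M (\<lambda>n \<omega>. riemann_sum (\<lambda>r. H r \<omega>) (\<lambda>r. W r \<omega>) s t (Suc n)) (J s t)"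
proof -
  from X_eq obtain I where ito: "is_ito_integral M F W T H I"
    and eq: "AE \<omega> in M. \<forall>t\<in>{0..T}. X t \<omega> = x0 + (LINT s:{0..t}|lborel. \<phi> s \<omega>) + I t \<omega>"
    unfolding H_def \<phi>_def by blast
  have conv: "conv_prob M (\<lambda>n \<omega>. riemann_sum (\<lambda>r. H r \<omega>) (\<lambda>r. W r \<omega>) s t (Suc n)) (\<lambda>\<omega>. I t \<omega> - I s \<omega>)"
    by (rule ito_integral_riemann[OF ito]) (use st H_adapted in \<open>auto intro: continuous_on_subset[OF H_cont]\<close>)
  have ae: "AE \<omega> in M. J s t \<omega> = I t \<omega> - I s \<omega>" using eq AE_space
  proof eventually_elim
    case (elim \<omega>)
    have "X t \<omega> = x0 + (LINT s:{0..t}|lborel. \<phi> s \<omega>) + I t \<omega>" "X s \<omega> = x0 + (LINT s:{0..s}|lborel. \<phi> s \<omega>) + I s \<omega>"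
      using elim(1) st by auto
    moreover have "(LINT u:{0..t}|lborel. \<phi> u \<omega>) = (LINT u:{0..s}|lborel. \<phi> u \<omega>) + (LINT u:{s..t}|lborel. \<phi> u \<omega>)"
      by (rule \<phi>_integral_split) (use elim st in auto)
    ultimately show ?case by (simp add: J_def)
  qed
  have IM[measurable]: "I u \<in> borel_measurable M" if "u \<in> {0..T}" for u
    using ito that F_measurable_M[of u "I u" borel] unfolding is_ito_integral_def by auto
  have [measurable]: "I t \<in> borel_measurable M" "I s \<in> borel_measurable M" using st by auto
  have RM: "(\<lambda>\<omega>. riemann_sum (\<lambda>r. H r \<omega>) (\<lambda>r. W r \<omega>) s t (Suc n)) \<in> borel_measurable M" for n
    unfolding riemann_sum_def
  proof (rule borel_measurable_sum)
    fix l assume "l \<in> {..<Suc n}"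
    have [measurable]: "W (uniform_point s t (Suc n) l) \<in> borel_measurable M" for l
      using st by (intro W_measurable) (auto simp: uniform_point_def)
    show "(\<lambda>\<omega>. H (uniform_point s t (Suc n) l) \<omega> *v (W (uniform_point s t (Suc n) (Suc l)) \<omega> - W (uniform_point s t (Suc n) l) \<omega>)) \<in> borel_measurable M" by measurable
  qed
  have "prob {\<omega> \<in> space M. norm (riemann_sum (\<lambda>r. H r \<omega>) (\<lambda>r. W r \<omega>) s t (Suc n) - (I t \<omega> - I s \<omega>)) > \<epsilon>}
    = prob {\<omega> \<in> space M. norm (riemann_sum (\<lambda>r. H r \<omega>) (\<lambda>r. W r \<omega>) s t (Suc n) - J s t \<omega>) > \<epsilon>}" for n \<epsilon>
  proof (rule finite_measure_eq_AE)
    show "AE \<omega> in M. (\<omega> \<in> {\<omega> \<in> space M. norm (riemann_sum (\<lambda>r. H r \<omega>) (\<lambda>r. W r \<omega>) s t (Suc n) - (I t \<omega> - I s \<omega>)) > \<epsilon>})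
      = (\<omega> \<in> {\<omega> \<in> space M. norm (riemann_sum (\<lambda>r. H r \<omega>) (\<lambda>r. W r \<omega>) s t (Suc n) - J s t \<omega>) > \<epsilon>})"
      using ae by eventually_elim simp
  qed (use RM[of n] in measurable)
  then show ?thesis using conv unfolding conv_prob_def by simp
qed

lemma riemann_measurable:
  assumes "0 \<le> s" "s < t" "\<And>u. Y u \<in> borel_measurable M"
  shows "(\<lambda>\<omega>. riemann_sum (\<lambda>r. Y r \<omega>) (\<lambda>r. W r \<omega>) s t n :: real^'d) \<in> borel_measurable M"
  unfolding riemann_sum_def
proof (rule borel_measurable_sum)
  fix l assume "l \<in> {..<n}"
  have [measurable]: "W (uniform_point s t n l) \<in> borel_measurable M" for l
    using assms by (intro W_measurable) (auto simp: uniform_point_def)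
  note [measurable] = assms(3)
  show "(\<lambda>\<omega>. Y (uniform_point s t n l) \<omega> *v (W (uniform_point s t n (Suc l)) \<omega> - W (uniform_point s t n l) \<omega>)) \<in> borel_measurable M" by measurable
qed

end

lemma growth_power_le:
  fixes a b c y :: real
  assumes "0 \<le> y" "y \<le> c * (1 + a + b)" "0 \<le> a" "0 \<le> b" "0 \<le> c" "1 \<le> p"
  shows "y ^ p \<le> c ^ p * 4 ^ p * (1 + a ^ p + b ^ p)"
proof -
  have "y ^ p \<le> (c * (1 + (a + b))) ^ p" using assms by (intro power_mono) (auto simp: add.assoc)
  also have "\<dots> = c ^ p * (1 + (a + b)) ^ p" by (simp add: power_mult_distrib)
  also have "(1 + (a + b)) ^ p \<le> 2 ^ p * (1 ^ p + (a + b) ^ p)" by (rule power_add_le) (use assms in auto)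
  also have "\<dots> \<le> 2 ^ p * (1 ^ p + 2 ^ p * (a ^ p + b ^ p))"
    by (intro mult_left_mono add_left_mono power_add_le) (use assms in auto)
  also have "\<dots> \<le> 2 ^ p * (2 ^ p * (1 + a ^ p + b ^ p))"
    by (intro mult_left_mono) (auto simp: algebra_simps)
  also have "\<dots> = 4 ^ p * (1 + a ^ p + b ^ p)" by (simp add: power_mult_distrib[symmetric])
  finally show ?thesis using assms by (simp add: mult_left_mono mult.assoc)
qed

lemma three_power_le:
  fixes a b c y :: real
  assumes "0 \<le> y" "y \<le> a + b + c" "0 \<le> a" "0 \<le> b" "0 \<le> c" "1 \<le> p"
  shows "y ^ p \<le> 4 ^ p * (a ^ p + b ^ p + c ^ p)"
proof -
  have "y ^ p \<le> (a + (b + c)) ^ p" using assms by (intro power_mono) auto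
  also have "\<dots> \<le> 2 ^ p * (a ^ p + (b + c) ^ p)" by (rule power_add_le) (use assms in auto)
  also have "\<dots> \<le> 2 ^ p * (a ^ p + 2 ^ p * (b ^ p + c ^ p))"
    by (intro mult_left_mono add_left_mono power_add_le) (use assms in auto)
  also have "\<dots> \<le> 2 ^ p * (2 ^ p * (a ^ p + b ^ p + c ^ p))"
  proof -
    have "1 * a ^ p \<le> 2 ^ p * a ^ p" using assms by (intro mult_right_mono) auto
    then show ?thesis by (intro mult_left_mono) (auto simp: algebra_simps)
  qed
  also have "\<dots> = 4 ^ p * (a ^ p + b ^ p + c ^ p)" by (simp add: power_mult_distrib[symmetric])
  finally show ?thesis .
qed

text \<open>A left Riemann sum of an increasing function stays below its integral; \<open>?G\<close>
  is a primitive, and each cell is handled by 1 + x \<le> exp x. The factor 1 / l on the right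
  drives the contraction in \<open>X_moment\<close>.\<close>

lemma riemann_exp_le:
  fixes m l t :: real
  assumes "0 < t" "0 < n" "0 \<le> m" "0 < l"
  shows "t * (\<Sum>i<n. 1 + m * exp (l * uniform_point 0 t n i)) / n \<le> t + m * exp (l * t) / l"
proof -
  let ?u = "uniform_point 0 t n"
  let ?G = "\<lambda>x. x + m * exp (l * x) / l"
  note up = uniform_point_props[OF assms(1,2)]
  have "t * (\<Sum>i<n. 1 + m * exp (l * ?u i)) / n = (\<Sum>i<n. (1 + m * exp (l * ?u i)) * (?u (Suc i) - ?u i))"
    unfolding up(6) by (simp add: sum_distrib_left sum_divide_distrib mult_ac)
  also have "\<dots> \<le> (\<Sum>i<n. ?G (?u (Suc i)) - ?G (?u i))"
  proof (rule sum_mono)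
    fix i
    have e: "l * ?u (Suc i) = l * ?u i + l * (?u (Suc i) - ?u i)" by (simp add: algebra_simps)
    have "exp (l * ?u i) * (1 + l * (?u (Suc i) - ?u i)) \<le> exp (l * ?u i) * exp (l * (?u (Suc i) - ?u i))"
      by (intro mult_left_mono exp_ge_add_one_self) auto
    also have "\<dots> = exp (l * ?u (Suc i))" by (subst e) (simp add: exp_add)
    finally have "m * (exp (l * ?u i) * (1 + l * (?u (Suc i) - ?u i))) \<le> m * exp (l * ?u (Suc i))"
      using assms by (intro mult_left_mono) auto
    then have "m * exp (l * ?u i) * (l * (?u (Suc i) - ?u i)) \<le> m * exp (l * ?u (Suc i)) - m * exp (l * ?u i)" by (simp add: algebra_simps)
    then have "m * exp (l * ?u i) * (?u (Suc i) - ?u i) \<le> (m * exp (l * ?u (Suc i)) - m * exp (l * ?u i)) / l"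
      using assms by (simp add: field_simps)
    then show "(1 + m * exp (l * ?u i)) * (?u (Suc i) - ?u i) \<le> ?G (?u (Suc i)) - ?G (?u i)"
      by (simp add: algebra_simps diff_divide_distrib)
  qed
  also have "\<dots> = ?G t - ?G 0" using sum_lessThan_telescope[of "\<lambda>i. ?G (?u i)" n] up(1,2) by simp
  also have "\<dots> \<le> ?G t" using assms by simp
  finally show ?thesis .
qed

lemma nn_integral_exp_le:
  fixes m l t :: real
  assumes "0 \<le> t" "0 \<le> m" "0 < l" "0 \<le> c"
  shows "(\<integral>\<^sup>+u\<in>{0..t}. ennreal (c * (1 + m * exp (l * u))) \<partial>lborel) \<le> ennreal (c * (t + m * exp (l * t) / l))"
proof -
  let ?G = "\<lambda>x. c * (x + m * exp (l * x) / l)"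
  have "(\<integral>\<^sup>+u. ennreal (c * (1 + m * exp (l * u))) * indicator {0..t} u \<partial>lborel) = ennreal (?G t - ?G 0)"
    by (rule nn_integral_FTC_Icc) (use assms in \<open>auto intro!: derivative_eq_intros mult_nonneg_nonneg add_nonneg_nonneg\<close>)
  also have "\<dots> \<le> ennreal (?G t)" using assms by (intro ennreal_leI) (auto simp: algebra_simps)
  finally show ?thesis .
qed

section \<open>Localised moment bounds for the solution\<close>

context sdde
begin

text \<open>Localisation by events instead of a stopping time: \<open>A R t\<close> depends on the
  path up to \<open>t\<close> only, lies in \<open>F t\<close> for nonnegative \<open>t\<close>, and
  decreases in \<open>t\<close>. Rational times make it measurable, and by continuity they stand for
  all times (\<open>A_iff\<close>).\<close>

definition A :: "real \<Rightarrow> real \<Rightarrow> 'a set" where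
  "A R t = {\<omega> \<in> space M. \<forall>q::rat. of_rat q \<le> t \<longrightarrow> norm (X (of_rat q) \<omega>) \<le> R}"

lemma A_iff:
  assumes w: "\<omega> \<in> space M"
  shows "\<omega> \<in> A R t \<longleftrightarrow> (\<forall>s\<le>t. norm (X s \<omega>) \<le> R)"
proof
  assume a: "\<omega> \<in> A R t"
  show "\<forall>s\<le>t. norm (X s \<omega>) \<le> R"
  proof (intro allI impI, rule ccontr)
    fix s assume s: "s \<le> t" "\<not> norm (X s \<omega>) \<le> R"
    have "continuous_on UNIV (\<lambda>t. norm (X t \<omega>))" using X_cont[OF w] by (intro continuous_intros)
    moreover have "0 < norm (X s \<omega>) - R" using s by simp
    ultimately obtain d where d: "d > 0" "\<And>q. dist q s < d \<Longrightarrow> dist (norm (X q \<omega>)) (norm (X s \<omega>)) < norm (X s \<omega>) - R"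
      unfolding continuous_on_iff by (metis UNIV_I)
    obtain q :: rat where q: "s - d < of_rat q" "of_rat q < s" using of_rat_dense[of "s - d" s] d by auto
    have "dist (norm (X (of_rat q) \<omega>)) (norm (X s \<omega>)) < norm (X s \<omega>) - R" by (rule d(2)) (use q in \<open>auto simp: dist_real_def\<close>)
    then have "norm (X (of_rat q) \<omega>) > R" by (auto simp: dist_real_def)
    moreover have "of_rat q \<le> t" using q s by simp
    ultimately show False using a by (auto simp: A_def not_le[symmetric])
  qed
qed (use w in \<open>auto simp: A_def\<close>)

lemma A_mono:
  assumes "s \<le> t"
  shows "A R t \<subseteq> A R s"
proof
  fix \<omega> assume w: "\<omega> \<in> A R t"
  then have "\<omega> \<in> space M" by (simp add: A_def)
  then show "\<omega> \<in> A R s" using w assms order_trans unfolding A_iff[OF \<open>\<omega> \<in> space M\<close>] by blast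
qed

lemma A_sets_F: "0 \<le> t \<Longrightarrow> A R t \<in> sets (F t)"
proof -
  assume t: "0 \<le> t"
  have sp: "space (F t) = space M" using subalg[OF t] by (simp add: subalgebra_def)
  have "{\<omega> \<in> space (F t). of_rat q \<le> t \<longrightarrow> norm (X (of_rat q) \<omega>) \<le> R} \<in> sets (F t)" for q :: rat
  proof (cases "of_rat q \<le> t")
    case True
    have Xq: "X (of_rat q) \<in> borel_measurable (F t)" by (rule X_measurable_F[OF t True])
    have "{\<omega> \<in> space (F t). norm (X (of_rat q) \<omega>) \<le> R} \<in> sets (F t)"
      by (rule borel_measurable_le[OF measurable_compose[OF Xq borel_measurable_norm] borel_measurable_const])
    then show ?thesis using True by simp
  next
    case False
    then show ?thesis by (simp only: simp_thms Collect_mem_eq sets.top)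
  qed
  then have "{\<omega> \<in> space (F t). \<forall>q::rat. of_rat q \<le> t \<longrightarrow> norm (X (of_rat q) \<omega>) \<le> R} \<in> sets (F t)"
    by (rule sets.sets_Collect_countable_All)
  then show ?thesis unfolding A_def sp .
qed

lemma A_sets[measurable]: "A R t \<in> sets M"
  unfolding A_def
proof (rule sets.sets_Collect_countable_All)
  show "{\<omega> \<in> space M. of_rat q \<le> t \<longrightarrow> norm (X (of_rat q) \<omega>) \<le> R} \<in> sets M" for q :: rat
    by (cases "of_rat q \<le> t") auto
qed

lemma A_joint[measurable]: "(\<lambda>(u, \<omega>). indicator (A R u) \<omega> :: real) \<in> borel_measurable (borel \<Otimes>\<^sub>M M)"
proof -
  have "(\<lambda>p :: real \<times> 'a. if (\<forall>q::rat. of_rat q \<le> fst p \<longrightarrow> norm (X (of_rat q) (snd p)) \<le> R) then 1 else 0 :: real) \<in> borel_measurable (borel \<Otimes>\<^sub>M M)"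
    by measurable
  then show ?thesis
    by (subst measurable_cong[where g = "\<lambda>p :: real \<times> 'a. if (\<forall>q::rat. of_rat q \<le> fst p \<longrightarrow> norm (X (of_rat q) (snd p)) \<le> R) then 1 else 0"])
      (auto simp: A_def indicator_def space_pair_measure)
qed

text \<open>A weighted supremum bound in the manner of Bielecki: integrating
  \<open>exp (l * u)\<close> gains the factor 1 / l, so for large \<open>l\<close> one application
  of the equation contracts.\<close>

definition localized_bound :: "nat \<Rightarrow> real \<Rightarrow> real \<Rightarrow> real \<Rightarrow> bool" where
  "localized_bound p R l m \<longleftrightarrow> (\<forall>t\<in>{0..T}. Ebd M (\<lambda>\<omega>. indicator (A R t) \<omega> * norm (X t \<omega>) ^ p) (m * exp (l * t)))"

text \<open>A delayed time that is not before 0 is covered by the bound at that earlier time, since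
  the event shrinks and the weight grows with time; otherwise the delayed value is
  \<open>x0\<close>. Stated for a general \<open>Y\<close> of linear growth so as to serve both
  coefficients.\<close>

lemma localized_growth:
  assumes p: "1 \<le> p" and b: "localized_bound p R l m" and l: "0 < l" "0 \<le> m" and u: "u \<in> {0..T}" and c: "0 \<le> c"
    and Y: "Y \<in> borel_measurable M" "\<And>\<omega>. norm (Y \<omega>) \<le> c * (1 + norm (X u \<omega>) + norm (X (u - \<tau>) \<omega>))"
  shows "Ebd M (\<lambda>\<omega>. indicator (A R u) \<omega> * norm (Y \<omega>) ^ p)
    (c ^ p * 4 ^ p * (2 * (1 + norm x0 ^ p)) * (1 + m * exp (l * u)))"
proof (rule Ebd_mono)
  have 1: "Ebd M (\<lambda>\<omega>. indicator (A R u) \<omega> * norm (X u \<omega>) ^ p) (m * exp (l * u))"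
    using b u by (simp add: localized_bound_def)
  have 2: "Ebd M (\<lambda>\<omega>. indicator (A R u) \<omega> * norm (X (u - \<tau>) \<omega>) ^ p) (norm x0 ^ p + m * exp (l * u))"
  proof (cases "0 \<le> u - \<tau>")
    case True
    show ?thesis
    proof (rule Ebd_mono)
      show "Ebd M (\<lambda>\<omega>. indicator (A R (u - \<tau>)) \<omega> * norm (X (u - \<tau>) \<omega>) ^ p) (m * exp (l * (u - \<tau>)))"
        using b True u tau by (simp add: localized_bound_def)
      show "indicator (A R u) \<omega> * norm (X (u - \<tau>) \<omega>) ^ p \<le> indicator (A R (u - \<tau>)) \<omega> * norm (X (u - \<tau>) \<omega>) ^ p" for \<omega>
        using A_mono[of "u - \<tau>" u R] tau by (intro mult_right_mono) (auto simp: indicator_def)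
      have "m * exp (l * (u - \<tau>)) \<le> m * exp (l * u)" using l tau by (intro mult_left_mono) auto
      then show "m * exp (l * (u - \<tau>)) \<le> norm x0 ^ p + m * exp (l * u)" by (simp add: add_increasing)
    qed auto
  next
    case False
    show ?thesis
    proof (rule Ebd_mono)
      show "Ebd M (\<lambda>\<omega>. norm x0 ^ p) (norm x0 ^ p)" by (rule Ebd_const) simp
      show "indicator (A R u) \<omega> * norm (X (u - \<tau>) \<omega>) ^ p \<le> norm x0 ^ p" if "\<omega> \<in> space M" for \<omega>
        using X_init[OF that, of "u - \<tau>"] False by (auto simp: indicator_def)
    qed (use l in auto)
  qed
  show "Ebd M (\<lambda>\<omega>. c ^ p * 4 ^ p * (1 + indicator (A R u) \<omega> * norm (X u \<omega>) ^ p + indicator (A R u) \<omega> * norm (X (u - \<tau>) \<omega>) ^ p))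
     (c ^ p * 4 ^ p * (1 + m * exp (l * u) + (norm x0 ^ p + m * exp (l * u))))"
    by (intro Ebd_cmult Ebd_add Ebd_const 1 2) (use c in auto)
  show "indicator (A R u) \<omega> * norm (Y \<omega>) ^ p \<le> c ^ p * 4 ^ p * (1 + indicator (A R u) \<omega> * norm (X u \<omega>) ^ p + indicator (A R u) \<omega> * norm (X (u - \<tau>) \<omega>) ^ p)" for \<omega>
    using growth_power_le[OF norm_ge_zero Y(2) norm_ge_zero norm_ge_zero c p, of \<omega>] c by (auto simp: indicator_def)
  have "1 + m * exp (l * u) + (norm x0 ^ p + m * exp (l * u)) \<le> 2 * (1 + norm x0 ^ p) * (1 + m * exp (l * u))"
    using l by (simp add: algebra_simps)
  then show "c ^ p * 4 ^ p * (1 + m * exp (l * u) + (norm x0 ^ p + m * exp (l * u))) \<le> c ^ p * 4 ^ p * (2 * (1 + norm x0 ^ p)) * (1 + m * exp (l * u))"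
    unfolding mult.assoc using c by (intro mult_left_mono) auto
  have [measurable]: "Y \<in> borel_measurable M" by (rule Y(1))
  show "(\<lambda>\<omega>. indicator (A R u) \<omega> * norm (Y \<omega>) ^ p) \<in> borel_measurable M" by measurable
qed (rule mult_nonneg_nonneg, simp_all)

text \<open>One application of the equation. Because the events decrease in time, the indicator of
  \<open>A R t\<close> may be replaced under the integrals by that of \<open>A R u\<close>, which is
  adapted at time \<open>u\<close>. It is essential that \<open>C\<close> does not depend on
  \<open>R\<close>, \<open>l\<close> and \<open>m\<close>.\<close>

lemma localized_step:
  assumes r: "1 \<le> r"
  shows "\<exists>C>0. \<forall>R l m. 0 < l \<longrightarrow> 0 \<le> m \<longrightarrow> localized_bound (2 * r) R l m \<longrightarrow>
    (\<forall>t\<in>{0..T}. Ebd M (\<lambda>\<omega>. indicator (A R t) \<omega> * norm (X t \<omega>) ^ (2 * r)) (C * (1 + T + m * exp (l * t) / l)))"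
proof -
  define p where "p = 2 * r"
  have p: "1 \<le> p" using r by (simp add: p_def)
  obtain Cw where Cw: "Cw > 0" and ws: "\<And>G a b n K (Y :: nat \<Rightarrow> 'a \<Rightarrow> real^'m^'d) B.
    wiener_filtration G \<Longrightarrow> 0 \<le> a \<Longrightarrow> a < b \<Longrightarrow> 0 < n \<Longrightarrow> K \<le> n \<Longrightarrow>
    (\<forall>l<K. Y l \<in> borel_measurable (G (uniform_point a b n l))) \<Longrightarrow>
    (\<forall>l<K. Ebd M (\<lambda>\<omega>. norm (Y l \<omega>) ^ (2 * r)) (B l)) \<Longrightarrow>
    Ebd M (\<lambda>\<omega>. running_max (\<lambda>k. norm (\<Sum>l<k. Y l \<omega> *v
      (W (uniform_point a b n (Suc l)) \<omega> - W (uniform_point a b n l) \<omega>))) K ^ (2 * r)) (Cw * (b - a) ^ r * (\<Sum>l<K. B l) / n)"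
    using wiener_sum_moment[OF r, where 'd = 'd] by blast
  define cf where "cf = (K + L) ^ p * 4 ^ p * (2 * (1 + norm x0 ^ p))"
  define cg where "cg = Kg ^ p * 4 ^ p * (2 * (1 + norm x0 ^ p))"
  have c0: "0 \<le> cf" "0 \<le> cg" using KL Kg_pos by (auto simp: cf_def cg_def)
  \<comment> \<open>The three summands belong to the initial value, the drift and the stochastic
    integral, \<open>4 ^ p\<close> to splitting the solution into them; the added 1 makes
    \<open>C\<close> positive.\<close>
  define C where "C = 4 ^ p * (norm x0 ^ p + T ^ (p - 1) * cf + Cw * T ^ (r - 1) * cg) + 1"
  have Cpos: "0 < C" using c0 Cw T by (auto simp: C_def intro!: add_nonneg_pos mult_nonneg_nonneg add_nonneg_nonneg)
  have main: "Ebd M (\<lambda>\<omega>. indicator (A R t) \<omega> * norm (X t \<omega>) ^ p) (C * (1 + T + m * exp (l * t) / l))"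
    if l: "0 < l" and m: "0 \<le> m" and b: "localized_bound p R l m" and t: "t \<in> {0..T}" for R l m t
  proof -
    define B where "B = T + m * exp (l * t) / l"
    have B0: "0 \<le> B" using T m l by (simp add: B_def)
    have tot: "4 ^ p * (norm x0 ^ p + T ^ (p - 1) * (cf * B) + Cw * T ^ (r - 1) * (cg * B)) \<le> C * (1 + B)"
    proof -
      have "norm x0 ^ p + T ^ (p - 1) * (cf * B) + Cw * T ^ (r - 1) * (cg * B)
        \<le> (norm x0 ^ p + T ^ (p - 1) * cf + Cw * T ^ (r - 1) * cg) * (1 + B)"
        using B0 c0 T Cw by (simp add: algebra_simps)
      then have "4 ^ p * (norm x0 ^ p + T ^ (p - 1) * (cf * B) + Cw * T ^ (r - 1) * (cg * B))
        \<le> 4 ^ p * ((norm x0 ^ p + T ^ (p - 1) * cf + Cw * T ^ (r - 1) * cg) * (1 + B))" by (intro mult_left_mono) auto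
      also have "\<dots> \<le> C * (1 + B)" unfolding C_def mult.assoc[symmetric] using B0 by (intro mult_right_mono) auto
      finally show ?thesis .
    qed
    show ?thesis
    proof (cases "t = 0")
      case True
      have "Ebd M (\<lambda>\<omega>. norm x0 ^ p) (norm x0 ^ p)" by (rule Ebd_const) simp
      then show ?thesis
      proof (rule Ebd_mono)
        show "indicator (A R t) \<omega> * norm (X t \<omega>) ^ p \<le> norm x0 ^ p" if "\<omega> \<in> space M" for \<omega>
          using X_init[OF that, of t] True by (auto simp: indicator_def)
        have "norm x0 ^ p \<le> 4 ^ p * norm x0 ^ p" using mult_right_mono[of 1 "4 ^ p" "norm x0 ^ p"] by simp
        also have "\<dots> \<le> 4 ^ p * (norm x0 ^ p + T ^ (p - 1) * (cf * B) + Cw * T ^ (r - 1) * (cg * B))"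
          using c0 B0 T Cw by (intro mult_left_mono) auto
        finally show "norm x0 ^ p \<le> C * (1 + T + m * exp (l * t) / l)" using tot by (simp add: B_def add.assoc)
      qed auto
    next
      case False
      then have t0: "0 < t" "t \<le> T" using t by auto
      let ?I = "\<lambda>u \<omega>. indicator (A R u) \<omega> :: real"
      have I_pow: "(?I u \<omega> * y) ^ p = ?I u \<omega> * y ^ p" for u \<omega> y using p by (auto simp: indicator_def power_0_left)
      have f1: "Ebd M (\<lambda>\<omega>. (LINT u:{0..t}|lborel. ?I u \<omega> * norm (\<phi> u \<omega>)) ^ p) ((t - 0) ^ (p - 1) * (cf * B))"
      proof (rule Ebd_time_integral)
        show "(\<lambda>(u, \<omega>). ?I u \<omega> * norm (\<phi> u \<omega>)) \<in> borel_measurable (borel \<Otimes>\<^sub>M M)" by measurable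
        show "set_integrable lborel {0..t} (\<lambda>u. ?I u \<omega> * norm (\<phi> u \<omega>))" if w: "\<omega> \<in> space M" for \<omega>
        proof (rule set_integrable_bound[OF \<phi>_integrable[OF w, of 0 t]])
          have "(\<lambda>u. ?I u \<omega>) \<in> borel_measurable borel" using measurable_compose[OF measurable_Pair2'[OF w] A_joint] by simp
          then show "set_borel_measurable lborel {0..t} (\<lambda>u. ?I u \<omega> * norm (\<phi> u \<omega>))"
            using \<phi>_path_measurable[OF w] unfolding set_borel_measurable_def by measurable
          show "AE u in lborel. u \<in> {0..t} \<longrightarrow> norm (?I u \<omega> * norm (\<phi> u \<omega>)) \<le> norm (\<phi> u \<omega>)" by (auto simp: indicator_def)
        qed
        show "Ebd M (\<lambda>\<omega>. (?I u \<omega> * norm (\<phi> u \<omega>)) ^ p) (cf * (1 + m * exp (l * u)))" if "u \<in> {0..t}" for u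
          unfolding I_pow cf_def
          by (rule localized_growth[OF p b l m]) (use that t0 KL \<phi>_growth in auto)
        show "(\<integral>\<^sup>+u\<in>{0..t}. ennreal (cf * (1 + m * exp (l * u))) \<partial>lborel) \<le> ennreal (cf * B)"
        proof (rule order_trans[OF nn_integral_exp_le])
          show "ennreal (cf * (t + m * exp (l * t) / l)) \<le> ennreal (cf * B)"
            unfolding B_def using t0 c0 by (intro ennreal_leI mult_left_mono add_right_mono) auto
        qed (use t0 m l c0 in auto)
      qed (use t0 p c0 B0 in auto)
      have f: "Ebd M (\<lambda>\<omega>. (?I t \<omega> * norm (LINT u:{0..t}|lborel. \<phi> u \<omega>)) ^ p) (T ^ (p - 1) * (cf * B))"
      proof (rule Ebd_mono[OF f1])
        show "(\<lambda>\<omega>. (?I t \<omega> * norm (LINT u:{0..t}|lborel. \<phi> u \<omega>)) ^ p) \<in> borel_measurable M"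
          unfolding set_lebesgue_integral_def by measurable
        show "(t - 0) ^ (p - 1) * (cf * B) \<le> T ^ (p - 1) * (cf * B)" using t0 c0 B0 by (intro mult_right_mono power_mono) auto
        fix \<omega> assume w: "\<omega> \<in> space M"
        have nn: "0 \<le> (LINT u:{0..t}|lborel. ?I u \<omega> * norm (\<phi> u \<omega>))"
          unfolding set_lebesgue_integral_def by (intro Bochner_Integration.integral_nonneg) auto
        have "?I t \<omega> * norm (LINT u:{0..t}|lborel. \<phi> u \<omega>) \<le> (LINT u:{0..t}|lborel. ?I u \<omega> * norm (\<phi> u \<omega>))"
        proof (cases "\<omega> \<in> A R t")
          case True
          have "norm (LINT u:{0..t}|lborel. \<phi> u \<omega>) \<le> (LINT u:{0..t}|lborel. norm (\<phi> u \<omega>))"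
            by (rule set_integral_norm_bound[OF \<phi>_integrable[OF w]])
          also have "\<dots> = (LINT u:{0..t}|lborel. ?I u \<omega> * norm (\<phi> u \<omega>))"
            by (rule set_lebesgue_integral_cong) (use True A_mono[of _ t R] in \<open>auto simp: indicator_def\<close>)
          finally show ?thesis using True by simp
        qed (use nn in simp)
        then show "(?I t \<omega> * norm (LINT u:{0..t}|lborel. \<phi> u \<omega>)) ^ p \<le> (LINT u:{0..t}|lborel. ?I u \<omega> * norm (\<phi> u \<omega>)) ^ p"
          by (intro power_mono) auto
      qed auto
      \<comment> \<open>The Riemann sums are formed with the integrand cut off at each grid time,
        which keeps it adapted. On \<open>A R t\<close> no cut-off is active, so there the sums
        agree with those of \<open>H\<close>.\<close>
      define Y where "Y u \<omega> = ?I u \<omega> *\<^sub>R H u \<omega>" for u \<omega>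
      have Ym: "Y u \<in> borel_measurable M" for u unfolding Y_def by measurable
      define S where "S n \<omega> = ?I t \<omega> *\<^sub>R riemann_sum (\<lambda>u. H u \<omega>) (\<lambda>u. W u \<omega>) 0 t (Suc n)" for n \<omega>
      have SY: "norm (S n \<omega>) \<le> norm (riemann_sum (\<lambda>u. Y u \<omega>) (\<lambda>u. W u \<omega>) 0 t (Suc n))" if w: "\<omega> \<in> space M" for n \<omega>
      proof (cases "\<omega> \<in> A R t")
        case True
        have "H (uniform_point 0 t (Suc n) i) \<omega> = Y (uniform_point 0 t (Suc n) i) \<omega>" if "i < Suc n" for i
          using True A_mono[of "uniform_point 0 t (Suc n) i" t R] uniform_point_props(5)[of 0 t "Suc n" i] t0 that by (auto simp: Y_def indicator_def)
        then show ?thesis using True by (simp add: S_def riemann_sum_def)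
      qed (simp add: S_def)
      have Sm: "S n \<in> borel_measurable M" for n
        unfolding S_def using riemann_measurable[of 0 t H "Suc n"] t0 by measurable
      have j: "Ebd M (\<lambda>\<omega>. norm (?I t \<omega> *\<^sub>R J 0 t \<omega>) ^ p) (Cw * T ^ (r - 1) * (cg * B))"
      proof (rule Ebd_conv_prob[where Y = S])
        show "conv_prob M S (\<lambda>\<omega>. ?I t \<omega> *\<^sub>R J 0 t \<omega>)"
        proof (rule conv_prob_dominated[where I = "{()}" and Y = "\<lambda>_ n \<omega>. riemann_sum (\<lambda>u. H u \<omega>) (\<lambda>u. W u \<omega>) 0 t (Suc n)" and Z = "\<lambda>_. J 0 t"])
          show "conv_prob M (\<lambda>n \<omega>. riemann_sum (\<lambda>u. H u \<omega>) (\<lambda>u. W u \<omega>) 0 t (Suc n)) (J 0 t)"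
            by (rule J_riemann) (use t0 in auto)
          show "(\<lambda>\<omega>. riemann_sum (\<lambda>u. H u \<omega>) (\<lambda>u. W u \<omega>) 0 t (Suc q)) \<in> borel_measurable M" for q
            by (rule riemann_measurable) (use t0 in auto)
          show "norm (S q \<omega> - ?I t \<omega> *\<^sub>R J 0 t \<omega>) \<le> (\<Sum>i\<in>{()}. norm (riemann_sum (\<lambda>u. H u \<omega>) (\<lambda>u. W u \<omega>) 0 t (Suc q) - J 0 t \<omega>))" for q \<omega>
            unfolding S_def by (auto simp: indicator_def)
        qed auto
        show "Ebd M (\<lambda>\<omega>. norm (S n \<omega>) ^ p) (Cw * T ^ (r - 1) * (cg * B))" for n
        proof (rule Ebd_mono)
          let ?u = "uniform_point 0 t (Suc n)"
          have uT: "?u i \<in> {0..T}" if "i < Suc n" for i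
            using uniform_point_props(4,5)[of 0 t "Suc n" i] t0 that by auto
          show "Ebd M (\<lambda>\<omega>. running_max (\<lambda>k. norm (\<Sum>i<k. Y (?u i) \<omega> *v (W (?u (Suc i)) \<omega> - W (?u i) \<omega>))) (Suc n) ^ (2 * r))
             (Cw * (t - 0) ^ r * (\<Sum>i<Suc n. cg * (1 + m * exp (l * ?u i))) / Suc n)"
          proof (rule ws[OF wiener_filtration_F])
            show "\<forall>i<Suc n. Y (?u i) \<in> borel_measurable (F (?u i))"
            proof (intro allI impI)
              fix i assume "i < Suc n"
              then have u0: "0 \<le> ?u i" using uT by auto
              have [measurable]: "H (?u i) \<in> borel_measurable (F (?u i))" "A R (?u i) \<in> sets (F (?u i))" using H_adapted[OF u0] A_sets_F[OF u0] by auto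
              show "Y (?u i) \<in> borel_measurable (F (?u i))" unfolding Y_def by measurable
            qed
            show "\<forall>i<Suc n. Ebd M (\<lambda>\<omega>. norm (Y (?u i) \<omega>) ^ (2 * r)) (cg * (1 + m * exp (l * ?u i)))"
            proof (intro allI impI)
              fix i assume i: "i < Suc n"
              have "norm (H (?u i) \<omega>) \<le> Kg * (1 + norm (X (?u i) \<omega>) + norm (X (?u i - \<tau>) \<omega>))" for \<omega>
                unfolding H_def by (rule g_growth[OF uT[OF i]])
              then have "Ebd M (\<lambda>\<omega>. ?I (?u i) \<omega> * norm (H (?u i) \<omega>) ^ p) (cg * (1 + m * exp (l * ?u i)))"
                unfolding cg_def by (intro localized_growth[OF p b l m uT[OF i]]) (use Kg_pos in auto)
              moreover have "norm (Y (?u i) \<omega>) ^ (2 * r) = ?I (?u i) \<omega> * norm (H (?u i) \<omega>) ^ p" for \<omega>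
                using I_pow[of "?u i" \<omega> "norm (H (?u i) \<omega>)"] by (simp add: Y_def p_def[symmetric])
              ultimately show "Ebd M (\<lambda>\<omega>. norm (Y (?u i) \<omega>) ^ (2 * r)) (cg * (1 + m * exp (l * ?u i)))" by simp
            qed
          qed (use t0 in auto)
          show "norm (S n \<omega>) ^ p \<le> running_max (\<lambda>k. norm (\<Sum>i<k. Y (?u i) \<omega> *v (W (?u (Suc i)) \<omega> - W (?u i) \<omega>))) (Suc n) ^ (2 * r)" if "\<omega> \<in> space M" for \<omega>
            unfolding p_def[symmetric]
          proof (intro power_mono norm_ge_zero order_trans[OF SY[OF that]])
            show "norm (riemann_sum (\<lambda>u. Y u \<omega>) (\<lambda>u. W u \<omega>) 0 t (Suc n)) \<le> running_max (\<lambda>k. norm (\<Sum>i<k. Y (?u i) \<omega> *v (W (?u (Suc i)) \<omega> - W (?u i) \<omega>))) (Suc n)"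
              unfolding riemann_sum_def by (rule running_max_ge[where s = "\<lambda>k. norm (\<Sum>i<k. Y (?u i) \<omega> *v (W (?u (Suc i)) \<omega> - W (?u i) \<omega>))", OF order_refl])
          qed
          have tr: "t ^ r = t ^ (r - 1) * t" using r by (cases r) auto
          have "Cw * (t - 0) ^ r * (\<Sum>i<Suc n. cg * (1 + m * exp (l * ?u i))) / Suc n
            = Cw * t ^ (r - 1) * (cg * (t * (\<Sum>i<Suc n. 1 + m * exp (l * ?u i)) / Suc n))"
            by (simp add: tr sum_distrib_left[symmetric] mult_ac del: sum.lessThan_Suc)
          also have "\<dots> \<le> Cw * t ^ (r - 1) * (cg * B)"
          proof (intro mult_left_mono)
            have "t * (\<Sum>i<Suc n. 1 + m * exp (l * ?u i)) / Suc n \<le> t + m * exp (l * t) / l"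
              by (rule riemann_exp_le) (use t0 m l in auto)
            also have "\<dots> \<le> B" using t0 by (simp add: B_def)
            finally show "t * (\<Sum>i<Suc n. 1 + m * exp (l * ?u i)) / Suc n \<le> B" .
          qed (use Cw c0 t0 in auto)
          also have "\<dots> \<le> Cw * T ^ (r - 1) * (cg * B)"
            using Cw c0 t0 B0 by (intro mult_right_mono mult_left_mono power_mono) auto
          finally show "Cw * (t - 0) ^ r * (\<Sum>i<Suc n. cg * (1 + m * exp (l * ?u i))) / Suc n \<le> Cw * T ^ (r - 1) * (cg * B)" .
        qed (use Sm in auto)
      qed (use Sm in auto)
      show ?thesis
      proof (rule Ebd_mono)
        show "Ebd M (\<lambda>\<omega>. 4 ^ p * (norm x0 ^ p + (?I t \<omega> * norm (LINT u:{0..t}|lborel. \<phi> u \<omega>)) ^ p + norm (?I t \<omega> *\<^sub>R J 0 t \<omega>) ^ p))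
          (4 ^ p * (norm x0 ^ p + T ^ (p - 1) * (cf * B) + Cw * T ^ (r - 1) * (cg * B)))"
          by (intro Ebd_cmult Ebd_add Ebd_const f j) auto
        show "4 ^ p * (norm x0 ^ p + T ^ (p - 1) * (cf * B) + Cw * T ^ (r - 1) * (cg * B)) \<le> C * (1 + T + m * exp (l * t) / l)"
          using tot by (simp add: B_def add.assoc)
        fix \<omega> assume w: "\<omega> \<in> space M"
        have eq: "X t \<omega> = x0 + (LINT u:{0..t}|lborel. \<phi> u \<omega>) + J 0 t \<omega>" using X_init[OF w, of 0] by (simp add: J_def)
        have "norm (X t \<omega>) \<le> norm x0 + norm (LINT u:{0..t}|lborel. \<phi> u \<omega>) + norm (J 0 t \<omega>)"
          unfolding eq using norm_triangle_ineq[of "x0 + (LINT u:{0..t}|lborel. \<phi> u \<omega>)" "J 0 t \<omega>"]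
            norm_triangle_ineq[of x0 "LINT u:{0..t}|lborel. \<phi> u \<omega>"] by linarith
        then have "(norm (X t \<omega>)) ^ p \<le> 4 ^ p * (norm x0 ^ p + norm (LINT u:{0..t}|lborel. \<phi> u \<omega>) ^ p + norm (J 0 t \<omega>) ^ p)"
          by (intro three_power_le) (use p in auto)
        then show "?I t \<omega> * norm (X t \<omega>) ^ p \<le> 4 ^ p * (norm x0 ^ p + (?I t \<omega> * norm (LINT u:{0..t}|lborel. \<phi> u \<omega>)) ^ p + norm (?I t \<omega> *\<^sub>R J 0 t \<omega>) ^ p)"
          by (auto simp: indicator_def)
      qed auto
    qed
  qed
  show ?thesis
  proof (intro exI[of _ C] conjI allI impI ballI)
    show "0 < C" by (rule Cpos)
  qed (rule main[unfolded p_def]; assumption)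
qed

text \<open>On \<open>A R t\<close> the moment is trivially at most R^p. Every use of
  \<open>localized_step\<close> halves the part of the bound that depends on \<open>R\<close>, so
  letting the number of uses grow removes \<open>R\<close>; afterwards \<open>R\<close> tends to
  infinity by Fatou's lemma. In this way no continuity of the moment in time is required.\<close>

lemma X_moment:
  assumes r: "1 \<le> r"
  shows "\<exists>C>0. \<forall>t\<le>T. Ebd M (\<lambda>\<omega>. norm (X t \<omega>) ^ (2 * r)) C"
proof -
  define p where "p = 2 * r"
  have p: "1 \<le> p" using r by (simp add: p_def)
  from localized_step[OF r] obtain C where C: "C > 0" and st: "\<forall>R l m. 0 < l \<longrightarrow> 0 \<le> m \<longrightarrow> localized_bound (2 * r) R l m \<longrightarrow>
    (\<forall>t\<in>{0..T}. Ebd M (\<lambda>\<omega>. indicator (A R t) \<omega> * norm (X t \<omega>) ^ (2 * r)) (C * (1 + T + m * exp (l * t) / l)))"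
    by (elim exE conjE) (rule that)
  note step = st[folded p_def, rule_format]
  define l where "l = 2 * C"
  define D where "D = 2 * C * (1 + T)"
  have l: "0 < l" and D: "0 < D" using C T by (auto simp: l_def D_def)
  text \<open>The choice of \<open>l\<close> makes the step a contraction of the weighted bound with fixed point \<open>D\<close>.\<close>
  have iter: "localized_bound p R l (D + R ^ p / 2 ^ k)" if R: "0 \<le> R" for R k
  proof (induction k)
    case 0
    have "Ebd M (\<lambda>\<omega>. indicator (A R t) \<omega> * norm (X t \<omega>) ^ p) ((D + R ^ p) * exp (l * t))" if t: "t \<in> {0..T}" for t
    proof (rule Ebd_mono)
      show "Ebd M (\<lambda>\<omega>. R ^ p) (R ^ p)" using R by (intro Ebd_const) auto
      show "indicator (A R t) \<omega> * norm (X t \<omega>) ^ p \<le> R ^ p" if "\<omega> \<in> space M" for \<omega>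
        using A_iff[OF that, of R t] R by (auto simp: indicator_def intro: power_mono)
      have "R ^ p * 1 \<le> (D + R ^ p) * exp (l * t)" using D l t R by (intro mult_mono) auto
      then show "R ^ p \<le> (D + R ^ p) * exp (l * t)" by simp
    qed auto
    then show ?case by (simp add: localized_bound_def)
  next
    case (Suc k)
    show ?case unfolding localized_bound_def
    proof
      fix t assume t: "t \<in> {0..T}"
      have e: "1 \<le> exp (l * t)" using l t by simp
      show "Ebd M (\<lambda>\<omega>. indicator (A R t) \<omega> * norm (X t \<omega>) ^ p) ((D + R ^ p / 2 ^ Suc k) * exp (l * t))"
      proof (rule Ebd_mono_const)
        show "Ebd M (\<lambda>\<omega>. indicator (A R t) \<omega> * norm (X t \<omega>) ^ p) (C * (1 + T + (D + R ^ p / 2 ^ k) * exp (l * t) / l))"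
          using Suc R D by (intro step l t) auto
        have "C * (1 + T + (D + R ^ p / 2 ^ k) * exp (l * t) / l) = C * (1 + T) + (D + R ^ p / 2 ^ k) / 2 * exp (l * t)"
          using C by (simp add: l_def field_simps)
        also have "\<dots> \<le> C * (1 + T) * exp (l * t) + (D + R ^ p / 2 ^ k) / 2 * exp (l * t)"
          using mult_left_mono[OF e, of "C * (1 + T)"] C T by simp
        also have "\<dots> = (D + R ^ p / 2 ^ Suc k) * exp (l * t)" by (simp add: D_def field_simps)
        finally show "C * (1 + T + (D + R ^ p / 2 ^ k) * exp (l * t) / l) \<le> (D + R ^ p / 2 ^ Suc k) * exp (l * t)" .
      qed
    qed
  qed
  \<comment> \<open>The second summand covers negative times, where the solution is
    \<open>x0\<close>.\<close>
  define E where "E = D * exp (l * T) + norm x0 ^ p"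
  have E: "0 < E" using D by (simp add: E_def add_pos_nonneg)
  have loc: "Ebd M (\<lambda>\<omega>. indicator (A R t) \<omega> * norm (X t \<omega>) ^ p) E" if R: "0 \<le> R" and t: "t \<in> {0..T}" for R t
  proof -
    have it: "Ebd M (\<lambda>\<omega>. indicator (A R t) \<omega> * norm (X t \<omega>) ^ p) ((D + R ^ p / 2 ^ k) * exp (l * t))" for k
      using iter[OF R, of k] t by (simp add: localized_bound_def)
    have "(\<lambda>k. (D + R ^ p * inverse (2 ^ k)) * exp (l * t)) \<longlonglongrightarrow> (D + R ^ p * 0) * exp (l * t)"
      by (intro tendsto_intros LIMSEQ_inverse_realpow_zero) auto
    then have lim: "(\<lambda>k. (D + R ^ p / 2 ^ k) * exp (l * t)) \<longlonglongrightarrow> D * exp (l * t)" by (simp add: divide_inverse)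
    have "integral\<^sup>L M (\<lambda>\<omega>. indicator (A R t) \<omega> * norm (X t \<omega>) ^ p) \<le> D * exp (l * t)"
      by (rule LIMSEQ_le_const[OF lim]) (use EbdD(4)[OF it] in blast)
    also have "\<dots> \<le> D * exp (l * T)" using D l t by (intro mult_left_mono) auto
    also have "\<dots> \<le> E" by (simp add: E_def)
    finally show ?thesis using EbdD(1,3)[OF it[of 0]] by (simp add: Ebd_def)
  qed
  have "Ebd M (\<lambda>\<omega>. norm (X t \<omega>) ^ p) E" if "t \<le> T" for t
  proof (cases "0 \<le> t")
    case True
    have "Ebd M (\<lambda>\<omega>. norm (X t \<omega>) ^ p) E"
    proof (rule Ebd_conv_prob[where Y = "\<lambda>k \<omega>. indicator (A (real k) t) \<omega> *\<^sub>R X t \<omega>"])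
      show "conv_prob M (\<lambda>k \<omega>. indicator (A (real k) t) \<omega> *\<^sub>R X t \<omega>) (X t)"
        unfolding conv_prob_def
      proof (intro allI impI measure_tendsto_zero)
        fix \<epsilon> :: real and \<omega> assume e: "0 < \<epsilon>" and w: "\<omega> \<in> space M"
        have "compact ((\<lambda>s. X s \<omega>) ` {0..t})" by (intro compact_continuous_image continuous_on_subset[OF X_cont[OF w]]) auto
        then have "bounded ((\<lambda>s. X s \<omega>) ` {0..t})" by (rule compact_imp_bounded)
        then obtain b where b: "\<And>s. s \<in> {0..t} \<Longrightarrow> norm (X s \<omega>) \<le> b" unfolding bounded_iff by blast
        have "\<omega> \<in> A (real k) t" if k: "nat \<lceil>max b (norm x0)\<rceil> \<le> k" for k
        proof -
          have "max b (norm x0) \<le> real k" using k by linarith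
          then have "norm (X s \<omega>) \<le> real k" if "s \<le> t" for s
            using b[of s] X_init[OF w, of s] that by (cases "s \<le> 0") auto
          then show ?thesis using A_iff[OF w] by blast
        qed
        then show "eventually (\<lambda>k. \<omega> \<notin> {\<omega> \<in> space M. norm (indicator (A (real k) t) \<omega> *\<^sub>R X t \<omega> - X t \<omega>) > \<epsilon>}) sequentially"
          using e by (intro eventually_sequentiallyI[of "nat \<lceil>max b (norm x0)\<rceil>"]) auto
      qed measurable
      show "Ebd M (\<lambda>\<omega>. norm (indicator (A (real k) t) \<omega> *\<^sub>R X t \<omega>) ^ p) E" for k
      proof (rule Ebd_mono[OF loc[of "real k" t]])
        show "norm (indicator (A (real k) t) \<omega> *\<^sub>R X t \<omega>) ^ p \<le> indicator (A (real k) t) \<omega> * norm (X t \<omega>) ^ p" for \<omega>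
          using p by (auto simp: indicator_def power_0_left)
      qed (use True that in auto)
    qed measurable
    then show ?thesis .
  next
    case False
    have "Ebd M (\<lambda>\<omega>. norm x0 ^ p) (norm x0 ^ p)" by (rule Ebd_const) simp
    then show ?thesis
      by (rule Ebd_mono) (use X_init[of _ t] False D in \<open>auto simp: E_def\<close>)
  qed
  then show ?thesis using E unfolding p_def by blast
qed

lemma growth_moment:
  assumes r: "1 \<le> r" and C: "\<And>t. t \<le> T \<Longrightarrow> Ebd M (\<lambda>\<omega>. norm (X t \<omega>) ^ (2 * r)) C" and u: "u \<le> T" and c: "0 \<le> c"
    and Y: "Y \<in> borel_measurable M" "\<And>\<omega>. norm (Y \<omega>) \<le> c * (1 + norm (X u \<omega>) + norm (X (u - \<tau>) \<omega>))"
  shows "Ebd M (\<lambda>\<omega>. norm (Y \<omega>) ^ (2 * r)) (c ^ (2 * r) * 4 ^ (2 * r) * (1 + C + C))"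
proof (rule Ebd_mono)
  show "Ebd M (\<lambda>\<omega>. c ^ (2 * r) * 4 ^ (2 * r) * (1 + norm (X u \<omega>) ^ (2 * r) + norm (X (u - \<tau>) \<omega>) ^ (2 * r))) (c ^ (2 * r) * 4 ^ (2 * r) * (1 + C + C))"
    by (intro Ebd_cmult Ebd_add Ebd_const C) (use u tau c in auto)
  show "norm (Y \<omega>) ^ (2 * r) \<le> c ^ (2 * r) * 4 ^ (2 * r) * (1 + norm (X u \<omega>) ^ (2 * r) + norm (X (u - \<tau>) \<omega>) ^ (2 * r))" for \<omega>
    by (rule growth_power_le) (use Y c r in auto)
qed (use Y in auto)

lemma \<phi>_moment:
  assumes r: "1 \<le> r"
  shows "\<exists>C>0. \<forall>t\<le>T. Ebd M (\<lambda>\<omega>. norm (\<phi> t \<omega>) ^ (2 * r)) C"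
proof -
  obtain C where C: "C > 0" "\<And>t. t \<le> T \<Longrightarrow> Ebd M (\<lambda>\<omega>. norm (X t \<omega>) ^ (2 * r)) C" using X_moment[OF r] by blast
  show ?thesis
    by (intro exI[of _ "(K + L) ^ (2 * r) * 4 ^ (2 * r) * (1 + C + C)"] conjI allI impI growth_moment[OF r C(2)])
      (use C KL \<phi>_growth in \<open>auto intro!: mult_pos_pos\<close>)
qed

lemma H_moment:
  assumes r: "1 \<le> r"
  shows "\<exists>C>0. \<forall>t\<in>{0..T}. Ebd M (\<lambda>\<omega>. norm (H t \<omega>) ^ (2 * r)) C"
proof -
  obtain C where C: "C > 0" "\<And>t. t \<le> T \<Longrightarrow> Ebd M (\<lambda>\<omega>. norm (X t \<omega>) ^ (2 * r)) C" using X_moment[OF r] by blast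
  show ?thesis
  proof (intro exI[of _ "Kg ^ (2 * r) * 4 ^ (2 * r) * (1 + C + C)"] conjI ballI)
    show "0 < Kg ^ (2 * r) * 4 ^ (2 * r) * (1 + C + C)" using C Kg_pos by (auto intro!: mult_pos_pos)
    fix t assume t: "t \<in> {0..T}"
    show "Ebd M (\<lambda>\<omega>. norm (H t \<omega>) ^ (2 * r)) (Kg ^ (2 * r) * 4 ^ (2 * r) * (1 + C + C))"
    proof (rule growth_moment[OF r C(2), where u = t])
      show "norm (H t \<omega>) \<le> Kg * (1 + norm (X t \<omega>) + norm (X (t - \<tau>) \<omega>))" for \<omega>
        unfolding H_def by (rule g_growth[OF t])
    qed (use t Kg_pos in auto)
  qed
qed

text \<open>The drift contributes the order 2r in the length of the interval, of which r suffices,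
  and the stochastic integral the order r. Negative times are included, with the constant initial
  value, because delayed arguments reach them.\<close>

lemma X_holder:
  assumes r: "1 \<le> r"
  shows "\<exists>C>0. \<forall>s t. s \<le> t \<longrightarrow> t \<le> T \<longrightarrow> Ebd M (\<lambda>\<omega>. norm (X t \<omega> - X s \<omega>) ^ (2 * r)) (C * (t - s) ^ r)"
proof -
  define p where "p = 2 * r"
  have p: "1 \<le> p" using r by (simp add: p_def)
  obtain Cw where Cw: "Cw > 0" and ws: "\<And>G a b n K (Y :: nat \<Rightarrow> 'a \<Rightarrow> real^'m^'d) B.
    wiener_filtration G \<Longrightarrow> 0 \<le> a \<Longrightarrow> a < b \<Longrightarrow> 0 < n \<Longrightarrow> K \<le> n \<Longrightarrow>
    (\<forall>l<K. Y l \<in> borel_measurable (G (uniform_point a b n l))) \<Longrightarrow>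
    (\<forall>l<K. Ebd M (\<lambda>\<omega>. norm (Y l \<omega>) ^ (2 * r)) (B l)) \<Longrightarrow>
    Ebd M (\<lambda>\<omega>. running_max (\<lambda>k. norm (\<Sum>l<k. Y l \<omega> *v
      (W (uniform_point a b n (Suc l)) \<omega> - W (uniform_point a b n l) \<omega>))) K ^ (2 * r)) (Cw * (b - a) ^ r * (\<Sum>l<K. B l) / n)"
    using wiener_sum_moment[OF r, where 'd = 'd] by blast
  obtain Cf where Cf: "Cf > 0" "\<And>t. t \<le> T \<Longrightarrow> Ebd M (\<lambda>\<omega>. norm (\<phi> t \<omega>) ^ p) Cf" using \<phi>_moment[OF r] unfolding p_def by blast
  obtain Ch where Ch: "Ch > 0" "\<And>t. t \<in> {0..T} \<Longrightarrow> Ebd M (\<lambda>\<omega>. norm (H t \<omega>) ^ p) Ch" using H_moment[OF r] unfolding p_def by blast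
  define C where "C = 2 ^ p * (T ^ r * Cf + Cw * Ch)"
  have Cpos: "0 < C" using Cf Ch Cw T by (auto simp: C_def intro!: mult_pos_pos add_pos_pos)
  have main: "Ebd M (\<lambda>\<omega>. norm (X t \<omega> - X s \<omega>) ^ p) (C * (t - s) ^ r)" if st: "0 \<le> s" "s < t" "t \<le> T" for s t
  proof -
    have tr: "(t - s) ^ p = (t - s) ^ r * (t - s) ^ r" by (simp add: p_def power_add mult_2)
    have f1: "Ebd M (\<lambda>\<omega>. (LINT u:{s..t}|lborel. norm (\<phi> u \<omega>)) ^ p) ((t - s) ^ (p - 1) * (Cf * (t - s)))"
    proof (rule Ebd_time_integral)
      show "set_integrable lborel {s..t} (\<lambda>u. norm (\<phi> u \<omega>))" if w: "\<omega> \<in> space M" for \<omega>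
        by (rule set_integrable_norm[OF \<phi>_integrable[OF w]])
      show "(\<integral>\<^sup>+u\<in>{s..t}. ennreal Cf \<partial>lborel) \<le> ennreal (Cf * (t - s))"
        using st Cf by (simp add: nn_integral_cmult_indicator ennreal_mult)
    qed (use st p Cf in auto)
    have f: "Ebd M (\<lambda>\<omega>. norm (LINT u:{s..t}|lborel. \<phi> u \<omega>) ^ p) (T ^ r * Cf * (t - s) ^ r)"
    proof (rule Ebd_mono[OF f1])
      show "(\<lambda>\<omega>. norm (LINT u:{s..t}|lborel. \<phi> u \<omega>) ^ p) \<in> borel_measurable M"
        unfolding set_lebesgue_integral_def by measurable
      show "norm (LINT u:{s..t}|lborel. \<phi> u \<omega>) ^ p \<le> (LINT u:{s..t}|lborel. norm (\<phi> u \<omega>)) ^ p" if "\<omega> \<in> space M" for \<omega>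
        by (intro power_mono set_integral_norm_bound \<phi>_integrable that) auto
      have "(t - s) ^ (p - 1) * (Cf * (t - s)) = Cf * (t - s) ^ p" using p by (cases p) auto
      also have "\<dots> \<le> Cf * (T ^ r * (t - s) ^ r)" unfolding tr using st Cf by (intro mult_left_mono mult_right_mono power_mono) auto
      finally show "(t - s) ^ (p - 1) * (Cf * (t - s)) \<le> T ^ r * Cf * (t - s) ^ r" by (simp add: mult_ac)
    qed auto
    have j: "Ebd M (\<lambda>\<omega>. norm (J s t \<omega>) ^ p) (Cw * Ch * (t - s) ^ r)"
    proof (rule Ebd_conv_prob[OF J_riemann[OF st]])
      show "(\<lambda>\<omega>. riemann_sum (\<lambda>u. H u \<omega>) (\<lambda>u. W u \<omega>) s t (Suc n)) \<in> borel_measurable M" for n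
        by (rule riemann_measurable) (use st in auto)
      fix n
      let ?u = "uniform_point s t (Suc n)"
      have uT: "?u i \<in> {0..T}" if "i < Suc n" for i
        using uniform_point_props(4,5)[of s t "Suc n" i] st that by auto
      show "Ebd M (\<lambda>\<omega>. norm (riemann_sum (\<lambda>u. H u \<omega>) (\<lambda>u. W u \<omega>) s t (Suc n)) ^ p) (Cw * Ch * (t - s) ^ r)"
      proof (rule Ebd_mono)
        show "Ebd M (\<lambda>\<omega>. running_max (\<lambda>k. norm (\<Sum>i<k. H (?u i) \<omega> *v (W (?u (Suc i)) \<omega> - W (?u i) \<omega>))) (Suc n) ^ (2 * r))
             (Cw * (t - s) ^ r * (\<Sum>i<Suc n. Ch) / Suc n)"
          by (rule ws[OF wiener_filtration_F]) (use st uT H_adapted Ch in \<open>auto simp: p_def\<close>)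
        show "norm (riemann_sum (\<lambda>u. H u \<omega>) (\<lambda>u. W u \<omega>) s t (Suc n)) ^ p \<le> running_max (\<lambda>k. norm (\<Sum>i<k. H (?u i) \<omega> *v (W (?u (Suc i)) \<omega> - W (?u i) \<omega>))) (Suc n) ^ (2 * r)" for \<omega>
          unfolding p_def[symmetric] riemann_sum_def
          by (intro power_mono norm_ge_zero running_max_ge[where s = "\<lambda>k. norm (\<Sum>i<k. H (?u i) \<omega> *v (W (?u (Suc i)) \<omega> - W (?u i) \<omega>))", OF order_refl])
        show "(\<lambda>\<omega>. norm (riemann_sum (\<lambda>u. H u \<omega>) (\<lambda>u. W u \<omega>) s t (Suc n)) ^ p) \<in> borel_measurable M"
          using riemann_measurable[of s t H "Suc n"] st by measurable
      qed (auto simp: mult_ac)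
    qed auto
    show ?thesis
    proof (rule Ebd_mono)
      show "Ebd M (\<lambda>\<omega>. 2 ^ p * (norm (LINT u:{s..t}|lborel. \<phi> u \<omega>) ^ p + norm (J s t \<omega>) ^ p)) (2 ^ p * (T ^ r * Cf * (t - s) ^ r + Cw * Ch * (t - s) ^ r))"
        by (intro Ebd_cmult Ebd_add f j) auto
      fix \<omega>
      have "norm (X t \<omega> - X s \<omega>) ^ p \<le> (norm (LINT u:{s..t}|lborel. \<phi> u \<omega>) + norm (J s t \<omega>)) ^ p"
        using norm_triangle_ineq[of "LINT u:{s..t}|lborel. \<phi> u \<omega>" "J s t \<omega>"] by (intro power_mono) (auto simp: J_def)
      also have "\<dots> \<le> 2 ^ p * (norm (LINT u:{s..t}|lborel. \<phi> u \<omega>) ^ p + norm (J s t \<omega>) ^ p)"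
        by (rule power_add_le) (use p in auto)
      finally show "norm (X t \<omega> - X s \<omega>) ^ p \<le> 2 ^ p * (norm (LINT u:{s..t}|lborel. \<phi> u \<omega>) ^ p + norm (J s t \<omega>) ^ p)" .
    qed (auto simp: C_def algebra_simps)
  qed
  have "Ebd M (\<lambda>\<omega>. norm (X t \<omega> - X s \<omega>) ^ p) (C * (t - s) ^ r)" if st: "s \<le> t" "t \<le> T" for s t
  proof (cases "max 0 s < t")
    case True
    show ?thesis
    proof (rule Ebd_mono[OF main[of "max 0 s" t]])
      have X0: "X s \<omega> = X (max 0 s) \<omega>" if "\<omega> \<in> space M" for \<omega>
        using X_init[OF that, of s] X_init[OF that, of 0] by (auto simp: max_def)
      then show "norm (X t \<omega> - X s \<omega>) ^ p \<le> norm (X t \<omega> - X (max 0 s) \<omega>) ^ p" if "\<omega> \<in> space M" for \<omega> using that by simp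
      show "C * (t - max 0 s) ^ r \<le> C * (t - s) ^ r" using True Cpos by (intro mult_left_mono power_mono) auto
    qed (use True st in auto)
  next
    case False
    have "X t \<omega> = X s \<omega>" if "\<omega> \<in> space M" for \<omega>
      using X_init[OF that, of s] X_init[OF that, of t] False st by (cases "t = s") (auto simp: max_def split: if_splits)
    moreover have "Ebd M (\<lambda>\<omega>. 0) 0" by (rule Ebd_const) simp
    ultimately show ?thesis
      by (elim Ebd_mono) (use Cpos st p in \<open>auto simp: power_0_left\<close>)
  qed
  then show ?thesis using Cpos unfolding p_def by blast
qed

end

section \<open>The randomized scheme\<close>

text \<open>Lets a moment bound that is uniform in a deterministic time be used at an independent
  random time.\<close>

lemma (in prob_space) Ebd_freeze:
  fixes Z :: "'a \<Rightarrow> real" and \<Phi> :: "real \<times> 'a \<Rightarrow> real"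
  assumes ind: "indep_of M G Z" and m[measurable]: "\<Phi> \<in> borel_measurable (borel \<Otimes>\<^sub>M G)"
    and nn: "\<And>x. 0 \<le> \<Phi> x" and b: "\<And>z. Ebd M (\<lambda>\<omega>. \<Phi> (z, \<omega>)) b"
  shows "Ebd M (\<lambda>\<omega>. \<Phi> (Z \<omega>, \<omega>)) b"
proof -
  have sub: "subalgebra M G" and Z[measurable]: "Z \<in> borel_measurable M" using ind by (auto simp: indep_of_def)
  note [measurable] = subalgebra_id_measurable[OF sub]
  interpret Z: prob_space "distr M borel Z" by (rule prob_space_distr) simp
  have b0: "0 \<le> b" using EbdD(5)[OF b] .
  have mm: "(\<lambda>\<omega>. \<Phi> (Z \<omega>, \<omega>)) \<in> borel_measurable M" by measurable
  have "(\<integral>\<^sup>+\<omega>. ennreal (\<Phi> (Z \<omega>, \<omega>)) \<partial>M) = (\<integral>\<^sup>+z. (\<integral>\<^sup>+\<omega>. ennreal (\<Phi> (z, \<omega>)) \<partial>M) \<partial>distr M borel Z)"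
    by (rule indep_of_nn_integral[OF ind, of "\<lambda>x. ennreal (\<Phi> x)"]) simp
  also have "\<dots> \<le> (\<integral>\<^sup>+z. ennreal b \<partial>distr M borel Z)"
  proof (rule nn_integral_mono)
    fix z
    have "(\<lambda>\<omega>. \<Phi> (z, \<omega>)) \<in> borel_measurable M" using EbdD(2)[OF b] .
    then show "(\<integral>\<^sup>+\<omega>. ennreal (\<Phi> (z, \<omega>)) \<partial>M) \<le> ennreal b" using b[of z] nn b0 by (subst Ebd_nn_integral[symmetric]) auto
  qed
  also have "\<dots> = ennreal b" using Z.emeasure_space_1 by simp
  finally show ?thesis using mm nn b0 by (subst Ebd_nn_integral) auto
qed

text \<open>\<open>G u\<close> stands for \<open>F u\<close> joined with all sampling points,
  \<open>Q j k\<close> for the whole filtration joined with all sampling points except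
  \<open>\<gamma> j k\<close>; only the measurability and independence that the estimates use are
  recorded. The range of the sampling points is prescribed everywhere, which the theorem achieves by
  clamping them.\<close>

locale randomized_sdde = sdde M F W f g \<tau> \<rho> \<alpha>1 \<alpha>2 T K L x0 X
  for M :: "'a measure" and F and W :: "real \<Rightarrow> 'a \<Rightarrow> real^'m"
    and f :: "real \<Rightarrow> real^'d \<Rightarrow> real^'d \<Rightarrow> real^'d"
    and g :: "real \<Rightarrow> real^'d \<Rightarrow> real^'d \<Rightarrow> real^'m^'d"
    and \<tau> \<rho> \<alpha>1 \<alpha>2 T K L :: real and x0 :: "real^'d" and X :: "real \<Rightarrow> 'a \<Rightarrow> real^'d" +
  fixes \<gamma> :: "nat \<Rightarrow> nat \<Rightarrow> 'a \<Rightarrow> real" and G :: "real \<Rightarrow> 'a measure" and Q :: "nat \<Rightarrow> nat \<Rightarrow> 'a measure"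
  assumes \<gamma>_range: "0 \<le> \<gamma> j k \<omega>" "\<gamma> j k \<omega> \<le> 1"
    and \<gamma>_distr: "1 \<le> k \<Longrightarrow> distr M borel (\<gamma> j k) = density lborel (indicator {0..1})"
    and G_wiener: "wiener_filtration G"
    and G_F: "0 \<le> u \<Longrightarrow> subalgebra (G u) (F u)"
    and G_\<gamma>: "0 \<le> u \<Longrightarrow> 1 \<le> k \<Longrightarrow> \<gamma> j k \<in> borel_measurable (G u)"
    and Q_X: "X s \<in> borel_measurable (Q j k)"
    and Q_\<gamma>: "1 \<le> l \<Longrightarrow> l < k \<Longrightarrow> \<gamma> j l \<in> borel_measurable (Q j k)"
    and Q_indep: "1 \<le> k \<Longrightarrow> indep_of M (Q j k) (\<gamma> j k)"
begin

lemma G_sub: "0 \<le> u \<Longrightarrow> subalgebra M (G u)"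
proof -
  assume "0 \<le> u"
  then have "indep_of M (G u) (\<lambda>\<omega>. W (u + 1) \<omega> - W u \<omega>)" using G_wiener by (auto simp: wiener_filtration_def)
  then show ?thesis by (simp add: indep_of_def)
qed

lemma G_mono: "0 \<le> u \<Longrightarrow> u \<le> v \<Longrightarrow> h \<in> measurable (G u) N \<Longrightarrow> h \<in> measurable (G v) N"
  using G_wiener unfolding wiener_filtration_def by (blast intro: subalgebra_measurable)

lemma G_W: "0 \<le> u \<Longrightarrow> u \<le> v \<Longrightarrow> W u \<in> borel_measurable (G v)"
  using G_mono[of u v "W u" borel] G_wiener unfolding wiener_filtration_def by blast

lemma Q_sub: "1 \<le> k \<Longrightarrow> subalgebra M (Q j k)"
  using Q_indep by (auto simp: indep_of_def)

lemma \<gamma>_measurable: "1 \<le> k \<Longrightarrow> \<gamma> j k \<in> borel_measurable M"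
  using Q_indep by (auto simp: indep_of_def)

definition h :: "nat \<Rightarrow> real" where "h N = \<tau> / real N"

abbreviation t :: "nat \<Rightarrow> nat \<Rightarrow> nat \<Rightarrow> real" where "t \<equiv> grid_time \<tau>"

lemma h_pos: "0 < N \<Longrightarrow> 0 < h N"
  using tau by (simp add: h_def)

lemma t_Suc: "t N j (Suc k) = t N j k + h N"
  by (simp add: grid_time_def h_def algebra_simps add_divide_distrib)

lemma t_0: "t N j 0 = real j * \<tau>"
  by (simp add: grid_time_def)

lemma t_N: "0 < N \<Longrightarrow> t N j N = t N (Suc j) 0"
  by (simp add: grid_time_def algebra_simps)

lemma t_shift: "t N (Suc j) k - \<tau> = t N j k"
  by (simp add: grid_time_def algebra_simps)

lemma t_nonneg: "0 \<le> t N j k"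
  using tau by (simp add: grid_time_def)

lemma t_mono: "k \<le> l \<Longrightarrow> t N j k \<le> t N j l"
  using tau by (auto simp: grid_time_def intro!: divide_right_mono mult_right_mono)

lemma t_le:
  assumes "0 < N" "k \<le> N" "real (Suc j) * \<tau> \<le> T"
  shows "t N j k \<le> T"
  using t_mono[OF assms(2), of N j] t_N[OF assms(1), of j] t_0[of N "Suc j"] assms(3) by simp

definition \<theta> :: "nat \<Rightarrow> nat \<Rightarrow> nat \<Rightarrow> 'a \<Rightarrow> real" where
  "\<theta> N j k \<omega> = t N j k + h N * \<gamma> j (Suc k) \<omega>"

lemma Ebd_randomized:
  assumes N: "0 < N" and \<Psi>: "(\<lambda>(s, \<omega>). \<Psi> s \<omega>) \<in> borel_measurable (borel \<Otimes>\<^sub>M Q j (Suc k))"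
    and nn: "\<And>s \<omega>. 0 \<le> \<Psi> s \<omega>" and b: "\<And>s. s \<in> {t N j k..t N j k + h N} \<Longrightarrow> Ebd M (\<Psi> s) b"
  shows "Ebd M (\<lambda>\<omega>. \<Psi> (\<theta> N j k \<omega>) \<omega>) b"
proof -
  \<comment> \<open>\<open>Ebd_freeze\<close> asks for the bound at every real \<open>z\<close>, but
    it is available inside the cell only. Clamping closes the gap and does not change the sampling
    point.\<close>
  define cl where "cl z = max 0 (min 1 z)" for z :: real
  have cl: "cl (\<gamma> j (Suc k) \<omega>) = \<gamma> j (Suc k) \<omega>" for \<omega> using \<gamma>_range[of j "Suc k" \<omega>] by (simp add: cl_def)
  have "Ebd M (\<lambda>\<omega>. (\<lambda>(z, \<omega>). \<Psi> (t N j k + h N * cl z) \<omega>) (\<gamma> j (Suc k) \<omega>, \<omega>)) b"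
  proof (rule Ebd_freeze[OF Q_indep])
    have "(\<lambda>p. (t N j k + h N * cl (fst p), snd p)) \<in> borel \<Otimes>\<^sub>M Q j (Suc k) \<rightarrow>\<^sub>M borel \<Otimes>\<^sub>M Q j (Suc k)"
      unfolding cl_def by measurable
    from measurable_compose[OF this \<Psi>]
    show "(\<lambda>(z, \<omega>). \<Psi> (t N j k + h N * cl z) \<omega>) \<in> borel_measurable (borel \<Otimes>\<^sub>M Q j (Suc k))" by (simp add: split_beta')
    show "Ebd M (\<lambda>\<omega>. (\<lambda>(z, \<omega>). \<Psi> (t N j k + h N * cl z) \<omega>) (z, \<omega>)) b" for z
    proof -
      have "0 \<le> h N * cl z" "h N * cl z \<le> h N * 1" using h_pos[OF N] by (auto simp: cl_def intro!: mult_left_mono)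
      then have "t N j k + h N * cl z \<in> {t N j k..t N j k + h N}" by simp
      from b[OF this] show ?thesis by simp
    qed
  qed (use nn in auto)
  then show ?thesis by (simp add: cl \<theta>_def)
qed

definition quad_err :: "nat \<Rightarrow> nat \<Rightarrow> nat \<Rightarrow> 'a \<Rightarrow> real^'d" where
  "quad_err N j k \<omega> = (LINT s:{t N j k..t N j (Suc k)}|lborel. \<phi> s \<omega>) - h N *\<^sub>R \<phi> (\<theta> N j k \<omega>) \<omega>"

lemma Q_\<phi>: "1 \<le> k \<Longrightarrow> (\<lambda>(s, \<omega>). \<phi> s \<omega>) \<in> borel_measurable (borel \<Otimes>\<^sub>M Q j k)"
  by (rule \<phi>_joint) (use Q_X Q_sub[of k j] in \<open>auto simp: subalgebra_def\<close>)

lemma Q_integral_\<phi>: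
  assumes "1 \<le> k"
  shows "(\<lambda>\<omega>. LINT s:{a..b}|lborel. \<phi> s \<omega>) \<in> borel_measurable (Q j k)"
proof -
  have [measurable]: "(\<lambda>p. \<phi> (snd p) (fst p)) \<in> borel_measurable (Q j k \<Otimes>\<^sub>M borel)"
    using measurable_pair_swap[OF Q_\<phi>[OF assms]] by (simp add: split_beta' comp_def)
  have "(\<lambda>\<omega>. \<integral>s. (\<lambda>p. indicator {a..b} (snd p) *\<^sub>R \<phi> (snd p) (fst p)) (\<omega>, s) \<partial>lborel) \<in> borel_measurable (Q j k)"
    by (rule sigma_finite_measure.borel_measurable_lebesgue_integral[OF sigma_finite_lborel]) (simp add: split_beta')
  then show ?thesis by (simp add: set_lebesgue_integral_def)
qed

text \<open>An affine change of variables: the drift sampled at a uniform point of a cell, times the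
  length of the cell, has the integral over the cell as its mean.\<close>

lemma uniform_integral:
  fixes \<psi> :: "real \<Rightarrow> real"
  assumes [measurable]: "\<psi> \<in> borel_measurable borel" and c: "0 < c"
  shows "c * (\<integral>z. \<psi> (a + c * z) \<partial>density lborel (indicator {0..1})) = (LINT s:{a..a + c}|lborel. \<psi> s)"
proof -
  have "(\<integral>z. \<psi> (a + c * z) \<partial>density lborel (\<lambda>z. ennreal (indicator {0..1} z))) = (\<integral>z. indicator {0..1} z *\<^sub>R \<psi> (a + c * z) \<partial>lborel)"
    by (rule integral_density) auto
  moreover have "density lborel (\<lambda>z. ennreal (indicator {0..1::real} z)) = density lborel (indicator {0..1})"
    by (rule arg_cong[where f = "density lborel"]) (auto simp: indicator_def)
  moreover have "(LINT s:{a..a + c}|lborel. \<psi> s) = \<bar>c\<bar> *\<^sub>R (\<integral>z. indicator {a..a + c} (a + c * z) *\<^sub>R \<psi> (a + c * z) \<partial>lborel)"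
    unfolding set_lebesgue_integral_def by (rule lborel_integral_real_affine) (use c in auto)
  moreover have "indicator {a..a + c} (a + c * z) = (indicator {0..1} z :: real)" for z
    using c by (auto simp: indicator_def zero_le_mult_iff mult_le_cancel_left1 not_le)
  ultimately show ?thesis using c by simp
qed

text \<open>Given \<open>Q j (Suc k)\<close>, the path of the solution is known while the next
  sampling point is still uniform, so freezing the path leaves exactly the mean computed in
  \<open>uniform_integral\<close>.\<close>

lemma quad_err_mart_diff:
  assumes N: "0 < N"
  shows "mart_diff M (Q j (Suc k)) (quad_err N j k)"
proof -
  define d where "d = (\<lambda>(z, \<omega>). (LINT s:{t N j k..t N j (Suc k)}|lborel. \<phi> s \<omega>) - h N *\<^sub>R \<phi> (t N j k + h N * z) \<omega>)"
  have "mart_diff M (Q j (Suc k)) (\<lambda>\<omega>. d (\<gamma> j (Suc k) \<omega>, \<omega>))"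
  proof (rule mart_diffI[OF Q_indep])
    have "(\<lambda>p. (t N j k + h N * fst p, snd p)) \<in> borel \<Otimes>\<^sub>M Q j (Suc k) \<rightarrow>\<^sub>M borel \<Otimes>\<^sub>M Q j (Suc k)" by measurable
    from measurable_compose[OF this Q_\<phi>]
    have 1: "(\<lambda>p. \<phi> (t N j k + h N * fst p) (snd p)) \<in> borel_measurable (borel \<Otimes>\<^sub>M Q j (Suc k))" by simp
    have 2: "(\<lambda>p. LINT s:{t N j k..t N j (Suc k)}|lborel. \<phi> s (snd p)) \<in> borel_measurable (borel \<Otimes>\<^sub>M Q j (Suc k))"
      by (rule measurable_compose[OF measurable_snd Q_integral_\<phi>]) simp
    show "d \<in> borel_measurable (borel \<Otimes>\<^sub>M Q j (Suc k))"
      unfolding d_def split_beta' by (intro borel_measurable_diff borel_measurable_scaleR 1 2 borel_measurable_const)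
    fix v :: "real^'d" and \<omega> assume w: "\<omega> \<in> space M"
    have [measurable]: "(\<lambda>s. \<phi> s \<omega>) \<in> borel_measurable borel" by (rule \<phi>_path_measurable[OF w])
    interpret Z: prob_space "distr M borel (\<gamma> j (Suc k))" by (rule prob_space_distr) (use \<gamma>_measurable in auto)
    let ?D = "density lborel (indicator {0..1::real}) :: real measure"
    have D: "distr M borel (\<gamma> j (Suc k)) = ?D" by (rule \<gamma>_distr) simp
    interpret D: prob_space ?D using Z.prob_space_axioms unfolding D .
    define c where "c = inner v (LINT s:{t N j k..t N j (Suc k)}|lborel. \<phi> s \<omega>)"
    have c: "c = (LINT s:{t N j k..t N j k + h N}|lborel. inner v (\<phi> s \<omega>))"
      unfolding c_def t_Suc using \<phi>_integrable[OF w, of "t N j k" "t N j k + h N"]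
      unfolding set_lebesgue_integral_def set_integrable_def by (subst integral_inner_right[symmetric]) auto
    have hc: "h N * (\<integral>z. inner v (\<phi> (t N j k + h N * z) \<omega>) \<partial>?D) = c"
      unfolding c by (rule uniform_integral) (use h_pos[OF N] in auto)
    show "(\<integral>z. inner v (d (z, \<omega>)) \<partial>distr M borel (\<gamma> j (Suc k))) = 0"
    proof (cases "integrable ?D (\<lambda>z. inner v (\<phi> (t N j k + h N * z) \<omega>))")
      case True
      have "(\<integral>z. inner v (d (z, \<omega>)) \<partial>?D) = (\<integral>z. c - h N * inner v (\<phi> (t N j k + h N * z) \<omega>) \<partial>?D)"
        by (simp add: d_def c_def inner_diff_right)
      also have "\<dots> = c - h N * (\<integral>z. inner v (\<phi> (t N j k + h N * z) \<omega>) \<partial>?D)"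
        using True D.prob_space by (simp add: Bochner_Integration.integral_diff)
      finally show ?thesis using hc unfolding D by simp
    next
      \<comment> \<open>Then the integrand of the claim is not integrable either, and its integral
        is 0 by convention.\<close>
      case False
      have "\<not> integrable ?D (\<lambda>z. inner v (d (z, \<omega>)))"
      proof
        assume "integrable ?D (\<lambda>z. inner v (d (z, \<omega>)))"
        then have "integrable ?D (\<lambda>z. (1 / h N) * (c - inner v (d (z, \<omega>))))" by (intro integrable_mult_right Bochner_Integration.integrable_diff) auto
        moreover have "(1 / h N) * (c - inner v (d (z, \<omega>))) = inner v (\<phi> (t N j k + h N * z) \<omega>)" for z
          using h_pos[OF N] by (simp add: d_def c_def inner_diff_right)
        ultimately show False using False by simp
      qed
      then show ?thesis unfolding D by (rule not_integrable_integral_eq)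
    qed
  qed auto
  then show ?thesis by (simp add: d_def quad_err_def[abs_def] \<theta>_def)
qed

lemma quad_err_adapted:
  assumes "k < i"
  shows "quad_err N j k \<in> borel_measurable (Q j (Suc i))"
proof -
  have [measurable]: "\<gamma> j (Suc k) \<in> borel_measurable (Q j (Suc i))" by (rule Q_\<gamma>) (use assms in auto)
  have "(\<lambda>\<omega>. (\<theta> N j k \<omega>, \<omega>)) \<in> Q j (Suc i) \<rightarrow>\<^sub>M borel \<Otimes>\<^sub>M Q j (Suc i)" unfolding \<theta>_def by measurable
  from measurable_compose[OF this Q_\<phi>] have 1: "(\<lambda>\<omega>. \<phi> (\<theta> N j k \<omega>) \<omega>) \<in> borel_measurable (Q j (Suc i))" by simp
  show ?thesis unfolding quad_err_def[abs_def]
    by (intro borel_measurable_diff borel_measurable_scaleR Q_integral_\<phi> 1 borel_measurable_const) auto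
qed

text \<open>Each error has a 2r-th moment of order h^(2r). One factor h^r = (\<tau> / N)^r supplies
  the normalisation N^-r of \<open>martingale_moment\<close>; the other remains in the bound and is
  the order 1/2.\<close>

lemma quad_moment:
  assumes r: "1 \<le> r"
  shows "\<exists>C>0. \<forall>N j. 0 < N \<longrightarrow> real (Suc j) * \<tau> \<le> T \<longrightarrow>
    Ebd M (\<lambda>\<omega>. running_max (\<lambda>k. norm (\<Sum>i<k. quad_err N j i \<omega>)) N ^ (2 * r)) (C * h N ^ r)"
proof -
  obtain C where C: "C > 0" and mm: "\<And>n K (D :: nat \<Rightarrow> 'a \<Rightarrow> real^'d) G B. 0 < n \<Longrightarrow> K \<le> n \<Longrightarrow>
    (\<forall>i<K. mart_diff M (G i) (D i)) \<Longrightarrow> (\<forall>i<K. \<forall>l<i. D l \<in> borel_measurable (G i)) \<Longrightarrow>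
    (\<forall>i<K. Ebd M (\<lambda>\<omega>. norm (D i \<omega>) ^ (2 * r)) (B i / real n ^ r)) \<Longrightarrow>
    Ebd M (\<lambda>\<omega>. running_max (\<lambda>k. norm (\<Sum>i<k. D i \<omega>)) K ^ (2 * r)) (C * (\<Sum>i<K. B i) / real n)"
    using martingale_moment[OF r, where 'b = "real^'d"] by blast
  obtain Cf where Cf: "Cf > 0" "\<And>s. s \<le> T \<Longrightarrow> Ebd M (\<lambda>\<omega>. norm (\<phi> s \<omega>) ^ (2 * r)) Cf" using \<phi>_moment[OF r] by blast
  define p where "p = 2 * r"
  have p: "1 \<le> p" using r by (simp add: p_def)
  define B where "B N = 2 ^ p * (2 * Cf) * \<tau> ^ r * h N ^ r" for N
  have main: "Ebd M (\<lambda>\<omega>. running_max (\<lambda>k. norm (\<Sum>i<k. quad_err N j i \<omega>)) N ^ (2 * r)) (C * (2 ^ p * (2 * Cf) * \<tau> ^ r) * h N ^ r)"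
    if N: "0 < N" and j: "real (Suc j) * \<tau> \<le> T" for N j
  proof -
    have tT: "t N j k \<le> T" if "k \<le> N" for k by (rule t_le[OF N that j])
    have bd: "Ebd M (\<lambda>\<omega>. norm (quad_err N j i \<omega>) ^ p) (B N / real N ^ r)" if i: "i < N" for i
    proof -
      have sT: "s \<le> T" if "s \<in> {t N j i..t N j i + h N}" for s
        using tT[of "Suc i"] that i by (simp add: t_Suc)
      have 1: "Ebd M (\<lambda>\<omega>. (LINT s:{t N j i..t N j (Suc i)}|lborel. norm (\<phi> s \<omega>)) ^ p) ((t N j (Suc i) - t N j i) ^ (p - 1) * (Cf * h N))"
      proof (rule Ebd_time_integral)
        show "set_integrable lborel {t N j i..t N j (Suc i)} (\<lambda>u. norm (\<phi> u \<omega>))" if w: "\<omega> \<in> space M" for \<omega>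
          by (rule set_integrable_norm[OF \<phi>_integrable[OF w]])
        show "(\<integral>\<^sup>+u\<in>{t N j i..t N j (Suc i)}. ennreal Cf \<partial>lborel) \<le> ennreal (Cf * h N)"
          using h_pos[OF N] Cf by (simp add: nn_integral_cmult_indicator ennreal_mult t_Suc)
        show "Ebd M (\<lambda>\<omega>. norm (\<phi> u \<omega>) ^ p) Cf" if "u \<in> {t N j i..t N j (Suc i)}" for u
          unfolding p_def by (rule Cf(2)) (use sT that in \<open>simp add: t_Suc\<close>)
      qed (use h_pos[OF N] p Cf in \<open>auto simp: t_Suc\<close>)
      have 1: "Ebd M (\<lambda>\<omega>. norm (LINT s:{t N j i..t N j (Suc i)}|lborel. \<phi> s \<omega>) ^ p) (h N ^ p * Cf)"
      proof (rule Ebd_mono[OF 1])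
        show "(\<lambda>\<omega>. norm (LINT s:{t N j i..t N j (Suc i)}|lborel. \<phi> s \<omega>) ^ p) \<in> borel_measurable M"
          unfolding set_lebesgue_integral_def by measurable
        show "norm (LINT s:{t N j i..t N j (Suc i)}|lborel. \<phi> s \<omega>) ^ p \<le> (LINT s:{t N j i..t N j (Suc i)}|lborel. norm (\<phi> s \<omega>)) ^ p" if "\<omega> \<in> space M" for \<omega>
          by (intro power_mono set_integral_norm_bound \<phi>_integrable that) auto
        show "(t N j (Suc i) - t N j i) ^ (p - 1) * (Cf * h N) \<le> h N ^ p * Cf" using p by (cases p) (auto simp: t_Suc)
      qed auto
      have 2: "Ebd M (\<lambda>\<omega>. (\<lambda>s \<omega>. norm (\<phi> s \<omega>) ^ p) (\<theta> N j i \<omega>) \<omega>) Cf"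
      proof (rule Ebd_randomized[OF N])
        have [measurable]: "(\<lambda>x. \<phi> (fst x) (snd x)) \<in> borel_measurable (borel \<Otimes>\<^sub>M Q j (Suc i))"
          using Q_\<phi>[of "Suc i" j] by (simp add: split_beta')
        show "(\<lambda>(s, \<omega>). norm (\<phi> s \<omega>) ^ p) \<in> borel_measurable (borel \<Otimes>\<^sub>M Q j (Suc i))"
          unfolding split_beta' by measurable
        show "Ebd M (\<lambda>\<omega>. norm (\<phi> s \<omega>) ^ p) Cf" if "s \<in> {t N j i..t N j i + h N}" for s
          unfolding p_def by (rule Cf(2)[OF sT[OF that]])
      qed auto
      have 2: "Ebd M (\<lambda>\<omega>. h N ^ p * norm (\<phi> (\<theta> N j i \<omega>) \<omega>) ^ p) (h N ^ p * Cf)"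
        by (rule Ebd_cmult[OF 2]) (use h_pos[OF N] in auto)
      show ?thesis
      proof (rule Ebd_mono)
        show "Ebd M (\<lambda>\<omega>. 2 ^ p * (norm (LINT s:{t N j i..t N j (Suc i)}|lborel. \<phi> s \<omega>) ^ p + h N ^ p * norm (\<phi> (\<theta> N j i \<omega>) \<omega>) ^ p)) (2 ^ p * (h N ^ p * Cf + h N ^ p * Cf))"
          by (intro Ebd_cmult Ebd_add 1 2) auto
        show "(\<lambda>\<omega>. norm (quad_err N j i \<omega>) ^ p) \<in> borel_measurable M"
          using quad_err_mart_diff[OF N, of j i] by (auto simp: mart_diff_def)
        fix \<omega>
        have "norm (quad_err N j i \<omega>) \<le> norm (LINT s:{t N j i..t N j (Suc i)}|lborel. \<phi> s \<omega>) + h N * norm (\<phi> (\<theta> N j i \<omega>) \<omega>)"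
          unfolding quad_err_def using norm_triangle_ineq4 h_pos[OF N] by (metis abs_of_pos norm_scaleR)
        then have "norm (quad_err N j i \<omega>) ^ p \<le> (norm (LINT s:{t N j i..t N j (Suc i)}|lborel. \<phi> s \<omega>) + h N * norm (\<phi> (\<theta> N j i \<omega>) \<omega>)) ^ p"
          by (intro power_mono) auto
        also have "\<dots> \<le> 2 ^ p * (norm (LINT s:{t N j i..t N j (Suc i)}|lborel. \<phi> s \<omega>) ^ p + (h N * norm (\<phi> (\<theta> N j i \<omega>) \<omega>)) ^ p)"
          by (rule power_add_le) (use p h_pos[OF N] in auto)
        finally show "norm (quad_err N j i \<omega>) ^ p \<le> 2 ^ p * (norm (LINT s:{t N j i..t N j (Suc i)}|lborel. \<phi> s \<omega>) ^ p + h N ^ p * norm (\<phi> (\<theta> N j i \<omega>) \<omega>) ^ p)"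
          by (simp add: power_mult_distrib)
        have "h N ^ p = h N ^ r * h N ^ r" by (simp add: p_def mult_2 power_add)
        also have "\<dots> = h N ^ r * (\<tau> ^ r / real N ^ r)" by (simp add: h_def power_divide)
        finally show "2 ^ p * (h N ^ p * Cf + h N ^ p * Cf) \<le> B N / real N ^ r" by (simp add: B_def mult_ac)
      qed auto
    qed
    have 1: "\<forall>i<N. mart_diff M (Q j (Suc i)) (quad_err N j i)" using quad_err_mart_diff[OF N] by blast
    have 2: "\<forall>i<N. \<forall>l<i. quad_err N j l \<in> borel_measurable (Q j (Suc i))" using quad_err_adapted by blast
    have 3: "\<forall>i<N. Ebd M (\<lambda>\<omega>. norm (quad_err N j i \<omega>) ^ (2 * r)) (B N / real N ^ r)" using bd unfolding p_def by blast
    have "Ebd M (\<lambda>\<omega>. running_max (\<lambda>k. norm (\<Sum>i<k. quad_err N j i \<omega>)) N ^ (2 * r)) (C * (\<Sum>i<N. B N) / real N)"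
      by (rule mm[OF N order_refl 1 2 3])
    then show ?thesis using N by (simp add: B_def mult_ac)
  qed
  show ?thesis
  proof (intro exI[of _ "C * (2 ^ p * (2 * Cf) * \<tau> ^ r)"] conjI allI impI)
    show "0 < C * (2 ^ p * (2 * Cf) * \<tau> ^ r)" using C Cf tau by simp
  qed (rule main; assumption)
qed

text \<open>The shifted first index is kept: index \<open>Suc j\<close> belongs to the delay
  interval number j, and index 0 to the initial segment. The recursion then needs no case
  distinction for the delayed argument.\<close>

definition Y :: "nat \<Rightarrow> nat \<Rightarrow> nat \<Rightarrow> 'a \<Rightarrow> real^'d" where
  "Y N j k \<omega> = euler_shifted f g \<tau> x0 N (\<lambda>t. W t \<omega>) (\<lambda>i l. \<gamma> i l \<omega>) j k"

lemma Y_0: "Y N 0 k \<omega> = x0"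
  by (simp add: Y_def)

lemma Y_Suc_0: "Y N (Suc j) 0 \<omega> = Y N j N \<omega>"
  by (simp add: Y_def)

lemma Y_Suc_Suc: "Y N (Suc j) (Suc k) \<omega> = Y N (Suc j) k \<omega> + h N *\<^sub>R f (\<theta> N j k \<omega>) (Y N (Suc j) k \<omega>) (Y N j k \<omega>)
   + g (t N j k) (Y N (Suc j) k \<omega>) (Y N j k \<omega>) *v (W (t N j (Suc k)) \<omega> - W (t N j k) \<omega>)"
  by (simp add: Y_def Let_def \<theta>_def h_def)

text \<open>\<open>G\<close> contains all sampling points from time 0 on, so only the Wiener
  increments decide at which time a value is known. The subtraction of \<tau> undoes the index
  shift, and the maximum with 0 serves index 0, where the value is constant.\<close>

lemma Y_adapted: "0 < N \<Longrightarrow> k \<le> N \<Longrightarrow> Y N j k \<in> borel_measurable (G (max 0 (t N j k - \<tau>)))"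
proof (induction j arbitrary: k)
  case 0
  then show ?case by (simp add: Y_0[abs_def])
next
  case (Suc j)
  note N = Suc.prems(1) and outer = Suc.IH[OF Suc.prems(1)]
  from Suc.prems(2) show ?case
  proof (induction k)
    case 0
    have "t N (Suc j) 0 - \<tau> = t N j N - \<tau>" using t_N[OF N] by simp
    then show ?case using outer[OF order_refl] by (simp add: Y_Suc_0[abs_def])
  next
    case (Suc k)
    have e: "max 0 (t N (Suc j) i - \<tau>) = t N j i" for i using t_nonneg[of N j i] by (simp add: t_shift)
    have le: "t N j k \<le> t N j (Suc k)" by (rule t_mono) simp
    have 1[measurable]: "Y N (Suc j) k \<in> borel_measurable (G (t N j (Suc k)))"
      using G_mono[OF t_nonneg le] Suc unfolding e by simp
    have 2[measurable]: "Y N j k \<in> borel_measurable (G (t N j (Suc k)))"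
      by (rule G_mono[OF _ _ outer[of k]]) (use Suc.prems tau le t_nonneg[of N j "Suc k"] in auto)
    have [measurable]: "\<gamma> j (Suc k) \<in> borel_measurable (G (t N j (Suc k)))" by (rule G_\<gamma>[OF t_nonneg]) simp
    have [measurable]: "W (t N j (Suc k)) \<in> borel_measurable (G (t N j (Suc k)))" "W (t N j k) \<in> borel_measurable (G (t N j (Suc k)))"
      by (rule G_W[OF t_nonneg], use le in simp)+
    show ?case unfolding e Y_Suc_Suc[abs_def] \<theta>_def by measurable
  qed
qed

end

text \<open>The factors 2 are those of \<open>powr_add_le\<close>, which arise in the delayed
  argument; in the recursion for the error they are slack.\<close>

lemma four_power_le:
  fixes a b c d y :: real
  assumes "0 \<le> y" "y \<le> a + b + 2 * c + 2 * d" "0 \<le> a" "0 \<le> b" "0 \<le> c" "0 \<le> d"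
  shows "y ^ p \<le> 8 ^ p * (a ^ p + b ^ p + c ^ p + d ^ p)"
proof -
  define m where "m = Max {a, b, c, d}"
  have m: "a \<le> m" "b \<le> m" "c \<le> m" "d \<le> m" unfolding m_def by (auto intro: Max_ge)
  have "m \<in> {a, b, c, d}" unfolding m_def by (rule Max_in) auto
  then have mp: "m ^ p \<le> a ^ p + b ^ p + c ^ p + d ^ p" using assms by auto
  have "y \<le> 8 * m" using assms m by linarith
  then have "y ^ p \<le> (8 * m) ^ p" using assms by (intro power_mono) auto
  also have "\<dots> \<le> 8 ^ p * (a ^ p + b ^ p + c ^ p + d ^ p)" using mp by (simp add: power_mult_distrib)
  finally show ?thesis .
qed

text \<open>The Hoelder exponent ends up outside the p-th powers, so that after taking means a
  concave power of a moment remains. \<open>u\<close>, \<open>v\<close> are the increments of the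
  exact solution, \<open>e\<close>, \<open>w\<close> the errors of the scheme.\<close>

lemma lipschitz_power_le:
  fixes u e v w :: "'c::real_normed_vector" and y :: real
  assumes y: "0 \<le> y" "y \<le> L * (norm (u + e) + norm (v + w) powr \<alpha>)" and L: "0 \<le> L" and a: "0 < \<alpha>" "\<alpha> \<le> 1" and p: "1 \<le> p"
  shows "y ^ p \<le> L ^ p * 8 ^ p * (norm u ^ p + norm e ^ p + (norm v ^ p) powr \<alpha> + (norm w ^ p) powr \<alpha>)"
proof -
  have "norm (v + w) powr \<alpha> \<le> (norm v + norm w) powr \<alpha>" using a by (intro powr_mono2 norm_triangle_ineq) auto
  also have "\<dots> \<le> 2 * norm v powr \<alpha> + 2 * norm w powr \<alpha>" by (rule powr_add_le) (use a in auto)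
  finally have 1: "norm (v + w) powr \<alpha> \<le> 2 * norm v powr \<alpha> + 2 * norm w powr \<alpha>" .
  have "norm (u + e) + norm (v + w) powr \<alpha> \<le> norm u + norm e + 2 * norm v powr \<alpha> + 2 * norm w powr \<alpha>"
    using 1 norm_triangle_ineq[of u e] by linarith
  then have "(norm (u + e) + norm (v + w) powr \<alpha>) ^ p \<le> 8 ^ p * (norm u ^ p + norm e ^ p + (norm v powr \<alpha>) ^ p + (norm w powr \<alpha>) ^ p)"
    by (intro four_power_le) auto
  then have 2: "(norm (u + e) + norm (v + w) powr \<alpha>) ^ p \<le> 8 ^ p * (norm u ^ p + norm e ^ p + (norm v ^ p) powr \<alpha> + (norm w ^ p) powr \<alpha>)"
    using p by (simp add: powr_power_commute)
  have "y ^ p \<le> (L * (norm (u + e) + norm (v + w) powr \<alpha>)) ^ p" using y by (intro power_mono)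
  also have "\<dots> = L ^ p * (norm (u + e) + norm (v + w) powr \<alpha>) ^ p" by (simp add: power_mult_distrib)
  also have "\<dots> \<le> L ^ p * (8 ^ p * (norm u ^ p + norm e ^ p + (norm v ^ p) powr \<alpha> + (norm w ^ p) powr \<alpha>))"
    using L by (intro mult_left_mono 2) auto
  finally show ?thesis by (simp add: mult.assoc)
qed

lemma discrete_Gronwall:
  fixes w :: "nat \<Rightarrow> real"
  assumes w: "\<And>k. k \<le> N \<Longrightarrow> w k \<le> A + q * (\<Sum>i<k. w i)" and q: "0 \<le> q" and A: "0 \<le> A"
  shows "k \<le> N \<Longrightarrow> w k \<le> A * (1 + q) ^ k"
proof (induction k rule: less_induct)
  case (less k)
  have geo: "q * (\<Sum>i<k. (1 + q) ^ i) = (1 + q) ^ k - 1" for k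
    by (induction k) (auto simp: algebra_simps)
  have "w k \<le> A + q * (\<Sum>i<k. w i)" by (rule w[OF less.prems])
  also have "\<dots> \<le> A + q * (\<Sum>i<k. A * (1 + q) ^ i)"
    using less q by (intro add_left_mono mult_left_mono sum_mono) auto
  also have "\<dots> = A + A * (q * (\<Sum>i<k. (1 + q) ^ i))" by (simp add: sum_distrib_left mult_ac)
  also have "\<dots> = A * (1 + q) ^ k" unfolding geo by (simp add: algebra_simps)
  finally show ?case .
qed

lemma uniform_point_concat:
  assumes "0 < N" "0 < q"
  shows "uniform_point (a + real i * c) (a + real (Suc i) * c) q l = uniform_point a (a + real N * c) (N * q) (i * q + l)"
  using assms by (simp add: uniform_point_def field_simps)

section \<open>Decomposition of the error and the moments of its parts\<close>

context randomized_sdde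
begin

text \<open>Indexed like \<open>Y\<close>, which explains the shift by \<tau>: with index 0 it is
  the error on the initial segment, which vanishes.\<close>

definition err :: "nat \<Rightarrow> nat \<Rightarrow> nat \<Rightarrow> 'a \<Rightarrow> real^'d" where
  "err N j k \<omega> = X (t N j k - \<tau>) \<omega> - Y N j k \<omega>"

definition \<zeta> :: "nat \<Rightarrow> nat \<Rightarrow> nat \<Rightarrow> 'a \<Rightarrow> real^'m^'d" where
  "\<zeta> N j k \<omega> = g (t N j k) (Y N (Suc j) k \<omega>) (Y N j k \<omega>)"

definition drift_err :: "nat \<Rightarrow> nat \<Rightarrow> nat \<Rightarrow> 'a \<Rightarrow> real^'d" where
  "drift_err N j k \<omega> = \<phi> (\<theta> N j k \<omega>) \<omega> - f (\<theta> N j k \<omega>) (Y N (Suc j) k \<omega>) (Y N j k \<omega>)"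

definition noise_err :: "nat \<Rightarrow> nat \<Rightarrow> nat \<Rightarrow> 'a \<Rightarrow> real^'d" where
  "noise_err N j k \<omega> = J (t N j k) (t N j (Suc k)) \<omega> - \<zeta> N j k \<omega> *v (W (t N j (Suc k)) \<omega> - W (t N j k) \<omega>)"

lemma err_0: "\<omega> \<in> space M \<Longrightarrow> 0 < N \<Longrightarrow> k \<le> N \<Longrightarrow> err N 0 k \<omega> = 0"
proof -
  assume w: "\<omega> \<in> space M" and N: "0 < N" "k \<le> N"
  have "t N 0 k \<le> \<tau>" using t_mono[OF N(2), of N 0] t_N[OF N(1), of 0] by (simp add: t_0)
  then show ?thesis using X_init[OF w, of "t N 0 k - \<tau>"] by (simp add: err_def Y_0)
qed

lemma err_Suc_0: "0 < N \<Longrightarrow> err N (Suc j) 0 \<omega> = err N j N \<omega>"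
  by (simp add: err_def Y_Suc_0 t_N)

text \<open>The increment of the solution is the drift integral plus \<open>J\<close> by definition,
  so this holds at every sample point. Inserting the drift of the exact solution at the sampled time
  separates the quadrature, which is a martingale, from the propagation of earlier errors.\<close>

lemma err_step: "err N (Suc j) (Suc k) \<omega> = err N (Suc j) k \<omega> + quad_err N j k \<omega> + h N *\<^sub>R drift_err N j k \<omega> + noise_err N j k \<omega>"
  by (simp add: err_def Y_Suc_Suc quad_err_def drift_err_def noise_err_def J_def \<zeta>_def t_shift scaleR_diff_right)

lemma err_eq:
  assumes "0 < N"
  shows "err N (Suc j) k \<omega> = err N j N \<omega> + (\<Sum>i<k. quad_err N j i \<omega>) + (\<Sum>i<k. h N *\<^sub>R drift_err N j i \<omega>) + (\<Sum>i<k. noise_err N j i \<omega>)"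
  by (induction k) (simp_all add: err_Suc_0[OF assms] err_step)

lemma Y_measurable_G: "0 < N \<Longrightarrow> k \<le> N \<Longrightarrow> Y N (Suc j) k \<in> borel_measurable (G (t N j k)) \<and> Y N j k \<in> borel_measurable (G (t N j k))"
proof -
  assume N: "0 < N" and k: "k \<le> N"
  have e: "max 0 (t N (Suc j) k - \<tau>) = t N j k" using t_nonneg[of N j k] by (simp add: t_shift)
  have "Y N j k \<in> borel_measurable (G (t N j k))"
    by (rule G_mono[OF _ _ Y_adapted[OF N k]]) (use t_nonneg[of N j k] tau in auto)
  then show ?thesis using Y_adapted[OF N k, of "Suc j"] unfolding e by simp
qed

lemma Y_measurable: "0 < N \<Longrightarrow> k \<le> N \<Longrightarrow> Y N j k \<in> borel_measurable M"
  using subalgebra_measurable[OF G_sub Y_adapted] by simp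

lemma \<zeta>_adapted: "0 < N \<Longrightarrow> k \<le> N \<Longrightarrow> \<zeta> N j k \<in> borel_measurable (G (t N j k))"
proof -
  assume "0 < N" "k \<le> N"
  note Y_measurable_G[OF this, of j]
  then have [measurable]: "Y N (Suc j) k \<in> borel_measurable (G (t N j k))" "Y N j k \<in> borel_measurable (G (t N j k))"
    by blast+
  show ?thesis unfolding \<zeta>_def by measurable
qed

lemma \<theta>_measurable: "\<theta> N j k \<in> borel_measurable M"
  unfolding \<theta>_def using \<gamma>_measurable[of "Suc k" j] by measurable

lemma err_measurable: "0 < N \<Longrightarrow> k \<le> N \<Longrightarrow> err N j k \<in> borel_measurable M"
  unfolding err_def using Y_measurable[of N k j] by measurable

lemma \<phi>_\<theta>_measurable: "(\<lambda>\<omega>. \<phi> (\<theta> N j k \<omega>) \<omega>) \<in> borel_measurable M"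
proof -
  have "(\<lambda>\<omega>. (\<theta> N j k \<omega>, \<omega>)) \<in> M \<rightarrow>\<^sub>M borel \<Otimes>\<^sub>M M" using \<theta>_measurable[of N j k] by measurable
  from measurable_compose[OF this \<phi>_jointM] show ?thesis by simp
qed

lemma drift_err_measurable: "0 < N \<Longrightarrow> k \<le> N \<Longrightarrow> drift_err N j k \<in> borel_measurable M"
  unfolding drift_err_def using Y_measurable[of N k] \<theta>_measurable[of N j k] \<phi>_\<theta>_measurable[of N j k]
  by measurable

lemma \<zeta>_measurable: "0 < N \<Longrightarrow> k \<le> N \<Longrightarrow> \<zeta> N j k \<in> borel_measurable M"
  unfolding \<zeta>_def using Y_measurable[of N k] by measurable

lemma noise_err_measurable: "0 < N \<Longrightarrow> k \<le> N \<Longrightarrow> noise_err N j k \<in> borel_measurable M"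
  unfolding noise_err_def using \<zeta>_measurable[of N k j] W_measurable[OF t_nonneg[of N j k]] W_measurable[OF t_nonneg[of N j "Suc k"]]
  by measurable

text \<open>Finiteness is the point: \<open>B\<close> may depend on \<open>N\<close>. It makes the
  moments to which Gronwall's lemma is applied finite; uniformity in \<open>N\<close> comes from
  that lemma.\<close>

lemma Y_moment:
  assumes r: "1 \<le> r" and N: "0 < N"
  shows "real j * \<tau> \<le> T \<Longrightarrow> k \<le> N \<Longrightarrow> \<exists>B. Ebd M (\<lambda>\<omega>. norm (Y N j k \<omega>) ^ (2 * r)) B"
proof (induction j arbitrary: k)
  case 0
  have "Ebd M (\<lambda>\<omega>. norm (Y N 0 k \<omega>) ^ (2 * r)) (norm x0 ^ (2 * r))" unfolding Y_0 by (rule Ebd_const) simp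
  then show ?case by blast
next
  case (Suc j)
  have "real j * \<tau> \<le> real (Suc j) * \<tau>" using tau by (intro mult_right_mono) auto
  then have jT: "real j * \<tau> \<le> T" using Suc.prems(1) by linarith
  note outer = Suc.IH[OF jT] and jT' = Suc.prems(1)
  from Suc.prems(2) show ?case
  proof (induction k)
    case 0
    then show ?case using outer[of N] by (simp add: Y_Suc_0)
  next
    case (Suc k)
    then have kN: "k \<le> N" by simp
    obtain By where By: "Ebd M (\<lambda>\<omega>. norm (Y N (Suc j) k \<omega>) ^ (2 * r)) By" using Suc by auto
    obtain Bz where Bz: "Ebd M (\<lambda>\<omega>. norm (Y N j k \<omega>) ^ (2 * r)) Bz" using outer[OF kN] by auto
    let ?y = "Y N (Suc j) k" and ?z = "Y N j k"
    have tk: "t N j k \<in> {0..T}" using t_nonneg t_le[OF N kN jT'] by auto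
    have st: "t N j k < t N j (Suc k)" using h_pos[OF N] by (simp add: t_Suc)
    note [measurable] = Y_measurable[OF N kN] \<theta>_measurable
    have grow: "Ebd M (\<lambda>\<omega>. norm (Z \<omega>) ^ (2 * r)) (c ^ (2 * r) * 4 ^ (2 * r) * (1 + By + Bz))"
      if Z: "Z \<in> borel_measurable M" and c: "0 \<le> c" and le: "\<And>\<omega>. norm (Z \<omega>) \<le> c * (1 + norm (?y \<omega>) + norm (?z \<omega>))"
      for Z :: "'a \<Rightarrow> 'z::{real_normed_vector, second_countable_topology}" and c
    proof (rule Ebd_mono)
      show "Ebd M (\<lambda>\<omega>. c ^ (2 * r) * 4 ^ (2 * r) * (1 + norm (?y \<omega>) ^ (2 * r) + norm (?z \<omega>) ^ (2 * r))) (c ^ (2 * r) * 4 ^ (2 * r) * (1 + By + Bz))"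
        by (intro Ebd_cmult Ebd_add Ebd_const By Bz) (use c in auto)
      show "norm (Z \<omega>) ^ (2 * r) \<le> c ^ (2 * r) * 4 ^ (2 * r) * (1 + norm (?y \<omega>) ^ (2 * r) + norm (?z \<omega>) ^ (2 * r))" for \<omega>
        by (rule growth_power_le) (use le c r in auto)
      show "(\<lambda>\<omega>. norm (Z \<omega>) ^ (2 * r)) \<in> borel_measurable M" using Z by measurable
    qed auto
    have 1: "Ebd M (\<lambda>\<omega>. norm (f (\<theta> N j k \<omega>) (?y \<omega>) (?z \<omega>)) ^ (2 * r)) ((K + L) ^ (2 * r) * 4 ^ (2 * r) * (1 + By + Bz))"
      by (rule grow) (use KL f_growth in auto)
    have "Ebd M (\<lambda>\<omega>. h N ^ (2 * r) * norm (f (\<theta> N j k \<omega>) (?y \<omega>) (?z \<omega>)) ^ (2 * r)) (h N ^ (2 * r) * ((K + L) ^ (2 * r) * 4 ^ (2 * r) * (1 + By + Bz)))"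
      by (rule Ebd_cmult[OF 1]) (use h_pos[OF N] in auto)
    moreover have "h N ^ (2 * r) * norm (f (\<theta> N j k \<omega>) (?y \<omega>) (?z \<omega>)) ^ (2 * r) = norm (h N *\<^sub>R f (\<theta> N j k \<omega>) (?y \<omega>) (?z \<omega>)) ^ (2 * r)" for \<omega>
      using h_pos[OF N] by (simp add: power_mult_distrib)
    ultimately have 1: "Ebd M (\<lambda>\<omega>. norm (h N *\<^sub>R f (\<theta> N j k \<omega>) (?y \<omega>) (?z \<omega>)) ^ (2 * r)) (h N ^ (2 * r) * ((K + L) ^ (2 * r) * 4 ^ (2 * r) * (1 + By + Bz)))" by simp
    have 2: "Ebd M (\<lambda>\<omega>. norm (\<zeta> N j k \<omega>) ^ (2 * r)) (Kg ^ (2 * r) * 4 ^ (2 * r) * (1 + By + Bz))"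
      by (rule grow) (use Kg_pos g_growth[OF tk] \<zeta>_measurable[OF N kN] in \<open>auto simp: \<zeta>_def\<close>)
    have ind: "indep_of M (G (t N j k)) (\<lambda>\<omega>. W (t N j (Suc k)) \<omega> - W (t N j k) \<omega>)"
      using G_wiener t_nonneg st by (auto simp: wiener_filtration_def)
    obtain Bg where 2: "Ebd M (\<lambda>\<omega>. norm (\<zeta> N j k \<omega> *v (W (t N j (Suc k)) \<omega> - W (t N j k) \<omega>)) ^ (2 * r)) Bg"
      using Ebd_increment[OF t_nonneg st ind \<zeta>_adapted[OF N kN] 2 r] by blast
    have "Ebd M (\<lambda>\<omega>. norm (Y N (Suc j) (Suc k) \<omega>) ^ (2 * r)) (4 ^ (2 * r) * (By + h N ^ (2 * r) * ((K + L) ^ (2 * r) * 4 ^ (2 * r) * (1 + By + Bz)) + Bg))"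
    proof (rule Ebd_mono)
      show "Ebd M (\<lambda>\<omega>. 4 ^ (2 * r) * (norm (?y \<omega>) ^ (2 * r) + norm (h N *\<^sub>R f (\<theta> N j k \<omega>) (?y \<omega>) (?z \<omega>)) ^ (2 * r)
          + norm (\<zeta> N j k \<omega> *v (W (t N j (Suc k)) \<omega> - W (t N j k) \<omega>)) ^ (2 * r)))
        (4 ^ (2 * r) * (By + h N ^ (2 * r) * ((K + L) ^ (2 * r) * 4 ^ (2 * r) * (1 + By + Bz)) + Bg))"
        by (intro Ebd_cmult Ebd_add By 1 2) auto
      fix \<omega>
      have "norm (Y N (Suc j) (Suc k) \<omega>) \<le> norm (?y \<omega>) + norm (h N *\<^sub>R f (\<theta> N j k \<omega>) (?y \<omega>) (?z \<omega>)) + norm (\<zeta> N j k \<omega> *v (W (t N j (Suc k)) \<omega> - W (t N j k) \<omega>))"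
        unfolding Y_Suc_Suc \<zeta>_def
        by (rule order_trans[OF norm_triangle_ineq add_right_mono[OF norm_triangle_ineq]])
      then show "norm (Y N (Suc j) (Suc k) \<omega>) ^ (2 * r) \<le> 4 ^ (2 * r) * (norm (?y \<omega>) ^ (2 * r) + norm (h N *\<^sub>R f (\<theta> N j k \<omega>) (?y \<omega>) (?z \<omega>)) ^ (2 * r)
          + norm (\<zeta> N j k \<omega> *v (W (t N j (Suc k)) \<omega> - W (t N j k) \<omega>)) ^ (2 * r))"
        by (intro three_power_le) (use r in auto)
      show "(\<lambda>\<omega>. norm (Y N (Suc j) (Suc k) \<omega>) ^ (2 * r)) \<in> borel_measurable M"
        using Y_measurable[OF N Suc.prems, of "Suc j"] by measurable
    qed auto
    then show ?case by blast
  qed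
qed

lemma err_moment:
  assumes r: "1 \<le> r" and N: "0 < N" and j: "real j * \<tau> \<le> T" and k: "k \<le> N"
  shows "integrable M (\<lambda>\<omega>. norm (err N j k \<omega>) ^ (2 * r))"
proof -
  obtain B where B: "Ebd M (\<lambda>\<omega>. norm (Y N j k \<omega>) ^ (2 * r)) B" using Y_moment[OF r N j k] by blast
  obtain C where C: "\<And>s. s \<le> T \<Longrightarrow> Ebd M (\<lambda>\<omega>. norm (X s \<omega>) ^ (2 * r)) C" using X_moment[OF r] by blast
  have "t N j k \<le> t N j N" by (rule t_mono[OF k])
  also have "t N j N = real j * \<tau> + \<tau>" using t_N[OF N, of j] by (simp add: t_0 algebra_simps)
  finally have tT: "t N j k - \<tau> \<le> T" using j by simp
  have "Ebd M (\<lambda>\<omega>. norm (err N j k \<omega>) ^ (2 * r)) (2 ^ (2 * r) * (C + B))"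
  proof (rule Ebd_mono)
    show "Ebd M (\<lambda>\<omega>. 2 ^ (2 * r) * (norm (X (t N j k - \<tau>) \<omega>) ^ (2 * r) + norm (Y N j k \<omega>) ^ (2 * r))) (2 ^ (2 * r) * (C + B))"
      by (intro Ebd_cmult Ebd_add C B tT) auto
    show "(\<lambda>\<omega>. norm (err N j k \<omega>) ^ (2 * r)) \<in> borel_measurable M" using err_measurable[OF N k, of j] by measurable
    fix \<omega>
    have "norm (err N j k \<omega>) ^ (2 * r) \<le> (norm (X (t N j k - \<tau>) \<omega>) + norm (Y N j k \<omega>)) ^ (2 * r)"
      unfolding err_def by (intro power_mono norm_triangle_ineq4) auto
    also have "\<dots> \<le> 2 ^ (2 * r) * (norm (X (t N j k - \<tau>) \<omega>) ^ (2 * r) + norm (Y N j k \<omega>) ^ (2 * r))"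
      by (rule power_add_le) (use r in auto)
    finally show "norm (err N j k \<omega>) ^ (2 * r) \<le> 2 ^ (2 * r) * (norm (X (t N j k - \<tau>) \<omega>) ^ (2 * r) + norm (Y N j k \<omega>) ^ (2 * r))" .
  qed auto
  then show ?thesis by (rule EbdD)
qed

text \<open>The difference at the sampled time is split at the left end of the cell into an
  increment of the exact solution and an error of the scheme. The increments sit at a random time;
  \<open>Ebd_randomized\<close> reduces them to bounds that are uniform over the cell.\<close>

lemma drift_err_moment:
  assumes r: "1 \<le> r" and N: "0 < N" and i: "i < N" and jT: "real (Suc j) * \<tau> \<le> T"
    and Cx: "0 < Cx" "\<And>s u. s \<le> u \<Longrightarrow> u \<le> T \<Longrightarrow> Ebd M (\<lambda>\<omega>. norm (X u \<omega> - X s \<omega>) ^ (2 * r)) (Cx * (u - s) ^ r)"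
    and a: "0 < a" "Ebd M (\<lambda>\<omega>. norm (err N j i \<omega>) ^ (2 * r)) a"
    and b: "0 < b" "\<And>s. s \<in> {t N j i..t N j (Suc i)} \<Longrightarrow> Ebd M (\<lambda>\<omega>. norm (X (s - \<tau>) \<omega> - X (t N j i - \<tau>) \<omega>) ^ (2 * r)) b"
    and v: "Ebd M (\<lambda>\<omega>. norm (err N (Suc j) i \<omega>) ^ (2 * r)) v"
  shows "Ebd M (\<lambda>\<omega>. norm (drift_err N j i \<omega>) ^ (2 * r)) (L ^ (2 * r) * 8 ^ (2 * r) * (Cx * h N ^ r + v + b powr \<alpha>1 + a powr \<alpha>1))"
proof -
  have iN: "i \<le> N" using i by simp
  have sT: "s \<le> T" if "s \<in> {t N j i..t N j i + h N}" for s
    using that t_le[OF N _ jT, of "Suc i"] i by (simp add: t_Suc)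
  have sp: "space (Q j (Suc i)) = space M" using Q_sub[of "Suc i" j] by (simp add: subalgebra_def)
  have [measurable]: "(\<lambda>p. X (fst p) (snd p)) \<in> borel_measurable (borel \<Otimes>\<^sub>M Q j (Suc i))"
    using X_joint[OF Q_X sp] by (simp add: split_beta')
  have Xs: "(\<lambda>p. X (fst p - \<tau>) (snd p)) \<in> borel_measurable (borel \<Otimes>\<^sub>M Q j (Suc i))"
  proof -
    have "(\<lambda>p. (fst p - \<tau>, snd p)) \<in> borel \<Otimes>\<^sub>M Q j (Suc i) \<rightarrow>\<^sub>M borel \<Otimes>\<^sub>M Q j (Suc i)" by measurable
    from measurable_compose[OF this X_joint[OF Q_X sp]] show ?thesis by simp
  qed
  have Xc: "(\<lambda>p. X s (snd p)) \<in> borel_measurable (borel \<Otimes>\<^sub>M Q j (Suc i))" for s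
    by (rule measurable_compose[OF measurable_snd Q_X])
  note [measurable] = Xs Xc
  have 1: "Ebd M (\<lambda>\<omega>. (\<lambda>s \<omega>. norm (X s \<omega> - X (t N j i) \<omega>) ^ (2 * r)) (\<theta> N j i \<omega>) \<omega>) (Cx * h N ^ r)"
  proof (rule Ebd_randomized[OF N])
    show "(\<lambda>(s, \<omega>). norm (X s \<omega> - X (t N j i) \<omega>) ^ (2 * r)) \<in> borel_measurable (borel \<Otimes>\<^sub>M Q j (Suc i))"
      unfolding split_beta' by measurable
    show "Ebd M (\<lambda>\<omega>. norm (X s \<omega> - X (t N j i) \<omega>) ^ (2 * r)) (Cx * h N ^ r)" if s: "s \<in> {t N j i..t N j i + h N}" for s
    proof (rule Ebd_mono_const[OF Cx(2)])
      show "Cx * (s - t N j i) ^ r \<le> Cx * h N ^ r" using s Cx by (intro mult_left_mono power_mono) auto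
    qed (use s sT in auto)
  qed auto
  have 2: "Ebd M (\<lambda>\<omega>. (\<lambda>s \<omega>. norm (X (s - \<tau>) \<omega> - X (t N j i - \<tau>) \<omega>) ^ (2 * r)) (\<theta> N j i \<omega>) \<omega>) b"
  proof (rule Ebd_randomized[OF N])
    show "(\<lambda>(s, \<omega>). norm (X (s - \<tau>) \<omega> - X (t N j i - \<tau>) \<omega>) ^ (2 * r)) \<in> borel_measurable (borel \<Otimes>\<^sub>M Q j (Suc i))"
      unfolding split_beta' by measurable
    show "Ebd M (\<lambda>\<omega>. norm (X (s - \<tau>) \<omega> - X (t N j i - \<tau>) \<omega>) ^ (2 * r)) b" if "s \<in> {t N j i..t N j i + h N}" for s
      using b(2)[of s] that by (simp add: t_Suc)
  qed auto
  show ?thesis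
  proof (rule Ebd_mono)
    show "Ebd M (\<lambda>\<omega>. L ^ (2 * r) * 8 ^ (2 * r) * (norm (X (\<theta> N j i \<omega>) \<omega> - X (t N j i) \<omega>) ^ (2 * r) + norm (err N (Suc j) i \<omega>) ^ (2 * r)
        + (norm (X (\<theta> N j i \<omega> - \<tau>) \<omega> - X (t N j i - \<tau>) \<omega>) ^ (2 * r)) powr \<alpha>1 + (norm (err N j i \<omega>) ^ (2 * r)) powr \<alpha>1))
      (L ^ (2 * r) * 8 ^ (2 * r) * (Cx * h N ^ r + v + b powr \<alpha>1 + a powr \<alpha>1))"
      by (intro Ebd_cmult Ebd_add Ebd_powr 1 2 v a b(1) alpha1) (use KL in auto)
    show "(\<lambda>\<omega>. norm (drift_err N j i \<omega>) ^ (2 * r)) \<in> borel_measurable M" using drift_err_measurable[OF N iN, of j] by measurable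
    fix \<omega>
    show "norm (drift_err N j i \<omega>) ^ (2 * r) \<le> L ^ (2 * r) * 8 ^ (2 * r) * (norm (X (\<theta> N j i \<omega>) \<omega> - X (t N j i) \<omega>) ^ (2 * r) + norm (err N (Suc j) i \<omega>) ^ (2 * r)
        + (norm (X (\<theta> N j i \<omega> - \<tau>) \<omega> - X (t N j i - \<tau>) \<omega>) ^ (2 * r)) powr \<alpha>1 + (norm (err N j i \<omega>) ^ (2 * r)) powr \<alpha>1)"
    proof (rule lipschitz_power_le)
      have "norm (drift_err N j i \<omega>) \<le> L * (norm (X (\<theta> N j i \<omega>) \<omega> - Y N (Suc j) i \<omega>) + norm (X (\<theta> N j i \<omega> - \<tau>) \<omega> - Y N j i \<omega>) powr \<alpha>1)"
        unfolding drift_err_def \<phi>_def by (rule f_lip)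
      then show "norm (drift_err N j i \<omega>) \<le> L * (norm (X (\<theta> N j i \<omega>) \<omega> - X (t N j i) \<omega> + err N (Suc j) i \<omega>) + norm (X (\<theta> N j i \<omega> - \<tau>) \<omega> - X (t N j i - \<tau>) \<omega> + err N j i \<omega>) powr \<alpha>1)"
        by (simp add: err_def t_shift)
    qed (use KL alpha1 r in auto)
  qed auto
qed

lemma diffusion_err_moment:
  assumes r: "1 \<le> r" and N: "0 < N" and i: "i < N" and jT: "real (Suc j) * \<tau> \<le> T"
    and C: "0 < C" "\<And>s. s \<le> T \<Longrightarrow> Ebd M (\<lambda>\<omega>. norm (X s \<omega>) ^ (2 * r)) C"
    and Cx: "0 < Cx" "\<And>s u. s \<le> u \<Longrightarrow> u \<le> T \<Longrightarrow> Ebd M (\<lambda>\<omega>. norm (X u \<omega> - X s \<omega>) ^ (2 * r)) (Cx * (u - s) ^ r)"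
    and a: "0 < a" "Ebd M (\<lambda>\<omega>. norm (err N j i \<omega>) ^ (2 * r)) a"
    and b: "0 < b" "\<And>s. s \<in> {t N j i..t N j (Suc i)} \<Longrightarrow> Ebd M (\<lambda>\<omega>. norm (X (s - \<tau>) \<omega> - X (t N j i - \<tau>) \<omega>) ^ (2 * r)) b"
    and v: "Ebd M (\<lambda>\<omega>. norm (err N (Suc j) i \<omega>) ^ (2 * r)) v"
    and s: "s \<in> {t N j i..t N j (Suc i)}"
  shows "Ebd M (\<lambda>\<omega>. norm (H s \<omega> - \<zeta> N j i \<omega>) ^ (2 * r))
    (2 ^ (2 * r) * (K ^ (2 * r) * h N powr (\<rho> * real (2 * r)) * 4 ^ (2 * r) * (1 + C + C)
      + L ^ (2 * r) * 8 ^ (2 * r) * (Cx * h N ^ r + v + b powr \<alpha>2 + a powr \<alpha>2)))"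
proof -
  have iN: "i \<le> N" using i by simp
  have sT: "s \<le> T" using s t_le[OF N _ jT, of "Suc i"] i by simp
  let ?g = "\<lambda>\<omega>. g (t N j i) (X s \<omega>) (X (s - \<tau>) \<omega>)"
  have hp: "0 < h N" by (rule h_pos[OF N])
  have 1: "Ebd M (\<lambda>\<omega>. norm (H s \<omega> - ?g \<omega>) ^ (2 * r)) ((K * h N powr \<rho>) ^ (2 * r) * 4 ^ (2 * r) * (1 + C + C))"
  proof (rule growth_moment[OF r C(2) sT])
    show "norm (H s \<omega> - ?g \<omega>) \<le> K * h N powr \<rho> * (1 + norm (X s \<omega>) + norm (X (s - \<tau>) \<omega>))" for \<omega>
    proof -
      have "norm (H s \<omega> - ?g \<omega>) \<le> K * (1 + norm (X s \<omega>) + norm (X (s - \<tau>) \<omega>)) * \<bar>s - t N j i\<bar> powr \<rho>"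
        unfolding H_def by (rule g_time)
      also have "\<dots> \<le> K * (1 + norm (X s \<omega>) + norm (X (s - \<tau>) \<omega>)) * h N powr \<rho>"
        using s KL rho by (intro mult_left_mono powr_mono2) (auto simp: t_Suc)
      finally show ?thesis by (simp add: mult_ac)
    qed
  qed (use KL in auto)
  have 2: "Ebd M (\<lambda>\<omega>. norm (?g \<omega> - \<zeta> N j i \<omega>) ^ (2 * r)) (L ^ (2 * r) * 8 ^ (2 * r) * (Cx * h N ^ r + v + b powr \<alpha>2 + a powr \<alpha>2))"
  proof (rule Ebd_mono)
    have Xb: "Ebd M (\<lambda>\<omega>. norm (X s \<omega> - X (t N j i) \<omega>) ^ (2 * r)) (Cx * h N ^ r)"
    proof (rule Ebd_mono_const[OF Cx(2)])
      show "Cx * (s - t N j i) ^ r \<le> Cx * h N ^ r" using s Cx by (intro mult_left_mono power_mono) (auto simp: t_Suc)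
    qed (use s sT in auto)
    show "Ebd M (\<lambda>\<omega>. L ^ (2 * r) * 8 ^ (2 * r) * (norm (X s \<omega> - X (t N j i) \<omega>) ^ (2 * r) + norm (err N (Suc j) i \<omega>) ^ (2 * r)
        + (norm (X (s - \<tau>) \<omega> - X (t N j i - \<tau>) \<omega>) ^ (2 * r)) powr \<alpha>2 + (norm (err N j i \<omega>) ^ (2 * r)) powr \<alpha>2))
      (L ^ (2 * r) * 8 ^ (2 * r) * (Cx * h N ^ r + v + b powr \<alpha>2 + a powr \<alpha>2))"
      by (intro Ebd_cmult Ebd_add Ebd_powr Xb b(2)[OF s] v a b(1) alpha2) (use KL in auto)
    show "(\<lambda>\<omega>. norm (?g \<omega> - \<zeta> N j i \<omega>) ^ (2 * r)) \<in> borel_measurable M" using \<zeta>_measurable[OF N iN, of j] by measurable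
    fix \<omega>
    show "norm (?g \<omega> - \<zeta> N j i \<omega>) ^ (2 * r) \<le> L ^ (2 * r) * 8 ^ (2 * r) * (norm (X s \<omega> - X (t N j i) \<omega>) ^ (2 * r) + norm (err N (Suc j) i \<omega>) ^ (2 * r)
        + (norm (X (s - \<tau>) \<omega> - X (t N j i - \<tau>) \<omega>) ^ (2 * r)) powr \<alpha>2 + (norm (err N j i \<omega>) ^ (2 * r)) powr \<alpha>2)"
    proof (rule lipschitz_power_le)
      have "norm (?g \<omega> - \<zeta> N j i \<omega>) \<le> L * (norm (X s \<omega> - Y N (Suc j) i \<omega>) + norm (X (s - \<tau>) \<omega> - Y N j i \<omega>) powr \<alpha>2)"
        unfolding \<zeta>_def by (rule g_lip)
      then show "norm (?g \<omega> - \<zeta> N j i \<omega>) \<le> L * (norm (X s \<omega> - X (t N j i) \<omega> + err N (Suc j) i \<omega>) + norm (X (s - \<tau>) \<omega> - X (t N j i - \<tau>) \<omega> + err N j i \<omega>) powr \<alpha>2)"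
        by (simp add: err_def t_shift)
    qed (use KL alpha2 r in auto)
  qed auto
  have e: "(K * h N powr \<rho>) ^ (2 * r) = K ^ (2 * r) * h N powr (\<rho> * real (2 * r))"
    using hp by (simp add: power_mult_distrib powr_power mult_ac)
  show ?thesis
  proof (rule Ebd_mono)
    show "Ebd M (\<lambda>\<omega>. 2 ^ (2 * r) * (norm (H s \<omega> - ?g \<omega>) ^ (2 * r) + norm (?g \<omega> - \<zeta> N j i \<omega>) ^ (2 * r)))
      (2 ^ (2 * r) * (K ^ (2 * r) * h N powr (\<rho> * real (2 * r)) * 4 ^ (2 * r) * (1 + C + C)
      + L ^ (2 * r) * 8 ^ (2 * r) * (Cx * h N ^ r + v + b powr \<alpha>2 + a powr \<alpha>2)))"
      using Ebd_cmult[OF Ebd_add[OF 1 2], of "2 ^ (2 * r)"] unfolding e by simp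
    show "(\<lambda>\<omega>. norm (H s \<omega> - \<zeta> N j i \<omega>) ^ (2 * r)) \<in> borel_measurable M" using \<zeta>_measurable[OF N iN, of j] by measurable
    fix \<omega>
    have "norm (H s \<omega> - \<zeta> N j i \<omega>) ^ (2 * r) \<le> (norm (H s \<omega> - ?g \<omega>) + norm (?g \<omega> - \<zeta> N j i \<omega>)) ^ (2 * r)"
      using norm_triangle_ineq[of "H s \<omega> - ?g \<omega>" "?g \<omega> - \<zeta> N j i \<omega>"] by (intro power_mono) auto
    also have "\<dots> \<le> 2 ^ (2 * r) * (norm (H s \<omega> - ?g \<omega>) ^ (2 * r) + norm (?g \<omega> - \<zeta> N j i \<omega>) ^ (2 * r))"
      by (rule power_add_le) (use r in auto)
    finally show "norm (H s \<omega> - \<zeta> N j i \<omega>) ^ (2 * r) \<le> 2 ^ (2 * r) * (norm (H s \<omega> - ?g \<omega>) ^ (2 * r) + norm (?g \<omega> - \<zeta> N j i \<omega>) ^ (2 * r))" .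
  qed auto
qed

end

section \<open>Propagation of the error\<close>

lemma sum_lessThan_concat:
  fixes F :: "nat \<Rightarrow> 'c::comm_monoid_add"
  shows "(\<Sum>m<k * q. F m) = (\<Sum>i<k. \<Sum>l<q. F (i * q + l))"
proof -
  have "(\<Sum>m<k * q. F m) = (\<Sum>i<k. sum F {i * q..<i * q + q})" by (rule sum.nat_group[symmetric])
  also have "\<dots> = (\<Sum>i<k. \<Sum>l<q. F (i * q + l))"
  proof (rule sum.cong[OF refl])
    fix i
    have "sum F {i * q..<i * q + q} = sum F {0 + i * q..<q + i * q}" by (simp add: add.commute)
    also have "\<dots> = (\<Sum>l<q. F (i * q + l))"
      unfolding sum.shift_bounds_nat_ivl by (simp add: add.commute lessThan_atLeast0)
    finally show "sum F {i * q..<i * q + q} = (\<Sum>l<q. F (i * q + l))" .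
  qed
  finally show ?thesis .
qed

context randomized_sdde
begin

text \<open>On the refinement of the grid into \<open>Nq\<close> cells the Riemann approximation of the noise error is
  a single sum of Wiener increments with adapted coefficients.\<close>

lemma noise_riemann_concat:
  assumes N: "0 < N" and q: "0 < q"
  shows "(\<Sum>i<k. riemann_sum (\<lambda>s. H s \<omega>) (\<lambda>s. W s \<omega>) (t N j i) (t N j (Suc i)) q - \<zeta> N j i \<omega> *v (W (t N j (Suc i)) \<omega> - W (t N j i) \<omega>))
    = (\<Sum>m<k * q. (H (uniform_point (t N j 0) (t N j N) (N * q) m) \<omega> - \<zeta> N j (m div q) \<omega>) *v
        (W (uniform_point (t N j 0) (t N j N) (N * q) (Suc m)) \<omega> - W (uniform_point (t N j 0) (t N j N) (N * q) m) \<omega>))"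
proof -
  have tk: "t N j i = t N j 0 + real i * h N" for i by (simp add: grid_time_def h_def)
  have pt: "uniform_point (t N j i) (t N j (Suc i)) q l = uniform_point (t N j 0) (t N j N) (N * q) (i * q + l)" for i l
    using uniform_point_concat[OF N q, of "t N j 0" i "h N" l] unfolding tk[symmetric] .
  have st: "t N j i < t N j (Suc i)" for i using h_pos[OF N] by (simp add: t_Suc)
  have "riemann_sum (\<lambda>s. H s \<omega>) (\<lambda>s. W s \<omega>) (t N j i) (t N j (Suc i)) q - \<zeta> N j i \<omega> *v (W (t N j (Suc i)) \<omega> - W (t N j i) \<omega>)
    = (\<Sum>l<q. (H (uniform_point (t N j 0) (t N j N) (N * q) (i * q + l)) \<omega> - \<zeta> N j ((i * q + l) div q) \<omega>) *v
        (W (uniform_point (t N j 0) (t N j N) (N * q) (Suc (i * q + l))) \<omega> - W (uniform_point (t N j 0) (t N j N) (N * q) (i * q + l)) \<omega>))" for i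
  proof -
    let ?u = "uniform_point (t N j i) (t N j (Suc i)) q"
    have "W (t N j (Suc i)) \<omega> - W (t N j i) \<omega> = (\<Sum>l<q. W (?u (Suc l)) \<omega> - W (?u l) \<omega>)"
      using sum_lessThan_telescope[of "\<lambda>l. W (?u l) \<omega>" q] uniform_point_props(1,2)[OF st q, of i] by simp
    then have "riemann_sum (\<lambda>s. H s \<omega>) (\<lambda>s. W s \<omega>) (t N j i) (t N j (Suc i)) q - \<zeta> N j i \<omega> *v (W (t N j (Suc i)) \<omega> - W (t N j i) \<omega>)
      = (\<Sum>l<q. (H (?u l) \<omega> - \<zeta> N j i \<omega>) *v (W (?u (Suc l)) \<omega> - W (?u l) \<omega>))"
      by (simp only: riemann_sum_def linear_sum[OF matrix_vector_mul_linear] sum_subtractf[symmetric] matrix_vector_mult_diff_rdistrib)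
    also have "\<dots> = (\<Sum>l<q. (H (uniform_point (t N j 0) (t N j N) (N * q) (i * q + l)) \<omega> - \<zeta> N j ((i * q + l) div q) \<omega>) *v
        (W (uniform_point (t N j 0) (t N j N) (N * q) (Suc (i * q + l))) \<omega> - W (uniform_point (t N j 0) (t N j N) (N * q) (i * q + l)) \<omega>))"
    proof (rule sum.cong[OF refl])
      fix l assume "l \<in> {..<q}"
      then have "(i * q + l) div q = i" by simp
      then show "(H (?u l) \<omega> - \<zeta> N j i \<omega>) *v (W (?u (Suc l)) \<omega> - W (?u l) \<omega>)
        = (H (uniform_point (t N j 0) (t N j N) (N * q) (i * q + l)) \<omega> - \<zeta> N j ((i * q + l) div q) \<omega>) *v
        (W (uniform_point (t N j 0) (t N j N) (N * q) (Suc (i * q + l))) \<omega> - W (uniform_point (t N j 0) (t N j N) (N * q) (i * q + l)) \<omega>)"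
        unfolding pt by simp
    qed
    finally show ?thesis .
  qed
  then show ?thesis unfolding sum_lessThan_concat by simp
qed

text \<open>The bound is proved for Riemann approximations with q points per cell, uniformly in q,
  and passes to the limit by Fatou's lemma; the running maximum converges because it moves by at
  most the sum of the changes of the summands. The value \<open>B i\<close> is repeated on the q
  parts of cell i, and the q cancels against the N q cells of the refinement.\<close>

lemma noise_moment:
  assumes r: "1 \<le> r"
  shows "\<exists>C>0. \<forall>N j k B. 0 < N \<longrightarrow> k \<le> N \<longrightarrow> real (Suc j) * \<tau> \<le> T \<longrightarrow>
    (\<forall>i<k. \<forall>s\<in>{t N j i..t N j (Suc i)}. Ebd M (\<lambda>\<omega>. norm (H s \<omega> - \<zeta> N j i \<omega>) ^ (2 * r)) (B i)) \<longrightarrow>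
    Ebd M (\<lambda>\<omega>. running_max (\<lambda>l. norm (\<Sum>i<l. noise_err N j i \<omega>)) k ^ (2 * r)) (C * (\<Sum>i<k. B i) / real N)"
proof -
  obtain Cw where Cw: "Cw > 0" and ws: "\<And>G a b n K (Y :: nat \<Rightarrow> 'a \<Rightarrow> real^'m^'d) B.
    wiener_filtration G \<Longrightarrow> 0 \<le> a \<Longrightarrow> a < b \<Longrightarrow> 0 < n \<Longrightarrow> K \<le> n \<Longrightarrow>
    (\<forall>l<K. Y l \<in> borel_measurable (G (uniform_point a b n l))) \<Longrightarrow>
    (\<forall>l<K. Ebd M (\<lambda>\<omega>. norm (Y l \<omega>) ^ (2 * r)) (B l)) \<Longrightarrow>
    Ebd M (\<lambda>\<omega>. running_max (\<lambda>k. norm (\<Sum>l<k. Y l \<omega> *v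
      (W (uniform_point a b n (Suc l)) \<omega> - W (uniform_point a b n l) \<omega>))) K ^ (2 * r)) (Cw * (b - a) ^ r * (\<Sum>l<K. B l) / n)"
    using wiener_sum_moment[OF r, where 'd = 'd] by blast
  have main: "Ebd M (\<lambda>\<omega>. running_max (\<lambda>l. norm (\<Sum>i<l. noise_err N j i \<omega>)) k ^ (2 * r)) (Cw * \<tau> ^ r * (\<Sum>i<k. B i) / real N)"
    if N: "0 < N" and k: "k \<le> N" and jT: "real (Suc j) * \<tau> \<le> T"
      and B: "\<forall>i<k. \<forall>s\<in>{t N j i..t N j (Suc i)}. Ebd M (\<lambda>\<omega>. norm (H s \<omega> - \<zeta> N j i \<omega>) ^ (2 * r)) (B i)"
    for N j k B
  proof -
    define R where "R n i \<omega> = riemann_sum (\<lambda>s. H s \<omega>) (\<lambda>s. W s \<omega>) (t N j i) (t N j (Suc i)) (Suc n)" for n i \<omega>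
    define D where "D i \<omega> = \<zeta> N j i \<omega> *v (W (t N j (Suc i)) \<omega> - W (t N j i) \<omega>)" for i \<omega>
    have noise: "noise_err N j i \<omega> = J (t N j i) (t N j (Suc i)) \<omega> - D i \<omega>" for i \<omega> by (simp add: noise_err_def D_def)
    have tT: "t N j i \<le> T" if "i \<le> N" for i by (rule t_le[OF N that jT])
    have st: "t N j i < t N j (Suc i)" for i using h_pos[OF N] by (simp add: t_Suc)
    have RM[measurable]: "R n i \<in> borel_measurable M" for n i
      unfolding R_def by (rule riemann_measurable[OF t_nonneg st]) simp
    have DM: "D i \<in> borel_measurable M" if "i \<le> N" for i
      unfolding D_def using \<zeta>_measurable[OF N that, of j] W_measurable[OF t_nonneg[of N j i]] W_measurable[OF t_nonneg[of N j "Suc i"]]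
      by measurable
    have NM: "noise_err N j i \<in> borel_measurable M" if "i \<le> N" for i by (rule noise_err_measurable[OF N that])
    define U where "U n \<omega> = running_max (\<lambda>l. norm (\<Sum>i<l. R n i \<omega> - D i \<omega>)) k" for n \<omega>
    define V where "V \<omega> = running_max (\<lambda>l. norm (\<Sum>i<l. noise_err N j i \<omega>)) k" for \<omega>
    have U0: "0 \<le> U n \<omega>" for n \<omega> unfolding U_def by (rule running_max_nonneg) simp
    have V0: "0 \<le> V \<omega>" for \<omega> unfolding V_def by (rule running_max_nonneg) simp
    have UM: "U n \<in> borel_measurable M" for n unfolding U_def
    proof (rule running_max_measurable)
      fix l assume "l \<le> k"
      then show "(\<lambda>\<omega>. norm (\<Sum>i<l. R n i \<omega> - D i \<omega>)) \<in> borel_measurable M"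
        using DM k by (intro measurable_compose[OF _ borel_measurable_norm] borel_measurable_sum borel_measurable_diff RM) auto
    qed
    have VM: "V \<in> borel_measurable M" unfolding V_def
    proof (rule running_max_measurable)
      fix l assume "l \<le> k"
      then show "(\<lambda>\<omega>. norm (\<Sum>i<l. noise_err N j i \<omega>)) \<in> borel_measurable M"
        using NM k by (intro measurable_compose[OF _ borel_measurable_norm] borel_measurable_sum) auto
    qed
    have conv: "conv_prob M U V"
    proof (rule conv_prob_dominated[where I = "{..<k}" and Y = "\<lambda>i n. R n i" and Z = "\<lambda>i. J (t N j i) (t N j (Suc i))"])
      show "conv_prob M (\<lambda>n. R n i) (J (t N j i) (t N j (Suc i)))" if "i \<in> {..<k}" for i
        unfolding R_def by (rule J_riemann[OF t_nonneg st tT]) (use that k in auto)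
      show "norm (U n \<omega> - V \<omega>) \<le> (\<Sum>i<k. norm (R n i \<omega> - J (t N j i) (t N j (Suc i)) \<omega>))" for n \<omega>
        unfolding U_def V_def real_norm_def
      proof (rule running_max_diff_le)
        fix l assume l: "l \<le> k"
        have "\<bar>norm (\<Sum>i<l. R n i \<omega> - D i \<omega>) - norm (\<Sum>i<l. noise_err N j i \<omega>)\<bar>
          \<le> norm ((\<Sum>i<l. R n i \<omega> - D i \<omega>) - (\<Sum>i<l. noise_err N j i \<omega>))" by (rule norm_triangle_ineq3)
        also have "(\<Sum>i<l. R n i \<omega> - D i \<omega>) - (\<Sum>i<l. noise_err N j i \<omega>) = (\<Sum>i<l. R n i \<omega> - J (t N j i) (t N j (Suc i)) \<omega>)"
          unfolding noise sum_subtractf[symmetric] by (rule sum.cong) auto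
        also have "norm \<dots> \<le> (\<Sum>i<l. norm (R n i \<omega> - J (t N j i) (t N j (Suc i)) \<omega>))" by (rule norm_sum)
        also have "\<dots> \<le> (\<Sum>i<k. norm (R n i \<omega> - J (t N j i) (t N j (Suc i)) \<omega>))" using l by (intro sum_mono2) auto
        finally show "\<bar>norm (\<Sum>i<l. R n i \<omega> - D i \<omega>) - norm (\<Sum>i<l. noise_err N j i \<omega>)\<bar> \<le> (\<Sum>i<k. norm (R n i \<omega> - J (t N j i) (t N j (Suc i)) \<omega>))" .
      qed
    qed auto
    have "Ebd M (\<lambda>\<omega>. norm (V \<omega>) ^ (2 * r)) (Cw * \<tau> ^ r * (\<Sum>i<k. B i) / real N)"
    proof (rule Ebd_conv_prob[OF conv VM UM])
      fix n
      let ?q = "Suc n"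
      let ?u = "uniform_point (t N j 0) (t N j N) (N * ?q)"
      define Z where "Z m \<omega> = H (?u m) \<omega> - \<zeta> N j (m div ?q) \<omega>" for m \<omega>
      have t0N: "t N j 0 < t N j N" using t_N[OF N, of j] tau by (simp add: t_0)
      have Nq: "0 < N * ?q" using N by simp
      have tk: "t N j i = t N j 0 + real i * h N" for i by (simp add: grid_time_def h_def)
      \<comment> \<open>Fine grid point number m is point number m mod q of the coarse cell m div q,
        so the coefficient of the scheme used there is already known at that time.\<close>
      have cell: "?u m \<in> {t N j (m div ?q)..t N j (Suc (m div ?q))}" for m
      proof -
        have "?u m = uniform_point (t N j (m div ?q)) (t N j (Suc (m div ?q))) ?q (m mod ?q)"
          using uniform_point_concat[OF N, of ?q "t N j 0" "m div ?q" "h N" "m mod ?q"]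
          unfolding tk[symmetric] div_mult_mod_eq by simp
        moreover have "m mod ?q \<le> ?q" by (simp add: less_imp_le)
        ultimately show ?thesis using uniform_point_props(4,5)[OF st, of ?q "m mod ?q" "m div ?q"] by simp
      qed
      have dk: "m div ?q < k" if "m < k * ?q" for m using that by (simp add: less_mult_imp_div_less)
      have 1: "\<forall>m<k * ?q. Z m \<in> borel_measurable (G (?u m))"
      proof (intro allI impI)
        fix m assume "m < k * ?q"
        then have d: "m div ?q \<le> N" using dk k by (meson less_imp_le order_trans)
        have c: "t N j (m div ?q) \<le> ?u m" using cell[of m] by simp
        then have u0: "0 \<le> ?u m" using t_nonneg[of N j "m div ?q"] by linarith
        have "H (?u m) \<in> borel_measurable (G (?u m))" by (rule subalgebra_measurable[OF G_F[OF u0] H_adapted[OF u0]])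
        moreover have "\<zeta> N j (m div ?q) \<in> borel_measurable (G (?u m))" by (rule G_mono[OF t_nonneg c \<zeta>_adapted[OF N d]])
        ultimately show "Z m \<in> borel_measurable (G (?u m))" unfolding Z_def by measurable
      qed
      have 2: "\<forall>m<k * ?q. Ebd M (\<lambda>\<omega>. norm (Z m \<omega>) ^ (2 * r)) (B (m div ?q))"
        unfolding Z_def using B dk cell by blast
      have W: "Ebd M (\<lambda>\<omega>. running_max (\<lambda>l. norm (\<Sum>m<l. Z m \<omega> *v (W (?u (Suc m)) \<omega> - W (?u m) \<omega>))) (k * ?q) ^ (2 * r))
        (Cw * (t N j N - t N j 0) ^ r * (\<Sum>m<k * ?q. B (m div ?q)) / real (N * ?q))"
        by (rule ws[OF G_wiener t_nonneg t0N Nq mult_le_mono1[OF k] 1 2])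
      show "Ebd M (\<lambda>\<omega>. norm (U n \<omega>) ^ (2 * r)) (Cw * \<tau> ^ r * (\<Sum>i<k. B i) / real N)"
      proof (rule Ebd_mono[OF W])
        show "(\<lambda>\<omega>. norm (U n \<omega>) ^ (2 * r)) \<in> borel_measurable M" using UM[of n] by measurable
        fix \<omega>
        let ?S = "\<lambda>l. norm (\<Sum>m<l. Z m \<omega> *v (W (?u (Suc m)) \<omega> - W (?u m) \<omega>))"
        have "U n \<omega> \<le> running_max ?S (k * ?q)"
          unfolding U_def
        proof (rule running_max_le)
          fix l assume l: "l \<le> k"
          have "(\<Sum>i<l. R n i \<omega> - D i \<omega>) = (\<Sum>m<l * ?q. Z m \<omega> *v (W (?u (Suc m)) \<omega> - W (?u m) \<omega>))"
            unfolding R_def D_def Z_def by (rule noise_riemann_concat[OF N]) simp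
          then show "norm (\<Sum>i<l. R n i \<omega> - D i \<omega>) \<le> running_max ?S (k * ?q)"
            using running_max_ge[OF mult_le_mono1[OF l, of ?q], of ?S] by simp
        qed
        then show "norm (U n \<omega>) ^ (2 * r) \<le> running_max ?S (k * ?q) ^ (2 * r)" using U0[of n \<omega>] by (intro power_mono) auto
      next
        have "(\<Sum>m<k * ?q. B (m div ?q)) = (\<Sum>i<k. \<Sum>l<?q. B ((i * ?q + l) div ?q))" by (rule sum_lessThan_concat)
        also have "\<dots> = (\<Sum>i<k. \<Sum>l<?q. B i)" by (intro sum.cong refl) (simp del: mult_Suc_right)
        also have "\<dots> = real ?q * (\<Sum>i<k. B i)" by (simp add: sum_distrib_left del: of_nat_Suc)
        finally have s: "(\<Sum>m<k * ?q. B (m div ?q)) = real ?q * (\<Sum>i<k. B i)" .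
        have "t N j N - t N j 0 = \<tau>" using t_N[OF N, of j] by (simp add: t_0 algebra_simps)
        then show "Cw * (t N j N - t N j 0) ^ r * (\<Sum>m<k * ?q. B (m div ?q)) / real (N * ?q) \<le> Cw * \<tau> ^ r * (\<Sum>i<k. B i) / real N"
          unfolding s of_nat_mult using N by (simp add: field_simps del: of_nat_Suc)
      qed auto
    qed
    then show ?thesis using V0 by (simp add: V_def)
  qed
  show ?thesis
  proof (intro exI[of _ "Cw * \<tau> ^ r"] conjI allI impI)
    show "0 < Cw * \<tau> ^ r" using Cw tau by simp
  qed (rule main; assumption)
qed

text \<open>\<open>a\<close> bounds the error on the previous interval and \<open>b\<close> the oscillation of the delayed solution
  over one cell; on the first interval the latter vanishes, which is why it is kept separate.\<close>

lemma interval_step: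
  assumes r: "1 \<le> r"
  shows "\<exists>C>0. \<forall>N j a b. 0 < N \<longrightarrow> real (Suc j) * \<tau> \<le> T \<longrightarrow> 0 < a \<longrightarrow> 0 < b \<longrightarrow>
    (\<forall>k\<le>N. Ebd M (\<lambda>\<omega>. norm (err N j k \<omega>) ^ (2 * r)) a) \<longrightarrow>
    (\<forall>i<N. \<forall>s\<in>{t N j i..t N j (Suc i)}. Ebd M (\<lambda>\<omega>. norm (X (s - \<tau>) \<omega> - X (t N j i - \<tau>) \<omega>) ^ (2 * r)) b) \<longrightarrow>
    Ebd M (\<lambda>\<omega>. running_max (\<lambda>k. norm (err N (Suc j) k \<omega>)) N ^ (2 * r))
      (C * (h N powr (\<rho> * real (2 * r)) + h N ^ r + a + (a powr \<alpha>1 + b powr \<alpha>1) + (a powr \<alpha>2 + b powr \<alpha>2)))"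
proof -
  define p where "p = 2 * r"
  have p: "1 \<le> p" using r by (simp add: p_def)
  obtain CX where CX: "0 < CX" "\<And>s. s \<le> T \<Longrightarrow> Ebd M (\<lambda>\<omega>. norm (X s \<omega>) ^ p) CX" using X_moment[OF r] unfolding p_def by blast
  obtain Cx where Cx: "0 < Cx" "\<And>s u. s \<le> u \<Longrightarrow> u \<le> T \<Longrightarrow> Ebd M (\<lambda>\<omega>. norm (X u \<omega> - X s \<omega>) ^ p) (Cx * (u - s) ^ r)"
    using X_holder[OF r] unfolding p_def by blast
  obtain Cq where Cq: "0 < Cq" and quad: "\<And>N j. 0 < N \<Longrightarrow> real (Suc j) * \<tau> \<le> T \<Longrightarrow>
    Ebd M (\<lambda>\<omega>. running_max (\<lambda>k. norm (\<Sum>i<k. quad_err N j i \<omega>)) N ^ p) (Cq * h N ^ r)"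
    using quad_moment[OF r] unfolding p_def by blast
  from noise_moment[OF r] obtain Cn where Cn: "0 < Cn" and noise0: "\<forall>N j k B. 0 < N \<longrightarrow> k \<le> N \<longrightarrow> real (Suc j) * \<tau> \<le> T \<longrightarrow>
    (\<forall>i<k. \<forall>s\<in>{t N j i..t N j (Suc i)}. Ebd M (\<lambda>\<omega>. norm (H s \<omega> - \<zeta> N j i \<omega>) ^ (2 * r)) (B i)) \<longrightarrow>
    Ebd M (\<lambda>\<omega>. running_max (\<lambda>l. norm (\<Sum>i<l. noise_err N j i \<omega>)) k ^ (2 * r)) (Cn * (\<Sum>i<k. B i) / real N)"
    by (elim exE conjE) (rule that)
  \<comment> \<open>\<open>c1\<close> and \<open>c2\<close> weigh what the drift and the diffusion
    propagate from earlier errors and from the increments of the solution; \<open>c3\<close> weighs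
    the regularity of \<open>g\<close> in time.\<close>
  define c1 where "c1 = \<tau> ^ p * (L ^ p * 8 ^ p)"
  define c2 where "c2 = Cn * (2 ^ p * (L ^ p * 8 ^ p))"
  define c3 where "c3 = Cn * (2 ^ p * (K ^ p * 4 ^ p * (1 + CX + CX)))"
  have c0: "0 \<le> c1" "0 \<le> c2" "0 \<le> c3" using tau KL Cn CX by (auto simp: c1_def c2_def c3_def)
  \<comment> \<open>The coefficients of all inhomogeneous terms, with \<open>8 ^ p\<close> for
    splitting the error into four parts. \<open>q\<close> below collects those of the earlier errors
    on the same interval and enters the result as \<open>exp q\<close>.\<close>
  define A where "A = 8 ^ p * (1 + Cq + c1 * Cx + c1 + c3 + c2 * Cx + c2)"
  define q where "q = 8 ^ p * (c1 + c2)"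
  have Apos: "0 < A" unfolding A_def using c0 Cq Cx by (intro mult_pos_pos add_pos_nonneg) auto
  have q0: "0 \<le> q" using c0 by (simp add: q_def)
  have main: "Ebd M (\<lambda>\<omega>. running_max (\<lambda>k. norm (err N (Suc j) k \<omega>)) N ^ p)
      (A * exp q * (h N powr (\<rho> * real p) + h N ^ r + a + (a powr \<alpha>1 + b powr \<alpha>1) + (a powr \<alpha>2 + b powr \<alpha>2)))"
    if N: "0 < N" and jT: "real (Suc j) * \<tau> \<le> T" and a: "0 < a" and b: "0 < b"
      and err_a: "\<And>k. k \<le> N \<Longrightarrow> Ebd M (\<lambda>\<omega>. norm (err N j k \<omega>) ^ p) a"
      and osc_b: "\<And>i s. i < N \<Longrightarrow> s \<in> {t N j i..t N j (Suc i)} \<Longrightarrow> Ebd M (\<lambda>\<omega>. norm (X (s - \<tau>) \<omega> - X (t N j i - \<tau>) \<omega>) ^ p) b"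
    for N j a b
  proof -
    have hp: "0 < h N" by (rule h_pos[OF N])
    define D where "D = h N powr (\<rho> * real p) + h N ^ r + a + (a powr \<alpha>1 + b powr \<alpha>1) + (a powr \<alpha>2 + b powr \<alpha>2)"
    define E where "E k \<omega> = running_max (\<lambda>l. norm (err N (Suc j) l \<omega>)) k" for k \<omega>
    \<comment> \<open>The recursion is run for the running maximum: it dominates each single error,
      which feeds the estimates of drift and noise, and is in turn what these estimates
      control.\<close>
    define w where "w k = (\<integral>\<omega>. E k \<omega> ^ p \<partial>M)" for k
    have E0: "0 \<le> E k \<omega>" for k \<omega> unfolding E_def by (rule running_max_nonneg) simp
    have EM: "E k \<in> borel_measurable M" if "k \<le> N" for k
      unfolding E_def
    proof (rule running_max_measurable)
      show "(\<lambda>\<omega>. norm (err N (Suc j) l \<omega>)) \<in> borel_measurable M" if "l \<le> k" for l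
        by (rule measurable_compose[OF err_measurable[OF N] borel_measurable_norm]) (use that \<open>k \<le> N\<close> in auto)
    qed
    have Ew: "Ebd M (\<lambda>\<omega>. E k \<omega> ^ p) (w k)" if k: "k \<le> N" for k
      unfolding Ebd_def
    proof (intro conjI ballI)
      have nM: "(\<lambda>\<omega>. norm (err N (Suc j) i \<omega>)) \<in> borel_measurable M" if "i \<le> k" for i
        by (rule measurable_compose[OF err_measurable[OF N] borel_measurable_norm]) (use that k in auto)
      have "integrable M (\<lambda>\<omega>. (\<Sum>i\<le>k. norm (err N (Suc j) i \<omega>)) ^ p)"
      proof (rule integrable_power_sum)
        show "integrable M (\<lambda>\<omega>. norm (err N (Suc j) i \<omega>) ^ p)" if "i \<in> {..k}" for i
          unfolding p_def by (rule err_moment[OF r N jT]) (use that k in auto)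
      qed (use nM p in auto)
      then show "integrable M (\<lambda>\<omega>. E k \<omega> ^ p)"
      proof (rule Bochner_Integration.integrable_bound)
        show "AE \<omega> in M. norm (E k \<omega> ^ p) \<le> norm ((\<Sum>i\<le>k. norm (err N (Suc j) i \<omega>)) ^ p)"
        proof (rule AE_I2)
          fix \<omega>
          have "E k \<omega> ^ p \<le> (\<Sum>i\<le>k. norm (err N (Suc j) i \<omega>)) ^ p"
            unfolding E_def by (intro power_mono running_max_le_sum running_max_nonneg) auto
          then show "norm (E k \<omega> ^ p) \<le> norm ((\<Sum>i\<le>k. norm (err N (Suc j) i \<omega>)) ^ p)" using E0[of k \<omega>] by (simp add: sum_nonneg)
        qed
      qed (use EM[OF k] in measurable)
    qed (use E0 in \<open>auto simp: w_def\<close>)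
    have errw: "Ebd M (\<lambda>\<omega>. norm (err N (Suc j) i \<omega>) ^ p) (w i)" if i: "i \<le> N" for i
    proof (rule Ebd_mono[OF Ew[OF i]])
      show "norm (err N (Suc j) i \<omega>) ^ p \<le> E i \<omega> ^ p" for \<omega>
        unfolding E_def by (intro power_mono running_max_ge[of i i "\<lambda>l. norm (err N (Suc j) l \<omega>)"]) auto
      show "(\<lambda>\<omega>. norm (err N (Suc j) i \<omega>) ^ p) \<in> borel_measurable M" using err_measurable[OF N i, of "Suc j"] by measurable
    qed auto
    have step: "w k \<le> A * D + q / real N * (\<Sum>i<k. w i)" if k: "k \<le> N" for k
    proof -
      define B1 where "B1 i = L ^ p * 8 ^ p * (Cx * h N ^ r + w i + b powr \<alpha>1 + a powr \<alpha>1)" for i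
      define B2 where "B2 i = 2 ^ p * (K ^ p * h N powr (\<rho> * real p) * 4 ^ p * (1 + CX + CX) + L ^ p * 8 ^ p * (Cx * h N ^ r + w i + b powr \<alpha>2 + a powr \<alpha>2))" for i
      have dr: "Ebd M (\<lambda>\<omega>. norm (drift_err N j i \<omega>) ^ p) (B1 i)" if "i < k" for i
        unfolding p_def B1_def
        by (rule drift_err_moment[OF r N _ jT Cx(1) Cx(2)[unfolded p_def] a err_a[unfolded p_def] b osc_b[unfolded p_def] errw[unfolded p_def]])
          (use that k in auto)
      have di: "Ebd M (\<lambda>\<omega>. norm (H s \<omega> - \<zeta> N j i \<omega>) ^ (2 * r)) (B2 i)" if "i < k" "s \<in> {t N j i..t N j (Suc i)}" for i s
        unfolding p_def B2_def
        by (rule diffusion_err_moment[OF r N _ jT CX(1) CX(2)[unfolded p_def] Cx(1) Cx(2)[unfolded p_def] a err_a[unfolded p_def] b osc_b[unfolded p_def] errw[unfolded p_def]])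
          (use that k in auto)
      have nz: "Ebd M (\<lambda>\<omega>. running_max (\<lambda>l. norm (\<Sum>i<l. noise_err N j i \<omega>)) k ^ p) (Cn * (\<Sum>i<k. B2 i) / real N)"
        using noise0[rule_format, OF N k jT di] unfolding p_def by simp
      have qd: "Ebd M (\<lambda>\<omega>. running_max (\<lambda>k. norm (\<Sum>i<k. quad_err N j i \<omega>)) N ^ p) (Cq * h N ^ r)" by (rule quad[OF N jT])
      have dM: "drift_err N j i \<in> borel_measurable M" if "i < k" for i by (rule drift_err_measurable[OF N]) (use that k in auto)
      \<comment> \<open>Hoelder's inequality for at most \<open>N\<close> summands costs N^(p-1), of
        which h^p leaves a single factor 1 / N. Thus the drift contributes an average over the
        cells, as the noise does.\<close>
      have dr': "Ebd M (\<lambda>\<omega>. (\<Sum>i<k. h N * norm (drift_err N j i \<omega>)) ^ p) (\<tau> ^ p / real N * (\<Sum>i<k. B1 i))"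
      proof (rule Ebd_mono)
        show "Ebd M (\<lambda>\<omega>. real k ^ (p - 1) * (\<Sum>i<k. h N ^ p * norm (drift_err N j i \<omega>) ^ p)) (real k ^ (p - 1) * (\<Sum>i<k. h N ^ p * B1 i))"
          by (intro Ebd_cmult Ebd_sum dr) (use hp in auto)
        show "(\<lambda>\<omega>. (\<Sum>i<k. h N * norm (drift_err N j i \<omega>)) ^ p) \<in> borel_measurable M"
          by (intro borel_measurable_power borel_measurable_sum borel_measurable_times measurable_compose[OF dM borel_measurable_norm]) auto
        show "(\<Sum>i<k. h N * norm (drift_err N j i \<omega>)) ^ p \<le> real k ^ (p - 1) * (\<Sum>i<k. h N ^ p * norm (drift_err N j i \<omega>) ^ p)" for \<omega>
          using power_sum_le[of k "\<lambda>i. h N * norm (drift_err N j i \<omega>)" p] hp p by (simp add: power_mult_distrib)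
        show "0 \<le> (\<Sum>i<k. h N * norm (drift_err N j i \<omega>)) ^ p" for \<omega> using hp by (intro zero_le_power sum_nonneg) auto
        have B10: "0 \<le> (\<Sum>i<k. B1 i)" by (intro sum_nonneg EbdD(5)[OF dr]) auto
        have "real k ^ (p - 1) * (\<Sum>i<k. h N ^ p * B1 i) = real k ^ (p - 1) * h N ^ p * (\<Sum>i<k. B1 i)"
          by (simp add: sum_distrib_left mult.assoc)
        also have "\<dots> \<le> real N ^ (p - 1) * h N ^ p * (\<Sum>i<k. B1 i)"
          using k hp B10 by (intro mult_right_mono power_mono) auto
        also have "real N ^ (p - 1) * h N ^ p = \<tau> ^ p / real N"
          using N p by (cases p) (auto simp: h_def power_divide)
        finally show "real k ^ (p - 1) * (\<Sum>i<k. h N ^ p * B1 i) \<le> \<tau> ^ p / real N * (\<Sum>i<k. B1 i)" .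
      qed
      let ?R = "\<lambda>\<omega>. 8 ^ p * (norm (err N j N \<omega>) ^ p + running_max (\<lambda>k. norm (\<Sum>i<k. quad_err N j i \<omega>)) N ^ p
        + (\<Sum>i<k. h N * norm (drift_err N j i \<omega>)) ^ p + running_max (\<lambda>l. norm (\<Sum>i<l. noise_err N j i \<omega>)) k ^ p)"
      have Rb: "Ebd M ?R (8 ^ p * (a + Cq * h N ^ r + \<tau> ^ p / real N * (\<Sum>i<k. B1 i) + Cn * (\<Sum>i<k. B2 i) / real N))"
        by (intro Ebd_cmult Ebd_add err_a qd dr' nz) auto
      have ER: "E k \<omega> ^ p \<le> ?R \<omega>" for \<omega>
      proof (rule four_power_le)
        have q1: "0 \<le> running_max (\<lambda>k. norm (\<Sum>i<k. quad_err N j i \<omega>)) N" by (rule running_max_nonneg) simp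
        have q2: "0 \<le> running_max (\<lambda>l. norm (\<Sum>i<l. noise_err N j i \<omega>)) k" by (rule running_max_nonneg) simp
        have q3: "0 \<le> (\<Sum>i<k. h N * norm (drift_err N j i \<omega>))" using hp by (intro sum_nonneg) auto
        show "0 \<le> running_max (\<lambda>k. norm (\<Sum>i<k. quad_err N j i \<omega>)) N" "0 \<le> running_max (\<lambda>l. norm (\<Sum>i<l. noise_err N j i \<omega>)) k"
          "0 \<le> (\<Sum>i<k. h N * norm (drift_err N j i \<omega>))" "0 \<le> norm (err N j N \<omega>)" "0 \<le> E k \<omega>" by (rule q1 q2 q3 norm_ge_zero E0)+
        have "E k \<omega> \<le> norm (err N j N \<omega>) + running_max (\<lambda>k. norm (\<Sum>i<k. quad_err N j i \<omega>)) N
          + (\<Sum>i<k. h N * norm (drift_err N j i \<omega>)) + running_max (\<lambda>l. norm (\<Sum>i<l. noise_err N j i \<omega>)) k"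
          unfolding E_def
        proof (rule running_max_le)
          fix l assume l: "l \<le> k"
          have "norm (err N (Suc j) l \<omega>) \<le> norm (err N j N \<omega>) + norm (\<Sum>i<l. quad_err N j i \<omega>) + norm (\<Sum>i<l. h N *\<^sub>R drift_err N j i \<omega>) + norm (\<Sum>i<l. noise_err N j i \<omega>)"
            unfolding err_eq[OF N]
            by (rule order_trans[OF norm_triangle_ineq add_right_mono[OF order_trans[OF norm_triangle_ineq add_right_mono[OF norm_triangle_ineq]]]])
          also have "norm (\<Sum>i<l. quad_err N j i \<omega>) \<le> running_max (\<lambda>k. norm (\<Sum>i<k. quad_err N j i \<omega>)) N"
            using running_max_ge[of l N "\<lambda>k. norm (\<Sum>i<k. quad_err N j i \<omega>)"] l k by simp
          also have "norm (\<Sum>i<l. noise_err N j i \<omega>) \<le> running_max (\<lambda>l. norm (\<Sum>i<l. noise_err N j i \<omega>)) k"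
            using running_max_ge[of l k "\<lambda>k. norm (\<Sum>i<k. noise_err N j i \<omega>)"] l by simp
          also have "norm (\<Sum>i<l. h N *\<^sub>R drift_err N j i \<omega>) \<le> (\<Sum>i<l. norm (h N *\<^sub>R drift_err N j i \<omega>))" by (rule norm_sum)
          also have "\<dots> = (\<Sum>i<l. h N * norm (drift_err N j i \<omega>))" using hp by simp
          also have "\<dots> \<le> (\<Sum>i<k. h N * norm (drift_err N j i \<omega>))" using l hp by (intro sum_mono2) auto
          finally show "norm (err N (Suc j) l \<omega>) \<le> norm (err N j N \<omega>) + running_max (\<lambda>k. norm (\<Sum>i<k. quad_err N j i \<omega>)) N
            + (\<Sum>i<k. h N * norm (drift_err N j i \<omega>)) + running_max (\<lambda>l. norm (\<Sum>i<l. noise_err N j i \<omega>)) k" by simp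
        qed
        then show "E k \<omega> \<le> norm (err N j N \<omega>) + running_max (\<lambda>k. norm (\<Sum>i<k. quad_err N j i \<omega>)) N
          + 2 * (\<Sum>i<k. h N * norm (drift_err N j i \<omega>)) + 2 * running_max (\<lambda>l. norm (\<Sum>i<l. noise_err N j i \<omega>)) k"
          using q2 q3 by linarith
      qed
      have "w k \<le> (\<integral>\<omega>. ?R \<omega> \<partial>M)" unfolding w_def
        by (rule integral_mono[OF EbdD(1)[OF Ew[OF k]] EbdD(1)[OF Rb] ER])
      also have "\<dots> \<le> 8 ^ p * (a + Cq * h N ^ r + \<tau> ^ p / real N * (\<Sum>i<k. B1 i) + Cn * (\<Sum>i<k. B2 i) / real N)"
        by (rule EbdD(4)[OF Rb])
      finally have w1: "w k \<le> 8 ^ p * (a + Cq * h N ^ r + \<tau> ^ p / real N * (\<Sum>i<k. B1 i) + Cn * (\<Sum>i<k. B2 i) / real N)" .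
      define d1 where "d1 = Cx * h N ^ r + b powr \<alpha>1 + a powr \<alpha>1"
      define d2 where "d2 = Cx * h N ^ r + b powr \<alpha>2 + a powr \<alpha>2"
      define e where "e = h N powr (\<rho> * real p)"
      define s where "s = (\<Sum>i<k. w i)"
      have d0: "0 \<le> d1" "0 \<le> d2" "0 \<le> e" using Cx hp by (auto simp: d1_def d2_def e_def)
      have kN: "real k / real N \<le> 1" using k N by simp
      have "(\<Sum>i<k. B1 i) = L ^ p * 8 ^ p * (\<Sum>i<k. d1 + w i)"
        unfolding B1_def d1_def by (simp add: sum_distrib_left algebra_simps)
      also have "(\<Sum>i<k. d1 + w i) = real k * d1 + s" by (simp add: sum.distrib s_def)
      finally have S1: "\<tau> ^ p / real N * (\<Sum>i<k. B1 i) = c1 * (real k / real N * d1) + c1 / real N * s"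
        using N by (simp add: c1_def field_simps)
      have "(\<Sum>i<k. B2 i) = (\<Sum>i<k. 2 ^ p * (K ^ p * 4 ^ p * (1 + CX + CX)) * e + 2 ^ p * (L ^ p * 8 ^ p) * (d2 + w i))"
        unfolding B2_def d2_def e_def by (intro sum.cong refl) (simp add: algebra_simps)
      also have "\<dots> = real k * (2 ^ p * (K ^ p * 4 ^ p * (1 + CX + CX)) * e) + 2 ^ p * (L ^ p * 8 ^ p) * (real k * d2 + s)"
        by (simp add: sum.distrib s_def flip: sum_distrib_left)
      finally have S2': "(\<Sum>i<k. B2 i) = real k * (2 ^ p * (K ^ p * 4 ^ p * (1 + CX + CX)) * e) + 2 ^ p * (L ^ p * 8 ^ p) * (real k * d2 + s)" .
      have S2: "Cn * (\<Sum>i<k. B2 i) / real N = c3 * (real k / real N * e) + c2 * (real k / real N * d2) + c2 / real N * s"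
        unfolding S2' c2_def c3_def using N by (simp add: divide_simps) (simp add: algebra_simps)
      have le: "real k / real N * x \<le> x" if "0 \<le> x" for x using mult_right_mono[OF kN that] by simp
      have "w k \<le> 8 ^ p * (a + Cq * h N ^ r + (c1 * d1 + c1 / real N * s) + (c3 * e + c2 * d2 + c2 / real N * s))"
        using c0 le d0 by (intro order_trans[OF w1[unfolded S1 S2]] mult_left_mono add_mono order_refl mult_left_mono[OF le]) auto
      also have "\<dots> = 8 ^ p * (a + Cq * h N ^ r + c1 * d1 + c3 * e + c2 * d2) + q / real N * s"
        by (simp add: q_def algebra_simps add_divide_distrib)
      also have "8 ^ p * (a + Cq * h N ^ r + c1 * d1 + c3 * e + c2 * d2) \<le> A * D"
      proof -
        have Ds: "a \<le> D" "h N ^ r \<le> D" "e \<le> D" "b powr \<alpha>1 + a powr \<alpha>1 \<le> D" "b powr \<alpha>2 + a powr \<alpha>2 \<le> D"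
          using hp a by (auto simp: D_def e_def)
        have "c1 * d1 \<le> c1 * (Cx * D + D)" "c2 * d2 \<le> c2 * (Cx * D + D)"
          unfolding d1_def d2_def add.assoc using Ds Cx c0 by (auto intro!: mult_left_mono add_mono)
        moreover have "Cq * h N ^ r \<le> Cq * D" "c3 * e \<le> c3 * D" using Ds Cq c0 by (auto intro!: mult_left_mono)
        ultimately have "a + Cq * h N ^ r + c1 * d1 + c3 * e + c2 * d2 \<le> D + Cq * D + c1 * (Cx * D + D) + c3 * D + c2 * (Cx * D + D)"
          using Ds by linarith
        also have "\<dots> = (1 + Cq + c1 * Cx + c1 + c3 + c2 * Cx + c2) * D" by (simp add: algebra_simps)
        finally show ?thesis unfolding A_def mult.assoc by (intro mult_left_mono) auto
      qed
      finally show ?thesis by (simp add: s_def)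
    qed
    have D0: "0 \<le> D" using hp a by (simp add: D_def)
    have "w N \<le> A * D * (1 + q / real N) ^ N"
      by (rule discrete_Gronwall[OF step]) (use q0 Apos D0 in auto)
    also have "\<dots> \<le> A * D * exp q"
    proof (intro mult_left_mono)
      have "(1 + q / real N) ^ N \<le> exp (q / real N) ^ N" using q0 exp_ge_add_one_self[of "q / real N"] by (intro power_mono) auto
      also have "\<dots> = exp q" using N by (simp add: exp_of_nat_mult[symmetric])
      finally show "(1 + q / real N) ^ N \<le> exp q" .
    qed (use Apos D0 in auto)
    finally have "w N \<le> A * exp q * D" by (simp add: mult_ac)
    then show ?thesis using Ebd_mono_const[OF Ew[OF order_refl]] unfolding D_def E_def by blast
  qed
  show ?thesis
  proof (intro exI[of _ "A * exp q"] conjI allI impI)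
    show "0 < A * exp q" using Apos by simp
  qed (rule main[unfolded p_def]; blast)
qed

end

section \<open>The rate, by induction over the delay intervals\<close>

context randomized_sdde
begin

text \<open>Each interval multiplies the exponent by \<alpha>. At index 0 the error vanishes and any
  exponent is admissible; dividing by \<alpha> there makes the first interval start with the full
  order \<beta> of the scheme. Index \<open>Suc j\<close> thus carries \<beta> \<alpha>^j after the
  root of order 2r.\<close>

lemma scheme_convergence:
  assumes r: "1 \<le> r"
  defines "\<alpha> \<equiv> min \<alpha>1 \<alpha>2" and "\<beta> \<equiv> min \<rho> (1/2)"
  shows "real j * \<tau> \<le> T \<Longrightarrow> \<exists>A>0. \<forall>N. 0 < N \<longrightarrow> h N \<le> 1 \<longrightarrow>
    Ebd M (\<lambda>\<omega>. running_max (\<lambda>k. norm (err N j k \<omega>)) N ^ (2 * r)) (A * h N powr (2 * real r * \<beta> / \<alpha> * \<alpha> ^ j))"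
proof (induction j)
  case 0
  have "Ebd M (\<lambda>\<omega>. running_max (\<lambda>k. norm (err N 0 k \<omega>)) N ^ (2 * r)) (1 * h N powr (2 * real r * \<beta> / \<alpha> * \<alpha> ^ 0))" if N: "0 < N" for N
  proof -
    have "running_max (\<lambda>k. norm (err N 0 k \<omega>)) N = 0" if w: "\<omega> \<in> space M" for \<omega>
    proof (rule antisym)
      show "running_max (\<lambda>k. norm (err N 0 k \<omega>)) N \<le> 0" by (rule running_max_le) (simp add: err_0[OF w N])
    qed (rule running_max_nonneg, simp)
    then show ?thesis using r by (intro Ebd_zero) simp_all
  qed
  then show ?case by (intro exI[of _ 1]) auto
next
  case (Suc j)
  have al: "0 < \<alpha>" "\<alpha> \<le> 1" "\<alpha> \<le> \<alpha>1" "\<alpha> \<le> \<alpha>2" using alpha1 alpha2 by (auto simp: \<alpha>_def)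
  have be: "0 < \<beta>" "\<beta> \<le> \<rho>" "2 * \<beta> \<le> 1" using rho by (auto simp: \<beta>_def)
  have "real j * \<tau> \<le> real (Suc j) * \<tau>" using tau by (intro mult_right_mono) auto
  then have jT: "real j * \<tau> \<le> T" using Suc.prems by linarith
  from Suc.IH[OF jT] obtain A where A: "0 < A" and IH: "\<And>N. 0 < N \<Longrightarrow> h N \<le> 1 \<Longrightarrow>
    Ebd M (\<lambda>\<omega>. running_max (\<lambda>k. norm (err N j k \<omega>)) N ^ (2 * r)) (A * h N powr (2 * real r * \<beta> / \<alpha> * \<alpha> ^ j))" by blast
  from interval_step[OF r] obtain C where C: "0 < C" and step: "\<forall>N j a b. 0 < N \<longrightarrow> real (Suc j) * \<tau> \<le> T \<longrightarrow> 0 < a \<longrightarrow> 0 < b \<longrightarrow>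
    (\<forall>k\<le>N. Ebd M (\<lambda>\<omega>. norm (err N j k \<omega>) ^ (2 * r)) a) \<longrightarrow>
    (\<forall>i<N. \<forall>s\<in>{t N j i..t N j (Suc i)}. Ebd M (\<lambda>\<omega>. norm (X (s - \<tau>) \<omega> - X (t N j i - \<tau>) \<omega>) ^ (2 * r)) b) \<longrightarrow>
    Ebd M (\<lambda>\<omega>. running_max (\<lambda>k. norm (err N (Suc j) k \<omega>)) N ^ (2 * r))
      (C * (h N powr (\<rho> * real (2 * r)) + h N ^ r + a + (a powr \<alpha>1 + b powr \<alpha>1) + (a powr \<alpha>2 + b powr \<alpha>2)))"
    by (elim exE conjE) (rule that)
  obtain Cx where Cx: "0 < Cx" "\<And>s u. s \<le> u \<Longrightarrow> u \<le> T \<Longrightarrow> Ebd M (\<lambda>\<omega>. norm (X u \<omega> - X s \<omega>) ^ (2 * r)) (Cx * (u - s) ^ r)"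
    using X_holder[OF r] by blast
  define e where "e = 2 * real r * \<beta> / \<alpha> * \<alpha> ^ j"
  define e' where "e' = 2 * real r * \<beta> / \<alpha> * \<alpha> ^ Suc j"
  \<comment> \<open>On the first interval the delayed solution is constant, so \<open>b\<close> may
    be chosen freely and gets the exponent of the error. Later the increments of the solution give
    h^r, and \<open>real r * \<alpha>\<close> is at least \<open>e'\<close> because 2 \<beta> \<le>
    1 and \<alpha>^j \<le> \<alpha>.\<close>
  define eb where "eb = (if j = 0 then e else real r)"
  have e'_eq: "e' = e * \<alpha>" by (simp add: e_def e'_def)
  have e0: "0 \<le> e" using al be by (simp add: e_def)
  have e'2: "e' = 2 * real r * \<beta> * \<alpha> ^ j" using al by (simp add: e'_def)
  have aj: "\<alpha> ^ j \<le> 1" using al by (intro power_le_one) auto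
  have e'_le: "e' \<le> 2 * real r * \<beta>" unfolding e'2 using aj be by (simp add: mult_left_le)
  have b2: "2 * real r * \<beta> \<le> real r" using mult_left_mono[OF be(3), of "real r"] by (simp add: mult_ac)
  have eb: "e' \<le> eb * \<alpha>"
  proof (cases "j = 0")
    case False
    then have "\<alpha> ^ j \<le> \<alpha> ^ 1" using al by (intro power_decreasing) auto
    then have "2 * real r * \<beta> * \<alpha> ^ j \<le> 2 * real r * \<beta> * \<alpha>" using be by (intro mult_left_mono) auto
    also have "\<dots> \<le> real r * \<alpha>" using b2 al by (intro mult_right_mono) auto
    finally show ?thesis using False by (simp add: eb_def e'2)
  qed (simp add: eb_def e'_eq)
  have eb0: "0 \<le> eb" using e0 by (simp add: eb_def)
  have ea_i: "e' \<le> e * \<alpha>1" "e' \<le> e * \<alpha>2" using mult_left_mono[OF al(3) e0] mult_left_mono[OF al(4) e0] e'_eq by auto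
  have eb_i: "e' \<le> eb * \<alpha>1" "e' \<le> eb * \<alpha>2" using mult_left_mono[OF al(3) eb0] mult_left_mono[OF al(4) eb0] eb by linarith+
  have e'e: "e' \<le> e" using mult_left_mono[OF al(2) e0] e'_eq by simp
  define Bb where "Bb = 1 + Cx"
  have Bb: "0 < Bb" using Cx by (simp add: Bb_def)
  \<comment> \<open>As \<open>h N\<close> is at most 1, every term of \<open>interval_step\<close>
    is absorbed into the smallest exponent \<open>e'\<close>. The coefficients are 1 for each of the
    two powers of h, \<open>A\<close> for the previous error, and \<open>1 + A\<close> and
    \<open>1 + Bb\<close> for each of the two Hoelder exponents.\<close>
  have "Ebd M (\<lambda>\<omega>. running_max (\<lambda>k. norm (err N (Suc j) k \<omega>)) N ^ (2 * r)) (C * (2 + A + 2 * ((1 + A) + (1 + Bb))) * h N powr e')"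
    if N: "0 < N" and h1: "h N \<le> 1" for N
  proof -
    have hp: "0 < h N" by (rule h_pos[OF N])
    define a where "a = A * h N powr e"
    define b where "b = Bb * h N powr eb"
    have a0: "0 < a" and b0: "0 < b" using A Bb hp by (auto simp: a_def b_def)
    have 1: "\<forall>k\<le>N. Ebd M (\<lambda>\<omega>. norm (err N j k \<omega>) ^ (2 * r)) a"
    proof (intro allI impI)
      fix k assume k: "k \<le> N"
      show "Ebd M (\<lambda>\<omega>. norm (err N j k \<omega>) ^ (2 * r)) a"
      proof (rule Ebd_mono[OF IH[OF N h1]])
        show "(\<lambda>\<omega>. norm (err N j k \<omega>) ^ (2 * r)) \<in> borel_measurable M" using err_measurable[OF N k, of j] by measurable
        show "norm (err N j k \<omega>) ^ (2 * r) \<le> running_max (\<lambda>k. norm (err N j k \<omega>)) N ^ (2 * r)" for \<omega>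
          by (intro power_mono running_max_ge[OF k, of "\<lambda>k. norm (err N j k \<omega>)"]) auto
      qed (auto simp: a_def e_def)
    qed
    have 2: "\<forall>i<N. \<forall>s\<in>{t N j i..t N j (Suc i)}. Ebd M (\<lambda>\<omega>. norm (X (s - \<tau>) \<omega> - X (t N j i - \<tau>) \<omega>) ^ (2 * r)) b"
    proof (intro allI impI ballI)
      fix i s assume i: "i < N" and s: "s \<in> {t N j i..t N j (Suc i)}"
      show "Ebd M (\<lambda>\<omega>. norm (X (s - \<tau>) \<omega> - X (t N j i - \<tau>) \<omega>) ^ (2 * r)) b"
      proof (cases "j = 0")
        case True
        have "t N 0 (Suc i) \<le> \<tau>" using t_mono[of "Suc i" N N 0] t_N[OF N, of 0] i by (simp add: t_0)
        then have "X (s - \<tau>) \<omega> = X (t N j i - \<tau>) \<omega>" if "\<omega> \<in> space M" for \<omega>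
          using s True X_init[OF that, of "s - \<tau>"] X_init[OF that, of "t N j i - \<tau>"] by simp
        then show ?thesis using b0 r by (intro Ebd_zero) simp_all
      next
        case False
        show ?thesis
        proof (rule Ebd_mono_const[OF Cx(2)])
          show "t N j i - \<tau> \<le> s - \<tau>" using s by simp
          show "s - \<tau> \<le> T" using s t_le[OF N _ Suc.prems, of "Suc i"] i tau by simp
          have "(s - \<tau> - (t N j i - \<tau>)) ^ r \<le> h N ^ r" using s by (intro power_mono) (auto simp: t_Suc)
          also have "\<dots> = h N powr eb" using hp False by (simp add: eb_def powr_realpow)
          finally have "Cx * (s - \<tau> - (t N j i - \<tau>)) ^ r \<le> Cx * h N powr eb" using Cx by (intro mult_left_mono) auto
          also have "\<dots> \<le> b" unfolding b_def Bb_def by (intro mult_right_mono) auto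
          finally show "Cx * (s - \<tau> - (t N j i - \<tau>)) ^ r \<le> b" .
        qed
      qed
    qed
    have "Ebd M (\<lambda>\<omega>. running_max (\<lambda>k. norm (err N (Suc j) k \<omega>)) N ^ (2 * r))
      (C * (h N powr (\<rho> * real (2 * r)) + h N ^ r + a + (a powr \<alpha>1 + b powr \<alpha>1) + (a powr \<alpha>2 + b powr \<alpha>2)))"
      by (rule step[rule_format, OF N Suc.prems a0 b0]) (use 1 2 in auto)
    moreover have "C * (h N powr (\<rho> * real (2 * r)) + h N ^ r + a + (a powr \<alpha>1 + b powr \<alpha>1) + (a powr \<alpha>2 + b powr \<alpha>2))
      \<le> C * ((2 + A + 2 * ((1 + A) + (1 + Bb))) * h N powr e')"
    proof (rule mult_left_mono)
      have "2 * real r * \<beta> \<le> 2 * real r * \<rho>" using be by (intro mult_left_mono) auto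
      then have "e' \<le> \<rho> * real (2 * r)" using e'_le by (simp add: mult_ac)
      then have 1: "h N powr (\<rho> * real (2 * r)) \<le> h N powr e'" using hp h1 by (intro powr_mono') auto
      have "h N ^ r = h N powr real r" using hp by (simp add: powr_realpow)
      also have "\<dots> \<le> h N powr e'" using hp h1 e'_le b2 by (intro powr_mono') auto
      finally have 2: "h N ^ r \<le> h N powr e'" .
      have 3: "a \<le> A * h N powr e'" unfolding a_def using A hp h1 e'e by (intro mult_left_mono powr_mono') auto
      have 4: "a powr \<alpha>1 \<le> (1 + A) * h N powr e'" "a powr \<alpha>2 \<le> (1 + A) * h N powr e'"
        unfolding a_def by (rule scale_powr_le[OF A hp h1 alpha1 ea_i(1)], rule scale_powr_le[OF A hp h1 alpha2 ea_i(2)])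
      have 5: "b powr \<alpha>1 \<le> (1 + Bb) * h N powr e'" "b powr \<alpha>2 \<le> (1 + Bb) * h N powr e'"
        unfolding b_def by (rule scale_powr_le[OF Bb hp h1 alpha1 eb_i(1)], rule scale_powr_le[OF Bb hp h1 alpha2 eb_i(2)])
      have "h N powr (\<rho> * real (2 * r)) + h N ^ r + a + (a powr \<alpha>1 + b powr \<alpha>1) + (a powr \<alpha>2 + b powr \<alpha>2)
        \<le> h N powr e' + h N powr e' + A * h N powr e' + ((1 + A) * h N powr e' + (1 + Bb) * h N powr e') + ((1 + A) * h N powr e' + (1 + Bb) * h N powr e')"
        by (intro add_mono 1 2 3 4 5)
      also have "\<dots> = (2 + A + 2 * ((1 + A) + (1 + Bb))) * h N powr e'" by (simp add: algebra_simps)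
      finally show "h N powr (\<rho> * real (2 * r)) + h N ^ r + a + (a powr \<alpha>1 + b powr \<alpha>1) + (a powr \<alpha>2 + b powr \<alpha>2) \<le> (2 + A + 2 * ((1 + A) + (1 + Bb))) * h N powr e'" .
    qed (use C in simp)
    ultimately show ?thesis unfolding mult.assoc by (rule Ebd_mono_const)
  qed
  note main = this
  show ?case unfolding e'_def[symmetric]
  proof (intro exI[of _ "C * (2 + A + 2 * ((1 + A) + (1 + Bb)))"] conjI allI impI)
    show "0 < C * (2 + A + 2 * ((1 + A) + (1 + Bb)))" using C A Bb by (intro mult_pos_pos) auto
  qed (rule main; assumption)
qed

end

text \<open>Jensen's inequality for the concave power p / (2r). \<open>Z'\<close> agrees with
  \<open>Z\<close> only almost everywhere, since the sampling points had to be clamped.\<close>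

lemma (in prob_space) Lp_norm_le:
  fixes Z Z' :: "'a \<Rightarrow> real"
  assumes p: "2 \<le> p" and r: "p \<le> 2 * real r" and b: "Ebd M (\<lambda>\<omega>. Z \<omega> ^ (2 * r)) b" "0 < b"
    and Z: "Z \<in> borel_measurable M" "\<And>\<omega>. 0 \<le> Z \<omega>" and ae: "AE \<omega> in M. Z' \<omega> = Z \<omega>"
  shows "Lp_norm M p Z' \<le> ennreal (b powr (1 / (2 * real r)))"
proof -
  define q where "q = p / (2 * real r)"
  have r0: "0 < r" using p r by (cases r) auto
  have q: "0 < q" "q \<le> 1" using p r r0 by (auto simp: q_def)
  have e: "Z \<omega> powr p = (Z \<omega> ^ (2 * r)) powr q" for \<omega>
  proof (cases "Z \<omega> = 0")
    case True then show ?thesis using r0 q by simp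
  next
    case False
    then have "0 < Z \<omega>" using Z(2)[of \<omega>] by simp
    then have "(Z \<omega> ^ (2 * r)) powr q = Z \<omega> powr (real (2 * r) * q)" by (simp add: powr_realpow[symmetric] powr_powr)
    also have "real (2 * r) * q = p" using r0 by (simp add: q_def)
    finally show ?thesis by simp
  qed
  have E: "Ebd M (\<lambda>\<omega>. Z \<omega> powr p) (b powr q)" unfolding e by (rule Ebd_powr[OF b q])
  have "(\<integral>\<^sup>+\<omega>. ennreal (norm (Z' \<omega>) powr p) \<partial>M) = (\<integral>\<^sup>+\<omega>. ennreal (Z \<omega> powr p) \<partial>M)"
    by (rule nn_integral_cong_AE) (use ae Z(2) in \<open>auto elim!: eventually_mono\<close>)
  also have "\<dots> \<le> ennreal (b powr q)" using E EbdD(2)[OF E] by (subst Ebd_nn_integral[symmetric]) auto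
  finally have le: "(\<integral>\<^sup>+\<omega>. ennreal (norm (Z' \<omega>) powr p) \<partial>M) \<le> ennreal (b powr q)" .
  then have fin: "(\<integral>\<^sup>+\<omega>. ennreal (norm (Z' \<omega>) powr p) \<partial>M) \<noteq> \<infinity>" by (metis ennreal_neq_top infinity_ennreal_def top.extremum_uniqueI)
  have "enn2real (\<integral>\<^sup>+\<omega>. ennreal (norm (Z' \<omega>) powr p) \<partial>M) \<le> b powr q" using le by (simp add: enn2real_leI)
  then have "enn2real (\<integral>\<^sup>+\<omega>. ennreal (norm (Z' \<omega>) powr p) \<partial>M) powr (1 / p) \<le> (b powr q) powr (1 / p)"
    using p by (intro powr_mono2) auto
  also have "\<dots> = b powr (1 / (2 * real r))" using p by (simp add: powr_powr q_def)
  finally show ?thesis using fin by (simp add: Lp_norm_def Let_def ennreal_leI)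
qed

text \<open>Every clause sees the integrand on [0, T] and on the sample space only, so the equation
  passes to the coefficients and the solution with clamped time.\<close>

lemma is_ito_integral_cong:
  assumes "is_ito_integral M F W T H I" and eq: "\<And>s \<omega>. s \<in> {0..T} \<Longrightarrow> \<omega> \<in> space M \<Longrightarrow> H s \<omega> = H' s \<omega>"
    and sp: "\<And>t. t \<in> {0..T} \<Longrightarrow> space (F t) = space M"
  shows "is_ito_integral M F W T H' I"
proof -
  have prog: "progressively_measurable F T H' \<longleftrightarrow> progressively_measurable F T H"
    unfolding progressively_measurable_def
    by (intro ball_cong refl measurable_cong) (auto simp: space_pair_measure sp space_restrict_space eq)
  have i1: "(\<integral>\<^sup>+s\<in>{0..T}. ennreal ((norm (H s \<omega>))\<^sup>2) \<partial>lborel) = (\<integral>\<^sup>+s\<in>{0..T}. ennreal ((norm (H' s \<omega>))\<^sup>2) \<partial>lborel)"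
    if "\<omega> \<in> space M" for \<omega> by (intro nn_integral_cong) (auto simp: indicator_def eq that)
  have i2: "(\<integral>\<^sup>+s\<in>{0..T}. ennreal ((norm (S s \<omega> - H s \<omega>))\<^sup>2) \<partial>lborel) = (\<integral>\<^sup>+s\<in>{0..T}. ennreal ((norm (S s \<omega> - H' s \<omega>))\<^sup>2) \<partial>lborel)"
    if "\<omega> \<in> space M" for \<omega> S by (intro nn_integral_cong) (auto simp: indicator_def eq that)
  have a1: "(AE \<omega> in M. (\<integral>\<^sup>+s\<in>{0..T}. ennreal ((norm (H' s \<omega>))\<^sup>2) \<partial>lborel) < \<infinity>) \<longleftrightarrow> (AE \<omega> in M. (\<integral>\<^sup>+s\<in>{0..T}. ennreal ((norm (H s \<omega>))\<^sup>2) \<partial>lborel) < \<infinity>)"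
    by (rule AE_cong) (simp add: i1)
  have a2: "tendsto_zero_in_prob M (\<lambda>q \<omega>. \<integral>\<^sup>+s\<in>{0..T}. ennreal ((norm (S q s \<omega> - H' s \<omega>))\<^sup>2) \<partial>lborel)
    \<longleftrightarrow> tendsto_zero_in_prob M (\<lambda>q \<omega>. \<integral>\<^sup>+s\<in>{0..T}. ennreal ((norm (S q s \<omega> - H s \<omega>))\<^sup>2) \<partial>lborel)" for S
    unfolding tendsto_zero_in_prob_def using i2 by (simp cong: conj_cong)
  show ?thesis using assms(1) unfolding is_ito_integral_def prog a1 a2 .
qed

text \<open>The family is grouped into two blocks indexed by the Booleans, the member
  \<open>i\<close> alone and all the others; blocks of an independent family generate independent
  sigma-algebras.\<close>

lemma indep_family_split:
  fixes \<gamma> :: "'i \<Rightarrow> 'a \<Rightarrow> real"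
  assumes M: "prob_space M" and ind: "prob_space.indep_vars M (\<lambda>_. borel) \<gamma> I" and i: "i \<in> I"
    and A: "A \<in> sets borel" and c: "c \<in> sigma_sets (space M) (\<Union>l\<in>I - {i}. {\<gamma> l -` A \<inter> space M | A. A \<in> sets borel})"
  shows "measure M (\<gamma> i -` A \<inter> space M \<inter> c) = measure M (\<gamma> i -` A \<inter> space M) * measure M c"
proof -
  interpret prob_space M by fact
  define E where "E l = {\<gamma> l -` A \<inter> space M | A. A \<in> sets borel}" for l
  define J where "J b = (if b then {i} else I - {i})" for b
  have indE: "indep_sets E I" using ind unfolding indep_vars_def2 E_def by simp
  have "indep_sets (\<lambda>b. sigma_sets (space M) (\<Union>l\<in>J b. E l)) UNIV"
  proof (rule indep_sets_collect_sigma)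
    have "(\<Union>b\<in>UNIV. J b) = I" using i by (auto simp: J_def UNIV_bool)
    then show "indep_sets E (\<Union>b\<in>UNIV. J b)" using indE by simp
    show "disjoint_family_on J UNIV" by (auto simp: disjoint_family_on_def J_def)
    show "Int_stable (E l)" for l
    proof (rule Int_stableI)
      fix a b assume "a \<in> E l" "b \<in> E l"
      then obtain A B where "A \<in> sets borel" "B \<in> sets borel" "a = \<gamma> l -` A \<inter> space M" "b = \<gamma> l -` B \<inter> space M"
        by (auto simp: E_def)
      then show "a \<inter> b \<in> E l" unfolding E_def by (auto intro!: exI[of _ "A \<inter> B"])
    qed
  qed
  moreover have "\<gamma> i -` A \<inter> space M \<in> sigma_sets (space M) (\<Union>l\<in>J True. E l)"
    using A by (auto simp: J_def E_def intro!: sigma_sets.Basic)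
  moreover have "c \<in> sigma_sets (space M) (\<Union>l\<in>J False. E l)" using c by (simp add: J_def E_def)
  ultimately have "prob (\<Inter>b\<in>UNIV. (if b then \<gamma> i -` A \<inter> space M else c)) = (\<Prod>b\<in>UNIV. prob (if b then \<gamma> i -` A \<inter> space M else c))"
    by (intro indep_setsD[of "\<lambda>b. sigma_sets (space M) (\<Union>l\<in>J b. E l)" UNIV UNIV]) (auto split: if_splits)
  then show ?thesis by (simp add: UNIV_bool Int_commute mult.commute)
qed

text \<open>The drift is evaluated at a point of a cell and the diffusion at its left end. Both lie
  in [0, T], so the scheme does not see how the coefficients were extended, and it reads sampling
  points with positive second index only.\<close>

lemma euler_shifted_cong:
  assumes f: "\<And>s x z. s \<in> {0..T} \<Longrightarrow> f' s x z = f s x z" and g: "\<And>s x z. s \<in> {0..T} \<Longrightarrow> g' s x z = g s x z"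
    and c: "\<And>i l. c' i (Suc l) = c i (Suc l)" "\<And>i l. c i (Suc l) \<in> {0..1}"
    and N: "0 < N" and \<tau>: "0 < \<tau>"
  shows "real j * \<tau> \<le> T \<Longrightarrow> k \<le> N \<Longrightarrow> euler_shifted f' g' \<tau> x0 N w c' j k = euler_shifted f g \<tau> x0 N w c j k"
proof (induction j arbitrary: k)
  case 0 then show ?case by simp
next
  case (Suc j)
  have "real j * \<tau> \<le> real (Suc j) * \<tau>" using \<tau> by (intro mult_right_mono) auto
  then have jT: "real j * \<tau> \<le> T" using Suc.prems(1) by linarith
  note outer = Suc.IH[OF jT] and jT' = Suc.prems(1)
  from Suc.prems(2) show ?case
  proof (induction k)
    case 0 then show ?case using outer[of N] by simp
  next
    case (Suc k)
    let ?h = "\<tau> / real N"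
    have h: "0 < ?h" using N \<tau> by simp
    have t0: "0 \<le> grid_time \<tau> N j k" using \<tau> by (simp add: grid_time_def)
    have "real (Suc k) * ?h \<le> real N * ?h" using Suc.prems h by (intro mult_right_mono) auto
    then have "grid_time \<tau> N j (Suc k) \<le> real (Suc j) * \<tau>" using N by (simp add: grid_time_def algebra_simps)
    then have t1: "grid_time \<tau> N j k + ?h \<le> T" using jT' by (simp add: grid_time_def algebra_simps add_divide_distrib)
    have "0 \<le> ?h * c j (Suc k)" "?h * c j (Suc k) \<le> ?h * 1" using c(2)[of j k] h
      by (intro mult_nonneg_nonneg mult_left_mono; simp)+
    then have th: "grid_time \<tau> N j k + ?h * c j (Suc k) \<in> {0..T}" using t0 t1 by simp
    have tk: "grid_time \<tau> N j k \<in> {0..T}" using t0 t1 h by simp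
    have "f' (grid_time \<tau> N j k + ?h * c j (Suc k)) = f (grid_time \<tau> N j k + ?h * c j (Suc k))"
      and "g' (grid_time \<tau> N j k) = g (grid_time \<tau> N j k)" using f[OF th] g[OF tk] by blast+
    then show ?case using Suc.IH outer[of k] Suc.prems unfolding euler_shifted.simps by (simp only: Let_def c(1))
  qed
qed

theorem theorem4p1:
  fixes M :: "'a measure" and F :: "real \<Rightarrow> 'a measure"
    and W :: "real \<Rightarrow> 'a \<Rightarrow> real^'m"
    and \<gamma> :: "nat \<Rightarrow> nat \<Rightarrow> 'a \<Rightarrow> real"
    and p \<tau> \<rho> \<alpha>1 \<alpha>2 T :: real and n :: nat and x0 :: "real^'d"
    and f :: "real \<Rightarrow> real^'d \<Rightarrow> real^'d \<Rightarrow> real^'d"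
    and g :: "real \<Rightarrow> real^'d \<Rightarrow> real^'d \<Rightarrow> real^'m^'d"
    and X :: "real \<Rightarrow> 'a \<Rightarrow> real^'d"
  assumes "prob_space M" and "complete_measure M"
    and "usual_conditions M F"
    and "wiener_process M F W"
    and "scheme_randomness M F \<gamma>"
    and "2 \<le> p" and "0 < \<tau>"
    and "\<rho> \<in> {0<..1}" and "\<alpha>1 \<in> {0<..1}" and "\<alpha>2 \<in> {0<..1}"
    and T: "T = (real n + 1) * \<tau>"
    and A1: "\<forall>t\<in>{0..T}. continuous_on UNIV (\<lambda>(x, z). f t x z)"
    and A2: "\<forall>x z. (\<lambda>t. f t x z) \<in> borel_measurable (restrict_space borel {0..T})"
    and A3': "\<exists>Kf>0. \<exists>Lf>0.
       (\<forall>t\<in>{0..T}. norm (f t 0 0) \<le> Kf) \<and>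
       (\<forall>t\<in>{0..T}. \<forall>x1 x2 z1 z2.
          norm (f t x1 z1 - f t x2 z2) \<le> Lf * (norm (x1 - x2) + norm (z1 - z2) powr \<alpha>1))"
    and B1: "\<forall>t\<in>{0..T}. continuous_on UNIV (\<lambda>(x, z). g t x z)"
    and B2: "\<forall>x z. (\<lambda>t. g t x z) \<in> borel_measurable (restrict_space borel {0..T})"
    and B3': "\<exists>Kg>0. \<exists>Lg>0.
       (\<forall>t1\<in>{0..T}. \<forall>t2\<in>{0..T}. \<forall>x z.
          norm (g t1 x z - g t2 x z) \<le> Kg * (1 + norm x + norm z) * \<bar>t1 - t2\<bar> powr \<rho>) \<and>
       (\<forall>t\<in>{0..T}. \<forall>x1 x2 z1 z2.
          norm (g t x1 z1 - g t x2 z2) \<le> Lg * (norm (x1 - x2) + norm (z1 - z2) powr \<alpha>2))"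
    and X: "strong_solution M F W f g \<tau> x0 T X"
  shows "\<exists>C :: nat \<Rightarrow> real. (\<forall>j\<le>n. 0 < C j) \<and>
    (\<forall>N::nat. \<lceil>\<tau>\<rceil> \<le> int N \<longrightarrow> (\<forall>j\<le>n.
       Lp_norm M p (\<lambda>\<omega>. MAX k\<in>{0..N}.
            norm (X (grid_time \<tau> N j k) \<omega> - randomized_euler f g \<tau> x0 N W \<gamma> j k \<omega>))
         \<le> ennreal (C j * (\<tau> / real N) powr (min \<rho> (1/2) * min \<alpha>1 \<alpha>2 ^ j)) \<and>
       (min \<alpha>1 \<alpha>2 = 1 \<longrightarrow>
         Lp_norm M p (\<lambda>\<omega>. MAX k\<in>{0..N}.
            norm (X (grid_time \<tau> N j k) \<omega> - randomized_euler f g \<tau> x0 N W \<gamma> j k \<omega>))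
           \<le> ennreal (C j * (\<tau> / real N) powr min \<rho> (1/2)))))"
proof -
  interpret prob_space M by fact
  \<comment> \<open>Clamping extends the coefficients from [0, T], the solution from [-\<tau>, T],
    and confines the sampling points to [0, 1]. As \<open>cT\<close> does not increase distances,
    the regularity of \<open>g\<close> in time survives.\<close>
  define cT where "cT s = max 0 (min T s)" for s :: real
  define cX where "cX s = max (- \<tau>) (min T s)" for s :: real
  define c1 where "c1 z = max 0 (min 1 z)" for z :: real
  have T0: "0 < T" using T \<open>0 < \<tau>\<close> by simp
  have cT: "cT s \<in> {0..T}" for s using T0 by (simp add: cT_def)
  have cT_id: "s \<in> {0..T} \<Longrightarrow> cT s = s" for s by (simp add: cT_def)
  have cX: "cX s \<in> {-\<tau>..T}" for s using T0 \<open>0 < \<tau>\<close> by (auto simp: cX_def)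
  have cX_id: "s \<in> {-\<tau>..T} \<Longrightarrow> cX s = s" for s by (simp add: cX_def)
  define f' where "f' s x z = f (cT s) x z" for s x z
  define g' where "g' s x z = g (cT s) x z" for s x z
  define X' where "X' s \<omega> = X (cX s) \<omega>" for s \<omega>
  define \<gamma>' where "\<gamma>' j k \<omega> = c1 (\<gamma> j k \<omega>)" for j k \<omega>
  from A3' obtain Kf Lf where Kf: "Kf > 0" "Lf > 0" "\<And>t. t \<in> {0..T} \<Longrightarrow> norm (f t 0 0) \<le> Kf"
    and Lf: "\<And>t x1 x2 z1 z2. t \<in> {0..T} \<Longrightarrow> norm (f t x1 z1 - f t x2 z2) \<le> Lf * (norm (x1 - x2) + norm (z1 - z2) powr \<alpha>1)" by blast
  from B3' obtain Kg Lg where Kg: "Kg > 0" "Lg > 0"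
    "\<And>t1 t2 x z. t1 \<in> {0..T} \<Longrightarrow> t2 \<in> {0..T} \<Longrightarrow> norm (g t1 x z - g t2 x z) \<le> Kg * (1 + norm x + norm z) * \<bar>t1 - t2\<bar> powr \<rho>"
    and Lg: "\<And>t x1 x2 z1 z2. t \<in> {0..T} \<Longrightarrow> norm (g t x1 z1 - g t x2 z2) \<le> Lg * (norm (x1 - x2) + norm (z1 - z2) powr \<alpha>2)" by blast
  define K where "K = max Kf Kg"
  define L where "L = max Lf Lg"

  from \<open>usual_conditions M F\<close> have fil: "filtration (space M) (\<lambda>t. F (max 0 t))" and sub: "\<And>t. 0 \<le> t \<Longrightarrow> subalgebra M (F t)"
    by (auto simp: usual_conditions_def)
  have Fspace: "space (F t) = space M" if "0 \<le> t" for t using sub[OF that] by (simp add: subalgebra_def)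
  have Fmono: "subalgebra (F t) (F s)" if "0 \<le> s" "s \<le> t" for s t
    using filtration.sets_F_mono[OF fil that(2)] Fspace[of s] Fspace[of t] that by (simp add: subalgebra_def)
  from \<open>wiener_process M F W\<close> have Wcont: "AE \<omega> in M. continuous_on {0..} (\<lambda>t. W t \<omega>)"
    and Wad: "\<And>t. 0 \<le> t \<Longrightarrow> W t \<in> borel_measurable (F t)"
    and Winc: "\<And>s t. 0 \<le> s \<Longrightarrow> s < t \<Longrightarrow> indep_set (sets (F s)) {(\<lambda>\<omega>. W t \<omega> - W s \<omega>) -` A \<inter> space M | A. A \<in> sets borel}"
    and Wdis: "\<And>s t. 0 \<le> s \<Longrightarrow> s < t \<Longrightarrow> distributed M lborel (\<lambda>\<omega>. W t \<omega> - W s \<omega>) (\<lambda>x. ennreal (gauss_density (sqrt (t - s)) x))"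
    by (auto simp: wiener_process_def gauss_density_def)
  have WM: "W t \<in> borel_measurable M" if "0 \<le> t" for t by (rule subalgebra_measurable[OF sub[OF that] Wad[OF that]])
  have Wmeas: "(\<lambda>\<omega>. W t \<omega> - W s \<omega>) \<in> borel_measurable M" if "0 \<le> s" "s < t" for s t
    using WM[of s] WM[of t] that by (intro borel_measurable_diff) auto
  have Wind: "indep_of M (F s) (\<lambda>\<omega>. W t \<omega> - W s \<omega>)" if st: "0 \<le> s" "s < t" for s t
    unfolding indep_of_def
  proof (intro conjI ballI sub Wmeas st)
    fix A :: "(real^'m) set" and B assume "A \<in> sets borel" "B \<in> sets (F s)"
    then have "prob (B \<inter> ((\<lambda>\<omega>. W t \<omega> - W s \<omega>) -` A \<inter> space M)) = prob B * prob ((\<lambda>\<omega>. W t \<omega> - W s \<omega>) -` A \<inter> space M)"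
      by (intro indep_setD[OF Winc[OF st]]) auto
    then show "prob ((\<lambda>\<omega>. W t \<omega> - W s \<omega>) -` A \<inter> space M \<inter> B) = prob ((\<lambda>\<omega>. W t \<omega> - W s \<omega>) -` A \<inter> space M) * prob B"
      by (simp add: Int_commute mult.commute)
  qed
  interpret WS: wiener_space M F W
    by (intro wiener_space.intro wiener_space_axioms.intro) fact+

  from \<open>scheme_randomness M F \<gamma>\<close> have gi: "indep_vars (\<lambda>_. borel) (\<lambda>(j, k). \<gamma> j k) (UNIV \<times> {1..})"
    and gd: "\<And>j k. 1 \<le> k \<Longrightarrow> distributed M lborel (\<gamma> j k) (\<lambda>x. indicator {0..1::real} x / measure lborel {0..1::real})"
    and gs: "indep_set (sigma_sets (space M) (\<Union>j. \<Union>k\<in>{1..}. {\<gamma> j k -` A \<inter> space M | A. A \<in> sets borel})) (sigma_infinity M F)"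
    by (auto simp: scheme_randomness_def)
  have gM: "\<gamma> j k \<in> borel_measurable M" if "1 \<le> k" for j k using distributed_measurable[OF gd[OF that]] by simp

  \<comment> \<open>The two enlargements of the filtration by the sampling points\<close>
  define E\<Gamma> where "E\<Gamma> = (\<Union>j. \<Union>k\<in>{1..}. {\<gamma> j k -` A \<inter> space M | A. A \<in> sets borel})"
  define E\<Gamma>' where "E\<Gamma>' j k = (\<Union>l\<in>UNIV \<times> {1..} - {(j, k)}. {(\<lambda>(j, k). \<gamma> j k) l -` A \<inter> space M | A. A \<in> sets borel})" for j k :: nat
  define EF where "EF = (\<Union>t\<in>{0..}. sets (F t))"
  have EP: "E\<Gamma> \<subseteq> sets M" using gM by (auto simp: E\<Gamma>_def intro: measurable_sets)
  have EP': "E\<Gamma>' j k \<subseteq> E\<Gamma>" for j k by (fastforce simp: E\<Gamma>_def E\<Gamma>'_def)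
  have EFM: "EF \<subseteq> sets M" using sub by (auto simp: EF_def subalgebra_def)
  have pow: "A \<subseteq> sets M \<Longrightarrow> A \<subseteq> Pow (space M)" for A using sets.sets_into_space by blast
  define \<Gamma> where "\<Gamma> = sigma (space M) E\<Gamma>"
  define \<Gamma>' where "\<Gamma>' j k = sigma (space M) (E\<Gamma>' j k)" for j k
  define FI where "FI = sigma (space M) EF"
  have s\<Gamma>: "sets \<Gamma> = sigma_sets (space M) E\<Gamma>" "space \<Gamma> = space M"
    using pow[OF EP] by (auto simp: \<Gamma>_def)
  have s\<Gamma>': "sets (\<Gamma>' j k) = sigma_sets (space M) (E\<Gamma>' j k)" "space (\<Gamma>' j k) = space M" for j k
    using pow[OF order_trans[OF EP' EP]] by (auto simp: \<Gamma>'_def)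
  have sFI: "sets FI = sigma_infinity M F" "space FI = space M"
    using pow[OF EFM] by (auto simp: FI_def sigma_infinity_def EF_def)
  have sub\<Gamma>: "subalgebra M \<Gamma>" unfolding subalgebra_def s\<Gamma> using EP by (auto intro!: sets.sigma_sets_subset)
  have sub\<Gamma>': "subalgebra M (\<Gamma>' j k)" for j k unfolding subalgebra_def s\<Gamma>' using EP EP'[of j k] by (auto intro!: sets.sigma_sets_subset)
  have subFI: "subalgebra M FI"
    unfolding subalgebra_def sFI sigma_infinity_def using EFM by (auto simp: EF_def intro!: sets.sigma_sets_subset)
  have \<Gamma>'\<Gamma>: "sets (\<Gamma>' j k) \<subseteq> sets \<Gamma>" for j k unfolding s\<Gamma> s\<Gamma>' by (rule sigma_sets_mono'[OF EP'])
  have FFI: "sets (F t) \<subseteq> sets FI" if "0 \<le> t" for t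
    unfolding sFI sigma_infinity_def using that by (auto intro!: sigma_sets.Basic)
  have \<Gamma>FI: "prob (c \<inter> b) = prob c * prob b" if "c \<in> sets \<Gamma>" "b \<in> sets FI" for b c
    using indep_setD[OF gs] that unfolding s\<Gamma> sFI E\<Gamma>_def by blast
  have g\<Gamma>: "\<gamma> j k -` A \<inter> space M \<in> sets \<Gamma>" if "1 \<le> k" "A \<in> sets borel" for j k A
    unfolding s\<Gamma> E\<Gamma>_def using that by (intro sigma_sets.Basic) auto
  define G where "G u = sigma (space M) (sets (F u) \<union> sets \<Gamma>)" for u
  define Q where "Q j k = sigma (space M) (sets FI \<union> sets (\<Gamma>' j k))" for j k
  have sp_sub: "subalgebra M N \<Longrightarrow> sets N \<subseteq> Pow (space M)" for N using sets.sets_into_space by (auto simp: subalgebra_def)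
  have sG: "sets (G u) = sigma_sets (space M) (sets (F u) \<union> sets \<Gamma>)" "space (G u) = space M" if "0 \<le> u" for u
    using sp_sub[OF sub[OF that]] sp_sub[OF sub\<Gamma>] by (auto simp: G_def)
  have sQ: "sets (Q j k) = sigma_sets (space M) (sets FI \<union> sets (\<Gamma>' j k))" "space (Q j k) = space M" for j k
    using sp_sub[OF subFI] sp_sub[OF sub\<Gamma>'[of j k]] by (auto simp: Q_def)
  have G_F: "subalgebra (G u) (F u)" if "0 \<le> u" for u
    using that by (auto simp: subalgebra_def sG Fspace intro!: sigma_sets.Basic)
  have G_\<Gamma>: "subalgebra (G u) \<Gamma>" if "0 \<le> u" for u
    using that by (auto simp: subalgebra_def sG s\<Gamma>(2) intro!: sigma_sets.Basic)
  have G_mono: "subalgebra (G v) (G u)" if "0 \<le> u" "u \<le> v" for u v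
  proof -
    have "sets (F u) \<union> sets \<Gamma> \<subseteq> sets (F v) \<union> sets \<Gamma>" using Fmono[OF that] by (auto simp: subalgebra_def)
    then have "sigma_sets (space M) (sets (F u) \<union> sets \<Gamma>) \<subseteq> sigma_sets (space M) (sets (F v) \<union> sets \<Gamma>)" by (rule sigma_sets_mono')
    then show ?thesis using that by (simp add: subalgebra_def sG)
  qed
  have G_ind: "indep_of M (G u) (\<lambda>\<omega>. W v \<omega> - W u \<omega>)" if uv: "0 \<le> u" "u < v" for u v
    unfolding G_def
  proof (rule indep_of_join[OF sub[OF uv(1)] sub\<Gamma> Wmeas[OF uv]])
    fix A :: "(real^'m) set" and b c assume A: "A \<in> sets borel" and b: "b \<in> sets (F u)" and c: "c \<in> sets \<Gamma>"
    let ?Z = "(\<lambda>\<omega>. W v \<omega> - W u \<omega>) -` A \<inter> space M"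
    have "(\<lambda>\<omega>. W v \<omega> - W u \<omega>) \<in> borel_measurable (F v)"
      using Wad[of v] subalgebra_measurable[OF Fmono[of u v] Wad[OF uv(1)]] uv by (intro borel_measurable_diff) auto
    from measurable_sets[OF this A] have "?Z \<in> sets (F v)" using Fspace[of v] uv by simp
    then have Z: "?Z \<in> sets FI" using FFI[of v] uv by auto
    have bF: "b \<in> sets FI" using FFI[OF uv(1)] b by auto
    \<comment> \<open>The sampling event \<open>c\<close> is split off first, which is possible
      because the Wiener increment and \<open>b\<close> together belong to \<open>FI\<close>; only
      then the independence of the increment from \<open>F u\<close> is used.\<close>
    have "prob (?Z \<inter> (b \<inter> c)) = prob (c \<inter> (?Z \<inter> b))" by (rule arg_cong[where f = prob]) auto
    also have "\<dots> = prob c * prob (?Z \<inter> b)" by (rule \<Gamma>FI[OF c]) (use Z bF in auto)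
    also have "prob (?Z \<inter> b) = prob ?Z * prob b" using Wind[OF uv] A b by (auto simp: indep_of_def)
    also have "prob c * (prob ?Z * prob b) = prob ?Z * prob (c \<inter> b)" using \<Gamma>FI[OF c bF] by simp
    finally show "prob (?Z \<inter> (b \<inter> c)) = prob ?Z * prob (b \<inter> c)" by (simp add: Int_commute)
  qed
  have G_wiener: "WS.wiener_filtration G"
    unfolding WS.wiener_filtration_def using G_ind G_mono subalgebra_measurable[OF G_F Wad] by blast
  have c1m[measurable]: "c1 \<in> borel_measurable borel" unfolding c1_def by measurable
  have g'meas: "\<gamma>' j k \<in> borel_measurable N" if "\<gamma> j k \<in> borel_measurable N" for j k N
    unfolding \<gamma>'_def[abs_def] by (rule measurable_compose[OF that c1m])
  have gmeas\<Gamma>: "\<gamma> j k \<in> borel_measurable \<Gamma>" if "1 \<le> k" for j k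
    by (rule measurableI) (use g\<Gamma>[OF that] in \<open>auto simp: s\<Gamma>(2)\<close>)
  have Q_ind0: "indep_of M (Q j k) (\<gamma> j k)" if k: "1 \<le> k" for j k
    unfolding Q_def
  proof (rule indep_of_join[OF subFI sub\<Gamma>' gM[OF k]])
    fix A :: "real set" and b c assume A: "A \<in> sets borel" and b: "b \<in> sets FI" and c: "c \<in> sets (\<Gamma>' j k)"
    let ?Z = "\<gamma> j k -` A \<inter> space M"
    have Z: "?Z \<in> sets \<Gamma>" by (rule g\<Gamma>[OF k A])
    have c\<Gamma>: "c \<in> sets \<Gamma>" using \<Gamma>'\<Gamma> c by blast
    \<comment> \<open>Two independence assumptions meet: the sampling points as a whole against
      \<open>FI\<close>, and one sampling point against all the others.\<close>
    have "prob (?Z \<inter> (b \<inter> c)) = prob ((?Z \<inter> c) \<inter> b)" by (rule arg_cong[where f = prob]) auto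
    also have "\<dots> = prob (?Z \<inter> c) * prob b" by (rule \<Gamma>FI) (use Z c\<Gamma> b in auto)
    also have "prob (?Z \<inter> c) = prob ?Z * prob c"
    proof -
      have "prob ((\<lambda>(j, k). \<gamma> j k) (j, k) -` A \<inter> space M \<inter> c) = prob ((\<lambda>(j, k). \<gamma> j k) (j, k) -` A \<inter> space M) * prob c"
        by (rule indep_family_split[OF \<open>prob_space M\<close> gi]) (use k A c in \<open>auto simp: s\<Gamma>' E\<Gamma>'_def\<close>)
      then show ?thesis by simp
    qed
    also have "prob ?Z * prob c * prob b = prob ?Z * prob (b \<inter> c)" using \<Gamma>FI[OF c\<Gamma> b] by (simp add: Int_commute)
    finally show "prob (?Z \<inter> (b \<inter> c)) = prob ?Z * prob (b \<inter> c)" .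
  qed
  have Q_ind: "indep_of M (Q j k) (\<gamma>' j k)" if "1 \<le> k" for j k
    unfolding \<gamma>'_def[abs_def] by (rule indep_of_comp[OF Q_ind0[OF that] c1m])
  \<comment> \<open>The uniform law confines the sampling points to [0, 1] almost surely only, hence
    the clamped versions and an exceptional null set at the end.\<close>
  have gae: "AE \<omega> in M. \<gamma> j k \<omega> \<in> {0..1}" if k: "1 \<le> k" for j k
  proof -
    have "AE x in density lborel (\<lambda>x. indicator {0..1::real} x / measure lborel {0..1::real}). x \<in> {0..1::real}"
      by (subst AE_density) (auto simp: indicator_def)
    then have "AE x in distr M lborel (\<gamma> j k). x \<in> {0..1}" by (simp only: distributed_distr_eq_density[OF gd[OF k]])
    then show ?thesis by (rule AE_distrD[rotated]) (use gM[OF k] in simp)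
  qed
  have g_id: "AE \<omega> in M. \<forall>j l. \<gamma> j (Suc l) \<omega> \<in> {0..1}" using gae by (simp add: AE_all_countable)
  have g'_distr: "distr M borel (\<gamma>' j k) = density lborel (indicator {0..1})" if k: "1 \<le> k" for j k
  proof -
    have "distr M borel (\<gamma>' j k) = distr M borel (\<gamma> j k)"
    proof (rule distr_cong_AE)
      show "AE \<omega> in M. \<gamma>' j k \<omega> = \<gamma> j k \<omega>" using gae[OF k, of j] by eventually_elim (simp add: \<gamma>'_def c1_def)
    qed (use gM[OF k] g'meas in auto)
    also have "\<dots> = distr M lborel (\<gamma> j k)" by (rule distr_cong) auto
    also have "\<dots> = density lborel (\<lambda>x. indicator {0..1::real} x / measure lborel {0..1::real})" by (rule distributed_distr_eq_density[OF gd[OF k]])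
    also have "\<dots> = density lborel (indicator {0..1})" by (rule density_cong) (auto simp: indicator_def)
    finally show ?thesis .
  qed

  \<comment> \<open>The solution and the equation, extended to all times\<close>
  from X have Xc: "\<And>\<omega>. \<omega> \<in> space M \<Longrightarrow> continuous_on {-\<tau>..T} (\<lambda>t. X t \<omega>)"
    and X0: "\<And>\<omega> t. \<omega> \<in> space M \<Longrightarrow> t \<in> {-\<tau>..0} \<Longrightarrow> X t \<omega> = x0"
    and XF: "\<And>t. t \<in> {0..T} \<Longrightarrow> X t \<in> borel_measurable (F t)"
    by (auto simp: strong_solution_def)
  have X'c: "continuous_on UNIV (\<lambda>t. X' t \<omega>)" if w: "\<omega> \<in> space M" for \<omega>
    unfolding X'_def by (rule continuous_on_compose2[OF Xc[OF w]]) (use cX in \<open>auto simp: cX_def intro!: continuous_intros\<close>)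
  have X'0: "X' t \<omega> = x0" if "\<omega> \<in> space M" "t \<le> 0" for t \<omega>
    unfolding X'_def using that T0 \<open>0 < \<tau>\<close> by (intro X0) (auto simp: cX_def)
  have X'F: "X' t \<in> borel_measurable (F t)" if "0 \<le> t" for t
  proof -
    have c: "cX t = min T t" using that T0 \<open>0 < \<tau>\<close> by (auto simp: cX_def)
    have "X (min T t) \<in> borel_measurable (F t)"
      by (rule subalgebra_measurable[OF Fmono XF]) (use that T0 in auto)
    then show ?thesis unfolding X'_def[abs_def] c .
  qed
  have X'_id: "X' t = X t" if "t \<in> {-\<tau>..T}" for t using that by (simp add: X'_def[abs_def] cX_id)
  have X'eq: "\<exists>I. is_ito_integral M F W T (\<lambda>s \<omega>. g' s (X' s \<omega>) (X' (s - \<tau>) \<omega>)) I \<and>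
        (AE \<omega> in M. \<forall>t\<in>{0..T}. X' t \<omega> = x0 + (LINT s:{0..t}|lborel. f' s (X' s \<omega>) (X' (s - \<tau>) \<omega>)) + I t \<omega>)"
  proof -
    from X obtain I where I: "is_ito_integral M F W T (\<lambda>s \<omega>. g s (X s \<omega>) (X (s - \<tau>) \<omega>)) I"
      and eq: "AE \<omega> in M. \<forall>t\<in>{0..T}. X t \<omega> = x0 + (LINT s:{0..t}|lborel. f s (X s \<omega>) (X (s - \<tau>) \<omega>)) + I t \<omega>"
      unfolding strong_solution_def by blast
    have id: "X' s = X s" "X' (s - \<tau>) = X (s - \<tau>)" "cT s = s" if "s \<in> {0..T}" for s
      using that \<open>0 < \<tau>\<close> by (auto intro!: X'_id simp: cT_id)
    have "is_ito_integral M F W T (\<lambda>s \<omega>. g' s (X' s \<omega>) (X' (s - \<tau>) \<omega>)) I"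
      by (rule is_ito_integral_cong[OF I]) (use id Fspace in \<open>auto simp: g'_def\<close>)
    moreover have "AE \<omega> in M. \<forall>t\<in>{0..T}. X' t \<omega> = x0 + (LINT s:{0..t}|lborel. f' s (X' s \<omega>) (X' (s - \<tau>) \<omega>)) + I t \<omega>"
      using eq
    proof eventually_elim
      case (elim \<omega>)
      show ?case
      proof
        fix t assume t: "t \<in> {0..T}"
        have "(LINT s:{0..t}|lborel. f' s (X' s \<omega>) (X' (s - \<tau>) \<omega>)) = (LINT s:{0..t}|lborel. f s (X s \<omega>) (X (s - \<tau>) \<omega>))"
          by (rule set_lebesgue_integral_cong) (use t id in \<open>auto simp: f'_def\<close>)
        then show "X' t \<omega> = x0 + (LINT s:{0..t}|lborel. f' s (X' s \<omega>) (X' (s - \<tau>) \<omega>)) + I t \<omega>"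
          using elim t id(1)[OF t] by simp
      qed
    qed
    ultimately show ?thesis by blast
  qed
  have cTm: "cT \<in> borel \<rightarrow>\<^sub>M restrict_space borel {0..T}"
  proof (rule measurable_restrict_space2)
    show "cT \<in> borel_measurable borel" unfolding cT_def by measurable
  qed (use cT in auto)
  have cT_lip: "\<bar>cT s - cT t\<bar> \<le> \<bar>s - t\<bar>" for s t by (auto simp: cT_def)
  interpret S: sdde M F W f' g' \<tau> \<rho> \<alpha>1 \<alpha>2 T K L x0 X'
  proof (intro sdde.intro sdde_axioms.intro WS.wiener_space_axioms)
    show "norm (f' t 0 0) \<le> K" for t unfolding f'_def using Kf(3)[OF cT[of t]] by (simp add: K_def)
    show "norm (f' t x1 z1 - f' t x2 z2) \<le> L * (norm (x1 - x2) + norm (z1 - z2) powr \<alpha>1)" for t x1 x2 z1 z2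
      unfolding f'_def by (rule order_trans[OF Lf[OF cT]]) (auto simp: L_def intro!: mult_right_mono)
    show "norm (g' t x1 z1 - g' t x2 z2) \<le> L * (norm (x1 - x2) + norm (z1 - z2) powr \<alpha>2)" for t x1 x2 z1 z2
      unfolding g'_def by (rule order_trans[OF Lg[OF cT]]) (auto simp: L_def intro!: mult_right_mono)
    show "norm (g' t1 x z - g' t2 x z) \<le> K * (1 + norm x + norm z) * \<bar>t1 - t2\<bar> powr \<rho>" for t1 t2 x z
    proof -
      have "norm (g' t1 x z - g' t2 x z) \<le> Kg * (1 + norm x + norm z) * \<bar>cT t1 - cT t2\<bar> powr \<rho>"
        unfolding g'_def by (rule Kg(3)[OF cT cT])
      also have "\<dots> \<le> K * (1 + norm x + norm z) * \<bar>t1 - t2\<bar> powr \<rho>"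
        using \<open>\<rho> \<in> {0<..1}\<close> Kg(1) cT_lip[of t1 t2] by (intro mult_mono powr_mono2) (auto simp: K_def)
      finally show ?thesis .
    qed
    show "continuous_on UNIV (\<lambda>(x, z). f' t x z)" for t unfolding f'_def using A1 cT by blast
    show "(\<lambda>t. f' t x z) \<in> borel_measurable borel" for x z
      unfolding f'_def using measurable_compose[OF cTm A2[rule_format, of x z]] by simp
    show "0 < K" "0 < L" using Kf by (auto simp: K_def L_def)
  qed (fact T0 X'c X'0 X'F X'eq \<open>0 < \<tau>\<close> | (use \<open>\<rho> \<in> {0<..1}\<close> \<open>\<alpha>1 \<in> {0<..1}\<close> \<open>\<alpha>2 \<in> {0<..1}\<close> in simp))+
  have X'FI: "X' s \<in> borel_measurable FI" for s
  proof -
    have "X' s \<in> borel_measurable (F (max 0 s))" by (rule S.X_measurable_F) auto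
    moreover have "subalgebra FI (F (max 0 s))" using FFI[of "max 0 s"] by (simp add: subalgebra_def sFI Fspace)
    ultimately show ?thesis by (rule subalgebra_measurable[rotated])
  qed
  interpret R: randomized_sdde M F W f' g' \<tau> \<rho> \<alpha>1 \<alpha>2 T K L x0 X' \<gamma>' G Q
  proof (intro randomized_sdde.intro randomized_sdde_axioms.intro S.sdde_axioms)
    show "0 \<le> \<gamma>' j k \<omega>" "\<gamma>' j k \<omega> \<le> 1" for j k \<omega> by (auto simp: \<gamma>'_def c1_def)
    show "distr M borel (\<gamma>' j k) = density lborel (indicator {0..1})" if "1 \<le> k" for j k by (rule g'_distr[OF that])
    show "WS.wiener_filtration G" by (rule G_wiener)
    show "subalgebra (G u) (F u)" if "0 \<le> u" for u by (rule G_F[OF that])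
    show "\<gamma>' j k \<in> borel_measurable (G u)" if "0 \<le> u" "1 \<le> k" for u j k
      by (rule g'meas[OF subalgebra_measurable[OF G_\<Gamma>[OF that(1)] gmeas\<Gamma>[OF that(2)]]])
    show "X' s \<in> borel_measurable (Q j k)" for s j k
    proof (rule subalgebra_measurable[OF _ X'FI])
      show "subalgebra (Q j k) FI" by (auto simp: subalgebra_def sQ sFI(2) intro!: sigma_sets.Basic)
    qed
    show "\<gamma>' j l \<in> borel_measurable (Q j k)" if l: "1 \<le> l" "l < k" for j l k
    proof (rule g'meas, rule measurableI)
      fix A :: "real set" assume A: "A \<in> sets borel"
      have "\<gamma> j l -` A \<inter> space M \<in> E\<Gamma>' j k"
        unfolding E\<Gamma>'_def by (rule UN_I[of "(j, l)"]) (use l A in auto)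
      then show "\<gamma> j l -` A \<inter> space (Q j k) \<in> sets (Q j k)"
        unfolding sQ s\<Gamma>' by (intro sigma_sets.Basic UnI2) simp
    qed simp
    show "indep_of M (Q j k) (\<gamma>' j k)" if "1 \<le> k" for j k by (rule Q_ind[OF that])
  qed

  \<comment> \<open>From the even exponent back to p\<close>
  define r where "r = nat \<lceil>p / 2\<rceil>"
  have r: "1 \<le> r" unfolding r_def using \<open>2 \<le> p\<close> by linarith
  have "p / 2 \<le> real r" unfolding r_def by linarith
  then have pr: "p \<le> 2 * real r" by simp
  define \<alpha> where "\<alpha> = min \<alpha>1 \<alpha>2"
  define \<beta> where "\<beta> = min \<rho> (1/2)"
  have al: "0 < \<alpha>" using \<open>\<alpha>1 \<in> {0<..1}\<close> \<open>\<alpha>2 \<in> {0<..1}\<close> by (auto simp: \<alpha>_def)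
  have jT: "real (Suc j) * \<tau> \<le> T" if "j \<le> n" for j
    unfolding T using that \<open>0 < \<tau>\<close> by (intro mult_right_mono) auto
  have "\<forall>j\<in>{..n}. \<exists>A>0. \<forall>N. 0 < N \<longrightarrow> R.h N \<le> 1 \<longrightarrow>
    Ebd M (\<lambda>\<omega>. running_max (\<lambda>k. norm (R.err N (Suc j) k \<omega>)) N ^ (2 * r)) (A * R.h N powr (2 * real r * \<beta> / \<alpha> * \<alpha> ^ Suc j))"
    unfolding \<alpha>_def \<beta>_def using R.scheme_convergence[OF r jT] by simp
  then obtain A where A0: "\<And>j. j \<le> n \<Longrightarrow> 0 < A j" and A: "\<And>j N. j \<le> n \<Longrightarrow> 0 < N \<Longrightarrow> R.h N \<le> 1 \<Longrightarrow>
    Ebd M (\<lambda>\<omega>. running_max (\<lambda>k. norm (R.err N (Suc j) k \<omega>)) N ^ (2 * r)) (A j * R.h N powr (2 * real r * \<beta> / \<alpha> * \<alpha> ^ Suc j))"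
    by (auto dest!: bchoice)
  define C where "C j = A j powr (1 / (2 * real r))" for j
  have main: "Lp_norm M p (\<lambda>\<omega>. MAX k\<in>{0..N}.
            norm (X (grid_time \<tau> N j k) \<omega> - randomized_euler f g \<tau> x0 N W \<gamma> j k \<omega>))
         \<le> ennreal (C j * (\<tau> / real N) powr (\<beta> * \<alpha> ^ j))" if j: "j \<le> n" and N1: "\<lceil>\<tau>\<rceil> \<le> int N" for j N
  proof -
    \<comment> \<open>The lower bound on \<open>N\<close> enters here: it makes \<open>N\<close>
      positive and the step size at most 1, as the comparison of powers of h with different
      exponents requires.\<close>
    have "\<tau> \<le> real N" using N1 by linarith
    then have N: "0 < N" using \<open>0 < \<tau>\<close> by (cases N) auto
    have hN: "R.h N = \<tau> / real N" by (simp add: R.h_def)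
    have h1: "R.h N \<le> 1" using N \<open>\<tau> \<le> real N\<close> by (simp add: hN)
    have hp: "0 < R.h N" by (rule R.h_pos[OF N])
    let ?Z = "\<lambda>\<omega>. running_max (\<lambda>k. norm (R.err N (Suc j) k \<omega>)) N"
    let ?b = "A j * R.h N powr (2 * real r * \<beta> / \<alpha> * \<alpha> ^ Suc j)"
    have "Lp_norm M p (\<lambda>\<omega>. MAX k\<in>{0..N}.
            norm (X (grid_time \<tau> N j k) \<omega> - randomized_euler f g \<tau> x0 N W \<gamma> j k \<omega>)) \<le> ennreal (?b powr (1 / (2 * real r)))"
    proof (rule Lp_norm_le[OF \<open>2 \<le> p\<close> pr A[OF j N h1]])
      show "0 < ?b" using A0[OF j] hp by simp
      show "?Z \<in> borel_measurable M"
        by (rule running_max_measurable) (rule measurable_compose[OF R.err_measurable[OF N] borel_measurable_norm])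
      show "0 \<le> ?Z \<omega>" for \<omega> by (rule running_max_nonneg) simp
      show "AE \<omega> in M. (MAX k\<in>{0..N}. norm (X (grid_time \<tau> N j k) \<omega> - randomized_euler f g \<tau> x0 N W \<gamma> j k \<omega>)) = ?Z \<omega>"
        using g_id
      proof eventually_elim
        case (elim \<omega>)
        have "norm (X (grid_time \<tau> N j k) \<omega> - randomized_euler f g \<tau> x0 N W \<gamma> j k \<omega>) = norm (R.err N (Suc j) k \<omega>)" if k: "k \<le> N" for k
        proof -
          have "grid_time \<tau> N j k \<in> {-\<tau>..T}" using R.t_nonneg[of N j k] R.t_le[OF N k jT[OF j]] \<open>0 < \<tau>\<close> by simp
          then have "X (grid_time \<tau> N j k) = X' (grid_time \<tau> N (Suc j) k - \<tau>)" by (simp add: R.t_shift X'_id)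
          moreover have "R.Y N (Suc j) k \<omega> = randomized_euler f g \<tau> x0 N W \<gamma> j k \<omega>"
            unfolding R.Y_def randomized_euler_def
          proof (rule euler_shifted_cong[OF _ _ _ _ N \<open>0 < \<tau>\<close> jT[OF j] k])
            show "\<gamma>' i (Suc l) \<omega> = \<gamma> i (Suc l) \<omega>" "\<gamma> i (Suc l) \<omega> \<in> {0..1}" for i l
              using elim[rule_format, of i l] by (auto simp: \<gamma>'_def c1_def)
          qed (auto simp: f'_def g'_def cT_id)
          ultimately show ?thesis by (simp add: R.err_def)
        qed
        then have "(MAX k\<in>{0..N}. norm (X (grid_time \<tau> N j k) \<omega> - randomized_euler f g \<tau> x0 N W \<gamma> j k \<omega>)) = (MAX k\<in>{0..N}. norm (R.err N (Suc j) k \<omega>))"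
          by (intro arg_cong[where f = Max] image_cong) auto
        then show ?case by (simp add: Max_eq_running_max)
      qed
    qed
    also have "?b powr (1 / (2 * real r)) = C j * (\<tau> / real N) powr (\<beta> * \<alpha> ^ j)"
    proof -
      \<comment> \<open>The division by \<alpha> and the shift of the index cancel, and the root of
        order 2r removes the factor 2r.\<close>
      have "2 * real r * \<beta> / \<alpha> * \<alpha> ^ Suc j * (1 / (2 * real r)) = \<beta> * \<alpha> ^ j" using al r by simp
      then show ?thesis using A0[OF j] hp by (simp only: C_def hN powr_powr powr_mult powr_ge_zero less_imp_le)
    qed
    finally show ?thesis .
  qed
  show ?thesis
  proof (intro exI[of _ C] conjI allI impI)
    show "0 < C j" if "j \<le> n" for j using A0[OF that] by (simp add: C_def)
    show "Lp_norm M p (\<lambda>\<omega>. MAX k\<in>{0..N}. norm (X (grid_time \<tau> N j k) \<omega> - randomized_euler f g \<tau> x0 N W \<gamma> j k \<omega>))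
         \<le> ennreal (C j * (\<tau> / real N) powr (min \<rho> (1/2) * min \<alpha>1 \<alpha>2 ^ j))" if "\<lceil>\<tau>\<rceil> \<le> int N" "j \<le> n" for N j
      using main[OF that(2,1)] unfolding \<alpha>_def \<beta>_def .
    show "Lp_norm M p (\<lambda>\<omega>. MAX k\<in>{0..N}. norm (X (grid_time \<tau> N j k) \<omega> - randomized_euler f g \<tau> x0 N W \<gamma> j k \<omega>))
         \<le> ennreal (C j * (\<tau> / real N) powr min \<rho> (1/2))" if "\<lceil>\<tau>\<rceil> \<le> int N" "j \<le> n" "min \<alpha>1 \<alpha>2 = 1" for N j
      using main[OF that(2,1)] that(3) unfolding \<alpha>_def \<beta>_def by simp
  qed
qed

end
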